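(* Let $\alpha\in(0,1)$ be irrational with unbounded partial quotients, with denominators $(q_n)_{n\ge0}$. Then there are $\lambda>0$ and an increasing sequence of positive integers $(t_k)_{k\ge1}$ such that, for $L_n=\sum_{k=1}^n q_{t_k}$, $n\ge1$, the following holds for every real-valued centered function $\varphi$ of bounded variation on $\mathbb{T}^1$ satisfying the non-degeneracy condition $$\sum_{k=1}^n\|\widehat\varphi_{q_{t_k}}\|_2^2\ \ge\ c\,n\quad \text{for all } n\ge1,\ \text{for a constant } c>0:$$ keeping its distribution, the process $(\varphi_{L_n})_{n\ge1}$ can be redefined on a probability space together with a standard one-dimensional Wiener process $(\zeta(t))_{t\ge0}$ and an increasing sequence of random variables $(\tau_n)$ with $\tau_n/\|\varphi_{L_n}\|_2^2\to1$ a.e., such that $$\varphi_{L_n}=\zeta(\tau_n)+o(n^{\frac12-\lambda})\quad\text{a.e.}$$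
   Context: Continued fractions: $\alpha=[0;a_1,a_2,\dots]$ and $p_n/q_n$ are its convergents, with $p_{-1}=1$, $p_0=0$, $q_{-1}=0$, $q_0=1$, $q_{n+1}=a_{n+1}q_n+q_{n-1}$, $p_{n+1}=a_{n+1}p_n+p_{n-1}$; the $q_n$ are called the denominators of $\alpha$, the $a_n$ its partial quotients. $\mathbb{T}^1=\mathbb{R}/\mathbb{Z}$ is identified with $[0,1)$ and endowed with Lebesgue (uniform) measure $\mu$; it is the probability space on which the functions $\varphi_{L_n}$ are viewed as random variables, and $\|\cdot\|_2$ is the norm of $L^2(\mathbb{T}^1,\mu)$. A function is centered if its integral is $0$; bounded variation is understood for the restriction to $[0,1)$ of a $1$-periodic function. For $\ell\ge1$, the ergodic sum is $\varphi_\ell(x)=\sum_{j=0}^{\ell-1}\varphi(x+j\alpha)$. If the Fourier series of $\varphi$ is $\varphi(x)=\sum_{r\ne0}\frac{\gamma_r}{r}e^{2\pi i r x}$ (i.e. $\gamma_r=r\,c_r(\varphi)$), then for $\ell\ge1$ $$\widehat\varphi_\ell(x):=\sum_{r\ne0}\frac{\gamma_{r\ell}}{r}e^{2\pi i r x},$$ equivalently $\widehat\varphi_\ell(\ell x)=\sum_{j=0}^{\ell-1}\varphi(x+\tfrac{j}{\ell})$. *)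

theory Defs
  imports "HOL-Probability.Probability" "HOL-Library.Landau_Symbols"
begin

section \<open>Continued fractions\<close>

text \<open>
  Iterates of the Gauss map \<open>x \<mapsto> {1/x}\<close> at \<open>\<alpha>\<close>. For irrational \<open>\<alpha>\<close> in \<open>(0,1)\<close> all of
  them are irrational numbers in \<open>(0,1)\<close>, so no division by zero occurs.
\<close>

definition cf_remainder :: "real \<Rightarrow> nat \<Rightarrow> real" where
  "cf_remainder \<alpha> n = ((\<lambda>x. frac (1 / x)) ^^ n) \<alpha>"

text \<open>Partial quotients of \<open>\<alpha> = [0; a\<^sub>1, a\<^sub>2, \<dots>]\<close>.\<close>

fun partial_quotient :: "real \<Rightarrow> nat \<Rightarrow> nat" where
  "partial_quotient \<alpha> 0 = 0"
| "partial_quotient \<alpha> (Suc n) = nat \<lfloor>1 / cf_remainder \<alpha> n\<rfloor>"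

text \<open>The second equation is the recurrence for \<open>n = 0\<close> with \<open>q\<^sub>-\<^sub>1 = 0\<close>, \<open>q\<^sub>0 = 1\<close>.\<close>

fun cf_denominator :: "real \<Rightarrow> nat \<Rightarrow> nat" where
  "cf_denominator \<alpha> 0 = 1"
| "cf_denominator \<alpha> (Suc 0) = partial_quotient \<alpha> 1"
| "cf_denominator \<alpha> (Suc (Suc n)) =
     partial_quotient \<alpha> (Suc (Suc n)) * cf_denominator \<alpha> (Suc n) + cf_denominator \<alpha> n"


section \<open>Functions on the circle\<close>

text \<open>
  A function on the circle is represented by a 1-periodic function on the reals; the circle as
  a probability space is \<open>[0,1)\<close> with Lebesgue measure.
\<close>

definition circle_measure :: "real measure" where
  "circle_measure = restrict_space lborel {0..<1}"

definition one_periodic :: "(real \<Rightarrow> 'a) \<Rightarrow> bool" where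
  "one_periodic f \<longleftrightarrow> (\<forall>x. f (x + 1) = f x)"

definition bounded_variation_on :: "real set \<Rightarrow> (real \<Rightarrow> real) \<Rightarrow> bool" where
  "bounded_variation_on S f \<longleftrightarrow>
     (\<exists>B. \<forall>n (x :: nat \<Rightarrow> real).
        (\<forall>i\<le>n. x i \<in> S) \<and> (\<forall>i<n. x i \<le> x (Suc i)) \<longrightarrow>
        (\<Sum>i<n. \<bar>f (x (Suc i)) - f (x i)\<bar>) \<le> B)"

definition centered :: "(real \<Rightarrow> real) \<Rightarrow> bool" where
  "centered f \<longleftrightarrow> (\<integral>x. f x \<partial>circle_measure) = 0"

definition circle_L2_norm :: "(real \<Rightarrow> 'a :: real_normed_vector) \<Rightarrow> real" where
  "circle_L2_norm f = sqrt (\<integral>x. (norm (f x))\<^sup>2 \<partial>circle_measure)"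

definition ergodic_sum :: "real \<Rightarrow> (real \<Rightarrow> real) \<Rightarrow> nat \<Rightarrow> real \<Rightarrow> real" where
  "ergodic_sum \<alpha> \<phi> l x = (\<Sum>j<l. \<phi> (x + real j * \<alpha>))"

definition fourier_coeff :: "(real \<Rightarrow> real) \<Rightarrow> int \<Rightarrow> complex" where
  "fourier_coeff f r =
     (\<integral>x. complex_of_real (f x) * cis (- 2 * pi * of_int r * x) \<partial>circle_measure)"

definition gamma_coeff :: "(real \<Rightarrow> real) \<Rightarrow> int \<Rightarrow> complex" where
  "gamma_coeff f r = of_int r * fourier_coeff f r"

text \<open>
  \<open>hat_fun \<phi> l x\<close> is the sum of the Fourier series with coefficients \<open>\<gamma>\<^bsub>rl\<^esub> / r\<close>, \<open>r \<noteq> 0\<close>,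
  taken as the limit of the symmetric partial sums. It is the Fourier series of
  \<open>y \<mapsto> (\<Sum>j<l. \<phi> ((y + j) / l))\<close>, so for centered \<open>\<phi>\<close> of bounded variation
  the limit exists at every point (Dirichlet--Jordan) and is real.
\<close>

definition hat_fun :: "(real \<Rightarrow> real) \<Rightarrow> nat \<Rightarrow> real \<Rightarrow> complex" where
  "hat_fun \<phi> l x =
     lim (\<lambda>N. \<Sum>r\<in>{- int N..int N} - {0}.
       gamma_coeff \<phi> (r * int l) / of_int r * cis (2 * pi * of_int r * x))"


section \<open>Standard one-dimensional Wiener process\<close>

definition wiener_process :: "'w measure \<Rightarrow> (real \<Rightarrow> 'w \<Rightarrow> real) \<Rightarrow> bool" where
  "wiener_process M \<zeta> \<longleftrightarrow>
     prob_space M \<and>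
     (\<forall>t\<ge>0. \<zeta> t \<in> borel_measurable M) \<and>
     (\<forall>\<omega>\<in>space M. \<zeta> 0 \<omega> = 0) \<and>
     (\<forall>\<omega>\<in>space M. continuous_on {0..} (\<lambda>t. \<zeta> t \<omega>)) \<and>
     (\<forall>s t. 0 \<le> s \<and> s < t \<longrightarrow>
        distributed M lborel (\<lambda>\<omega>. \<zeta> t \<omega> - \<zeta> s \<omega>) (normal_density 0 (sqrt (t - s)))) \<and>
     (\<forall>n (t :: nat \<Rightarrow> real). 0 \<le> t 0 \<and> (\<forall>i<n. t i \<le> t (Suc i)) \<longrightarrow>
        prob_space.indep_vars M (\<lambda>_. borel) (\<lambda>i \<omega>. \<zeta> (t (Suc i)) \<omega> - \<zeta> (t i) \<omega>) {..<n})"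


section \<open>Processes redefined on another space\<close>

text \<open>
  Equality of the joint laws of two sequences of real random variables indexed by
  \<open>n \<ge> 1\<close>, as measures on the product sigma-algebra.
\<close>

definition same_law ::
  "'a measure \<Rightarrow> (nat \<Rightarrow> 'a \<Rightarrow> real) \<Rightarrow> 'b measure \<Rightarrow> (nat \<Rightarrow> 'b \<Rightarrow> real) \<Rightarrow> bool" where
  "same_law M X N Y \<longleftrightarrow>
     (\<forall>n\<ge>1. X n \<in> borel_measurable M) \<and> (\<forall>n\<ge>1. Y n \<in> borel_measurable N) \<and>
     distr M (\<Pi>\<^sub>M n\<in>{1..}. borel) (\<lambda>\<omega>. \<lambda>n\<in>{1..}. X n \<omega>) =
     distr N (\<Pi>\<^sub>M n\<in>{1..}. borel) (\<lambda>\<omega>. \<lambda>n\<in>{1..}. Y n \<omega>)"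

text \<open>
  HOL cannot quantify existentially over the type of sample points, so it is fixed to be the
  type of real sequences, on an arbitrary sigma-algebra. This is no restriction: a continuous process on \<open>[0,\<infinity>)\<close>
  together with two sequences of real random variables is determined by countably many real
  random variables, so its joint law can be realised on this type.
\<close>

type_synonym sample = "nat \<Rightarrow> real"

end

theory Submission
  imports Defs "HOL-Real_Asymp.Real_Asymp"
begin

text \<open>
The sequence \<open>t\<close> may be chosen freely, and it is chosen so sparse that the sums reduce to sums of
independent variables: \<open>t\<^sub>1 < t\<^sub>2 < \<dots>\<close> are taken with the partial quotients
\<open>a\<^bsub>t\<^sub>k + 1\<^esub>\<close> at least \<open>4\<^sup>k\<close>. Neither this choice nor the exponent \<open>\<delta> = 1/72\<close> involves \<open>\<phi>\<close>. Write
\<open>Q\<^sub>k\<close> for the denominators \<open>q\<^bsub>t\<^sub>k\<^esub>\<close>; all indices below start at 0, and then the large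
partial quotients have two consequences.

First, \<open>Q\<^sub>k \<alpha>\<close> is within \<open>1 / (4\<^bsup>k+1\<^esup> Q\<^sub>k)\<close> of an integer prime to \<open>Q\<^sub>k\<close>, so \<open>Q\<^sub>k\<close> successive points of an
orbit nearly form a translate of the subgroup generated by \<open>1/Q\<^sub>k\<close>. The ergodic sum over them at
\<open>y\<close> is therefore close to \<open>g\<^sub>k (Q\<^sub>k y)\<close>, where \<open>g\<^sub>k y = (\<Sum>j<Q\<^sub>k. \<phi> ((j + y) / Q\<^sub>k))\<close>: the error
is controlled by the variation of \<open>\<phi>\<close> near the points, its mean is of order \<open>4\<^bsup>-k\<^esup>\<close>, and it is
uniformly bounded (\<open>ergodic_sum_fold_sum\<close>, \<open>sum_spread_le\<close>).

Second, \<open>Q\<^bsub>k+1\<^esub> \<ge> 4\<^bsup>k+1\<^esup> Q\<^sub>k\<close>, so the multiples \<open>Q\<^sub>k x\<close> of a uniform point \<open>x\<close> are nearly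
independent modulo 1. The coupling is built the other way round: from independent uniform variables
\<open>u\<^sub>k\<close> one makes a uniform point whose multiples agree modulo 1 with \<open>u\<^bsub>k+1\<^esub>\<close> up to
\<open>2 / 4\<^bsup>k+1\<^esup>\<close> (\<open>mult_point\<close>, \<open>distr_point\<close>).

Together these write \<open>\<phi>\<^bsub>L\<^sub>n\<^esub>\<close> at that point as a sum of independent, centred, uniformly
bounded variables \<open>\<xi>\<^sub>0, \<dots>, \<xi>\<^bsub>n-1\<^esub>\<close>, up to an error bounded in \<open>n\<close> almost surely. The variance of \<open>\<xi>\<^sub>k\<close> is
\<open>\<parallel>g\<^sub>k\<parallel>\<^sub>2\<^sup>2\<close>. The Fourier coefficients of \<open>g\<^sub>k\<close> are those in the definition of \<open>hat_fun\<close>, so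
Bessel's inequality and Fatou's lemma bound it below by the square of the norm of \<open>hat_fun\<close>
(\<open>hat_fun_L2_norm_le\<close>), and the non-degeneracy condition makes the total variance grow linearly.

What remains is a strong invariance principle with polynomial rate for the \<open>\<xi>\<^sub>k\<close>. Cut the
indices into the blocks \<open>j\<^sup>6 \<le> k < (j + 1)\<^sup>6\<close>. Lindeberg's replacement argument, applied to smoothed
Lipschitz functions, shows that a sum of \<open>m\<close> bounded independent variables is at Wasserstein distance
\<open>O(m\<^bsup>1/3\<^esup>)\<close> from the normal law of the same variance (\<open>lipschitz_clt\<close>), and on the line the
monotone rearrangement realises this distance (\<open>monotone_coupling\<close>); a small independent noise added
to each block removes the atoms that would obstruct it. The resulting independent normal variables
become the increments over consecutive intervals of a Wiener process, whose paths inside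
the intervals are filled in by Levy's midpoint construction (\<open>wiener_process_exists\<close>). The time
\<open>\<tau>\<^sub>n\<close> is the variance of the blocks completed before \<open>n\<close>; it is deterministic and asymptotic to the
total variance.

With \<open>J \<le> n\<^bsup>1/6\<^esup>\<close> completed blocks of length \<open>O(J\<^sup>5)\<close>, the coupling errors have mean
\<open>O(i\<^bsup>5/3\<^esup>)\<close> and hence sum to \<open>O(J\<^bsup>17/6\<^esup>)\<close> almost surely; the incomplete block contributes at
most \<open>n\<^bsup>17/36\<^esup>\<close> by Hoeffding's inequality; and the noise at most \<open>n\<^bsup>1/6\<^esup>\<close>. So the total error is
\<open>O(n\<^bsup>17/36\<^esup>)\<close>, which is smaller than \<open>n\<^bsup>1/2-\<delta>\<^esup>\<close> for \<open>\<delta> = 1/72\<close>.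
\<close>

section \<open>Lebesgue measure on the circle\<close>

lemma space_circle [simp]: "space circle_measure = {0..<1}"
  by (simp add: circle_measure_def space_restrict_space)

lemma prob_space_circle: "prob_space circle_measure"
  by (rule prob_spaceI)
    (simp add: circle_measure_def space_restrict_space emeasure_restrict_space)

interpretation circle: prob_space circle_measure
  by (rule prob_space_circle)

lemma measurable_circle_borel:
  "f \<in> borel_measurable borel \<Longrightarrow> f \<in> borel_measurable circle_measure"
  unfolding circle_measure_def by (rule measurable_restrict_space1) simp

lemma id_measurable_circle: "(\<lambda>x. x) \<in> borel_measurable circle_measure"
  by (rule measurable_circle_borel) simp

lemma frac_measurable [measurable]: "frac \<in> borel_measurable (borel :: real measure)"
  unfolding frac_def[abs_def] by (intro borel_measurable_diff borel_measurable_real_floor) auto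

lemma nn_integral_circle:
  assumes [measurable]: "f \<in> borel_measurable borel"
  shows "(\<integral>\<^sup>+x. f x \<partial>circle_measure) = (\<integral>\<^sup>+x. f x * indicator {0..<1} x \<partial>lborel)"
  unfolding circle_measure_def by (subst nn_integral_restrict_space) auto

lemma integral_circle:
  fixes f :: "real \<Rightarrow> 'a :: {banach, second_countable_topology}"
  shows "(\<integral>x. f x \<partial>circle_measure) = (\<integral>x. indicator {0..<1} x *\<^sub>R f x \<partial>lborel)"
  unfolding circle_measure_def by (subst integral_restrict_space) auto

lemma integrable_circle_iff:
  fixes f :: "real \<Rightarrow> 'a :: {banach, second_countable_topology}"
  shows "integrable circle_measure f \<longleftrightarrow> integrable lborel (\<lambda>x. indicator {0..<1} x *\<^sub>R f x)"
  unfolding circle_measure_def by (subst integrable_restrict_space) auto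

lemma nn_integral_circle_rotation_frac:
  assumes [measurable]: "f \<in> borel_measurable borel"
  shows "(\<integral>\<^sup>+x. f (frac (x + c)) \<partial>circle_measure) = (\<integral>\<^sup>+x. f x \<partial>circle_measure)"
proof -
  define d where "d = frac c"
  have d: "0 \<le> d" "d < 1" by (auto simp: d_def frac_lt_1)
  have fr: "frac (x + c) = (if x < 1 - d then x + d else x + d - 1)" if "0 \<le> x" "x < 1" for x
  proof -
    have "frac x = x" using that by (simp add: frac_eq)
    then show ?thesis
      using frac_add[of x c] unfolding d_def by auto
  qed
  have "(\<integral>\<^sup>+x. f (frac (x + c)) \<partial>circle_measure)
      = (\<integral>\<^sup>+x. f (frac (x + c)) * indicator {0..<1} x \<partial>lborel)"
    by (rule nn_integral_circle) measurable
  also have "\<dots> = (\<integral>\<^sup>+x. f (d + 1 * x) * indicator {d..<1} (d + 1 * x)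
      + f ((d - 1) + 1 * x) * indicator {0..<d} ((d - 1) + 1 * x) \<partial>lborel)"
    by (intro nn_integral_cong) (use d in \<open>auto simp: fr indicator_def algebra_simps\<close>)
  also have "\<dots> = (\<integral>\<^sup>+x. f (d + 1 * x) * indicator {d..<1} (d + 1 * x) \<partial>lborel)
      + (\<integral>\<^sup>+x. f ((d - 1) + 1 * x) * indicator {0..<d} ((d - 1) + 1 * x) \<partial>lborel)"
    by (rule nn_integral_add) auto
  also have "(\<integral>\<^sup>+x. f (d + 1 * x) * indicator {d..<1} (d + 1 * x) \<partial>lborel)
     = (\<integral>\<^sup>+x. f x * indicator {d..<1} x \<partial>lborel)"
    using nn_integral_real_affine[of "\<lambda>x. f x * indicator {d..<1} x" 1 d] by simp
  also have "(\<integral>\<^sup>+x. f ((d - 1) + 1 * x) * indicator {0..<d} ((d - 1) + 1 * x) \<partial>lborel)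
     = (\<integral>\<^sup>+x. f x * indicator {0..<d} x \<partial>lborel)"
    using nn_integral_real_affine[of "\<lambda>x. f x * indicator {0..<d} x" 1 "d - 1"] by simp
  also have "(\<integral>\<^sup>+x. f x * indicator {d..<1} x \<partial>lborel) + (\<integral>\<^sup>+x. f x * indicator {0..<d} x \<partial>lborel)
     = (\<integral>\<^sup>+x. f x * indicator {d..<1} x + f x * indicator {0..<d} x \<partial>lborel)"
    by (rule nn_integral_add[symmetric]) auto
  also have "\<dots> = (\<integral>\<^sup>+x. f x * indicator {0..<1} x \<partial>lborel)"
    using d by (intro nn_integral_cong) (auto simp: indicator_def)
  also have "\<dots> = (\<integral>\<^sup>+x. f x \<partial>circle_measure)"
    by (rule nn_integral_circle[symmetric]) measurable
  finally show ?thesis .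
qed

lemma distr_circle_rotation:
  "distr circle_measure borel (\<lambda>x. frac (x + c)) = distr circle_measure borel (\<lambda>x. x)"
proof (rule measure_eqI)
  have m: "(\<lambda>x. frac (x + c)) \<in> borel_measurable circle_measure"
    by (rule measurable_circle_borel) measurable
  fix A assume "A \<in> sets (distr circle_measure borel (\<lambda>x. frac (x + c)))"
  then have A [measurable]: "A \<in> sets borel" by simp
  have "emeasure (distr circle_measure borel (\<lambda>x. frac (x + c))) A
      = (\<integral>\<^sup>+x. indicator A x \<partial>distr circle_measure borel (\<lambda>x. frac (x + c)))"
    by simp
  also have "\<dots> = (\<integral>\<^sup>+x. indicator A (frac (x + c)) \<partial>circle_measure)"
    by (rule nn_integral_distr[OF m]) simp
  also have "\<dots> = (\<integral>\<^sup>+x. indicator A x \<partial>circle_measure)"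
    by (rule nn_integral_circle_rotation_frac) simp
  also have "\<dots> = (\<integral>\<^sup>+x. indicator A x \<partial>distr circle_measure borel (\<lambda>x. x))"
    by (rule nn_integral_distr[OF id_measurable_circle, symmetric]) simp
  finally show "emeasure (distr circle_measure borel (\<lambda>x. frac (x + c))) A
      = emeasure (distr circle_measure borel (\<lambda>x. x)) A" by simp
qed simp

lemma one_periodic_add_int:
  fixes f :: "real \<Rightarrow> 'a"
  assumes "\<And>x. f (x + 1) = f x"
  shows "f (x + real_of_int m) = f x"
proof -
  have nat: "f (x + real n) = f x" for n x
  proof (induction n)
    case (Suc n)
    then show ?case using assms[of "x + real n"] by (simp add: algebra_simps)
  qed simp
  show ?thesis
  proof (cases "m \<ge> 0")
    case True
    then show ?thesis using nat[of x "nat m"] by simp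
  next
    case False
    then show ?thesis using nat[of "x + real_of_int m" "nat (- m)"] by simp
  qed
qed

lemma one_periodic_frac:
  fixes f :: "real \<Rightarrow> 'a"
  assumes "\<And>x. f (x + 1) = f x"
  shows "f (frac x) = f x"
  using one_periodic_add_int[of f x "- \<lfloor>x\<rfloor>"] assms by (simp add: frac_def)

lemma integral_circle_rotation:
  fixes f :: "real \<Rightarrow> 'a :: {banach, second_countable_topology}"
  assumes [measurable]: "f \<in> borel_measurable borel" and per: "\<And>x. f (x + 1) = f x"
  shows "(\<integral>x. f (x + c) \<partial>circle_measure) = (\<integral>x. f x \<partial>circle_measure)"
proof -
  have "(\<integral>x. f (x + c) \<partial>circle_measure) = (\<integral>x. f (frac (x + c)) \<partial>circle_measure)"
    using one_periodic_frac[of f] per by simp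
  also have "\<dots> = (\<integral>x. f x \<partial>distr circle_measure borel (\<lambda>x. frac (x + c)))"
    by (rule integral_distr[symmetric]) (auto intro!: measurable_circle_borel)
  also have "\<dots> = (\<integral>x. f x \<partial>circle_measure)"
    unfolding distr_circle_rotation by (rule integral_distr[OF id_measurable_circle]) simp
  finally show ?thesis .
qed

lemma indicator_unit_digits:
  assumes l: "l > 0"
  shows "(\<Sum>j<l. indicator {0..<1} (real l * x - real j)) = (indicator {0..<1} x :: real)"
proof -
  have eq: "indicator {0..<1} (real l * x - real j)
      = (if int j = \<lfloor>real l * x\<rfloor> then 1 else 0 :: real)" for j
    by (auto simp: indicator_def eq_commute[of "int j"] floor_eq_iff)
  show ?thesis
  proof (cases "x \<in> {0..<1}")
    case True
    have "real l * x < real l * 1" using True l by (intro mult_strict_left_mono) auto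
    then have f: "\<lfloor>real l * x\<rfloor> < int l" "\<lfloor>real l * x\<rfloor> \<ge> 0"
      using True by (auto simp: floor_less_iff)
    then obtain i where i: "\<lfloor>real l * x\<rfloor> = int i" "i < l"
      by (metis nonneg_int_cases of_nat_less_iff)
    show ?thesis unfolding eq i(1) using True i(2) by simp
  next
    case False
    have "int j \<noteq> \<lfloor>real l * x\<rfloor>" if "j < l" for j
    proof
      assume e: "int j = \<lfloor>real l * x\<rfloor>"
      have "real j \<le> real l * x" "real l * x < real j + 1"
        using e by linarith+
      then have a: "0 \<le> real l * x" "real l * x < real l * 1" using that by linarith+
      have "0 \<le> x" using a(1) l by (simp add: zero_le_mult_iff)
      moreover have "x < 1" using a(2) l by (simp only: mult_less_cancel_left_pos of_nat_0_less_iff)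
      ultimately show False using False by simp
    qed
    then show ?thesis unfolding eq using False by simp
  qed
qed

text \<open>
Each branch \<open>u \<mapsto> (j + u) / l\<close> maps the circle onto one of the \<open>l\<close> intervals of length \<open>1 / l\<close> and
contracts lengths by \<open>l\<close>; summing over the branches recovers the whole circle.
\<close>

lemma nn_integral_circle_digits:
  assumes [measurable]: "f \<in> borel_measurable borel" and l: "l > 0"
  shows "(\<Sum>j<l. \<integral>\<^sup>+u. f ((real j + u) / real l) \<partial>circle_measure)
     = ennreal (real l) * (\<integral>\<^sup>+x. f x \<partial>circle_measure)"
proof -
  have one: "(\<integral>\<^sup>+u. f ((real j + u) / real l) \<partial>circle_measure)
     = ennreal (real l) * (\<integral>\<^sup>+x. f x * indicator {0..<1} (real l * x - real j) \<partial>lborel)" for j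
  proof -
    have "(\<integral>\<^sup>+u. f ((real j + u) / real l) \<partial>circle_measure)
       = (\<integral>\<^sup>+u. f ((real j + u) / real l) * indicator {0..<1} u \<partial>lborel)"
      by (rule nn_integral_circle) measurable
    also have "\<dots> = ennreal (real l) * (\<integral>\<^sup>+x. f ((real j + (- real j + real l * x)) / real l)
        * indicator {0..<1} (- real j + real l * x) \<partial>lborel)"
      using nn_integral_real_affine[of "\<lambda>u. f ((real j + u) / real l) * indicator {0..<1} u" "real l" "- real j"] l
      by simp
    also have "\<dots> = ennreal (real l) * (\<integral>\<^sup>+x. f x * indicator {0..<1} (real l * x - real j) \<partial>lborel)"
      using l by (intro arg_cong2[where f="(*)"] refl nn_integral_cong) (auto simp: indicator_def)
    finally show ?thesis .
  qed
  have "(\<Sum>j<l. \<integral>\<^sup>+u. f ((real j + u) / real l) \<partial>circle_measure)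
     = ennreal (real l) * (\<integral>\<^sup>+x. (\<Sum>j<l. f x * indicator {0..<1} (real l * x - real j)) \<partial>lborel)"
    unfolding one by (subst nn_integral_sum) (auto simp: sum_distrib_left)
  also have "(\<integral>\<^sup>+x. (\<Sum>j<l. f x * indicator {0..<1} (real l * x - real j)) \<partial>lborel)
     = (\<integral>\<^sup>+x. f x * indicator {0..<1} x \<partial>lborel)"
  proof (rule nn_integral_cong)
    fix x :: real
    have "(\<Sum>j<l. f x * indicator {0..<1} (real l * x - real j))
        = f x * ennreal (\<Sum>j<l. indicator {0..<1} (real l * x - real j))"
      by (subst sum_ennreal[symmetric]) (auto simp: sum_distrib_left ennreal_indicator)
    then show "(\<Sum>j<l. f x * indicator {0..<1} (real l * x - real j)) = f x * indicator {0..<1} x"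
      by (simp add: indicator_unit_digits[OF l] ennreal_indicator)
  qed
  also have "\<dots> = (\<integral>\<^sup>+x. f x \<partial>circle_measure)"
    by (rule nn_integral_circle[symmetric]) measurable
  finally show ?thesis .
qed

lemma integral_circle_digits:
  fixes f :: "real \<Rightarrow> 'a :: {banach, second_countable_topology}"
  assumes int: "\<And>j. integrable circle_measure (\<lambda>u. f ((real j + u) / real l))" and l: "l > 0"
  shows "(\<Sum>j<l. \<integral>u. f ((real j + u) / real l) \<partial>circle_measure)
     = real l *\<^sub>R (\<integral>x. f x \<partial>circle_measure)"
proof -
  define F where "F = (\<lambda>j u. indicator {0..<1} u *\<^sub>R f ((real j + u) / real l))"
  have intF: "integrable lborel (F j)" for j
    using int[of j] unfolding integrable_circle_iff F_def .
  have F: "F j (- real j + real l * x) = indicator {0..<1} (real l * x - real j) *\<^sub>R f x" for j x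
    using l by (simp add: F_def algebra_simps)
  have int': "integrable lborel (\<lambda>x. indicator {0..<1} (real l * x - real j) *\<^sub>R f x)" for j
    using lborel_integrable_real_affine[OF intF[of j], of "real l" "- real j"] l unfolding F by simp
  have one: "(\<integral>u. f ((real j + u) / real l) \<partial>circle_measure)
     = real l *\<^sub>R (\<integral>x. indicator {0..<1} (real l * x - real j) *\<^sub>R f x \<partial>lborel)" for j
    using lborel_integral_real_affine[of "real l" "F j" "- real j"] l
    unfolding F by (simp add: integral_circle F_def)
  have "(\<Sum>j<l. \<integral>u. f ((real j + u) / real l) \<partial>circle_measure)
     = real l *\<^sub>R (\<integral>x. (\<Sum>j<l. indicator {0..<1} (real l * x - real j) *\<^sub>R f x) \<partial>lborel)"
    unfolding one by (subst Bochner_Integration.integral_sum) (auto simp: int' scaleR_sum_right)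
  also have "(\<lambda>x. \<Sum>j<l. indicator {0..<1} (real l * x - real j) *\<^sub>R f x)
     = (\<lambda>x. indicator {0..<1} x *\<^sub>R f x)"
    by (simp add: scaleR_sum_left[symmetric] indicator_unit_digits[OF l])
  finally show ?thesis by (simp add: integral_circle)
qed

lemma measure_circle [simp]: "measure circle_measure {0..<1} = 1"
  using circle.prob_space by simp

section \<open>Periodic functions dominated by an increasing function\<close>

text \<open>
A function of bounded variation is handled only through an increasing function \<open>v\<close> whose increments
dominate those of \<open>f\<close>. The variation function of \<open>f\<close>, extended quasi-periodically, is the typical
\<open>v\<close>, and \<open>V\<close> is its increment over one period.
\<close>

definition dominated :: "real \<Rightarrow> (real \<Rightarrow> real) \<Rightarrow> (real \<Rightarrow> real) \<Rightarrow> bool" where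
  "dominated V v f \<longleftrightarrow> mono v \<and> (\<forall>x. v (x + 1) = v x + V) \<and> (\<forall>x. f (x + 1) = f x) \<and>
     (\<forall>x y. x \<le> y \<longrightarrow> \<bar>f y - f x\<bar> \<le> v y - v x)"

text \<open>
On \<open>[0,1)\<close> the variation function \<open>w\<close> works. Variation on \<open>[0,1)\<close> does not see the jump across an
integer, and this jump has to be paid for by the increment of \<open>v\<close> over a period.
\<close>

lemma bounded_variation_imp_dominated:
  assumes per: "one_periodic f" and bv: "bounded_variation_on {0..<1} f"
  obtains V v where "dominated V v f"
proof -
  obtain B where B: "\<And>n x. (\<forall>i\<le>n. x i \<in> {0..<1}) \<Longrightarrow> (\<forall>i<n. x i \<le> x (Suc i)) \<Longrightarrow>
        (\<Sum>i<n. \<bar>f (x (Suc i)) - f (x i)\<bar>) \<le> B"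
    using bv unfolding bounded_variation_on_def by blast
  define P where "P = (\<lambda>a (n::nat) x. (\<forall>i\<le>n. x i \<in> {0..a}) \<and> (\<forall>i<n. x i \<le> (x (Suc i) :: real)))"
  define A where "A = (\<lambda>a. {\<Sum>i<n. \<bar>f (x (Suc i)) - f (x i)\<bar> |n x. P a n x})"
  define w where "w = (\<lambda>a. Sup (A a))"
  have A_le: "s \<le> B" if "s \<in> A a" "a < 1" for s a
    using that unfolding A_def P_def by (force intro!: B)
  have bdd: "bdd_above (A a)" if "a < 1" for a
    using A_le[OF _ that] by (rule bdd_aboveI)
  have A0: "0 \<in> A a" if "0 \<le> a" for a
    unfolding A_def P_def mem_Collect_eq using that by (intro exI[of _ 0] exI[of _ "\<lambda>_. 0"]) auto
  have w_nonneg: "0 \<le> w a" if "0 \<le> a" "a < 1" for a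
    unfolding w_def by (rule cSup_upper[OF A0 bdd]) (use that in auto)
  have w_le: "w a \<le> B" if "0 \<le> a" "a < 1" for a
    unfolding w_def using A0[OF that(1)] A_le[OF _ that(2)] by (intro cSup_least) auto
  have w_step: "w a + \<bar>f b - f a\<bar> \<le> w b" if "0 \<le> a" "a \<le> b" "b < 1" for a b
  proof -
    have "s \<le> w b - \<bar>f b - f a\<bar>" if "s \<in> A a" for s
    proof -
      from that obtain n x where s: "s = (\<Sum>i<n. \<bar>f (x (Suc i)) - f (x i)\<bar>)" and x: "P a n x"
        unfolding A_def by blast
      define y where "y = (\<lambda>i. if i \<le> n then x i else if i = Suc n then a else b)"
      have "P b (Suc (Suc n)) y"
        using x \<open>0 \<le> a\<close> \<open>a \<le> b\<close> unfolding P_def y_def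
        by (auto simp: less_Suc_eq le_Suc_eq)
      then have "(\<Sum>i<Suc (Suc n). \<bar>f (y (Suc i)) - f (y i)\<bar>) \<in> A b"
        unfolding A_def by blast
      then have "(\<Sum>i<Suc (Suc n). \<bar>f (y (Suc i)) - f (y i)\<bar>) \<le> w b"
        unfolding w_def by (rule cSup_upper[OF _ bdd[OF \<open>b < 1\<close>]])
      moreover have "(\<Sum>i<n. \<bar>f (y (Suc i)) - f (y i)\<bar>) = s"
        unfolding s y_def by (intro sum.cong) auto
      ultimately show ?thesis by (simp add: y_def)
    qed
    then have "Sup (A a) \<le> w b - \<bar>f b - f a\<bar>"
      using A0[OF that(1)] by (intro cSup_least) auto
    then show ?thesis by (simp add: w_def)
  qed
  have f_le: "\<bar>f b - f a\<bar> \<le> B" if "0 \<le> a" "a < 1" "0 \<le> b" "b < 1" for a b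
  proof (cases "a \<le> b")
    case True
    then show ?thesis using w_step[of a b] w_nonneg[of a] w_le[of b] that by linarith
  next
    case False
    then show ?thesis using w_step[of b a] w_nonneg[of b] w_le[of a] that
      by (simp add: abs_minus_commute)
  qed
  \<comment> \<open>when \<open>x\<close> passes an integer, \<open>w (frac x)\<close> may drop by \<open>B\<close> and \<open>f\<close> may jump by \<open>B\<close>, whence \<open>2 * B\<close>\<close>
  define v where "v = (\<lambda>x. w (frac x) + 2 * B * of_int \<lfloor>x\<rfloor>)"
  have B0: "0 \<le> B" using w_nonneg[of 0] w_le[of 0] by simp
  have per': "f (frac x) = f x" for x
    using one_periodic_frac[of f x] per unfolding one_periodic_def by blast
  have fr: "0 \<le> frac x" "frac x < 1" for x :: real by (auto simp: frac_lt_1)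
  have step: "\<bar>f y - f x\<bar> \<le> v y - v x" if "x \<le> y" for x y
  proof (cases "\<lfloor>x\<rfloor> = \<lfloor>y\<rfloor>")
    case True
    then have "frac x \<le> frac y" using that by (simp add: frac_def)
    then show ?thesis using w_step[of "frac x" "frac y"] fr True by (simp add: v_def per')
  next
    case False
    then have "\<lfloor>x\<rfloor> + 1 \<le> \<lfloor>y\<rfloor>" using floor_mono[OF that] by linarith
    then have "1 \<le> real_of_int \<lfloor>y\<rfloor> - of_int \<lfloor>x\<rfloor>" by linarith
    then have "2 * B * 1 \<le> 2 * B * (real_of_int \<lfloor>y\<rfloor> - of_int \<lfloor>x\<rfloor>)"
      using B0 by (intro mult_left_mono) auto
    moreover have "\<bar>f y - f x\<bar> \<le> B" using f_le[of "frac x" "frac y"] fr by (simp add: per')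
    moreover have "w (frac x) \<le> B" "0 \<le> w (frac y)" using w_le w_nonneg fr by auto
    ultimately show ?thesis by (simp add: v_def algebra_simps)
  qed
  have "mono v" using step by (intro monoI) (smt (verit))
  moreover have "v (x + 1) = v x + 2 * B" for x
    by (simp add: v_def frac_def algebra_simps)
  ultimately have "dominated (2 * B) v f"
    using step per by (auto simp: dominated_def one_periodic_def)
  then show thesis by (rule that)
qed

text \<open>
The majorant of the oscillation of a dominated function on the interval of radius \<open>e\<close> around \<open>x\<close>.
Its integral over the circle is linear in \<open>e\<close>, which turns the pointwise failure of continuity of \<open>f\<close>
into a bound in mean.
\<close>

definition spread :: "(real \<Rightarrow> real) \<Rightarrow> real \<Rightarrow> real \<Rightarrow> real" where
  "spread v e x = v (x + e) - v (x - e)"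

context
  fixes V :: real and v f :: "real \<Rightarrow> real"
  assumes dom: "dominated V v f"
begin

lemma dominated_mono: "x \<le> y \<Longrightarrow> v x \<le> v y"
  using dom by (auto simp: dominated_def mono_def)

lemma dominated_add1 [simp]: "v (x + 1) = v x + V"
  using dom by (auto simp: dominated_def)

lemma dominated_periodic [simp]: "f (x + 1) = f x"
  using dom by (auto simp: dominated_def)

lemma dominated_diff: "x \<le> y \<Longrightarrow> \<bar>f y - f x\<bar> \<le> v y - v x"
  using dom by (auto simp: dominated_def)

lemma dominated_nonneg: "0 \<le> V"
  using dominated_mono[of 0 "0 + 1"] dominated_add1[of 0] by simp

lemma dominated_frac: "f (frac x) = f x"
  by (rule one_periodic_frac) simp

lemma dominated_diff_le: "\<bar>f x - f y\<bar> \<le> V"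
proof -
  have *: "\<bar>f b - f a\<bar> \<le> V" if "0 \<le> a" "a \<le> b" "b < 1" for a b
    using dominated_diff[of a b] dominated_mono[of 0 a] dominated_mono[of b "0 + 1"]
      dominated_add1[of 0] that by simp
  have "\<bar>f (frac x) - f (frac y)\<bar> \<le> V"
    using *[of "frac x" "frac y"] *[of "frac y" "frac x"] frac_lt_1[of x] frac_lt_1[of y]
    by (cases "frac x \<le> frac y") (auto simp: abs_minus_commute)
  then show ?thesis by (simp add: dominated_frac)
qed

lemma dominated_measurable_majorant: "v \<in> borel_measurable borel"
  using dom by (intro borel_measurable_mono) (simp add: dominated_def)

lemma dominated_measurable: "f \<in> borel_measurable borel"
proof -
  have "mono (\<lambda>x. v x - f x)"
    using dominated_diff by (intro monoI) (smt (verit))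
  then have "(\<lambda>x. v x - f x) \<in> borel_measurable borel" by (rule borel_measurable_mono)
  then have "(\<lambda>x. v x - (v x - f x)) \<in> borel_measurable borel"
    by (rule borel_measurable_diff[OF dominated_measurable_majorant])
  then show ?thesis by simp
qed

lemma dominated_integrable: "integrable circle_measure (\<lambda>x. f (x + c))"
proof (rule circle.integrable_const_bound[where B = "\<bar>f 0\<bar> + V"])
  note [measurable] = dominated_measurable
  show "AE x in circle_measure. norm (f (x + c)) \<le> \<bar>f 0\<bar> + V"
  proof (intro AE_I2)
    fix x show "norm (f (x + c)) \<le> \<bar>f 0\<bar> + V" using dominated_diff_le[of "x + c" 0] by simp
  qed
  show "(\<lambda>x. f (x + c)) \<in> borel_measurable circle_measure"
    by (rule measurable_circle_borel) measurable
qed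

text \<open>
A centred function is an average of its own differences \<open>f x - f y\<close>, each at most \<open>V\<close>.
\<close>

lemma centered_dominated_bound:
  assumes "centered f"
  shows "\<bar>f x\<bar> \<le> V"
proof -
  have int: "integrable circle_measure f" using dominated_integrable[of 0] by simp
  have "f x = (\<integral>y. f x - f y \<partial>circle_measure)"
    using assms int by (simp add: centered_def circle.prob_space)
  also have "\<bar>\<dots>\<bar> \<le> (\<integral>y. \<bar>f x - f y\<bar> \<partial>circle_measure)"
    by (rule integral_abs_bound)
  also have "\<dots> \<le> (\<integral>y. V \<partial>circle_measure)"
    by (rule integral_mono) (use int dominated_diff_le in auto)
  also have "\<dots> = V" by (simp add: circle.prob_space)
  finally show ?thesis .
qed

lemma spread_periodic: "spread v e (x + 1) = spread v e x"
proof -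
  have "x + 1 + e = (x + e) + 1" "x + 1 - e = (x - e) + 1" by auto
  then show ?thesis by (simp only: spread_def dominated_add1)
qed

lemma spread_measurable: "spread v e \<in> borel_measurable borel"
  using dominated_measurable_majorant unfolding spread_def by simp

lemma spread_nonneg: "0 \<le> e \<Longrightarrow> 0 \<le> spread v e x"
  unfolding spread_def using dominated_mono[of "x - e" "x + e"] by simp

lemma spread_mono: "d \<le> e \<Longrightarrow> spread v d x \<le> spread v e x"
  unfolding spread_def using dominated_mono[of "x + d" "x + e"] dominated_mono[of "x - e" "x - d"]
  by simp

lemma spread_le: "e \<le> 1 \<Longrightarrow> spread v e x \<le> 2 * V"
  using spread_mono[of e 1 x] dominated_add1[of x] dominated_add1[of "x - 1"]
  by (simp add: spread_def add.commute del: dominated_add1)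

lemma dominated_spread: "\<bar>s\<bar> \<le> e \<Longrightarrow> \<bar>f (x + s) - f x\<bar> \<le> spread v e x"
  unfolding spread_def
  using dominated_diff[of x "x + s"] dominated_diff[of "x + s" x]
    dominated_mono[of "x + s" "x + e"] dominated_mono[of "x - e" "x"]
    dominated_mono[of "x - e" "x + s"] dominated_mono[of "x" "x + e"]
  by (cases "s \<ge> 0") auto

lemma integrable_spread:
  assumes "0 \<le> e" "e \<le> 1" shows "integrable circle_measure (\<lambda>x. spread v e (x + c))"
proof (rule circle.integrable_const_bound[where B = "2 * V"])
  show "AE x in circle_measure. norm (spread v e (x + c)) \<le> 2 * V"
    using spread_nonneg spread_le assms by (intro AE_I2) auto
  show "(\<lambda>x. spread v e (x + c)) \<in> borel_measurable circle_measure"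
    by (rule measurable_circle_borel) (rule measurable_compose[OF _ spread_measurable], simp)
qed

text \<open>
\<open>v x - V * x\<close> is periodic and bounded, so its two translates have the same integral and only the
linear part contributes.
\<close>

lemma integral_spread: "(\<integral>x. spread v e (x + c) \<partial>circle_measure) = 2 * e * V"
proof -
  note [measurable] = dominated_measurable_majorant
  define p where "p x = v x - V * x" for x
  have [measurable]: "p \<in> borel_measurable borel" unfolding p_def by measurable
  have per: "p (x + 1) = p x" for x unfolding p_def dominated_add1 by (simp add: algebra_simps)
  have pb: "\<bar>p x\<bar> \<le> \<bar>v 0\<bar> + 2 * V" for x
  proof -
    have f: "0 \<le> frac x" "frac x \<le> 1" using frac_lt_1[of x] by auto
    have "0 \<le> V * frac x" "V * frac x \<le> V"
      using f dominated_nonneg by (auto intro: mult_left_le)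
    moreover have "v 0 \<le> v (frac x)" "v (frac x) \<le> v 0 + V"
      using dominated_mono[OF f(1)] dominated_mono[OF f(2)] dominated_add1[of 0] by auto
    ultimately have "\<bar>p (frac x)\<bar> \<le> \<bar>v 0\<bar> + 2 * V"
      using dominated_nonneg unfolding p_def by linarith
    then show ?thesis using one_periodic_frac[of p x] per by simp
  qed
  have int: "integrable circle_measure (\<lambda>x. p (x + d))" for d
    by (rule circle.integrable_const_bound[where B = "\<bar>v 0\<bar> + 2 * V"])
      (use pb in \<open>auto intro!: measurable_circle_borel\<close>)
  have "spread v e (x + c) = p (x + (c + e)) - p (x + (c - e)) + 2 * e * V" for x
    unfolding spread_def p_def by (simp add: algebra_simps)
  then have "(\<integral>x. spread v e (x + c) \<partial>circle_measure)
    = (\<integral>x. p (x + (c + e)) \<partial>circle_measure) - (\<integral>x. p (x + (c - e)) \<partial>circle_measure) + 2 * e * V"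
    using int[of "c + e"] int[of "c - e"] by (simp add: circle.prob_space)
  then show ?thesis using integral_circle_rotation[of p] per by simp
qed

end

text \<open>
The transfer operator of \<open>x \<mapsto> l x\<close>, without normalisation. For centred \<open>f\<close> it is the function that the
Fourier series \<open>hat_fun f l\<close> represents.
\<close>

definition fold_sum :: "nat \<Rightarrow> (real \<Rightarrow> real) \<Rightarrow> real \<Rightarrow> real" where
  "fold_sum l f y = (\<Sum>j<l. f ((real j + y) / real l))"

lemma fold_sum_add1:
  assumes "l > 0"
  shows "fold_sum l f (y + 1) = fold_sum l f y + (f (y / real l + 1) - f (y / real l))"
proof -
  define F where "F j = f ((real j + y) / real l)" for j
  have "fold_sum l f (y + 1) = (\<Sum>j<l. F (Suc j))"
    unfolding fold_sum_def F_def by (intro sum.cong) (auto simp: algebra_simps)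
  also have "\<dots> = (\<Sum>j<l. F j) + (F l - F 0)"
    using sum_lessThan_telescope[of F l] by (simp add: sum_subtractf)
  finally show ?thesis
    using assms by (simp add: fold_sum_def F_def add_divide_distrib add.commute)
qed

lemma fold_sum_mult: "l > 0 \<Longrightarrow> fold_sum l f (real l * y) = (\<Sum>j<l. f (y + real j / real l))"
  unfolding fold_sum_def by (intro sum.cong) (auto simp: add_divide_distrib add.commute)

text \<open>
The constant \<open>V\<close> does not grow with \<open>l\<close>: the points \<open>(j + y) / l\<close> together run through the circle
once, so the increment of \<open>fold_sum l v\<close> over a period telescopes to that of \<open>v\<close>.
\<close>

lemma dominated_fold_sum:
  assumes dom: "dominated V v f" and l: "l > 0"
  shows "dominated V (fold_sum l v) (fold_sum l f)"
  unfolding dominated_def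
proof (intro conjI allI impI)
  note d = dominated_mono[OF dom] dominated_add1[OF dom] dominated_periodic[OF dom] dominated_diff[OF dom]
  show "mono (fold_sum l v)"
    unfolding fold_sum_def using l by (intro monoI sum_mono d) (auto simp: divide_right_mono)
  fix x show "fold_sum l v (x + 1) = fold_sum l v x + V"
    by (simp add: fold_sum_add1[OF l] d)
  show "fold_sum l f (x + 1) = fold_sum l f x"
    by (simp add: fold_sum_add1[OF l] d)
  fix y :: real assume "x \<le> y"
  have "\<bar>fold_sum l f y - fold_sum l f x\<bar> \<le> (\<Sum>j<l. \<bar>f ((real j + y) / real l) - f ((real j + x) / real l)\<bar>)"
    unfolding fold_sum_def sum_subtractf[symmetric] by (rule sum_abs)
  also have "\<dots> \<le> (\<Sum>j<l. v ((real j + y) / real l) - v ((real j + x) / real l))"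
    using \<open>x \<le> y\<close> l by (intro sum_mono d) (auto simp: divide_right_mono)
  finally show "\<bar>fold_sum l f y - fold_sum l f x\<bar> \<le> fold_sum l v y - fold_sum l v x"
    by (simp add: fold_sum_def sum_subtractf)
qed

lemma dominated_integrable_digit:
  assumes dom: "dominated V v f"
  shows "integrable circle_measure (\<lambda>u. f ((real j + u) / real l))"
proof (rule circle.integrable_const_bound[where B = "\<bar>f 0\<bar> + V"])
  note [measurable] = dominated_measurable[OF dom]
  show "AE x in circle_measure. norm (f ((real j + x) / real l)) \<le> \<bar>f 0\<bar> + V"
  proof (intro AE_I2)
    fix x show "norm (f ((real j + x) / real l)) \<le> \<bar>f 0\<bar> + V"
      using dominated_diff_le[OF dom, of "(real j + x) / real l" 0] by simp
  qed
  show "(\<lambda>u. f ((real j + u) / real l)) \<in> borel_measurable circle_measure"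
    by (rule measurable_circle_borel) measurable
qed

lemma centered_fold_sum:
  assumes dom: "dominated V v f" and l: "l > 0" and cent: "centered f"
  shows "centered (fold_sum l f)"
  using integral_circle_digits[of f l] dominated_integrable_digit[OF dom] l cent
  unfolding centered_def fold_sum_def by (subst Bochner_Integration.integral_sum) auto

section \<open>Fourier series of dominated functions\<close>

definition wave :: "int \<Rightarrow> real \<Rightarrow> complex" where
  "wave r x = cis (2 * pi * of_int r * x)"

lemma wave_add: "wave r (x + y) = wave r x * wave r y"
  by (simp add: wave_def cis_mult distrib_left)

lemma wave_periodic [simp]: "wave r (x + 1) = wave r x"
  unfolding wave_add by (simp add: wave_def cis_multiple_2pi)

lemma wave_mult_wave: "wave r x * wave s x = wave (r + s) x"
  by (simp add: wave_def cis_mult algebra_simps)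

lemma cnj_wave: "cnj (wave r x) = wave (- r) x"
  by (simp add: wave_def cis_cnj)

lemma norm_wave [simp]: "norm (wave r x) = 1"
  by (simp add: wave_def)

lemma wave_measurable [measurable]: "wave r \<in> borel_measurable borel"
  unfolding wave_def by (intro borel_measurable_continuous_onI continuous_intros)

lemma wave_half: "r \<noteq> 0 \<Longrightarrow> wave r (1 / (2 * of_int r)) = - 1" "r \<noteq> 0 \<Longrightarrow> wave (- r) (1 / (2 * of_int r)) = - 1"
  by (simp_all add: wave_def complex_eq_iff)

lemma wave_0 [simp]: "wave 0 x = 1"
  by (simp add: wave_def)

lemma integrable_wave: "integrable circle_measure (wave r)"
  by (rule circle.integrable_const_bound[where B = 1]) (auto intro!: measurable_circle_borel)

lemma integral_wave: "(\<integral>x. wave r x \<partial>circle_measure) = (if r = 0 then 1 else 0)"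
proof (cases "r = 0")
  case False
  have "(\<integral>x. wave r x \<partial>circle_measure) = (\<integral>x. wave r (x + 1 / (2 * of_int r)) \<partial>circle_measure)"
    by (rule integral_circle_rotation[symmetric]) auto
  also have "\<dots> = - (\<integral>x. wave r x \<partial>circle_measure)"
    by (simp add: wave_add wave_half[OF False])
  finally show ?thesis using False by simp
qed (simp add: circle.prob_space)

lemma fourier_coeff_wave: "fourier_coeff f r = (\<integral>x. complex_of_real (f x) * wave (- r) x \<partial>circle_measure)"
  by (simp add: fourier_coeff_def wave_def)

lemma summable_differences_convergent:
  fixes a :: "nat \<Rightarrow> 'a :: real_normed_vector"
  assumes "summable (\<lambda>n. a (Suc n) - a n)"
  shows "convergent a"
proof -
  have "convergent (\<lambda>n. a 0 + (\<Sum>i<n. a (Suc i) - a i))"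
    using assms by (intro convergent_add convergent_const) (simp add: summable_iff_convergent)
  then show ?thesis by (simp add: sum_lessThan_telescope)
qed

definition trig_sum :: "(real \<Rightarrow> real) \<Rightarrow> int set \<Rightarrow> real \<Rightarrow> complex" where
  "trig_sum f A x = (\<Sum>r\<in>A. fourier_coeff f r * wave r x)"

abbreviation symm :: "nat \<Rightarrow> int set" where "symm N \<equiv> {- int N..int N} - {0}"

locale dominated_fun =
  fixes V :: real and v f :: "real \<Rightarrow> real"
  assumes dom: "dominated V v f"
begin

lemma meas [measurable]: "f \<in> borel_measurable borel"
  by (rule dominated_measurable[OF dom])

lemma bound: "\<bar>f x\<bar> \<le> \<bar>f 0\<bar> + V"
  using dominated_diff_le[OF dom, of x 0] by simp

lemma integrable_dominated_wave:
  "integrable circle_measure (\<lambda>x. complex_of_real (f (x + c)) * wave r x)"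
  by (rule circle.integrable_const_bound[where B = "\<bar>f 0\<bar> + V"])
    (use bound in \<open>auto intro!: measurable_circle_borel simp: norm_mult\<close>)

text \<open>
Translating by \<open>1 / (2 r)\<close> changes the sign of the exponential. Twice the coefficient is therefore the
Fourier coefficient of a difference of \<open>f\<close> over the distance \<open>1 / (2 |r|)\<close>, whose mean size is
controlled by \<open>integral_spread\<close>.
\<close>

lemma fourier_coeff_bound:
  assumes r: "r \<noteq> 0"
  shows "norm (fourier_coeff f r) \<le> V / (2 * \<bar>of_int r\<bar>)"
proof -
  define h where "h = 1 / (2 * real_of_int r)"
  let ?c = "fourier_coeff f r"
  have h: "wave (- r) h = - 1" using wave_half[OF r] by (simp add: h_def)
  have habs: "\<bar>h\<bar> = 1 / (2 * \<bar>of_int r\<bar>)" by (simp add: h_def abs_divide abs_mult)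
  have hle: "\<bar>h\<bar> \<le> 1"
  proof -
    have "1 \<le> \<bar>real_of_int r\<bar>" using r by linarith
    then show ?thesis by (simp add: habs field_simps)
  qed
  have "?c = (\<integral>x. complex_of_real (f (x + h)) * wave (- r) (x + h) \<partial>circle_measure)"
    unfolding fourier_coeff_wave
    by (rule integral_circle_rotation[symmetric]) (auto simp: dominated_periodic[OF dom])
  also have "\<dots> = - (\<integral>x. complex_of_real (f (x + h)) * wave (- r) x \<partial>circle_measure)"
    by (simp add: wave_add h)
  finally have "?c + ?c = (\<integral>x. complex_of_real (f (x + 0)) * wave (- r) x \<partial>circle_measure)
      - (\<integral>x. complex_of_real (f (x + h)) * wave (- r) x \<partial>circle_measure)"
    by (simp add: fourier_coeff_wave)
  also have "\<dots> = (\<integral>x. complex_of_real (f (x + 0)) * wave (- r) x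
      - complex_of_real (f (x + h)) * wave (- r) x \<partial>circle_measure)"
    by (rule Bochner_Integration.integral_diff[symmetric]) (rule integrable_dominated_wave)+
  finally have "norm (?c + ?c) = norm (\<integral>x. complex_of_real (f (x + 0)) * wave (- r) x
      - complex_of_real (f (x + h)) * wave (- r) x \<partial>circle_measure)" by simp
  also have "\<dots> \<le> (\<integral>x. norm (complex_of_real (f (x + 0)) * wave (- r) x
      - complex_of_real (f (x + h)) * wave (- r) x) \<partial>circle_measure)"
    by (rule integral_norm_bound)
  also have "\<dots> = (\<integral>x. \<bar>f (x + h) - f x\<bar> \<partial>circle_measure)"
    by (simp add: left_diff_distrib[symmetric] norm_mult abs_minus_commute flip: of_real_diff)
  also have "\<dots> \<le> (\<integral>x. spread v \<bar>h\<bar> (x + 0) \<partial>circle_measure)"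
    by (intro integral_mono integrable_abs Bochner_Integration.integrable_diff
      dominated_integrable[OF dom] dominated_integrable[OF dom, of 0, simplified] integrable_spread[OF dom])
      (use hle dominated_spread[OF dom, of h "\<bar>h\<bar>"] in auto)
  also have "\<dots> = 2 * \<bar>h\<bar> * V" by (rule integral_spread[OF dom])
  also have "norm (?c + ?c) = 2 * norm ?c"
    by (metis mult_2 norm_mult norm_numeral)
  finally show ?thesis unfolding habs by simp
qed

lemma fourier_coeff_fold_sum:
  assumes l: "l > 0"
  shows "fourier_coeff (fold_sum l f) r = of_nat l * fourier_coeff f (r * int l)"
proof -
  define F where "F x = complex_of_real (f x) * wave (- (r * int l)) x" for x
  have F: "F ((real j + u) / real l) = complex_of_real (f ((real j + u) / real l)) * wave (- r) u" for j u
  proof -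
    have "wave (- (r * int l)) ((real j + u) / real l) = wave (- r) (real j + u)"
      using l unfolding wave_def by (intro arg_cong[where f=cis]) (simp add: field_simps)
    also have "\<dots> = wave (- r) u"
      using one_periodic_add_int[of "wave (- r)" u "int j"] by (simp add: add.commute)
    finally show ?thesis by (simp add: F_def)
  qed
  have int: "integrable circle_measure (\<lambda>u. complex_of_real (f ((real j + u) / real l)) * wave (- r) u)" for j
    by (rule circle.integrable_const_bound[where B = "\<bar>f 0\<bar> + V"])
      (use bound in \<open>auto intro!: measurable_circle_borel simp: norm_mult\<close>)
  have "(\<Sum>j<l. \<integral>u. F ((real j + u) / real l) \<partial>circle_measure)
      = real l *\<^sub>R (\<integral>x. F x \<partial>circle_measure)"
    by (rule integral_circle_digits[OF _ l]) (simp add: F int)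
  moreover have "fourier_coeff (fold_sum l f) r = (\<Sum>j<l. \<integral>u. F ((real j + u) / real l) \<partial>circle_measure)"
    unfolding fourier_coeff_wave F fold_sum_def of_real_sum sum_distrib_right
    by (rule Bochner_Integration.integral_sum) (rule int)
  ultimately show ?thesis
    by (simp add: fourier_coeff_wave F_def scaleR_conv_of_real)
qed

lemma trig_sum_measurable [measurable]: "trig_sum f A \<in> borel_measurable borel"
  unfolding trig_sum_def by measurable

lemma norm_trig_sum: "norm (trig_sum f A x) \<le> (\<Sum>r\<in>A. norm (fourier_coeff f r))"
  unfolding trig_sum_def by (rule order_trans[OF norm_sum]) (simp add: norm_mult)

lemma integrable_trig_sum_square: "integrable circle_measure (\<lambda>x. (norm (trig_sum f A x))\<^sup>2)"
  by (rule circle.integrable_const_bound[where B = "(\<Sum>r\<in>A. norm (fourier_coeff f r))\<^sup>2"])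
    (use norm_trig_sum in \<open>auto intro!: measurable_circle_borel power_mono\<close>)

lemma integral_trig_sum_square:
  assumes A: "finite A"
  shows "(\<integral>x. (norm (trig_sum f A x))\<^sup>2 \<partial>circle_measure) = (\<Sum>r\<in>A. (norm (fourier_coeff f r))\<^sup>2)"
proof -
  let ?c = "fourier_coeff f"
  have "complex_of_real (\<integral>x. (norm (trig_sum f A x))\<^sup>2 \<partial>circle_measure)
     = (\<integral>x. complex_of_real ((norm (trig_sum f A x))\<^sup>2) \<partial>circle_measure)"
    by (rule integral_complex_of_real[symmetric])
  also have "\<dots> = (\<integral>x. (\<Sum>r\<in>A. \<Sum>s\<in>A. (?c r * cnj (?c s)) * wave (r - s) x) \<partial>circle_measure)"
  proof (intro Bochner_Integration.integral_cong refl)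
    fix x
    have "complex_of_real ((norm (trig_sum f A x))\<^sup>2) = trig_sum f A x * cnj (trig_sum f A x)"
      by (rule complex_norm_square)
    also have "\<dots> = (\<Sum>r\<in>A. \<Sum>s\<in>A. (?c r * wave r x) * (cnj (?c s) * wave (- s) x))"
      unfolding trig_sum_def by (simp add: sum_product cnj_wave)
    also have "\<dots> = (\<Sum>r\<in>A. \<Sum>s\<in>A. (?c r * cnj (?c s)) * wave (r - s) x)"
      using wave_mult_wave[of _ x "- _"] by (intro sum.cong refl) (simp add: ac_simps)
    finally show "complex_of_real ((norm (trig_sum f A x))\<^sup>2) = \<dots>" .
  qed
  also have "\<dots> = (\<Sum>r\<in>A. \<Sum>s\<in>A. (?c r * cnj (?c s)) * (if r = s then 1 else 0))"
    by (simp add: integrable_wave integral_wave Bochner_Integration.integral_sum)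
  also have "\<dots> = (\<Sum>r\<in>A. ?c r * cnj (?c r))"
    using A by (simp add: if_distrib cong: if_cong)
  also have "\<dots> = complex_of_real (\<Sum>r\<in>A. (norm (?c r))\<^sup>2)"
    unfolding of_real_sum complex_norm_square ..
  finally show ?thesis by (simp only: of_real_eq_iff)
qed

lemma bessel:
  assumes A: "finite A"
  shows "(\<Sum>r\<in>A. (norm (fourier_coeff f r))\<^sup>2) \<le> (\<integral>x. (f x)\<^sup>2 \<partial>circle_measure)"
proof -
  let ?c = "fourier_coeff f"
  define I where "I x = Re (complex_of_real (f x) * cnj (trig_sum f A x))" for x
  have sq: "(norm (complex_of_real a - z))\<^sup>2 = a\<^sup>2 - 2 * Re (complex_of_real a * cnj z) + (norm z)\<^sup>2" for a z
    unfolding cmod_power2 by (simp add: power2_eq_square algebra_simps)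
  have eq: "complex_of_real (f x) * cnj (trig_sum f A x) = (\<Sum>r\<in>A. cnj (?c r) * (complex_of_real (f x) * wave (- r) x))" for x
    unfolding trig_sum_def by (simp add: sum_distrib_left cnj_wave ac_simps)
  have int: "integrable circle_measure (\<lambda>x. complex_of_real (f x) * cnj (trig_sum f A x))"
    unfolding eq using integrable_dominated_wave[of 0] by auto
  have intf: "integrable circle_measure (\<lambda>x. (f x)\<^sup>2)"
    by (rule circle.integrable_const_bound[where B = "(\<bar>f 0\<bar> + V)\<^sup>2"])
     (use bound dominated_nonneg[OF dom] in \<open>auto intro!: measurable_circle_borel simp: abs_le_square_iff[symmetric]\<close>)
  have "(\<integral>x. complex_of_real (f x) * cnj (trig_sum f A x) \<partial>circle_measure) = (\<Sum>r\<in>A. cnj (?c r) * ?c r)"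
    unfolding eq using integrable_dominated_wave[of 0]
    by (subst Bochner_Integration.integral_sum) (auto simp: fourier_coeff_wave)
  also have "\<dots> = complex_of_real (\<Sum>r\<in>A. (norm (?c r))\<^sup>2)"
    unfolding of_real_sum complex_norm_square by (simp only: mult.commute)
  finally have I: "(\<integral>x. I x \<partial>circle_measure) = (\<Sum>r\<in>A. (norm (?c r))\<^sup>2)"
    unfolding I_def using int by (subst integral_Re) auto
  have intI: "integrable circle_measure I" unfolding I_def using int by (rule integrable_Re)
  have "0 \<le> (\<integral>x. (norm (complex_of_real (f x) - trig_sum f A x))\<^sup>2 \<partial>circle_measure)"
    by (rule integral_nonneg_AE) auto
  also have "\<dots> = (\<integral>x. (f x)\<^sup>2 - 2 * I x + (norm (trig_sum f A x))\<^sup>2 \<partial>circle_measure)"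
    by (simp only: sq I_def)
  also have "\<dots> = (\<integral>x. (f x)\<^sup>2 \<partial>circle_measure) - 2 * (\<integral>x. I x \<partial>circle_measure)
      + (\<integral>x. (norm (trig_sum f A x))\<^sup>2 \<partial>circle_measure)"
    using intf intI integrable_trig_sum_square by simp
  finally show ?thesis using I integral_trig_sum_square[OF A] by simp
qed

lemma card_symm_diff: "M \<le> N \<Longrightarrow> card (symm N - symm M) = 2 * (N - M)"
  by (subst card_Diff_subset) auto

lemma symm_diff_bound:
  assumes "0 < M" "M \<le> N" "r \<in> symm N - symm M"
  shows "norm (fourier_coeff f r) \<le> V / (2 * real M)"
proof -
  have r: "r \<noteq> 0" "int M \<le> \<bar>r\<bar>" using assms by auto
  have "real M \<le> \<bar>real_of_int r\<bar>" using r(2) by linarith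
  then have "V / (2 * \<bar>real_of_int r\<bar>) \<le> V / (2 * real M)"
    using assms dominated_nonneg[OF dom] by (intro divide_left_mono) auto
  then show ?thesis using fourier_coeff_bound[OF r(1)] by linarith
qed

lemma trig_sum_diff: "M \<le> N \<Longrightarrow> trig_sum f (symm N) x - trig_sum f (symm M) x = trig_sum f (symm N - symm M) x"
  unfolding trig_sum_def by (subst sum_diff) auto

lemma trig_sum_diff_bound:
  assumes "0 < M" "M \<le> N"
  shows "norm (trig_sum f (symm N) x - trig_sum f (symm M) x) \<le> V * real (N - M) / real M"
proof -
  have "norm (trig_sum f (symm N - symm M) x) \<le> (\<Sum>r\<in>symm N - symm M. V / (2 * real M))"
    by (rule order_trans[OF norm_trig_sum], intro sum_mono, rule symm_diff_bound[OF assms])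
  also have "\<dots> = V * real (N - M) / real M"
    using card_symm_diff[OF assms(2)] by simp
  finally show ?thesis using trig_sum_diff[OF assms(2)] by simp
qed

lemma trig_sum_square_diff_bound:
  assumes "0 < M" "M \<le> N"
  shows "(\<integral>x. (norm (trig_sum f (symm N) x - trig_sum f (symm M) x))\<^sup>2 \<partial>circle_measure)
     \<le> V\<^sup>2 * real (N - M) / (real M)\<^sup>2"
proof -
  have "(\<integral>x. (norm (trig_sum f (symm N - symm M) x))\<^sup>2 \<partial>circle_measure)
     = (\<Sum>r\<in>symm N - symm M. (norm (fourier_coeff f r))\<^sup>2)"
    by (rule integral_trig_sum_square) simp
  also have "\<dots> \<le> (\<Sum>r\<in>symm N - symm M. (V / (2 * real M))\<^sup>2)"
    by (intro sum_mono power_mono, rule symm_diff_bound[OF assms]) auto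
  also have "\<dots> = V\<^sup>2 * real (N - M) / (2 * (real M)\<^sup>2)"
    using card_symm_diff[OF assms(2)] by (simp add: power2_eq_square)
  also have "\<dots> \<le> V\<^sup>2 * real (N - M) / (real M)\<^sup>2"
    using assms by (intro divide_left_mono) auto
  finally show ?thesis using trig_sum_diff[OF assms(2)] by simp
qed

text \<open>
Between the orders \<open>j\<^sup>2\<close> and \<open>(j + 1)\<^sup>2\<close> there are about \<open>4 j\<close> frequencies with coefficients
\<open>O(j\<^bsup>-2\<^esup>)\<close>, so consecutive partial sums differ by \<open>O(j\<^bsup>-3/2\<^esup>)\<close> in mean square, which is
summable.
\<close>

lemma trig_sum_squares_convergent:
  "AE x in circle_measure. convergent (\<lambda>j. trig_sum f (symm (j\<^sup>2)) x)"
proof -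
  define T where "T j x = norm (trig_sum f (symm ((Suc (Suc j))\<^sup>2)) x - trig_sum f (symm ((Suc j)\<^sup>2)) x)" for j x
  have [measurable]: "T j \<in> borel_measurable circle_measure" for j
    unfolding T_def by (rule measurable_circle_borel) measurable
  define K where "K = 3 * V\<^sup>2 + 1"
  have K: "K \<ge> 0" by (simp add: K_def)
  have bound: "(\<integral>\<^sup>+x. ennreal (T j x) \<partial>circle_measure) \<le> ennreal (K * real (Suc j) powr (- 3/2))" for j
  proof -
    define m where "m = real (Suc j)"
    have m: "m \<ge> 1" by (simp add: m_def)
    define a where "a = m powr (3/2)"
    have a: "a > 0" using m by (simp add: a_def)
    have int: "integrable circle_measure (\<lambda>x. (T j x)\<^sup>2)"
      unfolding T_def by (subst trig_sum_diff) (auto intro: integrable_trig_sum_square)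
    have "(\<integral>x. (T j x)\<^sup>2 \<partial>circle_measure) \<le> V\<^sup>2 * real ((Suc (Suc j))\<^sup>2 - (Suc j)\<^sup>2) / (real ((Suc j)\<^sup>2))\<^sup>2"
      unfolding T_def by (rule trig_sum_square_diff_bound) auto
    also have "real ((Suc (Suc j))\<^sup>2 - (Suc j)\<^sup>2) = 2 * m + 1"
      by (simp add: m_def power2_eq_square of_nat_diff algebra_simps)
    also have "V\<^sup>2 * (2 * m + 1) / (real ((Suc j)\<^sup>2))\<^sup>2 \<le> V\<^sup>2 * (3 * m) / (real ((Suc j)\<^sup>2))\<^sup>2"
      using m by (intro divide_right_mono mult_left_mono) auto
    also have "\<dots> = 3 * V\<^sup>2 / m ^ 3"
    proof -
      have "(real ((Suc j)\<^sup>2))\<^sup>2 = m * m ^ 3"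
        by (simp only: m_def of_nat_power) algebra
      then show ?thesis using m by simp
    qed
    also have "m ^ 3 = a * a"
    proof -
      have "a * a = m powr (3/2 + 3/2)" unfolding a_def powr_add ..
      also have "\<dots> = m ^ 3" using m by (simp add: powr_numeral)
      finally show ?thesis ..
    qed
    finally have sq: "(\<integral>x. (T j x)\<^sup>2 \<partial>circle_measure) \<le> 3 * V\<^sup>2 / (a * a)" .
    have "(\<integral>\<^sup>+x. ennreal (T j x) \<partial>circle_measure) \<le> (\<integral>\<^sup>+x. ennreal (a * (T j x)\<^sup>2 + 1 / a) \<partial>circle_measure)"
    proof (intro nn_integral_mono ennreal_leI)
      fix x
      \<comment> \<open>the weighted inequality between \<open>T\<close> and \<open>T\<^sup>2\<close> replaces Cauchy--Schwarz; \<open>a\<close> balances its two terms\<close>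
      have "0 \<le> (a * T j x - 1)\<^sup>2 + a * T j x" using a by (simp add: T_def)
      then have "T j x * a \<le> a\<^sup>2 * (T j x)\<^sup>2 + 1"
        by (simp add: algebra_simps power2_eq_square)
      then have "T j x \<le> (a\<^sup>2 * (T j x)\<^sup>2 + 1) / a" using a by (simp add: pos_le_divide_eq)
      also have "\<dots> = a * (T j x)\<^sup>2 + 1 / a"
        using a by (simp add: add_divide_distrib power2_eq_square)
      finally show "T j x \<le> a * (T j x)\<^sup>2 + 1 / a" .
    qed
    also have "\<dots> = ennreal (\<integral>x. a * (T j x)\<^sup>2 + 1 / a \<partial>circle_measure)"
      using int a by (intro nn_integral_eq_integral) auto
    also have "(\<integral>x. a * (T j x)\<^sup>2 + 1 / a \<partial>circle_measure) = a * (\<integral>x. (T j x)\<^sup>2 \<partial>circle_measure) + 1 / a"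
      using int by (simp add: circle.prob_space)
    also have "\<dots> \<le> a * (3 * V\<^sup>2 / (a * a)) + 1 / a"
      using sq a by (intro add_right_mono mult_left_mono) auto
    also have "\<dots> = K / a" using a by (simp add: K_def field_simps)
    also have "\<dots> = K * m powr (- 3/2)" by (simp add: a_def powr_minus field_simps)
    finally show ?thesis by (simp add: m_def ennreal_leI)
  qed
  have "(\<integral>\<^sup>+x. (\<Sum>j. ennreal (T j x)) \<partial>circle_measure) = (\<Sum>j. \<integral>\<^sup>+x. ennreal (T j x) \<partial>circle_measure)"
    by (rule nn_integral_suminf) measurable
  also have "\<dots> \<le> (\<Sum>j. ennreal (K * real (Suc j) powr (- 3/2)))"
    by (intro suminf_le bound) auto
  also have "\<dots> < \<infinity>"
  proof -
    have "summable (\<lambda>j. real j powr (- 3/2))" by (subst summable_real_powr_iff) simp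
    then have "summable (\<lambda>j. K * real (Suc j) powr (- 3/2))"
      by (intro summable_mult) (subst summable_Suc_iff)
    then show ?thesis using K by (subst suminf_ennreal2) auto
  qed
  finally have "AE x in circle_measure. (\<Sum>j. ennreal (T j x)) \<noteq> \<infinity>"
    by (intro nn_integral_PInf_AE) auto
  then show ?thesis
  proof eventually_elim
    fix x assume "(\<Sum>j. ennreal (T j x)) \<noteq> \<infinity>"
    then have "summable (\<lambda>j. T j x)"
      by (intro summable_suminf_not_top) (auto simp: T_def)
    then have "summable (\<lambda>j. trig_sum f (symm ((Suc (Suc j))\<^sup>2)) x - trig_sum f (symm ((Suc j)\<^sup>2)) x)"
      unfolding T_def by (rule summable_norm_cancel)
    then have "convergent (\<lambda>j. trig_sum f (symm ((Suc j)\<^sup>2)) x)"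
      by (rule summable_differences_convergent)
    then show "convergent (\<lambda>j. trig_sum f (symm (j\<^sup>2)) x)"
      by (subst (asm) convergent_Suc_iff)
  qed
qed

text \<open>
An arbitrary order \<open>N\<close> lies within \<open>O(\<surd>N)\<close> of a square, and the frequencies in between have
coefficients \<open>O(1/N)\<close>, so their contribution is at most \<open>O(1/\<surd>N)\<close> at every point.
\<close>

lemma trig_sum_convergent:
  "AE x in circle_measure. convergent (\<lambda>N. trig_sum f (symm N) x)"
  using trig_sum_squares_convergent
proof eventually_elim
  fix x
  define s where "s N = nat \<lfloor>sqrt (real N)\<rfloor>" for N
  have s_top: "filterlim s at_top sequentially"
    unfolding s_def
    by (intro filterlim_compose[OF filterlim_nat_sequentially] filterlim_compose[OF filterlim_floor_sequentially]
      filterlim_compose[OF sqrt_at_top] filterlim_real_sequentially)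
  have near: "norm (trig_sum f (symm N) x - trig_sum f (symm ((s N)\<^sup>2)) x) \<le> 2 * V / real (s N)" if "N \<ge> 1" for N
  proof -
    have sq: "real (s N) \<le> sqrt (real N)" "sqrt (real N) < real (s N) + 1"
      unfolding s_def using of_int_floor_le[of "sqrt (real N)"] floor_less_iff[of "sqrt (real N)"] by (simp_all, linarith?)
    have s1: "s N \<ge> 1" using that unfolding s_def by (simp add: le_nat_iff)
    have "(real (s N))\<^sup>2 \<le> (sqrt (real N))\<^sup>2" using sq(1) by (intro power_mono) auto
    then have "real ((s N)\<^sup>2) \<le> real N" by simp
    then have le: "(s N)\<^sup>2 \<le> N" by (simp only: of_nat_le_iff)
    have "(sqrt (real N))\<^sup>2 < (real (s N) + 1)\<^sup>2" using sq(2) by (intro power_strict_mono) auto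
    then have "real N < (real (s N) + 1)\<^sup>2" by simp
    then have "real N < real ((s N + 1)\<^sup>2)" by (simp add: add.commute)
    then have "N < (s N + 1)\<^sup>2" by (simp only: of_nat_less_iff)
    then have "N - (s N)\<^sup>2 \<le> 2 * s N" by (simp add: power2_eq_square)
    then have "real (N - (s N)\<^sup>2) \<le> 2 * real (s N)" by linarith
    then have "V * real (N - (s N)\<^sup>2) / real ((s N)\<^sup>2) \<le> V * (2 * real (s N)) / real ((s N)\<^sup>2)"
      using dominated_nonneg[OF dom] by (intro divide_right_mono mult_left_mono) auto
    also have "\<dots> = 2 * V / real (s N)" using s1 by (simp add: power2_eq_square)
    finally show ?thesis using trig_sum_diff_bound[of "(s N)\<^sup>2" N x] s1 le by simp
  qed
  have "(\<lambda>N. 2 * V / real (s N)) \<longlonglongrightarrow> 0"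
    by (rule filterlim_compose[OF _ s_top, of "\<lambda>n. 2 * V / real n"]) real_asymp
  then have diff: "(\<lambda>N. trig_sum f (symm N) x - trig_sum f (symm ((s N)\<^sup>2)) x) \<longlonglongrightarrow> 0"
    by (rule Lim_null_comparison[rotated]) (use near in \<open>auto simp: eventually_sequentially\<close>)
  assume "convergent (\<lambda>j. trig_sum f (symm (j\<^sup>2)) x)"
  then obtain L where "(\<lambda>j. trig_sum f (symm (j\<^sup>2)) x) \<longlonglongrightarrow> L" by (auto simp: convergent_def)
  from tendsto_add[OF diff filterlim_compose[OF this s_top]]
  show "convergent (\<lambda>N. trig_sum f (symm N) x)" by (auto simp: convergent_def)
qed

text \<open>
Fatou's lemma along the partial sums, whose norms are bounded by Bessel's inequality. This
direction of the comparison carries a lower bound on \<open>hat_fun\<close> over to \<open>fold_sum\<close>.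
\<close>

lemma fourier_limit_L2_norm_le:
  "(circle_L2_norm (\<lambda>x. lim (\<lambda>N. trig_sum f (symm N) x)))\<^sup>2 \<le> (\<integral>x. (f x)\<^sup>2 \<partial>circle_measure)"
proof -
  let ?h = "\<lambda>x. lim (\<lambda>N. trig_sum f (symm N) x)"
  have [measurable]: "trig_sum f A \<in> borel_measurable circle_measure" for A
    by (rule measurable_circle_borel) measurable
  have "(\<integral>\<^sup>+x. ennreal ((norm (?h x))\<^sup>2) \<partial>circle_measure)
     = (\<integral>\<^sup>+x. liminf (\<lambda>N. ennreal ((norm (trig_sum f (symm N) x))\<^sup>2)) \<partial>circle_measure)"
  proof (rule nn_integral_cong_AE)
    show "AE x in circle_measure. ennreal ((norm (?h x))\<^sup>2) = liminf (\<lambda>N. ennreal ((norm (trig_sum f (symm N) x))\<^sup>2))"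
      using trig_sum_convergent
    proof eventually_elim
      fix x assume "convergent (\<lambda>N. trig_sum f (symm N) x)"
      then have "(\<lambda>N. trig_sum f (symm N) x) \<longlonglongrightarrow> ?h x" by (simp add: convergent_LIMSEQ_iff)
      then have "(\<lambda>N. ennreal ((norm (trig_sum f (symm N) x))\<^sup>2)) \<longlonglongrightarrow> ennreal ((norm (?h x))\<^sup>2)"
        by (intro tendsto_intros)
      then show "ennreal ((norm (?h x))\<^sup>2) = liminf (\<lambda>N. ennreal ((norm (trig_sum f (symm N) x))\<^sup>2))"
        by (intro lim_imp_Liminf[symmetric]) auto
    qed
  qed
  also have "\<dots> \<le> liminf (\<lambda>N. \<integral>\<^sup>+x. ennreal ((norm (trig_sum f (symm N) x))\<^sup>2) \<partial>circle_measure)"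
    by (rule nn_integral_liminf) measurable
  also have "\<dots> \<le> ennreal (\<integral>x. (f x)\<^sup>2 \<partial>circle_measure)"
  proof (rule Liminf_le)
    show "\<forall>\<^sub>F N in sequentially. (\<integral>\<^sup>+x. ennreal ((norm (trig_sum f (symm N) x))\<^sup>2) \<partial>circle_measure)
       \<le> ennreal (\<integral>x. (f x)\<^sup>2 \<partial>circle_measure)"
    proof (intro always_eventually allI)
      fix N
      have "(\<integral>\<^sup>+x. ennreal ((norm (trig_sum f (symm N) x))\<^sup>2) \<partial>circle_measure)
        = ennreal (\<Sum>r\<in>symm N. (norm (fourier_coeff f r))\<^sup>2)"
        by (subst nn_integral_eq_integral) (auto intro: integrable_trig_sum_square simp: integral_trig_sum_square)
      then show "(\<integral>\<^sup>+x. ennreal ((norm (trig_sum f (symm N) x))\<^sup>2) \<partial>circle_measure)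
       \<le> ennreal (\<integral>x. (f x)\<^sup>2 \<partial>circle_measure)"
        using bessel[of "symm N"] by (simp add: ennreal_leI)
    qed
  qed simp
  finally have le: "(\<integral>\<^sup>+x. ennreal ((norm (?h x))\<^sup>2) \<partial>circle_measure) \<le> ennreal (\<integral>x. (f x)\<^sup>2 \<partial>circle_measure)" .
  have f0: "0 \<le> (\<integral>x. (f x)\<^sup>2 \<partial>circle_measure)" by (rule integral_nonneg_AE) auto
  have "(\<integral>x. (norm (?h x))\<^sup>2 \<partial>circle_measure) \<le> (\<integral>x. (f x)\<^sup>2 \<partial>circle_measure)"
  \<comment> \<open>the Bochner integral of a function that is not integrable is 0\<close>
  proof (cases "integrable circle_measure (\<lambda>x. (norm (?h x))\<^sup>2)")
    case True
    then show ?thesis using le f0 by (subst (asm) nn_integral_eq_integral) auto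
  next
    case False
    then show ?thesis using f0 by (simp add: not_integrable_integral_eq)
  qed
  moreover have "0 \<le> (\<integral>x. (norm (?h x))\<^sup>2 \<partial>circle_measure)" by (rule integral_nonneg_AE) auto
  ultimately show ?thesis by (simp add: circle_L2_norm_def)
qed

end

lemma hat_fun_L2_norm_le:
  assumes dom: "dominated V v f" and l: "l > 0"
  shows "(circle_L2_norm (hat_fun f l))\<^sup>2 \<le> (\<integral>x. (fold_sum l f x)\<^sup>2 \<partial>circle_measure)"
proof -
  interpret f: dominated_fun V v f by standard (rule dom)
  interpret g: dominated_fun V "fold_sum l v" "fold_sum l f"
    by standard (rule dominated_fold_sum[OF dom l])
  have "gamma_coeff f (r * int l) / of_int r = fourier_coeff (fold_sum l f) r" if "r \<noteq> 0" for r
    using that by (simp add: gamma_coeff_def f.fourier_coeff_fold_sum[OF l])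
  then have "hat_fun f l = (\<lambda>x. lim (\<lambda>N. trig_sum (fold_sum l f) (symm N) x))"
    unfolding hat_fun_def trig_sum_def wave_def by (intro ext arg_cong[where f=lim] sum.cong) auto
  then show ?thesis using g.fourier_limit_L2_norm_le by simp
qed

section \<open>Continued fraction approximation\<close>

lemma cf_remainder_Suc: "cf_remainder \<alpha> (Suc n) = frac (1 / cf_remainder \<alpha> n)"
  by (simp add: cf_remainder_def)

text \<open>
The numerators \<open>p\<^sub>n\<close> of the convergents; as for the denominators, the initial values encode
\<open>p\<^bsub>-1\<^esub> = 1\<close> and \<open>p\<^sub>0 = 0\<close>.
\<close>

fun cf_numerator :: "real \<Rightarrow> nat \<Rightarrow> nat" where
  "cf_numerator \<alpha> 0 = 0"
| "cf_numerator \<alpha> (Suc 0) = 1"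
| "cf_numerator \<alpha> (Suc (Suc n)) =
     partial_quotient \<alpha> (Suc (Suc n)) * cf_numerator \<alpha> (Suc n) + cf_numerator \<alpha> n"

context
  fixes \<alpha> :: real
  assumes \<alpha>: "0 < \<alpha>" "\<alpha> < 1" "\<alpha> \<notin> \<rat>"
begin

lemma cf_remainder_bounds: "0 < cf_remainder \<alpha> n \<and> cf_remainder \<alpha> n < 1 \<and> cf_remainder \<alpha> n \<notin> \<rat>"
proof (induction n)
  case 0
  then show ?case using \<alpha> by (simp add: cf_remainder_def)
next
  case (Suc n)
  let ?x = "1 / cf_remainder \<alpha> n"
  have "?x \<notin> \<rat>"
  proof
    assume "?x \<in> \<rat>"
    then have "inverse ?x \<in> \<rat>" by (rule Rats_inverse)
    then show False using Suc by simp
  qed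
  then have "frac ?x \<notin> \<rat>"
    using Rats_add[of "frac ?x" "of_int \<lfloor>?x\<rfloor>"] Rats_of_int by (simp only: frac_def) auto
  moreover from this have "frac ?x \<noteq> 0" using Rats_0 by metis
  ultimately show ?case
    using frac_lt_1[of ?x] frac_ge_0[of ?x] unfolding cf_remainder_Suc by linarith
qed

lemma cf_remainder_inverse:
  "1 / cf_remainder \<alpha> n = real (partial_quotient \<alpha> (Suc n)) + cf_remainder \<alpha> (Suc n)"
  "partial_quotient \<alpha> (Suc n) \<ge> 1"
proof -
  have "1 \<le> 1 / cf_remainder \<alpha> n" using cf_remainder_bounds[of n] by (simp add: field_simps)
  then have f: "1 \<le> \<lfloor>1 / cf_remainder \<alpha> n\<rfloor>" by (simp add: le_floor_iff)
  then show "partial_quotient \<alpha> (Suc n) \<ge> 1" using nat_mono[OF f] by simp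
  have "real (nat \<lfloor>1 / cf_remainder \<alpha> n\<rfloor>) = of_int \<lfloor>1 / cf_remainder \<alpha> n\<rfloor>"
    using f by (intro of_nat_nat) linarith
  then show "1 / cf_remainder \<alpha> n = real (partial_quotient \<alpha> (Suc n)) + cf_remainder \<alpha> (Suc n)"
    by (simp add: cf_remainder_Suc frac_def)
qed

lemma cf_denominator_Suc_ge:
  "cf_denominator \<alpha> (Suc n) \<ge> partial_quotient \<alpha> (Suc n) * cf_denominator \<alpha> n"
  by (cases n) auto

lemma cf_denominator_pos: "cf_denominator \<alpha> n \<ge> 1"
proof (induction n)
  case (Suc n)
  have "1 * 1 \<le> partial_quotient \<alpha> (Suc n) * cf_denominator \<alpha> n"
    using Suc cf_remainder_inverse(2) by (rule mult_le_mono[rotated])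
  then show ?case using cf_denominator_Suc_ge[of n] by linarith
qed simp

lemma cf_denominator_mono: "m \<le> n \<Longrightarrow> cf_denominator \<alpha> m \<le> cf_denominator \<alpha> n"
proof (rule lift_Suc_mono_le[of "cf_denominator \<alpha>"])
  fix n
  have "1 * cf_denominator \<alpha> n \<le> partial_quotient \<alpha> (Suc n) * cf_denominator \<alpha> n"
    using cf_remainder_inverse(2) by (rule mult_le_mono1)
  then show "cf_denominator \<alpha> n \<le> cf_denominator \<alpha> (Suc n)" using cf_denominator_Suc_ge[of n] by linarith
qed

definition cf_error :: "nat \<Rightarrow> real" where
  "cf_error n = real (cf_denominator \<alpha> n) * \<alpha> - real (cf_numerator \<alpha> n)"

text \<open>
The recurrences of the convergents and of the Gauss map are the same linear recurrence, read in
opposite directions; hence \<open>q\<^sub>n \<alpha> - p\<^sub>n\<close> is, up to sign, a product of Gauss iterates.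
\<close>

lemma cf_error_Suc: "cf_error (Suc n) = - cf_remainder \<alpha> (Suc n) * cf_error n"
proof (induction n)
  case 0
  have "cf_remainder \<alpha> 0 = \<alpha>" by (simp add: cf_remainder_def)
  then have "1 / \<alpha> = real (partial_quotient \<alpha> (Suc 0)) + cf_remainder \<alpha> (Suc 0)"
    using cf_remainder_inverse(1)[of 0] by simp
  then have "1 = (real (partial_quotient \<alpha> (Suc 0)) + cf_remainder \<alpha> (Suc 0)) * \<alpha>"
    using \<alpha> by (simp only: field_simps)
  then show ?case by (simp add: cf_error_def algebra_simps del: partial_quotient.simps)
next
  case (Suc n)
  define r where "r = cf_remainder \<alpha> (Suc n)"
  have r: "r \<noteq> 0" using cf_remainder_bounds[of "Suc n"] by (simp add: r_def)
  have "cf_error (Suc (Suc n)) = real (partial_quotient \<alpha> (Suc (Suc n))) * cf_error (Suc n) + cf_error n"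
    by (simp add: cf_error_def algebra_simps del: partial_quotient.simps)
  also have "cf_error n = - cf_error (Suc n) / r" using Suc r by (simp add: r_def)
  also have "real (partial_quotient \<alpha> (Suc (Suc n))) = 1 / r - cf_remainder \<alpha> (Suc (Suc n))"
    using cf_remainder_inverse(1)[of "Suc n"] by (simp add: r_def)
  finally show ?case by (simp add: algebra_simps)
qed

lemma cf_determinant:
  "int (cf_numerator \<alpha> (Suc n)) * int (cf_denominator \<alpha> n)
     - int (cf_numerator \<alpha> n) * int (cf_denominator \<alpha> (Suc n)) = (- 1) ^ n"
  by (induction n) (simp_all add: algebra_simps del: partial_quotient.simps)

lemma cf_coprime: "coprime (cf_numerator \<alpha> n) (cf_denominator \<alpha> n)"
proof -
  have "coprime (int (cf_numerator \<alpha> n)) (int (cf_denominator \<alpha> n))"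
  proof (rule coprimeI)
    fix c assume "c dvd int (cf_numerator \<alpha> n)" "c dvd int (cf_denominator \<alpha> n)"
    then have "c dvd int (cf_numerator \<alpha> (Suc n)) * int (cf_denominator \<alpha> n)
     - int (cf_numerator \<alpha> n) * int (cf_denominator \<alpha> (Suc n))" by simp
    then have "c dvd (- 1) ^ n" unfolding cf_determinant .
    then show "is_unit c" by (rule dvd_trans) simp
  qed
  then show ?thesis by simp
qed

text \<open>
Consecutive errors have opposite signs and their combination with the denominators is the
determinant, so \<open>q\<^bsub>n+1\<^esub> \<bar>q\<^sub>n \<alpha> - p\<^sub>n\<bar> \<le> 1\<close>.
\<close>

lemma cf_error_le: "\<bar>cf_error n\<bar> \<le> 1 / real (cf_denominator \<alpha> (Suc n))"
proof -
  let ?q = "\<lambda>n. real (cf_denominator \<alpha> n)" and ?p = "\<lambda>n. real (cf_numerator \<alpha> n)"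
  have r: "0 < cf_remainder \<alpha> (Suc n)" using cf_remainder_bounds[of "Suc n"] by simp
  have q: "1 \<le> ?q m" for m using cf_denominator_pos[of m] by simp
  have "real_of_int (int (cf_numerator \<alpha> (Suc n)) * int (cf_denominator \<alpha> n)
     - int (cf_numerator \<alpha> n) * int (cf_denominator \<alpha> (Suc n))) = (- 1) ^ n"
    by (simp only: cf_determinant of_int_power of_int_minus of_int_1)
  then have "?p (Suc n) * ?q n - ?p n * ?q (Suc n) = (- 1) ^ n"
    by (simp only: of_int_diff of_int_mult of_int_of_nat_eq)
  then have "?q (Suc n) * cf_error n - ?q n * cf_error (Suc n) = (- 1) ^ n"
    by (simp add: cf_error_def algebra_simps del: cf_denominator.simps cf_numerator.simps)
  then have "cf_error n * (?q (Suc n) + ?q n * cf_remainder \<alpha> (Suc n)) = (- 1) ^ n"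
    unfolding cf_error_Suc by (simp add: algebra_simps)
  then have "\<bar>cf_error n\<bar> * \<bar>?q (Suc n) + ?q n * cf_remainder \<alpha> (Suc n)\<bar> = 1"
    by (simp only: abs_mult[symmetric] power_abs abs_minus_cancel abs_one power_one)
  moreover have "?q (Suc n) \<le> \<bar>?q (Suc n) + ?q n * cf_remainder \<alpha> (Suc n)\<bar>"
    using r q[of n] q[of "Suc n"] by simp
  ultimately have "\<bar>cf_error n\<bar> * ?q (Suc n) \<le> 1"
    by (metis abs_ge_zero mult_left_mono)
  then show ?thesis using q[of "Suc n"] by (simp add: field_simps)
qed

end

text \<open>
Only finitely many partial quotients precede a given index, so the unboundedness persists beyond it
and the indices can be picked one after the other.
\<close>

lemma large_partial_quotients:
  assumes "\<not> bdd_above (partial_quotient \<alpha> ` {1..})"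
  obtains t :: "nat \<Rightarrow> nat" where "strict_mono t" "\<And>k. t k > 0"
    "\<And>k. partial_quotient \<alpha> (Suc (t k)) \<ge> 4 ^ Suc k"
proof -
  have ex: "\<exists>n>N. partial_quotient \<alpha> (Suc n) \<ge> A" for N A
  proof (rule ccontr)
    assume "\<not> ?thesis"
    then have lt: "partial_quotient \<alpha> (Suc n) < A" if "n > N" for n using that by auto
    have "partial_quotient \<alpha> m \<le> A + (\<Sum>i\<le>Suc N. partial_quotient \<alpha> i)" if "m \<ge> 1" for m
    proof (cases "m \<le> Suc N")
      case True
      then show ?thesis using member_le_sum[of m "{..Suc N}" "partial_quotient \<alpha>"] by simp
    next
      case False
      show ?thesis
      proof -
        have "N < m - 1" using False by simp
        then show ?thesis using lt[of "m - 1"] that by (simp del: partial_quotient.simps)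
      qed
    qed
    then have "bdd_above (partial_quotient \<alpha> ` {1..})" by (intro bdd_aboveI) auto
    then show False using assms by simp
  qed
  have "\<exists>t. \<forall>k. (t k > 0 \<and> partial_quotient \<alpha> (Suc (t k)) \<ge> 4 ^ Suc k) \<and> t k < t (Suc k)"
  proof (rule dependent_nat_choice)
    show "\<exists>x. x > 0 \<and> partial_quotient \<alpha> (Suc x) \<ge> 4 ^ Suc 0" using ex[of 0] by blast
    fix x k
    show "\<exists>y. (y > 0 \<and> partial_quotient \<alpha> (Suc y) \<ge> 4 ^ Suc (Suc k)) \<and> x < y"
      using ex[of x "4 ^ Suc (Suc k)"] by (metis gr0I not_less0)
  qed
  then obtain t where t: "\<And>k. t k > 0" "\<And>k. partial_quotient \<alpha> (Suc (t k)) \<ge> 4 ^ Suc k" "\<And>k. t k < t (Suc k)"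
    by blast
  show thesis
    by (rule that[of t]) (use t in \<open>auto intro: strict_monoI_Suc\<close>)
qed

section \<open>Comparison of an ergodic sum with equidistributed points\<close>

text \<open>
Multiplication by \<open>p\<close> permutes the residues modulo \<open>q\<close>.
\<close>

lemma sum_rational_rotation:
  fixes F :: "real \<Rightarrow> real"
  assumes per: "\<And>x. F (x + 1) = F x" and cop: "coprime p q" and q: "q > 0"
  shows "(\<Sum>j<q. F (y + real j * (real p / real q))) = (\<Sum>j<q. F (y + real j / real q))"
proof -
  have inj: "inj_on (\<lambda>j. j * p mod q) {..<q}"
  proof (rule inj_onI)
    have *: "i = j" if "i \<le> j" "j < q" "i * p mod q = j * p mod q" for i j
    proof -
      have "q dvd j * p - i * p" using that by (metis mod_eq_dvd_iff_nat mult_le_mono1)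
      then have "q dvd (j - i) * p" by (simp add: diff_mult_distrib)
      then have "q dvd j - i" using cop by (metis coprime_commute coprime_dvd_mult_left_iff)
      then show ?thesis using that by (metis diff_diff_cancel diff_is_0_eq' diff_le_self dvd_imp_le leD le_less_trans not_gr_zero diff_zero)
    qed
    fix i j assume "i \<in> {..<q}" "j \<in> {..<q}" "i * p mod q = j * p mod q"
    then show "i = j" using *[of i j] *[of j i] by (cases "i \<le> j") auto
  qed
  have "(\<lambda>j. j * p mod q) ` {..<q} = {..<q}"
    by (rule endo_inj_surj) (use q inj in auto)
  then have bij: "bij_betw (\<lambda>j. j * p mod q) {..<q} {..<q}" using inj by (simp add: bij_betw_def)
  have "F (y + real j * (real p / real q)) = F (y + real (j * p mod q) / real q)" for j
  proof -
    have "real j * real p = real q * real (j * p div q) + real (j * p mod q)"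
      by (simp only: of_nat_mult[symmetric] of_nat_add[symmetric] mult_div_mod_eq)
    then have "real j * (real p / real q) = real (j * p mod q) / real q + of_int (int (j * p div q))"
      using q by (simp add: field_simps)
    then show ?thesis using one_periodic_add_int[of F "y + real (j * p mod q) / real q" "int (j * p div q)"] per
      by (simp add: add.assoc)
  qed
  then show ?thesis
    using sum.reindex_bij_betw[OF bij, of "\<lambda>j. F (y + real j / real q)"] by simp
qed

text \<open>
The intervals of radius at most \<open>1/q\<close> around \<open>q\<close> equally spaced points cover the circle at most
twice.
\<close>

lemma sum_spread_le:
  assumes dom: "dominated V v f" and q: "q > 0" and e: "e \<le> 1 / real q"
  shows "(\<Sum>j<q. spread v e (y + real j / real q)) \<le> 2 * V"
proof -
  define w where "w j = v (y + (real j - 1) / real q)" for j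
  have "(\<Sum>j<q. spread v e (y + real j / real q)) \<le> (\<Sum>j<q. spread v (1 / real q) (y + real j / real q))"
    by (intro sum_mono spread_mono[OF dom] e)
  also have "\<dots> = (\<Sum>j<q. (w (Suc (Suc j)) - w (Suc j)) + (w (Suc j) - w j))"
    unfolding spread_def w_def by (intro sum.cong) (simp_all add: add_divide_distrib diff_divide_distrib algebra_simps)
  also have "\<dots> = (w (Suc q) - w (Suc 0)) + (w q - w 0)"
    unfolding sum.distrib sum_lessThan_telescope[of "\<lambda>j. w (Suc j)"] sum_lessThan_telescope ..
  also have "w (Suc q) = w (Suc 0) + V"
    using q dominated_add1[OF dom, of y] by (simp add: w_def)
  also have "w q = w 0 + V"
    using q dominated_add1[OF dom, of "y - 1 / real q"] by (simp add: w_def diff_divide_distrib algebra_simps)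
  finally show ?thesis by simp
qed

text \<open>
Up to the time \<open>q\<close> the orbit stays within \<open>\<bar>q \<alpha> - p\<bar>\<close> of the rational rotation by \<open>p / q\<close>, whose orbit is
\<open>q\<close> equally spaced points.
\<close>

lemma ergodic_sum_fold_sum:
  assumes dom: "dominated V v f" and cop: "coprime p q" and q: "q > 0"
    and e: "\<bar>real q * \<alpha> - real p\<bar> \<le> e"
  shows "\<bar>(\<Sum>j<q. f (y + real j * \<alpha>)) - fold_sum q f (real q * y)\<bar>
     \<le> (\<Sum>j<q. spread v e (y + real j / real q))"
proof -
  define r where "r = real p / real q"
  have "fold_sum q f (real q * y) = (\<Sum>j<q. f (y + real j * r))"
    unfolding fold_sum_mult[OF q] r_def
    by (rule sum_rational_rotation[OF _ cop q, symmetric]) (rule dominated_periodic[OF dom])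
  then have "\<bar>(\<Sum>j<q. f (y + real j * \<alpha>)) - fold_sum q f (real q * y)\<bar>
     = \<bar>\<Sum>j<q. f (y + real j * \<alpha>) - f (y + real j * r)\<bar>" by (simp add: sum_subtractf)
  also have "\<dots> \<le> (\<Sum>j<q. \<bar>f (y + real j * \<alpha>) - f (y + real j * r)\<bar>)" by (rule sum_abs)
  also have "\<dots> \<le> (\<Sum>j<q. spread v e (y + real j * r))"
  proof (rule sum_mono)
    fix j assume j: "j \<in> {..<q}"
    have "real j * \<alpha> - real j * r = (real j / real q) * (real q * \<alpha> - real p)"
      using q by (simp add: r_def field_simps)
    then have "\<bar>real j * \<alpha> - real j * r\<bar> = (real j / real q) * \<bar>real q * \<alpha> - real p\<bar>"
      by (simp add: abs_mult)
    also have "\<dots> \<le> 1 * \<bar>real q * \<alpha> - real p\<bar>"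
      using j q by (intro mult_right_mono) auto
    finally have "\<bar>real j * \<alpha> - real j * r\<bar> \<le> e" using e by simp
    from dominated_spread[OF dom this, of "y + real j * r"]
    show "\<bar>f (y + real j * \<alpha>) - f (y + real j * r)\<bar> \<le> spread v e (y + real j * r)" by (simp add: algebra_simps)
  qed
  also have "\<dots> = (\<Sum>j<q. spread v e (y + real j / real q))"
    unfolding r_def by (rule sum_rational_rotation[OF _ cop q]) (rule spread_periodic[OF dom])
  finally show ?thesis .
qed

section \<open>Tools on independence\<close>

context prob_space
begin

lemma indep_vars_reindex:
  assumes ind: "indep_vars (\<lambda>_. N) X (f ` I)" and inj: "inj_on f I"
  shows "indep_vars (\<lambda>_. N) (\<lambda>i. X (f i)) I"
  unfolding indep_vars_def2
proof (intro conjI ballI indep_setsI)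
  fix i assume i: "i \<in> I"
  then show rv: "random_variable N (X (f i))" using ind by (auto simp: indep_vars_def)
  then show "{X (f i) -` A \<inter> space M |A. A \<in> sets N} \<subseteq> events" by (auto intro: measurable_sets)
next
  fix A J assume J: "J \<noteq> {}" "J \<subseteq> I" "finite J" and A: "\<forall>j\<in>J. A j \<in> {X (f j) -` A \<inter> space M |A. A \<in> sets N}"
  have injJ: "inj_on f J" using inj J by (auto intro: inj_on_subset)
  then have inv: "the_inv_into J f (f j) = j" if "j \<in> J" for j using that by (simp add: the_inv_into_f_f)
  define B where "B k = A (the_inv_into J f k)" for k
  have "prob (\<Inter>k\<in>f ` J. B k) = (\<Prod>k\<in>f ` J. prob (B k))"
  proof (rule indep_setsD)
    show "indep_sets (\<lambda>i. {X i -` A \<inter> space M |A. A \<in> sets N}) (f ` I)"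
      using ind by (simp add: indep_vars_def2)
    show "\<forall>j\<in>f ` J. B j \<in> {X j -` A \<inter> space M |A. A \<in> sets N}"
      using A inv by (auto simp: B_def)
  qed (use J in auto)
  moreover have "(\<Inter>k\<in>f ` J. B k) = (\<Inter>j\<in>J. A j)" using inv by (auto simp: B_def)
  moreover have "(\<Prod>k\<in>f ` J. prob (B k)) = (\<Prod>j\<in>J. prob (A j))"
    using injJ inv by (simp add: prod.reindex B_def)
  ultimately show "prob (\<Inter>j\<in>J. A j) = (\<Prod>j\<in>J. prob (A j))" by simp
qed

lemma indep_vars_blocks:
  assumes ind: "indep_vars (\<lambda>_. borel) X I" and "disjoint_family_on K L" "\<And>j. j \<in> L \<Longrightarrow> K j \<subseteq> I"
    and g: "\<And>j. j \<in> L \<Longrightarrow> g j \<in> measurable (PiM (K j) (\<lambda>_. borel)) N"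
  shows "indep_vars (\<lambda>_. N) (\<lambda>j \<omega>. g j (\<lambda>i\<in>K j. X i \<omega>)) L"
  by (rule indep_vars_compose2[OF indep_vars_restrict[OF ind]]) (use assms in auto)

lemma indep_var_blocks:
  assumes ind: "indep_vars (\<lambda>_. borel) X I" and "A \<inter> B = {}" "A \<subseteq> I" "B \<subseteq> I"
    and "g \<in> measurable (PiM A (\<lambda>_. borel)) N" "h \<in> measurable (PiM B (\<lambda>_. borel)) N'"
  shows "indep_var N (\<lambda>\<omega>. g (\<lambda>i\<in>A. X i \<omega>)) N' (\<lambda>\<omega>. h (\<lambda>i\<in>B. X i \<omega>))"
  using indep_var_compose[OF indep_var_restrict[OF ind assms(2-4)] assms(5,6)] by (simp add: comp_def)

lemma indep_vars_measurable: "indep_vars (\<lambda>_. borel) X I \<Longrightarrow> i \<in> I \<Longrightarrow> X i \<in> borel_measurable M"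
  by (auto simp: indep_vars_def)

lemma indep_var_nn_integral_pair:
  assumes ind: "indep_var S X T Y" and f: "f \<in> borel_measurable (S \<Otimes>\<^sub>M T)"
  shows "(\<integral>\<^sup>+\<omega>. f (X \<omega>, Y \<omega>) \<partial>M) = (\<integral>\<^sup>+x. \<integral>\<^sup>+y. f (x, y) \<partial>distr M T Y \<partial>distr M S X)"
proof -
  have rv[measurable]: "random_variable S X" "random_variable T Y" using ind by (auto dest: indep_var_rv1 indep_var_rv2)
  interpret Y: prob_space "distr M T Y" by (rule prob_space_distr) fact
  have f': "f \<in> borel_measurable (distr M S X \<Otimes>\<^sub>M distr M T Y)"
    using f by (simp cong: measurable_cong_sets)
  have "(\<integral>\<^sup>+\<omega>. f (X \<omega>, Y \<omega>) \<partial>M) = (\<integral>\<^sup>+z. f z \<partial>distr M (S \<Otimes>\<^sub>M T) (\<lambda>\<omega>. (X \<omega>, Y \<omega>)))"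
    by (rule nn_integral_distr[symmetric]) (use f in auto)
  also have "\<dots> = (\<integral>\<^sup>+z. f z \<partial>(distr M S X \<Otimes>\<^sub>M distr M T Y))"
    using ind by (simp add: indep_var_distribution_eq)
  also have "\<dots> = (\<integral>\<^sup>+x. \<integral>\<^sup>+y. f (x, y) \<partial>distr M T Y \<partial>distr M S X)"
    by (rule Y.nn_integral_fst[symmetric]) (rule f')
  finally show ?thesis .
qed

lemma indep_var_integral_pair:
  fixes f :: "'b \<times> 'b \<Rightarrow> 'd :: {banach, second_countable_topology}"
  assumes ind: "indep_var S X T Y" and f: "f \<in> borel_measurable (S \<Otimes>\<^sub>M T)"
    and int: "integrable M (\<lambda>\<omega>. f (X \<omega>, Y \<omega>))"
  shows "(\<integral>\<omega>. f (X \<omega>, Y \<omega>) \<partial>M) = (\<integral>\<omega>. (\<integral>\<omega>'. f (X \<omega>, Y \<omega>') \<partial>M) \<partial>M)"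
    "integrable M (\<lambda>\<omega>. (\<integral>\<omega>'. f (X \<omega>, Y \<omega>') \<partial>M))"
proof -
  have rv[measurable]: "random_variable S X" "random_variable T Y" using ind by (auto dest: indep_var_rv1 indep_var_rv2)
  interpret X: prob_space "distr M S X" by (rule prob_space_distr) fact
  interpret Y: prob_space "distr M T Y" by (rule prob_space_distr) fact
  interpret XY: pair_sigma_finite "distr M S X" "distr M T Y" ..
  have eq: "distr M (S \<Otimes>\<^sub>M T) (\<lambda>\<omega>. (X \<omega>, Y \<omega>)) = distr M S X \<Otimes>\<^sub>M distr M T Y"
    using ind by (simp add: indep_var_distribution_eq)
  have int': "integrable (distr M S X \<Otimes>\<^sub>M distr M T Y) f"
    unfolding eq[symmetric] using int f by (subst integrable_distr_eq) auto
  have in1: "(\<integral>y. f (X \<omega>, y) \<partial>distr M T Y) = (\<integral>\<omega>'. f (X \<omega>, Y \<omega>') \<partial>M)" if "\<omega> \<in> space M" for \<omega>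
    by (rule integral_distr) (use f measurable_space[OF rv(1) that] in auto)
  have meas: "(\<lambda>x. \<integral>y. f (x, y) \<partial>distr M T Y) \<in> borel_measurable S"
    using XY.integrable_fst'[OF int'] by (auto dest: borel_measurable_integrable)
  have "(\<integral>\<omega>. f (X \<omega>, Y \<omega>) \<partial>M) = (\<integral>z. f z \<partial>(distr M S X \<Otimes>\<^sub>M distr M T Y))"
    unfolding eq[symmetric] by (rule integral_distr[symmetric]) (use f in auto)
  also have "\<dots> = (\<integral>x. \<integral>y. f (x, y) \<partial>distr M T Y \<partial>distr M S X)"
    by (rule XY.integral_fst'[symmetric]) fact
  also have "\<dots> = (\<integral>\<omega>. \<integral>y. f (X \<omega>, y) \<partial>distr M T Y \<partial>M)"
    by (rule integral_distr) (use meas in auto)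
  also have "\<dots> = (\<integral>\<omega>. (\<integral>\<omega>'. f (X \<omega>, Y \<omega>') \<partial>M) \<partial>M)"
    by (intro Bochner_Integration.integral_cong in1 refl)
  finally show "(\<integral>\<omega>. f (X \<omega>, Y \<omega>) \<partial>M) = (\<integral>\<omega>. (\<integral>\<omega>'. f (X \<omega>, Y \<omega>') \<partial>M) \<partial>M)" .
  have "integrable M (\<lambda>\<omega>. \<integral>y. f (X \<omega>, y) \<partial>distr M T Y)"
    using XY.integrable_fst'[OF int'] meas by (subst (asm) integrable_distr_eq) auto
  then show "integrable M (\<lambda>\<omega>. (\<integral>\<omega>'. f (X \<omega>, Y \<omega>') \<partial>M))"
    by (rule Bochner_Integration.integrable_cong[THEN iffD1, rotated -1]) (auto simp: in1)
qed

text \<open>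
By monotone convergence the series has finite expectation.
\<close>

lemma AE_summable_of_expectation:
  assumes X[measurable]: "\<And>n. X n \<in> borel_measurable M" and nn: "\<And>n \<omega>. 0 \<le> X n \<omega>"
    and le: "\<And>n. (\<integral>\<^sup>+\<omega>. ennreal (X n \<omega>) \<partial>M) \<le> ennreal (c n)" and c: "summable c" "\<And>n. 0 \<le> c n"
  shows "AE \<omega> in M. summable (\<lambda>n. X n \<omega> :: real)"
proof -
  have "(\<integral>\<^sup>+\<omega>. (\<Sum>n. ennreal (X n \<omega>)) \<partial>M) = (\<Sum>n. \<integral>\<^sup>+\<omega>. ennreal (X n \<omega>) \<partial>M)"
    by (rule nn_integral_suminf) measurable
  also have "\<dots> \<le> (\<Sum>n. ennreal (c n))"
    by (intro suminf_le le) auto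
  also have "\<dots> < \<infinity>" using c by (subst suminf_ennreal2) auto
  finally have "AE \<omega> in M. (\<Sum>n. ennreal (X n \<omega>)) \<noteq> \<infinity>"
    by (intro nn_integral_PInf_AE) auto
  then show ?thesis
    by eventually_elim (auto intro!: summable_suminf_not_top nn)
qed

end

section \<open>A uniform point whose multiples have independent fractional parts\<close>

definition unit_uniform :: "real measure" where
  "unit_uniform = distr circle_measure borel (\<lambda>x. x)"

lemma sets_unit_uniform [simp, measurable_cong]: "sets unit_uniform = sets borel"
  by (simp add: unit_uniform_def)

lemma space_unit_uniform [simp]: "space unit_uniform = UNIV"
  by (simp add: unit_uniform_def)

lemma prob_space_unit_uniform: "prob_space unit_uniform"
  unfolding unit_uniform_def by (rule circle.prob_space_distr) (rule id_measurable_circle)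

lemma nn_integral_unit_uniform:
  "f \<in> borel_measurable borel \<Longrightarrow> (\<integral>\<^sup>+x. f x \<partial>unit_uniform) = (\<integral>\<^sup>+x. f x \<partial>circle_measure)"
  unfolding unit_uniform_def by (rule nn_integral_distr) (auto intro: id_measurable_circle)

lemma integral_unit_uniform:
  fixes f :: "real \<Rightarrow> 'a :: {banach, second_countable_topology}"
  shows "f \<in> borel_measurable borel \<Longrightarrow> (\<integral>x. f x \<partial>unit_uniform) = (\<integral>x. f x \<partial>circle_measure)"
  unfolding unit_uniform_def by (rule integral_distr) (auto intro: id_measurable_circle)

text \<open>
Given the digit \<open>\<lfloor>q x\<rfloor>\<close>, the fractional part of \<open>q x\<close> is uniform for a uniform \<open>x\<close>; replacing it by
an independent uniform variable therefore leaves the law of \<open>x\<close> unchanged.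
\<close>

lemma nn_integral_replace_frac:
  assumes [measurable]: "f \<in> borel_measurable borel" and q: "q > 0"
  shows "(\<integral>\<^sup>+x. \<integral>\<^sup>+w. f ((of_int \<lfloor>real q * x\<rfloor> + w) / real q) \<partial>unit_uniform \<partial>unit_uniform)
    = (\<integral>\<^sup>+x. f x \<partial>unit_uniform)"
proof -
  interpret U: prob_space unit_uniform by (rule prob_space_unit_uniform)
  define h where "h j = (\<integral>\<^sup>+w. f ((real j + w) / real q) \<partial>circle_measure)" for j
  define H where "H x = (\<integral>\<^sup>+w. f ((of_int \<lfloor>real q * x\<rfloor> + w) / real q) \<partial>unit_uniform)" for x
  have [measurable]: "H \<in> borel_measurable borel"
    unfolding H_def by measurable
  have "ennreal (real q) * (\<integral>\<^sup>+x. H x \<partial>circle_measure) = (\<Sum>j<q. \<integral>\<^sup>+u. H ((real j + u) / real q) \<partial>circle_measure)"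
    by (rule nn_integral_circle_digits[symmetric]) (use q in auto)
  also have "\<dots> = (\<Sum>j<q. \<integral>\<^sup>+u. h j \<partial>circle_measure)"
  proof (intro sum.cong refl nn_integral_cong)
    fix j u assume "u \<in> space circle_measure"
    then have "\<lfloor>real q * ((real j + u) / real q)\<rfloor> = int j" using q by (simp add: floor_eq_iff)
    then show "H ((real j + u) / real q) = h j"
      unfolding H_def h_def by (simp add: nn_integral_unit_uniform)
  qed
  also have "\<dots> = (\<Sum>j<q. h j)" using circle.emeasure_space_1 by simp
  also have "\<dots> = ennreal (real q) * (\<integral>\<^sup>+x. f x \<partial>circle_measure)"
    unfolding h_def by (rule nn_integral_circle_digits) (use q in auto)
  finally have "(\<integral>\<^sup>+x. H x \<partial>circle_measure) = (\<integral>\<^sup>+x. f x \<partial>circle_measure)"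
    using q by (subst (asm) ennreal_mult_cancel_left) (auto simp: ennreal_eq_0_iff)
  then show ?thesis by (simp add: nn_integral_unit_uniform H_def[symmetric])
qed

text \<open>
Each approximation keeps the digit \<open>\<lfloor>Q\<^sub>k x\<rfloor>\<close> of the previous one and replaces the fractional part
of \<open>Q\<^sub>k x\<close> by the next variable, so that afterwards \<open>Q\<^sub>k x\<close> equals \<open>w\<^bsub>k+1\<^esub>\<close> modulo 1 exactly. Later
steps move the point by at most about \<open>1 / Q\<^bsub>k+1\<^esub>\<close>, which hardly disturbs this.
\<close>

fun refine :: "(nat \<Rightarrow> nat) \<Rightarrow> (nat \<Rightarrow> real) \<Rightarrow> nat \<Rightarrow> real" where
  "refine Q w 0 = w 0"
| "refine Q w (Suc k) = (of_int \<lfloor>real (Q k) * refine Q w k\<rfloor> + w (Suc k)) / real (Q k)"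

lemma refine_cong: "(\<And>i. i \<le> k \<Longrightarrow> w i = w' i) \<Longrightarrow> refine Q w k = refine Q w' k"
  by (induction k) auto

lemma refine_measurable: "k \<le> m \<Longrightarrow> (\<lambda>w. refine Q w k) \<in> borel_measurable (PiM {..m} (\<lambda>_. borel))"
proof (induction k)
  case (Suc k)
  then have [measurable]: "(\<lambda>w. refine Q w k) \<in> borel_measurable (PiM {..m} (\<lambda>_. borel))"
    and [measurable]: "(\<lambda>w. w (Suc k)) \<in> borel_measurable (PiM {..m} (\<lambda>_. borel :: real measure))" by simp_all
  have "(\<lambda>w. real_of_int \<lfloor>real (Q k) * refine Q w k\<rfloor>) \<in> borel_measurable (PiM {..m} (\<lambda>_. borel))"
    by (rule measurable_compose[OF _ borel_measurable_real_floor]) simp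
  then show ?case unfolding refine.simps by (intro borel_measurable_divide borel_measurable_add) auto
qed simp

lemma fast_cauchy:
  fixes x b :: "nat \<Rightarrow> real"
  assumes b: "\<And>k. 0 < b k" "\<And>k. 2 * b k \<le> b (Suc k)" and x: "\<And>k. \<bar>x (Suc k) - x k\<bar> \<le> 1 / b k"
  shows "convergent x" "\<bar>lim x - x k\<bar> \<le> 2 / b k"
proof -
  have le: "\<bar>x (k + m) - x k\<bar> \<le> 2 / b k - 2 / b (k + m)" for k m
  proof (induction m)
    case (Suc m)
    have "2 / b (Suc (k + m)) \<le> 2 / (2 * b (k + m))"
      using b[of "k + m"] by (intro divide_left_mono) auto
    then show ?case using Suc x[of "k + m"] by simp
  qed simp
  have pw: "2 ^ k * b 0 \<le> b k" for k
  proof (induction k)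
    case (Suc k) then show ?case using b(2)[of k] by simp
  qed simp
  have "Cauchy x"
  proof (rule metric_CauchyI)
    fix e :: real assume "e > 0"
    obtain k where k: "4 / (e * b 0) < 2 ^ k" using real_arch_pow[of 2] by auto
    have "4 / b k \<le> 4 / (2 ^ k * b 0)" using pw[of k] b(1)[of 0] b(1)[of k] by (intro divide_left_mono) auto
    also have "\<dots> < e" using k \<open>e > 0\<close> b(1)[of 0] by (simp add: field_simps)
    finally have small: "4 / b k < e" .
    have near: "\<bar>x m - x k\<bar> \<le> 2 / b k" if "m \<ge> k" for m
    proof -
      have "\<bar>x m - x k\<bar> \<le> 2 / b k - 2 / b m" using le[of k "m - k"] that by simp
      moreover have "0 < 2 / b m" using b(1)[of m] by simp
      ultimately show ?thesis by linarith
    qed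
    show "\<exists>N. \<forall>m\<ge>N. \<forall>n\<ge>N. dist (x m) (x n) < e"
    proof (intro exI[of _ k] allI impI)
      fix m n assume "m \<ge> k" "n \<ge> k"
      then show "dist (x m) (x n) < e" using near[of m] near[of n] small by (simp add: dist_real_def)
    qed
  qed
  then show c: "convergent x" by (simp add: Cauchy_convergent_iff)
  then have lim: "x \<longlonglongrightarrow> lim x" by (simp add: convergent_LIMSEQ_iff)
  have "(\<lambda>m. \<bar>x (m + k) - x k\<bar>) \<longlonglongrightarrow> \<bar>lim x - x k\<bar>"
    by (intro tendsto_intros LIMSEQ_ignore_initial_segment lim)
  then show "\<bar>lim x - x k\<bar> \<le> 2 / b k"
  proof (rule LIMSEQ_le_const2)
    show "\<exists>N. \<forall>n\<ge>N. \<bar>x (n + k) - x k\<bar> \<le> 2 / b k"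
    proof (intro exI allI impI)
      fix n show "\<bar>x (n + k) - x k\<bar> \<le> 2 / b k"
        using le[of k n] divide_pos_pos[of 2 "b (k + n)"] b(1)[of "k + n"] unfolding add.commute[of n k]
        by linarith
    qed
  qed
qed

locale refinement = prob_space M for M :: "'a measure" +
  fixes u :: "nat \<Rightarrow> 'a \<Rightarrow> real" and Q :: "nat \<Rightarrow> nat"
  assumes indep_u: "indep_vars (\<lambda>_. borel) u UNIV"
    and distr_u: "\<And>k. distr M borel (u k) = unit_uniform"
    and u_range: "\<And>k \<omega>. 0 \<le> u k \<omega> \<and> u k \<omega> < 1"
    and Q_pos: "\<And>k. Q k > 0" and Q_fast: "\<And>k. 4 ^ Suc k * Q k \<le> Q (Suc k)"
begin

definition pt :: "nat \<Rightarrow> 'a \<Rightarrow> real" where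
  "pt k \<omega> = refine Q (\<lambda>i. u i \<omega>) k"

definition point :: "'a \<Rightarrow> real" where
  "point \<omega> = lim (\<lambda>k. pt k \<omega>)"

lemma u_measurable [measurable]: "u k \<in> borel_measurable M"
  using indep_u by (auto simp: indep_vars_def)

lemma pt_measurable [measurable]: "pt k \<in> borel_measurable M"
  unfolding pt_def by (induction k) (auto simp: pt_def[symmetric])

lemma pt_Suc: "pt (Suc k) \<omega> = (of_int \<lfloor>real (Q k) * pt k \<omega>\<rfloor> + u (Suc k) \<omega>) / real (Q k)"
  by (simp add: pt_def)

lemma mult_pt_Suc: "real (Q k) * pt (Suc k) \<omega> = of_int \<lfloor>real (Q k) * pt k \<omega>\<rfloor> + u (Suc k) \<omega>"
  using Q_pos[of k] by (simp add: pt_Suc)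

lemma pt_step: "\<bar>pt (Suc k) \<omega> - pt k \<omega>\<bar> \<le> 1 / real (Q k)"
proof -
  have "real (Q k) * (pt (Suc k) \<omega> - pt k \<omega>) = u (Suc k) \<omega> - frac (real (Q k) * pt k \<omega>)"
    by (simp add: right_diff_distrib mult_pt_Suc frac_def)
  also have "\<bar>\<dots>\<bar> \<le> 1"
    using u_range[of "Suc k" \<omega>] frac_lt_1[of "real (Q k) * pt k \<omega>"] frac_ge_0[of "real (Q k) * pt k \<omega>"] by linarith
  finally have "real (Q k) * \<bar>pt (Suc k) \<omega> - pt k \<omega>\<bar> \<le> 1" by (simp add: abs_mult)
  then show ?thesis using Q_pos[of k] by (simp add: field_simps)
qed

lemma Q_double: "2 * real (Q k) \<le> real (Q (Suc k))"
proof -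
  have "1 \<le> (4::nat) ^ k" by simp
  then have "2 * Q k \<le> 4 ^ Suc k * Q k" by (intro mult_le_mono1) simp
  then show ?thesis using Q_fast[of k] by linarith
qed

lemma point_near_pt: "convergent (\<lambda>k. pt k \<omega>)" "\<bar>point \<omega> - pt k \<omega>\<bar> \<le> 2 / real (Q k)"
  unfolding point_def
  by (rule fast_cauchy[where b = "\<lambda>k. real (Q k)"]; use Q_pos Q_double pt_step in simp)+

lemma point_measurable [measurable]: "point \<in> borel_measurable M"
  unfolding point_def by measurable

lemma mult_point:
  obtains s where "\<bar>s\<bar> \<le> 2 / 4 ^ Suc k"
    "real (Q k) * point \<omega> = of_int \<lfloor>real (Q k) * pt k \<omega>\<rfloor> + u (Suc k) \<omega> + s"
proof (rule that)
  define s where "s = real (Q k) * (point \<omega> - pt (Suc k) \<omega>)"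
  show "real (Q k) * point \<omega> = of_int \<lfloor>real (Q k) * pt k \<omega>\<rfloor> + u (Suc k) \<omega> + s"
    using mult_pt_Suc[of k \<omega>] by (simp add: s_def right_diff_distrib)
  have "\<bar>s\<bar> \<le> real (Q k) * (2 / real (Q (Suc k)))"
    unfolding s_def abs_mult using point_near_pt(2)[of \<omega> "Suc k"] by (intro mult_mono) auto
  also have "\<dots> \<le> real (Q k) * (2 / (4 ^ Suc k * real (Q k)))"
  proof (intro mult_left_mono divide_left_mono)
    have "real (4 ^ Suc k * Q k) \<le> real (Q (Suc k))" using Q_fast[of k] by (simp only: of_nat_le_iff)
    then show "4 ^ Suc k * real (Q k) \<le> real (Q (Suc k))" by simp
  qed (use Q_pos[of k] Q_pos[of "Suc k"] in auto)
  also have "\<dots> = 2 / 4 ^ Suc k" using Q_pos[of k] by simp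
  finally show "\<bar>s\<bar> \<le> 2 / 4 ^ Suc k" .
qed

lemma indep_pt_u: "indep_var borel (pt k) borel (u (Suc k))"
proof -
  have "indep_var borel (\<lambda>\<omega>. refine Q (\<lambda>i\<in>{..k}. u i \<omega>) k) borel (\<lambda>\<omega>. (\<lambda>f. f (Suc k)) (\<lambda>i\<in>{Suc k}. u i \<omega>))"
    by (rule indep_var_blocks[OF indep_u]) (auto intro: refine_measurable)
  moreover have "refine Q (\<lambda>i\<in>{..k}. u i \<omega>) k = pt k \<omega>" for \<omega>
    unfolding pt_def by (rule refine_cong) auto
  ultimately show ?thesis by simp
qed

text \<open>
By induction: the point \<open>pt k\<close> is independent of the new variable, and \<open>nn_integral_replace_frac\<close>
applies to the step.
\<close>

lemma distr_pt: "distr M borel (pt k) = unit_uniform"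
proof (induction k)
  case 0
  have "pt 0 = u 0" by (auto simp: pt_def)
  then show ?case by (simp add: distr_u)
next
  case (Suc k)
  show ?case
  proof (rule measure_eqI)
    fix A assume "A \<in> sets (distr M borel (pt (Suc k)))"
    then have [measurable]: "A \<in> sets borel" by simp
    have "emeasure (distr M borel (pt (Suc k))) A = (\<integral>\<^sup>+x. indicator A x \<partial>distr M borel (pt (Suc k)))" by simp
    also have "\<dots> = (\<integral>\<^sup>+\<omega>. indicator A (pt (Suc k) \<omega>) \<partial>M)"
      by (rule nn_integral_distr) auto
    also have "\<dots> = (\<integral>\<^sup>+\<omega>. (\<lambda>(x, w). indicator A ((of_int \<lfloor>real (Q k) * x\<rfloor> + w) / real (Q k))) (pt k \<omega>, u (Suc k) \<omega>) \<partial>M)"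
      by (simp add: pt_Suc)
    also have "\<dots> = (\<integral>\<^sup>+x. \<integral>\<^sup>+w. (\<lambda>(x, w). indicator A ((of_int \<lfloor>real (Q k) * x\<rfloor> + w) / real (Q k))) (x, w)
        \<partial>distr M borel (u (Suc k)) \<partial>distr M borel (pt k))"
      by (rule indep_var_nn_integral_pair[OF indep_pt_u]) measurable
    also have "\<dots> = (\<integral>\<^sup>+x. \<integral>\<^sup>+w. indicator A ((of_int \<lfloor>real (Q k) * x\<rfloor> + w) / real (Q k)) \<partial>unit_uniform \<partial>unit_uniform)"
      by (simp add: Suc distr_u)
    also have "\<dots> = (\<integral>\<^sup>+x. indicator A x \<partial>unit_uniform)"
      by (rule nn_integral_replace_frac) (use Q_pos in auto)
    finally show "emeasure (distr M borel (pt (Suc k))) A = emeasure unit_uniform A" by simp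
  qed simp
qed

lemma measure_unit_uniform_atMost: "0 \<le> a \<Longrightarrow> a \<le> 1 \<Longrightarrow> measure unit_uniform {..a} = a"
proof -
  assume a: "0 \<le> a" "a \<le> 1"
  have "emeasure unit_uniform {..a} = (\<integral>\<^sup>+x. indicator {..a} x \<partial>unit_uniform)" by simp
  also have "\<dots> = (\<integral>\<^sup>+x. indicator {..a} x * indicator {0..<1} x \<partial>lborel)"
    by (subst nn_integral_unit_uniform, simp) (rule nn_integral_circle, simp)
  also have "\<dots> = (\<integral>\<^sup>+x. indicator ({..a} \<inter> {0..<1}) x \<partial>lborel)"
    by (intro nn_integral_cong) (auto simp: indicator_def)
  also have "\<dots> = emeasure lborel ({..a} \<inter> {0..<1})" by (rule nn_integral_indicator) auto
  also have "\<dots> = ennreal a"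
  proof (cases "a = 1")
    case True
    then have "{..a} \<inter> {0..<1} = {0..<1}" by auto
    then show ?thesis using True by simp
  next
    case False
    then have "{..a} \<inter> {0..<1} = {0..a}" using a by auto
    then show ?thesis using a by simp
  qed
  finally show ?thesis using a by (simp add: measure_def)
qed

text \<open>
The limit is within \<open>2 / Q\<^sub>k\<close> of the uniform variable \<open>pt k\<close>, so its distribution function is squeezed
between shifts of the uniform one.
\<close>

lemma distr_point: "distr M borel point = unit_uniform"
proof (rule cdf_unique)
  interpret U: prob_space unit_uniform by (rule prob_space_unit_uniform)
  show "real_distribution (distr M borel point)" by (rule real_distribution_distr) simp
  show "real_distribution unit_uniform" by standard simp
  have cdfU: "cdf unit_uniform = (\<lambda>a. max 0 (min 1 a))"
  proof
    fix a :: real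
    consider "a < 0" | "0 \<le> a" "a \<le> 1" | "a > 1" by linarith
    then show "cdf unit_uniform a = max 0 (min 1 a)"
    proof cases
      case 1
      then have "measure unit_uniform {..a} \<le> measure unit_uniform {..0}" by (intro U.finite_measure_mono) auto
      then show ?thesis using 1 measure_unit_uniform_atMost[of 0] by (simp add: cdf_def antisym)
    next
      case 3
      then have "measure unit_uniform {..1} \<le> measure unit_uniform {..a}" by (intro U.finite_measure_mono) auto
      then show ?thesis using 3 measure_unit_uniform_atMost[of 1] U.prob_le_1[of "{..a}"] by (simp add: cdf_def)
    qed (simp add: cdf_def measure_unit_uniform_atMost)
  qed
  have pr: "prob {\<omega>\<in>space M. pt k \<omega> \<le> a} = max 0 (min 1 a)" for k a
  proof -
    have "prob {\<omega>\<in>space M. pt k \<omega> \<le> a} = cdf (distr M borel (pt k)) a"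
      by (simp add: cdf_def measure_distr vimage_def Int_def conj_commute)
    then show ?thesis by (simp only: distr_pt cdfU)
  qed
  show "cdf (distr M borel point) = cdf unit_uniform"
  proof
    fix a
    let ?p = "prob {\<omega>\<in>space M. point \<omega> \<le> a}"
    have "cdf (distr M borel point) a = ?p"
      by (simp add: cdf_def measure_distr vimage_def Int_def conj_commute)
    have up: "?p \<le> max 0 (min 1 (a + 2 / real (Q k)))" for k
    proof -
      have "?p \<le> prob {\<omega>\<in>space M. pt k \<omega> \<le> a + 2 / real (Q k)}"
      proof (rule finite_measure_mono)
        show "{\<omega>\<in>space M. point \<omega> \<le> a} \<subseteq> {\<omega>\<in>space M. pt k \<omega> \<le> a + 2 / real (Q k)}"
        proof safe
          fix \<omega> assume "point \<omega> \<le> a"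
          then show "pt k \<omega> \<le> a + 2 / real (Q k)" using point_near_pt(2)[of \<omega> k] by linarith
        qed
      qed measurable
      then show ?thesis by (simp add: pr)
    qed
    have lo: "max 0 (min 1 (a - 2 / real (Q k))) \<le> ?p" for k
    proof -
      have "prob {\<omega>\<in>space M. pt k \<omega> \<le> a - 2 / real (Q k)} \<le> ?p"
      proof (rule finite_measure_mono)
        show "{\<omega>\<in>space M. pt k \<omega> \<le> a - 2 / real (Q k)} \<subseteq> {\<omega>\<in>space M. point \<omega> \<le> a}"
        proof safe
          fix \<omega> assume "pt k \<omega> \<le> a - 2 / real (Q k)"
          then show "point \<omega> \<le> a" using point_near_pt(2)[of \<omega> k] by linarith
        qed
      qed measurable
      then show ?thesis by (simp add: pr)
    qed
    have Q2: "real k \<le> real (Q k)" for k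
    proof (induction k)
      case (Suc k) then show ?case using Q_double[of k] Q_pos[of k] by simp
    qed simp
    have "(\<lambda>k. 2 / real (Q k)) \<longlonglongrightarrow> 0"
    proof (rule tendsto_sandwich[of "\<lambda>_. 0" _ _ "\<lambda>k. 2 / real k"])
      show "\<forall>\<^sub>F k in sequentially. 2 / real (Q k) \<le> 2 / real k"
        using Q2 Q_pos by (auto simp: eventually_sequentially intro!: exI[of _ 1] divide_left_mono)
      show "(\<lambda>k. 2 / real k) \<longlonglongrightarrow> 0" by real_asymp
    qed auto
    then have "(\<lambda>k. max 0 (min 1 (a + 2 / real (Q k)))) \<longlonglongrightarrow> max 0 (min 1 (a + 0))"
      "(\<lambda>k. max 0 (min 1 (a - 2 / real (Q k)))) \<longlonglongrightarrow> max 0 (min 1 (a - 0))"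
      by (intro tendsto_intros; assumption)+
    then have "?p \<le> max 0 (min 1 a)" "max 0 (min 1 a) \<le> ?p"
      using LIMSEQ_le_const[of _ "max 0 (min 1 (a + 0))" ?p] LIMSEQ_le_const2[of _ "max 0 (min 1 (a - 0))" ?p]
        up lo unfolding add_0_right diff_0_right by blast+
    then show "cdf (distr M borel point) a = cdf unit_uniform a"
      using \<open>cdf (distr M borel point) a = ?p\<close> by (simp add: cdfU)
  qed
qed

end

section \<open>Centred normal laws\<close>

text \<open>
Parametrised by the variance \<open>s\<close>. As the image of the standard normal law it makes sense for \<open>s = 0\<close>
as well, where it is the point mass at 0.
\<close>

definition normal_law :: "real \<Rightarrow> real measure" where
  "normal_law s = distr std_normal_distribution borel (\<lambda>z. sqrt s * z)"

lemma real_distribution_normal_law: "real_distribution (normal_law s)"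
proof -
  interpret real_distribution std_normal_distribution by (rule real_dist_normal_dist)
  show ?thesis unfolding normal_law_def by (rule real_distribution_distr) simp
qed

lemma prob_space_normal_law: "prob_space (normal_law s)"
  using real_distribution_normal_law by (simp add: real_distribution_def)

lemma sets_normal_law [simp, measurable_cong]: "sets (normal_law s) = sets borel"
  by (simp add: normal_law_def)

lemma space_normal_law [simp]: "space (normal_law s) = UNIV"
  by (simp add: normal_law_def)

lemma integral_normal_law:
  fixes f :: "real \<Rightarrow> 'a :: {banach, second_countable_topology}"
  shows "f \<in> borel_measurable borel \<Longrightarrow> (\<integral>x. f x \<partial>normal_law s) = (\<integral>z. f (sqrt s * z) \<partial>std_normal_distribution)"
  unfolding normal_law_def by (rule integral_distr) auto

lemma integrable_normal_law_iff:
  fixes f :: "real \<Rightarrow> 'a :: {banach, second_countable_topology}"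
  shows "f \<in> borel_measurable borel \<Longrightarrow> integrable (normal_law s) f \<longleftrightarrow> integrable std_normal_distribution (\<lambda>z. f (sqrt s * z))"
  unfolding normal_law_def by (rule integrable_distr_eq) auto

lemma char_normal_law:
  assumes "0 \<le> s"
  shows "char (normal_law s) t = complex_of_real (exp (- (s * t\<^sup>2) / 2))"
proof -
  have "char (normal_law s) t = (CLINT z|std_normal_distribution. iexp (t * (sqrt s * z)))"
    unfolding char_def by (rule integral_normal_law) simp
  also have "\<dots> = char std_normal_distribution (t * sqrt s)"
    by (simp add: char_def mult.assoc)
  also have "\<dots> = complex_of_real (exp (- (t * sqrt s)\<^sup>2 / 2))"
    by (simp only: char_std_normal_distribution)
  finally show ?thesis using assms by (simp add: power_mult_distrib mult.commute)
qed

text \<open>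
Levy's uniqueness theorem.
\<close>

lemma (in prob_space) normal_lawI:
  assumes "0 \<le> s" and [measurable]: "X \<in> borel_measurable M"
    and "\<And>t. char (distr M borel X) t = complex_of_real (exp (- (s * t\<^sup>2) / 2))"
  shows "distr M borel X = normal_law s"
  by (rule Levy_uniqueness)
    (use assms in \<open>auto intro!: real_distribution_distr real_distribution_normal_law simp: char_normal_law\<close>)

lemma (in prob_space) normal_law_sum:
  assumes ind: "indep_vars (\<lambda>_. borel) X I" and s: "\<And>i. i \<in> I \<Longrightarrow> 0 \<le> s i"
    and X: "\<And>i. i \<in> I \<Longrightarrow> distr M borel (X i) = normal_law (s i)"
  shows "distr M borel (\<lambda>\<omega>. \<Sum>i\<in>I. X i \<omega>) = normal_law (\<Sum>i\<in>I. s i)"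
proof (cases "finite I")
  case True
  show ?thesis
  proof (rule normal_lawI)
    show "(\<lambda>\<omega>. \<Sum>i\<in>I. X i \<omega>) \<in> borel_measurable M"
      using ind by (intro borel_measurable_sum) (auto simp: indep_vars_def)
    fix t
    have "char (distr M borel (\<lambda>\<omega>. \<Sum>i\<in>I. X i \<omega>)) t = (\<Prod>i\<in>I. complex_of_real (exp (- (s i * t\<^sup>2) / 2)))"
      unfolding char_distr_sum[OF ind] by (intro prod.cong) (auto simp: X char_normal_law s)
    also have "\<dots> = complex_of_real (exp (\<Sum>i\<in>I. - (s i * t\<^sup>2) / 2))"
      by (simp only: of_real_prod exp_sum[OF True])
    finally show "char (distr M borel (\<lambda>\<omega>. \<Sum>i\<in>I. X i \<omega>)) t = complex_of_real (exp (- ((\<Sum>i\<in>I. s i) * t\<^sup>2) / 2))"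
      by (simp add: sum_divide_distrib sum_distrib_right sum_negf)
  qed (use s in \<open>auto intro: sum_nonneg\<close>)
next
  case False
  have "distr M borel (\<lambda>\<omega>. 0) = normal_law 0"
    by (rule normal_lawI) (simp_all add: char_def integral_distr prob_space del: distr_const)
  then show ?thesis using False by simp
qed

lemma integral_normal_law_add:
  fixes F :: "real \<Rightarrow> real"
  assumes st: "0 \<le> s" "0 \<le> t" and F: "F \<in> borel_measurable borel" "\<And>x. \<bar>F x\<bar> \<le> A"
  shows "(\<integral>z. (\<integral>x. F (x + z) \<partial>normal_law s) \<partial>normal_law t) = (\<integral>x. F x \<partial>normal_law (s + t))"
proof -
  note [measurable] = F(1)
  interpret s: prob_space "normal_law s" by (rule prob_space_normal_law)
  interpret t: prob_space "normal_law t" by (rule prob_space_normal_law)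
  interpret st: pair_prob_space "normal_law t" "normal_law s" ..
  have ds: "distr (normal_law t \<Otimes>\<^sub>M normal_law s) borel snd = normal_law s"
    by (rule measure_eqI) (auto simp: emeasure_distr space_pair_measure snd_vimage_eq_Times s.emeasure_pair_measure_Times t.emeasure_space_1[simplified] Times_Int_Times)
  have dt: "distr (normal_law t \<Otimes>\<^sub>M normal_law s) borel fst = normal_law t"
    by (rule measure_eqI) (auto simp: emeasure_distr space_pair_measure fst_vimage_eq_Times s.emeasure_pair_measure_Times s.emeasure_space_1[simplified] Times_Int_Times)
  have "st.indep_var borel fst borel snd"
    unfolding st.indep_var_distribution_eq ds dt
    by (auto intro!: measure_eqI simp: emeasure_distr cong: measurable_cong_sets)
       (simp add: sets_pair_measure_cong[OF sets_normal_law sets_normal_law])?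
  then have char: "char (distr (normal_law t \<Otimes>\<^sub>M normal_law s) borel (\<lambda>\<omega>. fst \<omega> + snd \<omega>)) r
      = char (normal_law t) r * char (normal_law s) r" for r
    by (simp add: st.char_distr_add ds dt)
  have d: "distr (normal_law t \<Otimes>\<^sub>M normal_law s) borel (\<lambda>\<omega>. fst \<omega> + snd \<omega>) = normal_law (s + t)"
    by (rule st.normal_lawI) (use st in \<open>auto simp: char char_normal_law exp_add[symmetric] simp flip: of_real_mult, auto simp: algebra_simps add_divide_distrib\<close>)
  have "(\<integral>z. (\<integral>x. F (x + z) \<partial>normal_law s) \<partial>normal_law t) = (\<integral>\<omega>. F (snd \<omega> + fst \<omega>) \<partial>(normal_law t \<Otimes>\<^sub>M normal_law s))"
    by (subst st.integral_fst'[symmetric]) (auto intro!: st.integrable_const_bound[where B = A] F(2))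
  also have "\<dots> = (\<integral>x. F x \<partial>distr (normal_law t \<Otimes>\<^sub>M normal_law s) borel (\<lambda>\<omega>. fst \<omega> + snd \<omega>))"
    by (subst integral_distr) (auto simp: add.commute)
  finally show ?thesis unfolding d .
qed

definition abs_moment3 :: real where "abs_moment3 = (\<integral>z. \<bar>z\<bar> ^ 3 \<partial>std_normal_distribution)"

lemma std_normal_moments:
  "integrable std_normal_distribution (\<lambda>z. z)" "(\<integral>z. z \<partial>std_normal_distribution) = 0"
  "integrable std_normal_distribution (\<lambda>z. z\<^sup>2)" "(\<integral>z. z\<^sup>2 \<partial>std_normal_distribution) = 1"
  "integrable std_normal_distribution (\<lambda>z. \<bar>z\<bar> ^ 3)"
  using integrable_std_normal_distribution_moment[of 1] integrable_std_normal_distribution_moment[of 2]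
    integral_std_normal_distribution_moment_odd[of 1] std_normal_distribution_even_moments(1)[of 1]
    integrable_abs[OF integrable_std_normal_distribution_moment[of 3]]
  by (simp_all add: power_abs fact_numeral)

section \<open>Lindeberg's replacement argument\<close>

text \<open>
Twice differentiable with a second derivative of Lipschitz constant \<open>K\<close>: all that the third-order
Taylor estimate in Lindeberg's argument needs.
\<close>

definition smooth :: "real \<Rightarrow> (real \<Rightarrow> real) \<Rightarrow> bool" where
  "smooth K F \<longleftrightarrow> (\<exists>F' F''. (\<forall>x. (F has_real_derivative F' x) (at x)) \<and>
     (\<forall>x. (F' has_real_derivative F'' x) (at x)) \<and> (\<forall>x y. \<bar>F'' x - F'' y\<bar> \<le> K * \<bar>x - y\<bar>))"

lemma smooth_shift: "smooth K F \<Longrightarrow> smooth K (\<lambda>x. F (x + c))"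
proof -
  assume "smooth K F"
  then obtain F' F'' where d: "\<And>x. (F has_real_derivative F' x) (at x)"
    "\<And>x. (F' has_real_derivative F'' x) (at x)" and l: "\<And>x y. \<bar>F'' x - F'' y\<bar> \<le> K * \<bar>x - y\<bar>"
    by (auto simp: smooth_def)
  show ?thesis
    unfolding smooth_def
  proof (intro exI conjI allI)
    fix x y
    show "((\<lambda>x. F (x + c)) has_real_derivative F' (x + c)) (at x)"
      using d(1)[of "x + c"] by (simp add: DERIV_shift)
    show "((\<lambda>x. F' (x + c)) has_real_derivative F'' (x + c)) (at x)"
      using d(2)[of "x + c"] by (simp add: DERIV_shift)
    show "\<bar>F'' (x + c) - F'' (y + c)\<bar> \<le> K * \<bar>x - y\<bar>" using l[of "x + c" "y + c"] by simp
  qed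
qed

lemma smooth_taylor:
  assumes "smooth K F" and K: "0 \<le> K"
  obtains F' F'' where "\<And>w y. \<bar>F (w + y) - (F w + y * F' w + y\<^sup>2 / 2 * F'' w)\<bar> \<le> K * \<bar>y\<bar> ^ 3"
proof -
  obtain F' F'' where d: "\<And>x. (F has_real_derivative F' x) (at x)"
    "\<And>x. (F' has_real_derivative F'' x) (at x)" and l: "\<And>x y. \<bar>F'' x - F'' y\<bar> \<le> K * \<bar>x - y\<bar>"
    using assms(1) by (auto simp: smooth_def)
  have "\<bar>F (w + y) - (F w + y * F' w + y\<^sup>2 / 2 * F'' w)\<bar> \<le> K * \<bar>y\<bar> ^ 3" for w y
  proof -
    let ?S = "{- \<bar>y\<bar>..\<bar>y\<bar>}"
    have shift: "((\<lambda>z. F (z + w)) has_real_derivative F' (z + w)) (at z)"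
      "((\<lambda>z. F' (z + w)) has_real_derivative F'' (z + w)) (at z)" for z
      using d(1)[of "z + w"] d(2)[of "z + w"] by (simp_all add: DERIV_shift)
    have d1: "((\<lambda>z. F' (z + w) - z * F'' w) has_real_derivative F'' (z + w) - 1 * F'' w) (at z within ?S)" for z
      by (rule has_field_derivative_at_within, intro DERIV_diff DERIV_cmult_right DERIV_ident shift)
    have b1: "\<bar>F' (z + w) - F' w - z * F'' w\<bar> \<le> K * \<bar>y\<bar> * \<bar>y\<bar>" if z: "z \<in> ?S" for z
    proof -
      have "norm ((F' (z + w) - z * F'' w) - (F' (0 + w) - 0 * F'' w)) \<le> K * \<bar>y\<bar> * norm (z - 0)"
      proof (rule field_differentiable_bound[OF _ d1])
        fix x assume "x \<in> ?S"
        then have "K * \<bar>x + w - w\<bar> \<le> K * \<bar>y\<bar>" using K by (intro mult_left_mono) auto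
        then show "norm (F'' (x + w) - 1 * F'' w) \<le> K * \<bar>y\<bar>" using l[of "x + w" w] by simp
      qed (use z in auto)
      also have "\<dots> \<le> K * \<bar>y\<bar> * \<bar>y\<bar>" using z K by (intro mult_left_mono) auto
      finally show ?thesis by (simp add: algebra_simps)
    qed
    have d0: "((\<lambda>z. F (z + w) - z * F' w - z\<^sup>2 * (F'' w / 2)) has_real_derivative
        F' (z + w) - 1 * F' w - (2 * z) * (F'' w / 2)) (at z within ?S)" for z
    proof (rule has_field_derivative_at_within, intro DERIV_diff DERIV_cmult_right DERIV_ident shift)
      show "((\<lambda>z. z\<^sup>2) has_real_derivative 2 * z) (at z)" using DERIV_pow[of 2 z] by simp
    qed
    have "norm ((F (y + w) - y * F' w - y\<^sup>2 * (F'' w / 2)) - (F (0 + w) - 0 * F' w - 0\<^sup>2 * (F'' w / 2)))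
       \<le> K * \<bar>y\<bar> * \<bar>y\<bar> * norm (y - 0)"
      by (rule field_differentiable_bound[OF _ d0]) (use b1 in auto)
    then show ?thesis by (simp add: algebra_simps power3_eq_cube)
  qed
  then show thesis by (rule that)
qed

lemma smooth_continuous: "smooth K F \<Longrightarrow> continuous_on UNIV F"
  by (auto simp: smooth_def continuous_on_eq_continuous_at intro: DERIV_isCont)

lemma smooth_measurable: "smooth K F \<Longrightarrow> F \<in> borel_measurable borel"
  by (rule borel_measurable_continuous_onI[OF smooth_continuous])

lemma taylor_expectation:
  fixes X :: "'a \<Rightarrow> real" and F F' F'' :: "real \<Rightarrow> real" and K :: real
  assumes P: "prob_space P" and X[measurable]: "X \<in> borel_measurable P" and F[measurable]: "F \<in> borel_measurable borel"
    and T: "\<And>w y. \<bar>F (w + y) - (F w + y * F' w + y\<^sup>2 / 2 * F'' w)\<bar> \<le> K * \<bar>y\<bar> ^ 3"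
    and m: "integrable P X" "(\<integral>\<omega>. X \<omega> \<partial>P) = 0" "integrable P (\<lambda>\<omega>. (X \<omega>)\<^sup>2)" "integrable P (\<lambda>\<omega>. \<bar>X \<omega>\<bar> ^ 3)"
  shows "\<bar>(\<integral>\<omega>. F (w + X \<omega>) \<partial>P) - (F w + (\<integral>\<omega>. (X \<omega>)\<^sup>2 \<partial>P) / 2 * F'' w)\<bar> \<le> K * (\<integral>\<omega>. \<bar>X \<omega>\<bar> ^ 3 \<partial>P)"
proof -
  interpret prob_space P by fact
  define R where "R \<omega> = F (w + X \<omega>) - (F w + X \<omega> * F' w + (X \<omega>)\<^sup>2 / 2 * F'' w)" for \<omega>
  have [measurable]: "R \<in> borel_measurable P" unfolding R_def by measurable
  have R: "\<bar>R \<omega>\<bar> \<le> K * \<bar>X \<omega>\<bar> ^ 3" for \<omega> unfolding R_def by (rule T)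
  have intR: "integrable P R"
    by (rule Bochner_Integration.integrable_bound[of P "\<lambda>\<omega>. K * \<bar>X \<omega>\<bar> ^ 3"])
      (use m(4) order_trans[OF R abs_ge_self] in auto)
  have "(\<integral>\<omega>. F (w + X \<omega>) \<partial>P) = (\<integral>\<omega>. R \<omega> + (F w + X \<omega> * F' w + (X \<omega>)\<^sup>2 / 2 * F'' w) \<partial>P)"
    by (simp add: R_def)
  also have "\<dots> = (\<integral>\<omega>. R \<omega> \<partial>P) + (F w + (\<integral>\<omega>. (X \<omega>)\<^sup>2 \<partial>P) / 2 * F'' w)"
    using intR m by (simp add: prob_space)
  finally have "\<bar>(\<integral>\<omega>. F (w + X \<omega>) \<partial>P) - (F w + (\<integral>\<omega>. (X \<omega>)\<^sup>2 \<partial>P) / 2 * F'' w)\<bar> = \<bar>\<integral>\<omega>. R \<omega> \<partial>P\<bar>" by simp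
  also have "\<dots> \<le> (\<integral>\<omega>. \<bar>R \<omega>\<bar> \<partial>P)" by (rule integral_abs_bound)
  also have "\<dots> \<le> (\<integral>\<omega>. K * \<bar>X \<omega>\<bar> ^ 3 \<partial>P)"
    by (rule integral_mono[OF integrable_abs[OF intR] integrable_mult_right[OF m(4)]]) (rule R)
  finally show ?thesis by simp
qed

lemma normal_law_moments:
  assumes s: "0 \<le> s"
  shows "integrable (normal_law s) (\<lambda>x. x)" "(\<integral>x. x \<partial>normal_law s) = 0"
    "integrable (normal_law s) (\<lambda>x. x\<^sup>2)" "(\<integral>x. x\<^sup>2 \<partial>normal_law s) = s"
    "integrable (normal_law s) (\<lambda>x. \<bar>x\<bar> ^ 3)" "(\<integral>x. \<bar>x\<bar> ^ 3 \<partial>normal_law s) = sqrt s ^ 3 * abs_moment3"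
proof -
  have m: "(\<lambda>x::real. x) \<in> borel_measurable borel" "(\<lambda>x::real. x\<^sup>2) \<in> borel_measurable borel"
    "(\<lambda>x::real. \<bar>x\<bar> ^ 3) \<in> borel_measurable borel" by measurable
  have e: "(sqrt s * z)\<^sup>2 = s * z\<^sup>2" "\<bar>sqrt s * z\<bar> ^ 3 = sqrt s ^ 3 * \<bar>z\<bar> ^ 3" for z
    using s by (simp_all add: power_mult_distrib abs_mult)
  show "integrable (normal_law s) (\<lambda>x. x)" "integrable (normal_law s) (\<lambda>x. x\<^sup>2)"
    "integrable (normal_law s) (\<lambda>x. \<bar>x\<bar> ^ 3)"
    unfolding integrable_normal_law_iff[OF m(1)] integrable_normal_law_iff[OF m(2)] integrable_normal_law_iff[OF m(3)] e
    by (intro integrable_mult_right std_normal_moments)+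
  show "(\<integral>x. x \<partial>normal_law s) = 0" "(\<integral>x. x\<^sup>2 \<partial>normal_law s) = s"
    "(\<integral>x. \<bar>x\<bar> ^ 3 \<partial>normal_law s) = sqrt s ^ 3 * abs_moment3"
    unfolding integral_normal_law[OF m(1)] integral_normal_law[OF m(2)] integral_normal_law[OF m(3)] e
    by (simp_all only: integral_mult_right_zero std_normal_moments abs_moment3_def mult_zero_right mult_1_right)
qed

lemma integral_normal_law_0:
  fixes F :: "real \<Rightarrow> real"
  assumes [measurable]: "F \<in> borel_measurable borel"
  shows "(\<integral>x. F x \<partial>normal_law 0) = F 0"
proof -
  interpret g: real_distribution std_normal_distribution by (rule real_dist_normal_dist)
  have "(\<integral>x. F x \<partial>normal_law 0) = (\<integral>z. F 0 \<partial>std_normal_distribution)"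
    by (subst integral_normal_law) simp_all
  also have "\<dots> = F 0 * g.prob (space std_normal_distribution)" by (simp only: lebesgue_integral_const real_scaleR_def mult.commute)
  finally show ?thesis by (simp only: g.prob_space mult_1_right)
qed

text \<open>
Induction over the index set. Exchanging one variable for a normal one of the same variance
costs two Taylor remainders of third order, because the terms of order 0, 1 and 2 agree. The
exchanged normal variable is then absorbed into the test function by a shift, and the
induction hypothesis applies to every shifted function.
\<close>

lemma (in prob_space) lindeberg:
  assumes "finite I" and ind: "indep_vars (\<lambda>_. borel) X I"
    and B: "\<And>i \<omega>. i \<in> I \<Longrightarrow> \<bar>X i \<omega>\<bar> \<le> B" and mean: "\<And>i. i \<in> I \<Longrightarrow> expectation (X i) = 0" and "0 \<le> B"
    and F: "smooth K F" "0 \<le> K" "\<And>x. \<bar>F x\<bar> \<le> A"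
  shows "\<bar>expectation (\<lambda>\<omega>. F (\<Sum>i\<in>I. X i \<omega>)) - (\<integral>x. F x \<partial>normal_law (\<Sum>i\<in>I. expectation (\<lambda>\<omega>. (X i \<omega>)\<^sup>2)))\<bar>
     \<le> real (card I) * (K * ((1 + abs_moment3) * B ^ 3))"
  using assms(1) ind B mean F
proof (induction I arbitrary: F rule: finite_induct)
  case empty
  have "(\<integral>x. F x \<partial>normal_law 0) = F 0"
    by (rule integral_normal_law_0) (rule smooth_measurable[OF empty(4)])
  then show ?case by (simp add: prob_space)
next
  case (insert i I)
  let ?e = "K * ((1 + abs_moment3) * B ^ 3)"
  let ?S = "\<lambda>\<omega>. \<Sum>i\<in>I. X i \<omega>"
  let ?v = "expectation (\<lambda>\<omega>. (X i \<omega>)\<^sup>2)" and ?V = "\<Sum>i\<in>I. expectation (\<lambda>\<omega>. (X i \<omega>)\<^sup>2)"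
  let ?N = "normal_law ?v"
  interpret N: prob_space ?N by (rule prob_space_normal_law)
  interpret MN: pair_sigma_finite M ?N ..
  interpret MNp: pair_prob_space M ?N ..
  have Fm [measurable]: "F \<in> borel_measurable borel" by (rule smooth_measurable) (rule insert.prems)
  have mean_i: "expectation (X i) = 0" using insert.prems(3) by blast
  have [measurable]: "X j \<in> borel_measurable M" if "j \<in> insert i I" for j
    using insert.prems(1) that by (auto simp: indep_vars_def)
  have Xi[measurable]: "X i \<in> borel_measurable M" by simp
  have S[measurable]: "?S \<in> borel_measurable M" by (rule borel_measurable_sum) simp
  have XB: "\<bar>X i \<omega>\<bar> \<le> B" for \<omega> using insert.prems by simp
  have X2: "(X i \<omega>)\<^sup>2 \<le> B\<^sup>2" and X3: "\<bar>X i \<omega>\<bar> ^ 3 \<le> B ^ 3" for \<omega>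
    using power_mono[OF XB[of \<omega>] abs_ge_zero, of 2] power_mono[OF XB[of \<omega>] abs_ge_zero, of 3] by auto
  have v: "0 \<le> ?v" "0 \<le> ?V" by (auto intro!: sum_nonneg integral_nonneg_AE)
  have m: "integrable M (X i)" "integrable M (\<lambda>\<omega>. (X i \<omega>)\<^sup>2)" "integrable M (\<lambda>\<omega>. \<bar>X i \<omega>\<bar> ^ 3)"
    using XB X2 X3 by (auto intro: integrable_const_bound[where B = B] integrable_const_bound[where B = "B\<^sup>2"]
      integrable_const_bound[where B = "B ^ 3"])
  have vB: "?v \<le> B\<^sup>2"
    using integral_mono[OF m(2), of "\<lambda>_. B\<^sup>2"] X2 by (simp add: prob_space)
  have "sqrt ?v \<le> B" using vB \<open>0 \<le> B\<close> by (simp add: real_le_lsqrt)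
  then have vB3: "sqrt ?v ^ 3 \<le> B ^ 3" using v by (intro power_mono) auto
  have m3: "expectation (\<lambda>\<omega>. \<bar>X i \<omega>\<bar> ^ 3) \<le> B ^ 3"
    using integral_mono[OF m(3), of "\<lambda>_. B ^ 3"] X3 by (simp add: prob_space)
  have c0: "0 \<le> abs_moment3" unfolding abs_moment3_def by (rule integral_nonneg_AE) auto
  obtain F' F'' where T: "\<And>w y. \<bar>F (w + y) - (F w + y * F' w + y\<^sup>2 / 2 * F'' w)\<bar> \<le> K * \<bar>y\<bar> ^ 3"
    using smooth_taylor[OF insert.prems(4,5)] by blast
  \<comment> \<open>the cost of exchanging one variable, the rest of the sum being frozen at \<open>w\<close>\<close>
  have swap: "\<bar>expectation (\<lambda>\<omega>. F (w + X i \<omega>)) - (\<integral>z. F (w + z) \<partial>?N)\<bar> \<le> ?e" for w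
  proof -
    have "\<bar>expectation (\<lambda>\<omega>. F (w + X i \<omega>)) - (F w + ?v / 2 * F'' w)\<bar> \<le> K * expectation (\<lambda>\<omega>. \<bar>X i \<omega>\<bar> ^ 3)"
      by (rule taylor_expectation[OF prob_space_axioms Xi Fm T m(1) mean_i m(2) m(3)])
    moreover have "\<bar>(\<integral>z. F (w + z) \<partial>?N) - (F w + (\<integral>z. z\<^sup>2 \<partial>?N) / 2 * F'' w)\<bar> \<le> K * (\<integral>z. \<bar>z\<bar> ^ 3 \<partial>?N)"
      by (rule taylor_expectation[OF prob_space_normal_law _ Fm T normal_law_moments(1,2,3,5)[OF v(1)]]) simp
    moreover have "K * expectation (\<lambda>\<omega>. \<bar>X i \<omega>\<bar> ^ 3) \<le> K * B ^ 3" "K * (\<integral>z. \<bar>z\<bar> ^ 3 \<partial>?N) \<le> K * (B ^ 3 * abs_moment3)"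
      using m3 vB3 c0 insert.prems(5) normal_law_moments(6)[OF v(1)]
      by (auto intro!: mult_left_mono mult_right_mono)
    ultimately show ?thesis using normal_law_moments(4)[OF v(1)] by (simp add: algebra_simps)
  qed
  have bound: "integrable M (\<lambda>\<omega>. F (f \<omega>))" if "f \<in> borel_measurable M" for f
    using that insert.prems(6) by (intro integrable_const_bound[where B = A]) auto
  have ind: "indep_var borel ?S borel (X i)"
  proof -
    have "indep_var borel (\<lambda>\<omega>. (\<lambda>f. \<Sum>j\<in>I. f j) (\<lambda>j\<in>I. X j \<omega>)) borel (\<lambda>\<omega>. (\<lambda>f. f i) (\<lambda>j\<in>{i}. X j \<omega>))"
      by (rule indep_var_blocks[OF insert.prems(1)]) (use insert.hyps in auto)
    then show ?thesis by simp
  qed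
  have "expectation (\<lambda>\<omega>. F (\<Sum>i\<in>insert i I. X i \<omega>)) = expectation (\<lambda>\<omega>. (\<lambda>(s, x). F (s + x)) (?S \<omega>, X i \<omega>))"
    using insert.hyps by (simp add: add.commute)
  also have "\<dots> = expectation (\<lambda>\<omega>. expectation (\<lambda>\<omega>'. (\<lambda>(s, x). F (s + x)) (?S \<omega>, X i \<omega>')))"
    by (rule indep_var_integral_pair[OF ind]) (auto intro!: bound)
  finally have e1: "expectation (\<lambda>\<omega>. F (\<Sum>i\<in>insert i I. X i \<omega>)) = expectation (\<lambda>\<omega>. expectation (\<lambda>\<omega>'. F (?S \<omega> + X i \<omega>')))" by simp
  have i1: "integrable M (\<lambda>\<omega>. expectation (\<lambda>\<omega>'. F (?S \<omega> + X i \<omega>')))"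
    using indep_var_integral_pair(2)[OF ind, of "\<lambda>(s, x). F (s + x)"] bound[of "\<lambda>\<omega>. ?S \<omega> + X i \<omega>"] by simp
  have iMN: "integrable (M \<Otimes>\<^sub>M ?N) (\<lambda>(\<omega>, z). F (?S \<omega> + z))"
    by (rule MNp.integrable_const_bound[where B = A]) (use insert.prems(6) in auto)
  have i2: "integrable M (\<lambda>\<omega>. \<integral>z. F (?S \<omega> + z) \<partial>?N)"
    using MN.integrable_fst[OF iMN] .
  have i3: "integrable ?N (\<lambda>z. expectation (\<lambda>\<omega>. F (?S \<omega> + z)))"
    using MN.integrable_snd[OF iMN] .
  have s1: "\<bar>expectation (\<lambda>\<omega>. expectation (\<lambda>\<omega>'. F (?S \<omega> + X i \<omega>'))) - expectation (\<lambda>\<omega>. \<integral>z. F (?S \<omega> + z) \<partial>?N)\<bar> \<le> ?e"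
  proof -
    have "\<bar>expectation (\<lambda>\<omega>. expectation (\<lambda>\<omega>'. F (?S \<omega> + X i \<omega>')) - (\<integral>z. F (?S \<omega> + z) \<partial>?N))\<bar>
       \<le> expectation (\<lambda>\<omega>. \<bar>expectation (\<lambda>\<omega>'. F (?S \<omega> + X i \<omega>')) - (\<integral>z. F (?S \<omega> + z) \<partial>?N)\<bar>)"
      by (rule integral_abs_bound)
    also have "\<dots> \<le> expectation (\<lambda>\<omega>. ?e)"
      by (rule integral_mono) (use i1 i2 swap in auto)
    finally show ?thesis using i1 i2 by (simp add: prob_space)
  qed
  have e2: "expectation (\<lambda>\<omega>. \<integral>z. F (?S \<omega> + z) \<partial>?N) = (\<integral>z. expectation (\<lambda>\<omega>. F (?S \<omega> + z)) \<partial>?N)"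
    by (rule MN.Fubini_integral[OF iMN, symmetric])
  have IH: "\<bar>expectation (\<lambda>\<omega>. F (?S \<omega> + z)) - (\<integral>x. F (x + z) \<partial>normal_law ?V)\<bar> \<le> real (card I) * ?e" for z
    by (rule insert.IH[of "\<lambda>x. F (x + z)", OF indep_vars_subset[OF insert.prems(1)] _ _ smooth_shift])
      (use insert.prems in auto)
  have i4: "integrable ?N (\<lambda>z. \<integral>x. F (x + z) \<partial>normal_law ?V)"
  proof -
    interpret V: prob_space "normal_law ?V" by (rule prob_space_normal_law)
    interpret VN: pair_sigma_finite "normal_law ?V" ?N ..
    interpret VNp: pair_prob_space "normal_law ?V" ?N ..
    have "integrable (normal_law ?V \<Otimes>\<^sub>M ?N) (\<lambda>(x, z). F (x + z))"
      by (rule VNp.integrable_const_bound[where B = A]) (use insert.prems(6) in auto)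
    then show ?thesis by (rule VN.integrable_snd)
  qed
  have s2: "\<bar>(\<integral>z. expectation (\<lambda>\<omega>. F (?S \<omega> + z)) \<partial>?N) - (\<integral>z. (\<integral>x. F (x + z) \<partial>normal_law ?V) \<partial>?N)\<bar> \<le> real (card I) * ?e"
  proof -
    have "\<bar>\<integral>z. expectation (\<lambda>\<omega>. F (?S \<omega> + z)) - (\<integral>x. F (x + z) \<partial>normal_law ?V) \<partial>?N\<bar>
       \<le> (\<integral>z. \<bar>expectation (\<lambda>\<omega>. F (?S \<omega> + z)) - (\<integral>x. F (x + z) \<partial>normal_law ?V)\<bar> \<partial>?N)"
      by (rule integral_abs_bound)
    also have "\<dots> \<le> (\<integral>z. real (card I) * ?e \<partial>?N)"
      by (rule integral_mono) (use i3 i4 IH in auto)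
    finally show ?thesis using i3 i4 N.prob_space by simp
  qed
  have e3: "(\<integral>z. (\<integral>x. F (x + z) \<partial>normal_law ?V) \<partial>?N) = (\<integral>x. F x \<partial>normal_law (?V + ?v))"
    by (rule integral_normal_law_add[where A = A]) (use v insert.prems in auto)
  have "real (card (insert i I)) * ?e = real (card I) * ?e + ?e"
    using insert.hyps by (simp add: algebra_simps)
  moreover have "(\<Sum>i\<in>insert i I. expectation (\<lambda>\<omega>. (X i \<omega>)\<^sup>2)) = ?V + ?v" using insert.hyps by simp
  ultimately show ?case using s1 s2 e1 e2 e3 by simp
qed

section \<open>Smoothing a Lipschitz function\<close>

lemma lipschitz_continuous:
  fixes f :: "real \<Rightarrow> real"
  assumes "\<And>x y. \<bar>f x - f y\<bar> \<le> \<bar>x - y\<bar>"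
  shows "continuous_on UNIV f"
  unfolding continuous_on_iff dist_real_def using assms by (metis order_le_less_trans)

text \<open>
\<open>F x\<close> is the mean of \<open>g\<close> over \<open>[x, x + h]\<close>. Each such average gains one derivative and moves a
1-Lipschitz function by at most \<open>h\<close>.
\<close>

lemma box_average:
  fixes g :: "real \<Rightarrow> real"
  assumes cont: "continuous_on UNIV g" and h: "0 < h" and A: "\<And>x. \<bar>g x\<bar> \<le> A"
    and lip: "\<And>x y. \<bar>g x - g y\<bar> \<le> \<bar>x - y\<bar>"
  obtains F where "\<And>x. (F has_real_derivative (g (x + h) - g x) / h) (at x)"
    "\<And>x. \<bar>F x\<bar> \<le> A" "\<And>x. \<bar>F x - g x\<bar> \<le> h" "\<And>x y. \<bar>F x - F y\<bar> \<le> \<bar>x - y\<bar>"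
proof -
  obtain G where G: "\<And>x. (G has_vector_derivative g x) (at x)"
    using einterval_antiderivative[of "-\<infinity>" "\<infinity>" g] cont by (auto simp: continuous_on_eq_continuous_at)
  then have dG: "(G has_real_derivative g x) (at x)" for x
    by (simp add: has_real_derivative_iff_has_vector_derivative)
  define F where "F x = (G (x + h) - G x) / h" for x
  have dF: "(F has_real_derivative (g (x + h) - g x) / h) (at x)" for x
    unfolding F_def
    by (intro DERIV_cdivide DERIV_diff dG) (use dG[of "x + h"] in \<open>simp add: DERIV_shift\<close>)
  have mid: "\<exists>c. x < c \<and> c < x + h \<and> F x = g c" for x
  proof -
    obtain c where "x < c" "c < x + h" "G (x + h) - G x = (x + h - x) * g c"
      using MVT2[of x "x + h" G g] dG h by auto
    then show ?thesis using h by (intro exI[of _ c]) (simp add: F_def)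
  qed
  have FA: "\<bar>F x\<bar> \<le> A" for x using mid[of x] A by metis
  have Fg: "\<bar>F x - g x\<bar> \<le> h" for x
  proof -
    obtain c where c: "x < c" "c < x + h" "F x = g c" using mid by blast
    then show ?thesis using lip[of c x] by simp
  qed
  have "\<bar>F x - F y\<bar> \<le> \<bar>x - y\<bar>" for x y
  proof -
    have "norm (F x - F y) \<le> 1 * norm (x - y)"
    proof (rule field_differentiable_bound[OF convex_UNIV])
      fix z show "(F has_field_derivative (g (z + h) - g z) / h) (at z within UNIV)" using dF by simp
      show "norm ((g (z + h) - g z) / h) \<le> 1" using lip[of "z + h" z] h by simp
    qed auto
    then show ?thesis by simp
  qed
  then show thesis using that dF FA Fg by blast
qed

text \<open>
Two box averages of width \<open>h\<close>.
\<close>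

lemma smooth_approximation:
  fixes f :: "real \<Rightarrow> real"
  assumes h: "0 < h" and A: "\<And>x. \<bar>f x\<bar> \<le> A" and lip: "\<And>x y. \<bar>f x - f y\<bar> \<le> \<bar>x - y\<bar>"
  obtains F where "smooth (4 / h\<^sup>2) F" "\<And>x. \<bar>F x\<bar> \<le> A" "\<And>x. \<bar>F x - f x\<bar> \<le> 2 * h"
proof -
  obtain F1 where F1: "\<And>x. (F1 has_real_derivative (f (x + h) - f x) / h) (at x)"
    "\<And>x. \<bar>F1 x\<bar> \<le> A" "\<And>x. \<bar>F1 x - f x\<bar> \<le> h" "\<And>x y. \<bar>F1 x - F1 y\<bar> \<le> \<bar>x - y\<bar>"
    by (rule box_average[OF lipschitz_continuous[OF lip] h A lip]) blast
  obtain F2 where F2: "\<And>x. (F2 has_real_derivative (F1 (x + h) - F1 x) / h) (at x)"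
    "\<And>x. \<bar>F2 x\<bar> \<le> A" "\<And>x. \<bar>F2 x - F1 x\<bar> \<le> h"
    by (rule box_average[OF lipschitz_continuous[OF F1(4)] h F1(2) F1(4)]) blast
  define F'' where "F'' x = ((f (x + h + h) - f (x + h)) / h - (f (x + h) - f x) / h) / h" for x
  have "((\<lambda>x. (F1 (x + h) - F1 x) / h) has_real_derivative F'' x) (at x)" for x
    unfolding F''_def by (intro DERIV_cdivide DERIV_diff F1(1)) (use F1(1)[of "x + h"] in \<open>simp add: DERIV_shift\<close>)
  moreover have "\<bar>F'' x - F'' y\<bar> \<le> 4 / h\<^sup>2 * \<bar>x - y\<bar>" for x y
  proof -
    have e: "F'' z = (f (z + h + h) - 2 * f (z + h) + f z) / h\<^sup>2" for z
      using h by (simp add: F''_def field_simps power2_eq_square)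
    have "\<bar>F'' x - F'' y\<bar> = \<bar>(f (x + h + h) - f (y + h + h)) - 2 * (f (x + h) - f (y + h)) + (f x - f y)\<bar> / h\<^sup>2"
      unfolding e diff_divide_distrib[symmetric] abs_divide by (simp add: algebra_simps)
    also have "\<dots> \<le> (4 * \<bar>x - y\<bar>) / h\<^sup>2"
    proof (rule divide_right_mono)
      have d: "x + h + h - (y + h + h) = x - y" "x + h - (y + h) = x - y" by simp_all
      have abc: "\<bar>a\<bar> \<le> t \<Longrightarrow> \<bar>b\<bar> \<le> t \<Longrightarrow> \<bar>c\<bar> \<le> t \<Longrightarrow> \<bar>a - 2 * b + c\<bar> \<le> 4 * t" for a b c t :: real
        unfolding abs_le_iff by linarith
      show "\<bar>(f (x + h + h) - f (y + h + h)) - 2 * (f (x + h) - f (y + h)) + (f x - f y)\<bar> \<le> 4 * \<bar>x - y\<bar>"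
        by (rule abc) (use lip[of "x + h + h" "y + h + h"] lip[of "x + h" "y + h"] lip[of x y] d in simp_all)
    qed simp
    finally show ?thesis by simp
  qed
  ultimately have "smooth (4 / h\<^sup>2) F2" unfolding smooth_def
    by (intro exI[of _ "\<lambda>x. (F1 (x + h) - F1 x) / h"] exI[of _ F''] conjI allI F2(1)) auto
  moreover have "\<bar>F2 x - f x\<bar> \<le> 2 * h" for x using F2(3)[of x] F1(3)[of x] by linarith
  ultimately show thesis using that F2(2) by blast
qed

text \<open>
Smoothing at scale \<open>h\<close> costs \<open>2 h\<close> for each of the two laws, and Lindeberg's bound then costs
\<open>4 / h\<^sup>2\<close> times the number of terms; \<open>h = (card I)\<^bsup>1/3\<^esup>\<close> balances the two.
\<close>

lemma (in prob_space) lipschitz_clt: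
  fixes f :: "real \<Rightarrow> real"
  assumes fin: "finite I" "I \<noteq> {}" and ind: "indep_vars (\<lambda>_. borel) X I"
    and B: "\<And>i \<omega>. i \<in> I \<Longrightarrow> \<bar>X i \<omega>\<bar> \<le> B" and mean: "\<And>i. i \<in> I \<Longrightarrow> expectation (X i) = 0" and B0: "0 \<le> B"
    and A: "\<And>x. \<bar>f x\<bar> \<le> A" and lip: "\<And>x y. \<bar>f x - f y\<bar> \<le> \<bar>x - y\<bar>"
  shows "\<bar>expectation (\<lambda>\<omega>. f (\<Sum>i\<in>I. X i \<omega>)) - (\<integral>x. f x \<partial>normal_law (\<Sum>i\<in>I. expectation (\<lambda>\<omega>. (X i \<omega>)\<^sup>2)))\<bar>
     \<le> 4 * (1 + (1 + abs_moment3) * B ^ 3) * real (card I) powr (1/3)"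
proof -
  define h where "h = real (card I) powr (1/3)"
  let ?S = "\<lambda>\<omega>. \<Sum>i\<in>I. X i \<omega>"
  let ?N = "normal_law (\<Sum>i\<in>I. expectation (\<lambda>\<omega>. (X i \<omega>)\<^sup>2))"
  interpret N: prob_space ?N by (rule prob_space_normal_law)
  have c: "0 < real (card I)" using fin by (simp add: card_gt_0_iff)
  have h: "0 < h" using fin by (simp add: h_def)
  have h3: "real (card I) = h * h * h"
    using c by (simp add: h_def powr_add[symmetric])
  obtain F where F: "smooth (4 / h\<^sup>2) F" "\<And>x. \<bar>F x\<bar> \<le> A" "\<And>x. \<bar>F x - f x\<bar> \<le> 2 * h"
    using smooth_approximation[OF h A lip] by blast
  have contf: "continuous_on UNIV f"
    using lip by (rule lipschitz_continuous)
  have [measurable]: "f \<in> borel_measurable borel" by (rule borel_measurable_continuous_onI[OF contf])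
  have [measurable]: "F \<in> borel_measurable borel" by (rule smooth_measurable) (rule F)
  have S [measurable]: "?S \<in> borel_measurable M"
    using ind by (intro borel_measurable_sum) (auto simp: indep_vars_def)
  have close: "\<bar>(\<integral>\<omega>. F (g \<omega>) \<partial>P) - (\<integral>\<omega>. f (g \<omega>) \<partial>P)\<bar> \<le> 2 * h"
    if P: "prob_space P" and [measurable]: "g \<in> borel_measurable P" for P :: "'c measure" and g
  proof -
    interpret P: prob_space P by (rule P)
    have i: "integrable P (\<lambda>\<omega>. F (g \<omega>))" "integrable P (\<lambda>\<omega>. f (g \<omega>))"
      by (rule P.integrable_const_bound[where B = A], use F(2) A in simp, simp)+
    have "\<bar>\<integral>\<omega>. F (g \<omega>) - f (g \<omega>) \<partial>P\<bar> \<le> (\<integral>\<omega>. \<bar>F (g \<omega>) - f (g \<omega>)\<bar> \<partial>P)" by (rule integral_abs_bound)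
    also have "\<dots> \<le> (\<integral>\<omega>. 2 * h \<partial>P)"
      by (rule integral_mono) (use i F(3) in auto)
    finally show ?thesis using i by (simp add: P.prob_space)
  qed
  have "\<bar>expectation (\<lambda>\<omega>. F (?S \<omega>)) - (\<integral>x. F x \<partial>?N)\<bar> \<le> real (card I) * (4 / h\<^sup>2 * ((1 + abs_moment3) * B ^ 3))"
    by (rule lindeberg[OF fin(1) ind B mean B0 F(1) _ F(2)]) simp_all
  also have "\<dots> = 4 * h * ((1 + abs_moment3) * B ^ 3)"
    unfolding h3 using h by (simp add: power2_eq_square)
  finally have "\<bar>expectation (\<lambda>\<omega>. f (?S \<omega>)) - (\<integral>x. f x \<partial>?N)\<bar> \<le> 4 * h + 4 * h * ((1 + abs_moment3) * B ^ 3)"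
    using close[OF prob_space_axioms S] close[OF prob_space_normal_law, of "\<lambda>x. x" "\<Sum>i\<in>I. expectation (\<lambda>\<omega>. (X i \<omega>)\<^sup>2)"]
    by simp
  also have "\<dots> = 4 * (1 + (1 + abs_moment3) * B ^ 3) * h" by (simp add: algebra_simps)
  finally show ?thesis unfolding h_def .
qed

section \<open>Monotone coupling\<close>

text \<open>
The probability integral transform. Without atoms the distribution function is continuous and takes
the value \<open>u\<close>.
\<close>

lemma (in prob_space) distr_cdf_uniform:
  assumes [measurable]: "S \<in> borel_measurable M" and atom: "\<And>s. prob {\<omega>\<in>space M. S \<omega> = s} = 0"
    and u: "0 < u" "u < 1"
  shows "prob {\<omega>\<in>space M. cdf (distr M borel S) (S \<omega>) \<le> u} = u"
proof -
  let ?D = "distr M borel S"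
  interpret D: real_distribution ?D by (rule real_distribution_distr) simp
  have cont: "isCont (cdf ?D) s" for s
    unfolding D.isCont_cdf using atom[of s] by (simp add: measure_distr vimage_def Int_def conj_commute)
  have c: "cdf ?D s = prob {\<omega>\<in>space M. S \<omega> \<le> s}" for s
    by (simp add: cdf_def measure_distr vimage_def Int_def conj_commute)
  obtain a where a: "cdf ?D a < u"
    using order_tendstoD(2)[OF D.cdf_lim_at_bot u(1)] by (auto simp: eventually_at_bot_linorder)
  obtain b where b: "u < cdf ?D b"
    using order_tendstoD(1)[OF D.cdf_lim_at_top_prob u(2)] by (auto simp: eventually_at_top_linorder)
  let ?L = "{s. cdf ?D s \<le> u}"
  have bdd: "bdd_above ?L"
    using b D.cdf_nondecreasing by (intro bdd_aboveI[of _ b]) (smt (verit) mem_Collect_eq)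
  have ne: "?L \<noteq> {}" using a by (auto intro: less_imp_le)
  have closed: "closed ?L"
    by (intro closed_Collect_le continuous_at_imp_continuous_on ballI cont continuous_on_const)
  define s0 where "s0 = Sup ?L"
  have s0: "cdf ?D s0 \<le> u" using closed_contains_Sup[OF ne bdd closed] by (simp add: s0_def)
  have above: "u < cdf ?D s" if "s > s0" for s
    using cSup_upper[OF _ bdd, of s] that by (force simp: s0_def not_le[symmetric])
  have "u \<le> cdf ?D s0"
  proof (rule tendsto_lowerbound)
    show "(cdf ?D \<longlongrightarrow> cdf ?D s0) (at_right s0)" using cont[of s0] by (simp add: isCont_def filterlim_at_split)
    show "\<forall>\<^sub>F s in at_right s0. u \<le> cdf ?D s"
      using above by (auto simp: eventually_at_right_field intro!: exI[of _ "s0 + 1"] less_imp_le)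
  qed simp
  then have "cdf ?D s0 = u" using s0 by simp
  moreover have "cdf ?D s \<le> u \<longleftrightarrow> s \<le> s0" for s
    using above[of s] s0 D.cdf_nondecreasing[of s s0] by (meson leD leI order_trans)
  ultimately show ?thesis using c[of s0] by simp
qed

text \<open>
\<open>h\<close> is the quantile function of \<open>N\<close> composed with the distribution function of \<open>S\<close>. The two
variables are then monotone functions of one uniform variable \<open>R\<close>, so for each \<open>x\<close> the events
\<open>S \<le> x\<close> and \<open>h (S) \<le> x\<close> are nested and the probability of their difference is the difference of
the distribution functions. Integrating over \<open>x\<close> gives \<open>E \<bar>S - h (S)\<bar>\<close> as the \<open>L\<^sup>1\<close> distance of the
distribution functions, and this in turn is the difference of expectations of a single 1-Lipschitz
function, the one whose derivative is the sign of that difference.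
\<close>

lemma (in prob_space) monotone_coupling:
  assumes S[measurable]: "S \<in> borel_measurable M" and atom: "\<And>s. prob {\<omega>\<in>space M. S \<omega> = s} = 0"
    and N: "real_distribution N"
    and close: "\<And>f A. (\<And>x. \<bar>f x\<bar> \<le> A) \<Longrightarrow> (\<And>x y. \<bar>f x - f y\<bar> \<le> \<bar>x - y\<bar>) \<Longrightarrow>
       \<bar>expectation (\<lambda>\<omega>. f (S \<omega>)) - (\<integral>x. f x \<partial>N)\<bar> \<le> C"
  obtains h where "h \<in> borel_measurable borel" "distr M borel (\<lambda>\<omega>. h (S \<omega>)) = N"
    "(\<integral>\<^sup>+\<omega>. ennreal \<bar>S \<omega> - h (S \<omega>)\<bar> \<partial>M) \<le> ennreal C"
proof -
  let ?D = "distr M borel S"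
  interpret D: cdf_distribution ?D by (simp add: cdf_distribution_def real_distribution_distr)
  interpret N: cdf_distribution N by (simp add: cdf_distribution_def N)
  define R where "R \<omega> = cdf ?D (S \<omega>)" for \<omega>
  have [measurable]: "R \<in> borel_measurable M" unfolding R_def by measurable
  have PR: "prob {\<omega>\<in>space M. R \<omega> \<le> u} = u" if "0 < u" "u < 1" for u
    unfolding R_def by (rule distr_cdf_uniform[OF S atom that])
  have Rb: "0 \<le> R \<omega>" "R \<omega> \<le> 1" for \<omega>
    unfolding R_def using D.cdf_nonneg D.cdf_bounded_prob by auto
  have R01: "AE \<omega> in M. 0 < R \<omega> \<and> R \<omega> < 1"
  proof -
    have "prob {\<omega>\<in>space M. R \<omega> \<le> 0} \<le> 1 / real (Suc (Suc n))" for n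
      using PR[of "1 / real (Suc (Suc n))"]
        finite_measure_mono[of "{\<omega>\<in>space M. R \<omega> \<le> 0}" "{\<omega>\<in>space M. R \<omega> \<le> 1 / real (Suc (Suc n))}"]
      by (force intro: order_trans[of _ "0 :: real"])
    then have "prob {\<omega>\<in>space M. R \<omega> \<le> 0} \<le> 0"
    proof (rule LIMSEQ_le_const[rotated, OF exI[of _ 0], OF allI, OF impI])
      show "(\<lambda>n. 1 / real (Suc (Suc n))) \<longlonglongrightarrow> 0" by real_asymp
    qed
    then have "prob {\<omega>\<in>space M. R \<omega> \<le> 0} = 0" by (simp add: measure_le_0_iff)
    then have "AE \<omega> in M. 0 < R \<omega>"
      by (subst (asm) prob_eq_0) (auto simp: not_le)
    moreover have "1 - 1 / real (Suc (Suc n)) \<le> prob {\<omega>\<in>space M. R \<omega> < 1}" for n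
    proof -
      have "prob {\<omega>\<in>space M. R \<omega> \<le> 1 - 1 / real (Suc (Suc n))} \<le> prob {\<omega>\<in>space M. R \<omega> < 1}"
        by (rule finite_measure_mono) (auto simp: less_le_trans intro: le_less_trans)
      then show ?thesis using PR[of "1 - 1 / real (Suc (Suc n))"] by simp
    qed
    then have "1 \<le> prob {\<omega>\<in>space M. R \<omega> < 1}"
    proof (rule LIMSEQ_le_const2[rotated, OF exI[of _ 0], OF allI, OF impI])
      show "(\<lambda>n. 1 - 1 / real (Suc (Suc n))) \<longlonglongrightarrow> 1" by real_asymp
    qed
    then have "prob {\<omega>\<in>space M. R \<omega> < 1} = 1" by (simp add: antisym)
    then have "AE \<omega> in M. R \<omega> < 1" by (subst (asm) prob_eq_1) auto
    ultimately show ?thesis by eventually_elim auto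
  qed
  define I where "I u = indicator {0<..<1} u *\<^sub>R N.I u" for u
  have I_meas [measurable]: "I \<in> borel_measurable borel"
    using borel_measurable_restrict_space_iff[of "{0<..<1}" borel N.I] N.measurable_CI
    unfolding I_def by simp
  define h where "h s = I (cdf ?D s)" for s
  have h_meas [measurable]: "h \<in> borel_measurable borel" unfolding h_def by measurable
  define Z where "Z \<omega> = h (S \<omega>)" for \<omega>
  have [measurable]: "Z \<in> borel_measurable M" unfolding Z_def by measurable
  have Zle: "AE \<omega> in M. \<forall>x. Z \<omega> \<le> x \<longleftrightarrow> R \<omega> \<le> cdf N x"
    using R01
  proof eventually_elim
    case (elim \<omega>)
    then have "Z \<omega> = N.I (R \<omega>)" by (simp add: Z_def h_def I_def R_def)
    then show ?case using N.pseudoinverse[of "R \<omega>"] elim by metis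
  qed
  have PR': "prob {\<omega>\<in>space M. R \<omega> \<le> u} = u" if "0 \<le> u" "u \<le> 1" for u
  proof -
    consider "u = 0" | "u = 1" | "0 < u" "u < 1" using \<open>0 \<le> u\<close> \<open>u \<le> 1\<close> by fastforce
    then show ?thesis
    proof cases
      case 1
      have "prob {\<omega>\<in>space M. R \<omega> \<le> 0} = 0"
        using R01 by (subst prob_eq_0) (auto elim: eventually_mono)
      then show ?thesis using 1 by simp
    next
      case 2
      have "prob {\<omega>\<in>space M. R \<omega> \<le> 1} = 1"
        using Rb(2) by (simp add: prob_space)
      then show ?thesis using 2 by simp
    qed (rule PR)
  qed
  have PZ: "prob {\<omega>\<in>space M. Z \<omega> \<le> x} = cdf N x" for x
  proof -
    have "prob {\<omega>\<in>space M. Z \<omega> \<le> x} = prob {\<omega>\<in>space M. R \<omega> \<le> cdf N x}"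
      by (rule measure_eq_AE) (use Zle in \<open>auto elim: eventually_mono\<close>)
    then show ?thesis using PR' N.cdf_nonneg N.cdf_bounded_prob by simp
  qed
  have distr: "distr M borel Z = N"
  proof (rule cdf_unique)
    show "cdf (distr M borel Z) = cdf N"
      using PZ by (auto simp: fun_eq_iff cdf_def measure_distr vimage_def Int_def conj_commute)
  qed (auto intro: real_distribution_distr N)
  define H where "H x = cdf N x - cdf ?D x" for x
  have H_meas [measurable]: "H \<in> borel_measurable borel" unfolding H_def by measurable
  have H1: "\<bar>H x\<bar> \<le> 1" for x
    unfolding H_def using D.cdf_nonneg[of x] D.cdf_bounded_prob[of x] N.cdf_nonneg[of x] N.cdf_bounded_prob[of x] by linarith
  have PS: "prob {\<omega>\<in>space M. S \<omega> \<le> x} = cdf ?D x" for x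
    by (simp add: cdf_def measure_distr vimage_def Int_def conj_commute)
  \<comment> \<open>both events are sublevel sets of \<open>R\<close>, hence nested up to a null set\<close>
  have sd: "(\<integral>\<^sup>+\<omega>. ennreal \<bar>indicator {S \<omega>..} x - indicator {Z \<omega>..} x\<bar> \<partial>M) = ennreal \<bar>H x\<bar>" for x :: real
  proof -
    have RS: "AE \<omega> in M. S \<omega> \<le> x \<longleftrightarrow> R \<omega> \<le> cdf ?D x"
    proof -
      have sub: "{\<omega>\<in>space M. S \<omega> \<le> x} \<subseteq> {\<omega>\<in>space M. R \<omega> \<le> cdf ?D x}"
        using D.cdf_nondecreasing by (auto simp: R_def)
      have "prob ({\<omega>\<in>space M. R \<omega> \<le> cdf ?D x} - {\<omega>\<in>space M. S \<omega> \<le> x}) = 0"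
        using sub PR'[of "cdf ?D x"] PS D.cdf_nonneg D.cdf_bounded_prob by (subst finite_measure_Diff) auto
      then have "AE \<omega> in M. \<omega> \<notin> {\<omega>\<in>space M. R \<omega> \<le> cdf ?D x} - {\<omega>\<in>space M. S \<omega> \<le> x}"
        by (subst (asm) prob_eq_0) auto
      then show ?thesis using AE_space
      proof eventually_elim
        case (elim \<omega>)
        then show ?case using subsetD[OF sub, of \<omega>] by simp blast
      qed
    qed
    have ab: "AE \<omega> in M. ennreal \<bar>indicator {S \<omega>..} x - indicator {Z \<omega>..} x\<bar>
        = indicator ({\<omega>\<in>space M. R \<omega> \<le> max (cdf ?D x) (cdf N x)} - {\<omega>\<in>space M. R \<omega> \<le> min (cdf ?D x) (cdf N x)}) \<omega>"
      using RS Zle AE_space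
    proof eventually_elim
      case (elim \<omega>)
      have "Z \<omega> \<le> x \<longleftrightarrow> R \<omega> \<le> cdf N x" using elim(2) by (rule spec)
      then show ?case using elim(1,3)
        by (cases "S \<omega> \<le> x"; cases "Z \<omega> \<le> x") (simp_all add: le_max_iff_disj)
    qed
    have "(\<integral>\<^sup>+\<omega>. ennreal \<bar>indicator {S \<omega>..} x - indicator {Z \<omega>..} x\<bar> \<partial>M)
      = emeasure M ({\<omega>\<in>space M. R \<omega> \<le> max (cdf ?D x) (cdf N x)} - {\<omega>\<in>space M. R \<omega> \<le> min (cdf ?D x) (cdf N x)})"
      by (subst nn_integral_cong_AE[OF ab]) (rule nn_integral_indicator, measurable)
    also have "\<dots> = ennreal (max (cdf ?D x) (cdf N x) - min (cdf ?D x) (cdf N x))"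
    proof -
      have p: "prob {\<omega>\<in>space M. R \<omega> \<le> max (cdf ?D x) (cdf N x)} = max (cdf ?D x) (cdf N x)"
        "prob {\<omega>\<in>space M. R \<omega> \<le> min (cdf ?D x) (cdf N x)} = min (cdf ?D x) (cdf N x)"
        using N.cdf_nonneg[of x] N.cdf_bounded_prob[of x] D.cdf_nonneg[of x] D.cdf_bounded_prob[of x]
        by (intro PR'; simp)+
      have "prob ({\<omega>\<in>space M. R \<omega> \<le> max (cdf ?D x) (cdf N x)} - {\<omega>\<in>space M. R \<omega> \<le> min (cdf ?D x) (cdf N x)})
        = prob {\<omega>\<in>space M. R \<omega> \<le> max (cdf ?D x) (cdf N x)} - prob {\<omega>\<in>space M. R \<omega> \<le> min (cdf ?D x) (cdf N x)}"
        by (rule finite_measure_Diff) (auto simp: le_max_iff_disj)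
      then show ?thesis by (simp only: emeasure_eq_measure p)
    qed
    also have "max (cdf ?D x) (cdf N x) - min (cdf ?D x) (cdf N x) = \<bar>H x\<bar>"
      unfolding H_def by (cases "cdf ?D x \<le> cdf N x") (simp_all add: max_def min_def)
    finally show ?thesis .
  qed
  have "(\<integral>\<^sup>+\<omega>. ennreal \<bar>S \<omega> - Z \<omega>\<bar> \<partial>M) = (\<integral>\<^sup>+\<omega>. \<integral>\<^sup>+x. ennreal \<bar>indicator {S \<omega>..} x - indicator {Z \<omega>..} x\<bar> \<partial>lborel \<partial>M)"
  proof (rule nn_integral_cong)
    fix \<omega>
    have e: "ennreal \<bar>indicator {a..} x - indicator {b..} x\<bar> = indicator {min a b..<max a b} x" for a b x :: real
      by (auto simp: indicator_def)
    have "(\<integral>\<^sup>+x. ennreal \<bar>indicator {S \<omega>..} x - indicator {Z \<omega>..} x\<bar> \<partial>lborel) = emeasure lborel {min (S \<omega>) (Z \<omega>)..<max (S \<omega>) (Z \<omega>)}"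
      unfolding e by simp
    also have "\<dots> = ennreal \<bar>S \<omega> - Z \<omega>\<bar>" by (cases "S \<omega> \<le> Z \<omega>") simp_all
    finally show "ennreal \<bar>S \<omega> - Z \<omega>\<bar> = (\<integral>\<^sup>+x. ennreal \<bar>indicator {S \<omega>..} x - indicator {Z \<omega>..} x\<bar> \<partial>lborel)" ..
  qed
  also have "\<dots> = (\<integral>\<^sup>+x. \<integral>\<^sup>+\<omega>. ennreal \<bar>indicator {S \<omega>..} x - indicator {Z \<omega>..} x\<bar> \<partial>M \<partial>lborel)"
  proof -
    interpret pair_sigma_finite lborel M ..
    have "(\<lambda>(x, \<omega>). ennreal \<bar>indicator {S \<omega>..} x - indicator {Z \<omega>..} x\<bar>) = (\<lambda>(x, \<omega>). ennreal \<bar>(if S \<omega> \<le> x then 1 else 0) - (if Z \<omega> \<le> x then 1 else 0)\<bar>)"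
      by (auto simp: indicator_def fun_eq_iff)
    also have "\<dots> \<in> borel_measurable (lborel \<Otimes>\<^sub>M M)" by measurable
    finally show ?thesis by (intro Fubini')
  qed
  also have "\<dots> = (\<integral>\<^sup>+x. ennreal \<bar>H x\<bar> \<partial>lborel)" unfolding sd ..
  also have "\<dots> \<le> ennreal C"
  proof -
    have bound: "(\<integral>\<^sup>+x. ennreal \<bar>H x\<bar> * indicator {- real n..real n} x \<partial>lborel) \<le> ennreal C" for n
    proof -
      \<comment> \<open>the cut-off at \<open>n\<close> makes the test function bounded; it is removed by monotone convergence\<close>
      define w where "w x = sgn (H x) * indicator {- real n..real n} x" for x
      define f where "f y = (\<integral>x. w x * indicator {..<y} x \<partial>lborel)" for y
      have [measurable]: "w \<in> borel_measurable borel" unfolding w_def by measurable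
      have iJ: "integrable lborel (indicator {- real n..real n} :: real \<Rightarrow> real)" by simp
      have wb: "\<bar>w x\<bar> \<le> indicator {- real n..real n} x" for x
        by (auto simp: w_def indicator_def sgn_real_def)
      have iw: "integrable lborel (\<lambda>x. w x * k x)" if "k \<in> borel_measurable borel" "\<And>x. \<bar>k x\<bar> \<le> 1" for k
      proof (rule Bochner_Integration.integrable_bound[OF iJ])
        show "AE x in lborel. norm (w x * k x) \<le> norm (indicator {- real n..real n} x :: real)"
        proof (rule AE_I2)
          fix x
          have "\<bar>w x\<bar> * \<bar>k x\<bar> \<le> indicator {- real n..real n} x * 1"
            using wb[of x] that(2)[of x] by (intro mult_mono) auto
          then show "norm (w x * k x) \<le> norm (indicator {- real n..real n} x :: real)" by (simp add: abs_mult)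
        qed
      qed (use that in measurable)
      have fi: "integrable lborel (\<lambda>x. w x * indicator {..<y} x)" for y
        by (rule iw) (auto simp: indicator_def)
      have fA: "\<bar>f y\<bar> \<le> 2 * real n" for y
      proof -
        have "\<bar>f y\<bar> \<le> (\<integral>x. \<bar>w x * indicator {..<y} x\<bar> \<partial>lborel)" unfolding f_def by (rule integral_abs_bound)
        also have "\<dots> \<le> (\<integral>x. indicator {- real n..real n} x \<partial>lborel)"
        proof (rule integral_mono[OF integrable_abs[OF fi] iJ])
          fix x show "\<bar>w x * indicator {..<y} x\<bar> \<le> indicator {- real n..real n} x"
            using wb[of x] by (cases "x < y") simp_all
        qed
        also have "\<dots> = 2 * real n" by simp
        finally show ?thesis .
      qed
      have lip0: "\<bar>f y - f x\<bar> \<le> y - x" if "x \<le> y" for x y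
      proof -
        have "f y - f x = (\<integral>z. w z * indicator {..<y} z - w z * indicator {..<x} z \<partial>lborel)"
          unfolding f_def by (rule Bochner_Integration.integral_diff[OF fi fi, symmetric])
        also have "\<dots> = (\<integral>z. w z * indicator {x..<y} z \<partial>lborel)"
          using that by (intro Bochner_Integration.integral_cong refl) (auto simp: indicator_def)
        also have "\<bar>\<dots>\<bar> \<le> (\<integral>z. \<bar>w z * indicator {x..<y} z\<bar> \<partial>lborel)" by (rule integral_abs_bound)
        also have "\<dots> \<le> (\<integral>z. indicator {x..<y} z \<partial>lborel)"
        proof (rule integral_mono)
          show "integrable lborel (\<lambda>z. \<bar>w z * indicator {x..<y} z\<bar>)"
            by (rule integrable_abs, rule iw) (auto simp: indicator_def)
          fix z show "\<bar>w z * indicator {x..<y} z\<bar> \<le> indicator {x..<y} z"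
            using order_trans[OF wb[of z], of 1] by (auto simp: indicator_def abs_mult)
          show "integrable lborel (indicator {x..<y} :: real \<Rightarrow> real)"
            by (rule integrable_real_indicator) (use that in auto)
        qed
        also have "\<dots> = y - x" using that by simp
        finally show ?thesis .
      qed
      have lip: "\<bar>f x - f y\<bar> \<le> \<bar>x - y\<bar>" for x y
        using lip0[of x y] lip0[of y x] by (cases "x \<le> y") (auto simp: abs_minus_commute)
      have [measurable]: "f \<in> borel_measurable borel"
      proof (rule borel_measurable_continuous_onI)
        show "continuous_on UNIV f"
          using lip by (rule lipschitz_continuous)
      qed
      have Ef: "(\<integral>\<omega>. f (g \<omega>) \<partial>P) = (\<integral>x. w x * (1 - measure P {\<omega>\<in>space P. g \<omega> \<le> x}) \<partial>lborel)"
        if P: "prob_space P" and [measurable]: "g \<in> borel_measurable P" for P :: "'c measure" and g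
      proof -
        interpret P: prob_space P by (rule P)
        interpret LP: pair_sigma_finite lborel P ..
        have m: "(\<lambda>(x, \<omega>). w x * (if x < g \<omega> then 1 else 0)) \<in> borel_measurable (lborel \<Otimes>\<^sub>M P)" by measurable
        have in1: "(\<integral>\<omega>. w x * (if x < g \<omega> then 1 else 0) \<partial>P) = w x * (1 - measure P {\<omega>\<in>space P. g \<omega> \<le> x})" for x
        proof -
          have "(\<integral>\<omega>. (if x < g \<omega> then 1 else 0) \<partial>P) = (\<integral>\<omega>. indicator {\<omega>\<in>space P. x < g \<omega>} \<omega> \<partial>P)"
            by (intro Bochner_Integration.integral_cong) (auto simp: indicator_def)
          also have "\<dots> = P.prob {\<omega>\<in>space P. x < g \<omega>}" by simp
          also have "\<dots> = 1 - P.prob {\<omega>\<in>space P. g \<omega> \<le> x}"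
            by (subst P.prob_compl[symmetric]) (auto intro!: arg_cong[where f = P.prob])
          finally show ?thesis by simp
        qed
        have int: "integrable (lborel \<Otimes>\<^sub>M P) (\<lambda>(x, \<omega>). w x * (if x < g \<omega> then 1 else 0))"
        proof (rule LP.Fubini_integrable[OF m])
          show "integrable lborel (\<lambda>x. \<integral>\<omega>. norm (case (x, \<omega>) of (x, \<omega>) \<Rightarrow> w x * (if x < g \<omega> then 1 else 0)) \<partial>P)"
          proof (rule Bochner_Integration.integrable_bound[OF iJ])
            show "AE x in lborel. norm (\<integral>\<omega>. norm (case (x, \<omega>) of (x, \<omega>) \<Rightarrow> w x * (if x < g \<omega> then 1 else 0)) \<partial>P) \<le> norm (indicator {- real n..real n} x :: real)"
            proof (rule AE_I2)
              fix x
              have "(\<integral>\<omega>. norm (w x * (if x < g \<omega> then 1 else 0)) \<partial>P) \<le> (\<integral>\<omega>. indicator {- real n..real n} x \<partial>P)"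
                by (rule integral_mono) (use wb[of x] in \<open>auto intro!: P.integrable_const_bound[where B = "\<bar>w x\<bar>"]\<close>)
              also have "\<dots> = indicator {- real n..real n} x" by (simp add: P.prob_space)
              finally show "norm (\<integral>\<omega>. norm (case (x, \<omega>) of (x, \<omega>) \<Rightarrow> w x * (if x < g \<omega> then 1 else 0)) \<partial>P) \<le> norm (indicator {- real n..real n} x :: real)"
                by (simp add: integral_nonneg_AE)
            qed
          qed measurable
          show "AE x in lborel. integrable P (\<lambda>\<omega>. case (x, \<omega>) of (x, \<omega>) \<Rightarrow> w x * (if x < g \<omega> then 1 else 0))"
          proof (rule AE_I2)
            fix x
            show "integrable P (\<lambda>\<omega>. case (x, \<omega>) of (x, \<omega>) \<Rightarrow> w x * (if x < g \<omega> then 1 else 0))"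
              by (rule P.integrable_const_bound[where B = "\<bar>w x\<bar>"]) auto
          qed
        qed
        have "(\<integral>\<omega>. f (g \<omega>) \<partial>P) = (\<integral>\<omega>. \<integral>x. w x * (if x < g \<omega> then 1 else 0) \<partial>lborel \<partial>P)"
          unfolding f_def by (intro Bochner_Integration.integral_cong refl) (auto simp: indicator_def)
        also have "\<dots> = (\<integral>x. \<integral>\<omega>. w x * (if x < g \<omega> then 1 else 0) \<partial>P \<partial>lborel)"
          by (rule LP.Fubini_integral[OF int])
        finally show ?thesis unfolding in1 .
      qed
      have i1: "integrable lborel (\<lambda>x. w x * (1 - cdf ?D x))"
        by (rule iw) (use D.cdf_nonneg D.cdf_bounded_prob in \<open>auto simp: abs_le_iff intro: order_trans[of _ 0]\<close>)
      have i2: "integrable lborel (\<lambda>x. w x * (1 - cdf N x))"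
        by (rule iw) (use N.cdf_nonneg N.cdf_bounded_prob in \<open>auto simp: abs_le_iff intro: order_trans[of _ 0]\<close>)
      have "{\<omega> \<in> space N. \<omega> \<le> x} = {..x}" for x using N.space_eq_univ by auto
      then have EN: "(\<integral>y. f y \<partial>N) = (\<integral>x. w x * (1 - cdf N x) \<partial>lborel)"
        using Ef[OF N.prob_space_axioms, of "\<lambda>x. x"] by (simp add: cdf_def)
      have ES: "expectation (\<lambda>\<omega>. f (S \<omega>)) = (\<integral>x. w x * (1 - cdf ?D x) \<partial>lborel)"
        using Ef[OF prob_space_axioms S] by (simp add: PS)
      have iH: "integrable lborel (\<lambda>x. \<bar>H x\<bar> * indicator {- real n..real n} x)"
        by (rule Bochner_Integration.integrable_bound[OF iJ]) (use H1 in \<open>auto simp: indicator_def\<close>)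
      have "(\<integral>x. \<bar>H x\<bar> * indicator {- real n..real n} x \<partial>lborel) = (\<integral>x. w x * (1 - cdf ?D x) - w x * (1 - cdf N x) \<partial>lborel)"
        by (intro Bochner_Integration.integral_cong refl) (auto simp: w_def H_def indicator_def sgn_real_def abs_if algebra_simps)
      also have "\<dots> = expectation (\<lambda>\<omega>. f (S \<omega>)) - (\<integral>y. f y \<partial>N)"
        using i1 i2 by (simp add: EN ES)
      also have "\<dots> \<le> C" using close[OF fA lip] by linarith
      finally have "(\<integral>x. \<bar>H x\<bar> * indicator {- real n..real n} x \<partial>lborel) \<le> C" .
      moreover have "(\<integral>\<^sup>+x. ennreal \<bar>H x\<bar> * indicator {- real n..real n} x \<partial>lborel) = ennreal (\<integral>x. \<bar>H x\<bar> * indicator {- real n..real n} x \<partial>lborel)"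
      proof -
        have "ennreal \<bar>H x\<bar> * indicator {- real n..real n} x = ennreal (\<bar>H x\<bar> * indicator {- real n..real n} x)" for x
          by (cases "x \<in> {- real n..real n}") simp_all
        then show ?thesis using nn_integral_eq_integral[OF iH] by simp
      qed
      ultimately show ?thesis by (simp add: ennreal_leI)
    qed
    have "(\<integral>\<^sup>+x. ennreal \<bar>H x\<bar> \<partial>lborel) = (\<integral>\<^sup>+x. (SUP n. ennreal \<bar>H x\<bar> * indicator {- real n..real n} x) \<partial>lborel)"
    proof (rule nn_integral_cong)
      fix x
      obtain n where n: "\<bar>x\<bar> \<le> real n" using real_arch_simple[of "\<bar>x\<bar>"] by blast
      show "ennreal \<bar>H x\<bar> = (SUP n. ennreal \<bar>H x\<bar> * indicator {- real n..real n} x)"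
      proof (rule antisym)
        have "ennreal \<bar>H x\<bar> = ennreal \<bar>H x\<bar> * indicator {- real n..real n} x"
          using n by (simp add: abs_le_iff)
        also have "\<dots> \<le> (SUP n. ennreal \<bar>H x\<bar> * indicator {- real n..real n} x)"
          by (rule SUP_upper) simp
        finally show "ennreal \<bar>H x\<bar> \<le> (SUP n. ennreal \<bar>H x\<bar> * indicator {- real n..real n} x)" .
        show "(SUP n. ennreal \<bar>H x\<bar> * indicator {- real n..real n} x) \<le> ennreal \<bar>H x\<bar>"
        proof (rule SUP_least)
          fix m show "ennreal \<bar>H x\<bar> * indicator {- real m..real m} x \<le> ennreal \<bar>H x\<bar>"
            by (cases "x \<in> {- real m..real m}") simp_all
        qed
      qed
    qed
    also have "\<dots> = (SUP n. \<integral>\<^sup>+x. ennreal \<bar>H x\<bar> * indicator {- real n..real n} x \<partial>lborel)"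
      by (rule nn_integral_monotone_convergence_SUP)
        (auto simp: incseq_def le_fun_def indicator_def intro!: mult_left_mono)
    also have "\<dots> \<le> ennreal C" by (intro SUP_least bound)
    finally show ?thesis .
  qed
  finally have "(\<integral>\<^sup>+\<omega>. ennreal \<bar>S \<omega> - h (S \<omega>)\<bar> \<partial>M) \<le> ennreal C" by (simp add: Z_def)
  moreover have "distr M borel (\<lambda>\<omega>. h (S \<omega>)) = N" using distr unfolding Z_def .
  ultimately show thesis using that h_meas by blast
qed

section \<open>Independence under rotations, splitting and limits\<close>

lemma normal_law_1: "normal_law 1 = std_normal_distribution"
  unfolding normal_law_def by (simp add: distr_id2 mult_1[abs_def])

lemma distr_normal_law_scale:
  assumes "prob_space M" and X[measurable]: "X \<in> borel_measurable M" and s: "0 \<le> s"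
    and d: "distr M borel X = normal_law 1"
  shows "distr M borel (\<lambda>\<omega>. sqrt s * X \<omega>) = normal_law s"
proof -
  have "distr M borel (\<lambda>\<omega>. sqrt s * X \<omega>) = distr (distr M borel X) borel (\<lambda>z. sqrt s * z)"
    by (subst distr_distr) (auto simp: comp_def)
  also have "\<dots> = normal_law s" unfolding d normal_law_1 by (simp add: normal_law_def)
  finally show ?thesis .
qed

lemma normal_law_density:
  assumes "0 < s"
  shows "normal_law s = density lborel (normal_density 0 (sqrt s))"
proof -
  interpret real_distribution std_normal_distribution by (rule real_dist_normal_dist)
  have "distributed std_normal_distribution lborel (\<lambda>x. x) std_normal_density"
    by (auto simp: distributed_def distr_id2)
  from normal_density_affine[OF this, of "sqrt s" 0] assms
  have "distributed std_normal_distribution lborel (\<lambda>x. sqrt s * x) (normal_density 0 (sqrt s))" by simp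
  then have "distr std_normal_distribution lborel (\<lambda>x. sqrt s * x) = density lborel (normal_density 0 (sqrt s))"
    by (simp add: distributed_def)
  moreover have "distr std_normal_distribution lborel (\<lambda>x. sqrt s * x) = normal_law s"
    unfolding normal_law_def by (rule distr_cong) auto
  ultimately show ?thesis by simp
qed

lemma nn_integral_normal_law_1:
  "f \<in> borel_measurable borel \<Longrightarrow> (\<integral>\<^sup>+x. f x \<partial>normal_law 1) = (\<integral>\<^sup>+x. ennreal (std_normal_density x) * f x \<partial>lborel)"
  unfolding normal_law_1 by (rule nn_integral_density) auto

lemma std_normal_density_rotate:
  "std_normal_density ((u + w) / sqrt 2) * std_normal_density ((u - w) / sqrt 2)
    = std_normal_density u * std_normal_density w"
proof -
  have "((u + w) / sqrt 2)\<^sup>2 + ((u - w) / sqrt 2)\<^sup>2 = u\<^sup>2 + w\<^sup>2"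
    by (simp add: power_divide power2_eq_square field_simps)
  then have "exp (- (((u + w) / sqrt 2)\<^sup>2) / 2) * exp (- (((u - w) / sqrt 2)\<^sup>2) / 2) = exp (- (u\<^sup>2) / 2) * exp (- (w\<^sup>2) / 2)"
    unfolding exp_add[symmetric] by (simp add: field_simps)
  then show ?thesis unfolding std_normal_density_def by (simp add: field_simps)
qed

text \<open>
The standard normal density on the plane depends on the radius only, and the linear map has
determinant of modulus 1.
\<close>

lemma nn_integral_normal_rotate:
  fixes f :: "real \<times> real \<Rightarrow> ennreal"
  assumes [measurable]: "f \<in> borel_measurable (borel \<Otimes>\<^sub>M borel)"
  shows "(\<integral>\<^sup>+a. \<integral>\<^sup>+b. f ((a + b) / sqrt 2, (a - b) / sqrt 2) \<partial>normal_law 1 \<partial>normal_law 1)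
    = (\<integral>\<^sup>+a. \<integral>\<^sup>+b. f (a, b) \<partial>normal_law 1 \<partial>normal_law 1)"
proof -
  define p where "p x = ennreal (std_normal_density x)" for x
  have [measurable]: "p \<in> borel_measurable borel" unfolding p_def by measurable
  have two: "(\<integral>\<^sup>+a. \<integral>\<^sup>+b. g (a, b) \<partial>normal_law 1 \<partial>normal_law 1) = (\<integral>\<^sup>+a. \<integral>\<^sup>+b. p a * p b * g (a, b) \<partial>lborel \<partial>lborel)"
    if [measurable]: "g \<in> borel_measurable (borel \<Otimes>\<^sub>M borel)" for g
  proof -
    have "(\<integral>\<^sup>+a. \<integral>\<^sup>+b. g (a, b) \<partial>normal_law 1 \<partial>normal_law 1) = (\<integral>\<^sup>+a. \<integral>\<^sup>+b. p b * g (a, b) \<partial>lborel \<partial>normal_law 1)"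
      unfolding p_def by (intro nn_integral_cong nn_integral_normal_law_1) measurable
    also have "\<dots> = (\<integral>\<^sup>+a. p a * \<integral>\<^sup>+b. p b * g (a, b) \<partial>lborel \<partial>lborel)"
      unfolding p_def by (rule nn_integral_normal_law_1) measurable
    also have "\<dots> = (\<integral>\<^sup>+a. \<integral>\<^sup>+b. p a * p b * g (a, b) \<partial>lborel \<partial>lborel)"
      by (simp add: nn_integral_cmult[symmetric] mult.assoc)
    finally show ?thesis .
  qed
  have r2: "sqrt 2 * sqrt 2 = (2::real)" "sqrt 2 \<noteq> (0::real)" by simp_all
  have "(\<integral>\<^sup>+a. \<integral>\<^sup>+b. f ((a + b) / sqrt 2, (a - b) / sqrt 2) \<partial>normal_law 1 \<partial>normal_law 1)
     = (\<integral>\<^sup>+a. \<integral>\<^sup>+b. p a * p b * f ((a + b) / sqrt 2, (a - b) / sqrt 2) \<partial>lborel \<partial>lborel)"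
    using two[of "\<lambda>(a, b). f ((a + b) / sqrt 2, (a - b) / sqrt 2)"] by simp
  also have "\<dots> = (\<integral>\<^sup>+b. \<integral>\<^sup>+a. p a * p b * f ((a + b) / sqrt 2, (a - b) / sqrt 2) \<partial>lborel \<partial>lborel)"
    by (rule lborel_pair.Fubini'[symmetric]) measurable
  also have "\<dots> = (\<integral>\<^sup>+b. ennreal (sqrt 2) * (\<integral>\<^sup>+u. p (sqrt 2 * u - b) * p b * f (u, u - sqrt 2 * b) \<partial>lborel) \<partial>lborel)"
  proof (rule nn_integral_cong)
    fix b :: real
    have e: "- b + sqrt 2 * u = sqrt 2 * u - b" "(sqrt 2 * u - b + b) / sqrt 2 = u"
      "(sqrt 2 * u - b - b) / sqrt 2 = u - sqrt 2 * b" for u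
      using r2 by (simp_all add: field_simps)
    have "(\<integral>\<^sup>+a. p a * p b * f ((a + b) / sqrt 2, (a - b) / sqrt 2) \<partial>lborel)
      = ennreal \<bar>sqrt 2\<bar> * (\<integral>\<^sup>+u. p (- b + sqrt 2 * u) * p b *
          f ((- b + sqrt 2 * u + b) / sqrt 2, (- b + sqrt 2 * u - b) / sqrt 2) \<partial>lborel)"
      by (rule nn_integral_real_affine) auto
    then show "(\<integral>\<^sup>+a. p a * p b * f ((a + b) / sqrt 2, (a - b) / sqrt 2) \<partial>lborel)
      = ennreal (sqrt 2) * (\<integral>\<^sup>+u. p (sqrt 2 * u - b) * p b * f (u, u - sqrt 2 * b) \<partial>lborel)"
      unfolding e by simp
  qed
  also have "\<dots> = (\<integral>\<^sup>+b. \<integral>\<^sup>+u. ennreal (sqrt 2) * (p (sqrt 2 * u - b) * p b * f (u, u - sqrt 2 * b)) \<partial>lborel \<partial>lborel)"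
    by (subst nn_integral_cmult) auto
  also have "\<dots> = (\<integral>\<^sup>+u. \<integral>\<^sup>+b. ennreal (sqrt 2) * (p (sqrt 2 * u - b) * p b * f (u, u - sqrt 2 * b)) \<partial>lborel \<partial>lborel)"
    by (rule lborel_pair.Fubini') measurable
  also have "\<dots> = (\<integral>\<^sup>+u. \<integral>\<^sup>+w. p u * p w * f (u, w) \<partial>lborel \<partial>lborel)"
  proof (rule nn_integral_cong)
    fix u :: real
    have e: "u / sqrt 2 + - (1 / sqrt 2) * w = (u - w) / sqrt 2" "sqrt 2 * ((u - w) / sqrt 2) = u - w"
      "sqrt 2 * u - (u - w) / sqrt 2 = (u + w) / sqrt 2" for w
      using r2 by (simp_all add: field_simps)
    have k: "ennreal (1 / sqrt 2) * (ennreal (sqrt 2) * x) = x" for x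
      by (simp add: mult.assoc[symmetric] ennreal_mult[symmetric])
    have pp: "p ((u + w) / sqrt 2) * p ((u - w) / sqrt 2) = p u * p w" for w
      unfolding p_def by (subst (1 2) ennreal_mult[symmetric]) (simp_all add: std_normal_density_rotate)
    have "(\<integral>\<^sup>+b. ennreal (sqrt 2) * (p (sqrt 2 * u - b) * p b * f (u, u - sqrt 2 * b)) \<partial>lborel)
      = ennreal \<bar>- (1 / sqrt 2)\<bar> * (\<integral>\<^sup>+w. ennreal (sqrt 2) * (p (sqrt 2 * u - (u / sqrt 2 + - (1 / sqrt 2) * w)) * p (u / sqrt 2 + - (1 / sqrt 2) * w)
          * f (u, u - sqrt 2 * (u / sqrt 2 + - (1 / sqrt 2) * w))) \<partial>lborel)"
      by (rule nn_integral_real_affine) auto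
    also have "\<dots> = ennreal (1 / sqrt 2) * (\<integral>\<^sup>+w. ennreal (sqrt 2) * (p u * p w * f (u, w)) \<partial>lborel)"
      unfolding e by (simp add: pp)
    also have "\<dots> = (\<integral>\<^sup>+w. p u * p w * f (u, w) \<partial>lborel)"
      by (subst nn_integral_cmult) (auto simp: k)
    finally show "(\<integral>\<^sup>+b. ennreal (sqrt 2) * (p (sqrt 2 * u - b) * p b * f (u, u - sqrt 2 * b)) \<partial>lborel)
      = (\<integral>\<^sup>+w. p u * p w * f (u, w) \<partial>lborel)" .
  qed
  also have "\<dots> = (\<integral>\<^sup>+a. \<integral>\<^sup>+b. f (a, b) \<partial>normal_law 1 \<partial>normal_law 1)"
    by (rule two[symmetric]) measurable
  finally show ?thesis .
qed

context prob_space
begin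

lemma normal_rotate:
  assumes ind: "indep_var borel X borel Y"
    and X: "distr M borel X = normal_law 1" and Y: "distr M borel Y = normal_law 1"
  shows "distr M borel (\<lambda>\<omega>. (X \<omega> + Y \<omega>) / sqrt 2) = normal_law 1" (is ?plus)
    "distr M borel (\<lambda>\<omega>. (X \<omega> - Y \<omega>) / sqrt 2) = normal_law 1" (is ?minus)
    "A \<in> sets borel \<Longrightarrow> B \<in> sets borel \<Longrightarrow>
      prob {\<omega>\<in>space M. (X \<omega> + Y \<omega>) / sqrt 2 \<in> A \<and> (X \<omega> - Y \<omega>) / sqrt 2 \<in> B}
      = prob {\<omega>\<in>space M. (X \<omega> + Y \<omega>) / sqrt 2 \<in> A} * prob {\<omega>\<in>space M. (X \<omega> - Y \<omega>) / sqrt 2 \<in> B}"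
proof -
  interpret N: prob_space "normal_law 1" by (rule prob_space_normal_law)
  have [measurable]: "X \<in> borel_measurable M" "Y \<in> borel_measurable M"
    using ind by (auto dest: indep_var_rv1 indep_var_rv2)
  have joint: "emeasure M {\<omega>\<in>space M. (X \<omega> + Y \<omega>) / sqrt 2 \<in> A \<and> (X \<omega> - Y \<omega>) / sqrt 2 \<in> B}
     = emeasure (normal_law 1) A * emeasure (normal_law 1) B"
    if [measurable]: "A \<in> sets borel" "B \<in> sets borel" for A B
  proof -
    define f :: "real \<times> real \<Rightarrow> ennreal" where "f z = indicator A (fst z) * indicator B (snd z)" for z
    have [measurable]: "f \<in> borel_measurable (borel \<Otimes>\<^sub>M borel)" unfolding f_def by measurable
    have "emeasure M {\<omega>\<in>space M. (X \<omega> + Y \<omega>) / sqrt 2 \<in> A \<and> (X \<omega> - Y \<omega>) / sqrt 2 \<in> B}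
       = (\<integral>\<^sup>+\<omega>. indicator {\<omega>\<in>space M. (X \<omega> + Y \<omega>) / sqrt 2 \<in> A \<and> (X \<omega> - Y \<omega>) / sqrt 2 \<in> B} \<omega> \<partial>M)"
      by (rule nn_integral_indicator[symmetric]) measurable
    also have "\<dots> = (\<integral>\<^sup>+\<omega>. (\<lambda>(a, b). f ((a + b) / sqrt 2, (a - b) / sqrt 2)) (X \<omega>, Y \<omega>) \<partial>M)"
      by (intro nn_integral_cong) (auto simp: f_def indicator_def)
    also have "\<dots> = (\<integral>\<^sup>+a. \<integral>\<^sup>+b. (\<lambda>(a, b). f ((a + b) / sqrt 2, (a - b) / sqrt 2)) (a, b) \<partial>distr M borel Y \<partial>distr M borel X)"
      by (rule indep_var_nn_integral_pair[OF ind]) measurable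
    also have "\<dots> = (\<integral>\<^sup>+a. \<integral>\<^sup>+b. f ((a + b) / sqrt 2, (a - b) / sqrt 2) \<partial>normal_law 1 \<partial>normal_law 1)"
      unfolding X Y by simp
    also have "\<dots> = (\<integral>\<^sup>+a. \<integral>\<^sup>+b. f (a, b) \<partial>normal_law 1 \<partial>normal_law 1)"
      by (rule nn_integral_normal_rotate) measurable
    also have "\<dots> = emeasure (normal_law 1) A * emeasure (normal_law 1) B"
      by (simp add: f_def nn_integral_cmult nn_integral_multc)
    finally show ?thesis .
  qed
  have one: "emeasure (normal_law 1) UNIV = 1" using N.emeasure_space_1 by simp
  show ?plus
  proof (rule measure_eqI)
    fix A assume "A \<in> sets (distr M borel (\<lambda>\<omega>. (X \<omega> + Y \<omega>) / sqrt 2))"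
    then show "emeasure (distr M borel (\<lambda>\<omega>. (X \<omega> + Y \<omega>) / sqrt 2)) A = emeasure (normal_law 1) A"
      using joint[of A UNIV] by (simp add: emeasure_distr one vimage_def Int_def conj_commute)
  qed simp
  show ?minus
  proof (rule measure_eqI)
    fix A assume "A \<in> sets (distr M borel (\<lambda>\<omega>. (X \<omega> - Y \<omega>) / sqrt 2))"
    then show "emeasure (distr M borel (\<lambda>\<omega>. (X \<omega> - Y \<omega>) / sqrt 2)) A = emeasure (normal_law 1) A"
      using joint[of UNIV A] by (simp add: emeasure_distr one vimage_def Int_def conj_commute)
  qed simp
  assume "A \<in> sets borel" "B \<in> sets borel"
  then show "prob {\<omega>\<in>space M. (X \<omega> + Y \<omega>) / sqrt 2 \<in> A \<and> (X \<omega> - Y \<omega>) / sqrt 2 \<in> B}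
      = prob {\<omega>\<in>space M. (X \<omega> + Y \<omega>) / sqrt 2 \<in> A} * prob {\<omega>\<in>space M. (X \<omega> - Y \<omega>) / sqrt 2 \<in> B}"
    using joint[of A B] joint[of A UNIV] joint[of UNIV B] by (simp add: one measure_def enn2real_mult)
qed

text \<open>
The probability of a joint event factorises first over the pairs and then within each pair; a component
that does not occur in the event is subjected to the whole line.
\<close>

lemma indep_vars_split:
  fixes P :: "'i \<Rightarrow> 'a \<Rightarrow> real \<times> real"
  assumes ind: "indep_vars (\<lambda>_. borel \<Otimes>\<^sub>M borel) P K"
    and prod: "\<And>k A B. k \<in> K \<Longrightarrow> A \<in> sets borel \<Longrightarrow> B \<in> sets borel \<Longrightarrow>
      prob {\<omega>\<in>space M. fst (P k \<omega>) \<in> A \<and> snd (P k \<omega>) \<in> B}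
      = prob {\<omega>\<in>space M. fst (P k \<omega>) \<in> A} * prob {\<omega>\<in>space M. snd (P k \<omega>) \<in> B}"
  shows "indep_vars (\<lambda>_. borel) (\<lambda>(k, b) \<omega>. if b then snd (P k \<omega>) else fst (P k \<omega>)) (K \<times> UNIV)"
  unfolding indep_vars_def2
proof (intro conjI ballI indep_setsI)
  let ?Q = "\<lambda>(k, b) \<omega>. if b then snd (P k \<omega>) else fst (P k \<omega>)"
  have Pm: "P k \<in> measurable M (borel \<Otimes>\<^sub>M borel)" if "k \<in> K" for k using ind that by (auto simp: indep_vars_def)
  have fm: "(\<lambda>\<omega>. fst (P k \<omega>)) \<in> borel_measurable M" "(\<lambda>\<omega>. snd (P k \<omega>)) \<in> borel_measurable M" if "k \<in> K" for k
    using Pm[OF that] by measurable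
  show m: "?Q i \<in> borel_measurable M" if "i \<in> K \<times> UNIV" for i
    using that fm by (cases i; cases "snd i") auto
  show "{?Q i -` A \<inter> space M |A. A \<in> sets borel} \<subseteq> events" if "i \<in> K \<times> UNIV" for i
    using m[OF that] by (auto intro: measurable_sets)
  fix A J assume J: "J \<noteq> {}" "J \<subseteq> K \<times> UNIV" "finite J" and "\<forall>j\<in>J. A j \<in> {?Q j -` A \<inter> space M |A. A \<in> sets borel}"
  then have "\<forall>j\<in>J. \<exists>B. B \<in> sets borel \<and> A j = ?Q j -` B \<inter> space M" by blast
  from bchoice[OF this] obtain B0 where B0: "\<And>j. j \<in> J \<Longrightarrow> B0 j \<in> sets borel \<and> A j = ?Q j -` B0 j \<inter> space M" by blast
  define B where "B j = (if j \<in> J then B0 j else UNIV)" for j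
  have Bs: "B j \<in> sets borel" for j using B0 by (auto simp: B_def)
  let ?L = "fst ` J"
  have L: "?L \<noteq> {}" "?L \<subseteq> K" "finite ?L" using J by auto
  have one: "prob (?Q (k, b) -` B (k, b) \<inter> space M) = (if (k, b) \<in> J then prob (A (k, b)) else 1)" for k b
    using B0[of "(k, b)"] by (auto simp: B_def prob_space)
  have "(\<Inter>j\<in>J. A j) = (\<Inter>k\<in>?L. P k -` (B (k, False) \<times> B (k, True)) \<inter> space M)" (is "?l = ?r")
  proof (intro equalityI subsetI)
    fix \<omega> assume w: "\<omega> \<in> ?l"
    then have sp: "\<omega> \<in> space M" using J B0 by blast
    show "\<omega> \<in> ?r"
    proof (rule INT_I)
      fix k assume "k \<in> ?L"
      have "?Q (k, b) \<omega> \<in> B (k, b)" for b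
        using w B0[of "(k, b)"] by (auto simp: B_def)
      from this[of False] this[of True] show "\<omega> \<in> P k -` (B (k, False) \<times> B (k, True)) \<inter> space M"
        using sp by (auto simp: mem_Times_iff)
    qed
  next
    fix \<omega> assume w: "\<omega> \<in> ?r"
    show "\<omega> \<in> ?l"
    proof (rule INT_I)
      fix j assume j: "j \<in> J"
      obtain k b where [simp]: "j = (k, b)" by (cases j)
      have "k \<in> ?L" using j by force
      then have "\<omega> \<in> P k -` (B (k, False) \<times> B (k, True)) \<inter> space M" using w by blast
      then show "\<omega> \<in> A j" using B0[OF j] j by (cases b) (auto simp: B_def mem_Times_iff split: if_splits)
    qed
  qed
  then have "prob (\<Inter>j\<in>J. A j) = prob (\<Inter>k\<in>?L. P k -` (B (k, False) \<times> B (k, True)) \<inter> space M)" by simp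
  also have "\<dots> = (\<Prod>k\<in>?L. prob (P k -` (B (k, False) \<times> B (k, True)) \<inter> space M))"
    by (rule indep_varsD[OF ind]) (use L Bs in auto)
  also have "\<dots> = (\<Prod>k\<in>?L. \<Prod>b\<in>UNIV. prob (?Q (k, b) -` B (k, b) \<inter> space M))"
  proof (intro prod.cong refl)
    fix k assume "k \<in> ?L"
    then have "k \<in> K" using L by auto
    have "P k -` (B (k, False) \<times> B (k, True)) \<inter> space M = {\<omega>\<in>space M. fst (P k \<omega>) \<in> B (k, False) \<and> snd (P k \<omega>) \<in> B (k, True)}"
      by (auto simp: mem_Times_iff)
    then have "prob (P k -` (B (k, False) \<times> B (k, True)) \<inter> space M)
      = prob {\<omega>\<in>space M. fst (P k \<omega>) \<in> B (k, False)} * prob {\<omega>\<in>space M. snd (P k \<omega>) \<in> B (k, True)}"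
      using prod[OF \<open>k \<in> K\<close> Bs Bs] by simp
    then show "prob (P k -` (B (k, False) \<times> B (k, True)) \<inter> space M) = (\<Prod>b\<in>UNIV. prob (?Q (k, b) -` B (k, b) \<inter> space M))"
      by (simp add: UNIV_bool vimage_def Int_def conj_commute mult.commute)
  qed
  also have "\<dots> = (\<Prod>j\<in>?L \<times> UNIV. if j \<in> J then prob (A j) else 1)"
    unfolding one by (subst prod.cartesian_product) (auto intro!: prod.cong)
  also have "\<dots> = (\<Prod>j\<in>J. prob (A j))"
  proof -
    have "?L \<times> UNIV \<inter> {j. j \<in> J} = J" by force
    then show ?thesis using L(3) by (subst prod.inter_filter[symmetric]) (auto simp: Int_def finite_cartesian_product)
  qed
  finally show "prob (\<Inter>j\<in>J. A j) = (\<Prod>j\<in>J. prob (A j))" .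
qed

lemma normal_law_limit:
  assumes X: "\<And>m. X m \<in> borel_measurable M" "Y \<in> borel_measurable M"
    and lim: "AE \<omega> in M. (\<lambda>m. X m \<omega>) \<longlonglongrightarrow> Y \<omega>"
    and law: "\<And>m. distr M borel (X m) = normal_law (s m)" "\<And>m. 0 \<le> s m" and s: "s \<longlonglongrightarrow> t"
  shows "distr M borel Y = normal_law t"
proof (rule normal_lawI)
  show t: "0 \<le> t" using s law(2) by (intro LIMSEQ_le_const) auto
  fix r
  have ch: "char (distr M borel Z) r = expectation (\<lambda>\<omega>. iexp (r * Z \<omega>))" if "Z \<in> borel_measurable M" for Z
    using that by (simp add: char_def integral_distr)
  have "(\<lambda>m. expectation (\<lambda>\<omega>. iexp (r * X m \<omega>))) \<longlonglongrightarrow> expectation (\<lambda>\<omega>. iexp (r * Y \<omega>))"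
  proof (rule integral_dominated_convergence[where w = "\<lambda>_. 1"])
    show "AE \<omega> in M. (\<lambda>m. iexp (r * X m \<omega>)) \<longlonglongrightarrow> iexp (r * Y \<omega>)"
      using lim by eventually_elim (auto intro!: tendsto_intros)
  qed (use X in auto)
  moreover have "expectation (\<lambda>\<omega>. iexp (r * X m \<omega>)) = complex_of_real (exp (- (s m * r\<^sup>2) / 2))" for m
    using ch[OF X(1), of m] by (simp add: law char_normal_law)
  moreover have "(\<lambda>m. complex_of_real (exp (- (s m * r\<^sup>2) / 2))) \<longlonglongrightarrow> complex_of_real (exp (- (t * r\<^sup>2) / 2))"
    by (intro tendsto_intros s) simp
  ultimately show "char (distr M borel Y) r = complex_of_real (exp (- (t * r\<^sup>2) / 2))"
    unfolding ch[OF X(2)] using LIMSEQ_unique by auto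
qed (rule X)

text \<open>
For bounded continuous functions of the variables the product rule for expectations passes to the
limit by dominated convergence. The half-lines, whose indicators are limits of such functions,
generate the Borel sets and are closed under intersection.
\<close>

lemma indep_vars_limit:
  fixes X :: "nat \<Rightarrow> 'i \<Rightarrow> 'a \<Rightarrow> real"
  assumes fin: "finite I" and ind: "\<And>m. indep_vars (\<lambda>_. borel) (X m) I"
    and Y: "\<And>i. i \<in> I \<Longrightarrow> Y i \<in> borel_measurable M"
    and lim: "\<And>i. i \<in> I \<Longrightarrow> AE \<omega> in M. (\<lambda>m. X m i \<omega>) \<longlonglongrightarrow> Y i \<omega>"
  shows "indep_vars (\<lambda>_. borel) Y I"
proof (cases "I = {}")
  case True
  then show ?thesis by (simp add: indep_vars_def indep_sets_def)
next
  case False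
  define E :: "real set set" where "E = insert UNIV (range greaterThan)"
  have gen: "sets borel = sigma_sets (space borel) E"
  proof -
    have "sets borel = sigma_sets UNIV (range (greaterThan :: real \<Rightarrow> _))" by (simp add: borel_Ioi)
    also have "\<dots> = sigma_sets UNIV E"
      unfolding E_def by (rule sigma_sets_eqI) (auto intro: sigma_sets_top)
    finally show ?thesis by simp
  qed
  have stable: "Int_stable E"
  proof -
    have "{a<..} \<inter> {b<..} = {max a b<..}" for a b :: real by auto
    then show ?thesis unfolding Int_stable_def E_def by auto
  qed
  \<comment> \<open>continuous functions increasing to the indicator of \<open>A\<close>, which is the whole line or a half-line \<open>{a<..}\<close>\<close>
  define f where "f k A x = (if A = UNIV then 1 else min 1 (max 0 (real k * (x - (THE a. A = {a<..})))))"
    for k :: nat and A :: "real set" and x :: real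
  have the: "(THE a. {b<..} = {a<..}) = b" for b :: real
    by (rule the_equality) (auto simp: greaterThan_subset_iff set_eq_subset)
  have ne: "{b<..} \<noteq> UNIV" for b :: real by (auto simp: set_eq_iff)
  have f_cont: "continuous_on UNIV (f k A)" for k A
    unfolding f_def by (cases "A = UNIV") (auto intro!: continuous_intros)
  have f_meas [measurable]: "f k A \<in> borel_measurable borel" for k A
    by (rule borel_measurable_continuous_onI[OF f_cont])
  have f_bound: "0 \<le> f k A x" "f k A x \<le> 1" for k A x by (auto simp: f_def)
  have f_lim: "(\<lambda>k. f k A x) \<longlonglongrightarrow> indicator A x" if "A \<in> E" for A x
  proof (cases "A = UNIV")
    case True
    then show ?thesis by (simp add: f_def)
  next
    case False
    then obtain a where a: "A = {a<..}" using \<open>A \<in> E\<close> unfolding E_def by blast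
    show ?thesis
    proof (cases "x > a")
      case True
      obtain K where K: "1 < real K * (x - a)" using reals_Archimedean3[of "x - a"] True by fastforce
      have "f k A x = 1" if "k \<ge> K" for k
      proof -
        have "real K * (x - a) \<le> real k * (x - a)" using that True by (intro mult_right_mono) auto
        then show ?thesis using K by (simp add: f_def a ne the)
      qed
      then have "\<forall>\<^sub>F k in sequentially. f k A x = 1" by (auto simp: eventually_sequentially)
      then show ?thesis using True by (simp add: a tendsto_eventually)
    next
      case le: False
      have "real k * (x - a) \<le> 0" for k using le by (intro mult_nonneg_nonpos) auto
      then have "f k A x = 0" for k by (simp add: f_def a ne the max_absorb1)
      then show ?thesis using le by (simp add: a)
    qed
  qed
  have prodE: "expectation (\<lambda>\<omega>. \<Prod>i\<in>I. f k (A i) (Y i \<omega>)) = (\<Prod>i\<in>I. expectation (\<lambda>\<omega>. f k (A i) (Y i \<omega>)))" for k A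
  proof -
    have Xm [measurable]: "X m i \<in> borel_measurable M" if "i \<in> I" for m i
      using ind[of m] that by (auto simp: indep_vars_def)
    have lim': "AE \<omega> in M. \<forall>i\<in>I. (\<lambda>m. f k (A i) (X m i \<omega>)) \<longlonglongrightarrow> f k (A i) (Y i \<omega>)"
    proof (rule AE_finite_allI[OF fin])
      fix i assume "i \<in> I"
      show "AE \<omega> in M. (\<lambda>m. f k (A i) (X m i \<omega>)) \<longlonglongrightarrow> f k (A i) (Y i \<omega>)"
        using lim[OF \<open>i \<in> I\<close>]
      proof eventually_elim
        case (elim \<omega>)
        have "isCont (f k (A i)) (Y i \<omega>)" using f_cont by (simp add: continuous_on_eq_continuous_at)
        from isCont_tendsto_compose[OF this elim] show ?case .
      qed
    qed
    have a: "(\<lambda>m. expectation (\<lambda>\<omega>. \<Prod>i\<in>I. f k (A i) (X m i \<omega>))) \<longlonglongrightarrow> expectation (\<lambda>\<omega>. \<Prod>i\<in>I. f k (A i) (Y i \<omega>))"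
    proof (rule integral_dominated_convergence[where w = "\<lambda>_. 1"])
      show "AE \<omega> in M. (\<lambda>m. \<Prod>i\<in>I. f k (A i) (X m i \<omega>)) \<longlonglongrightarrow> (\<Prod>i\<in>I. f k (A i) (Y i \<omega>))"
        using lim' by eventually_elim (auto intro!: tendsto_prod)
      show "AE \<omega> in M. norm (\<Prod>i\<in>I. f k (A i) (X m i \<omega>)) \<le> 1" for m
        using f_bound by (intro AE_I2) (auto intro!: prod_le_1 simp: abs_prod)
    qed (use Y Xm in \<open>auto intro!: borel_measurable_prod\<close>)
    have b: "(\<lambda>m. \<Prod>i\<in>I. expectation (\<lambda>\<omega>. f k (A i) (X m i \<omega>))) \<longlonglongrightarrow> (\<Prod>i\<in>I. expectation (\<lambda>\<omega>. f k (A i) (Y i \<omega>)))"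
    proof (rule tendsto_prod)
      fix i assume i: "i \<in> I"
      show "(\<lambda>m. expectation (\<lambda>\<omega>. f k (A i) (X m i \<omega>))) \<longlonglongrightarrow> expectation (\<lambda>\<omega>. f k (A i) (Y i \<omega>))"
      proof (rule integral_dominated_convergence[where w = "\<lambda>_. 1"])
        show "AE \<omega> in M. (\<lambda>m. f k (A i) (X m i \<omega>)) \<longlonglongrightarrow> f k (A i) (Y i \<omega>)"
          using lim' by eventually_elim (use i in auto)
        show "AE \<omega> in M. norm (f k (A i) (X m i \<omega>)) \<le> 1" for m
          using f_bound by (intro AE_I2) auto
      qed (use i Y Xm in auto)
    qed
    have c: "expectation (\<lambda>\<omega>. \<Prod>i\<in>I. f k (A i) (X m i \<omega>)) = (\<Prod>i\<in>I. expectation (\<lambda>\<omega>. f k (A i) (X m i \<omega>)))" for m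
    proof (rule indep_vars_lebesgue_integral[OF fin])
      show "indep_vars (\<lambda>_. borel) (\<lambda>i \<omega>. f k (A i) (X m i \<omega>)) I"
        by (rule indep_vars_compose2[OF ind]) simp
      show "integrable M (\<lambda>\<omega>. f k (A i) (X m i \<omega>))" if "i \<in> I" for i
        by (rule integrable_const_bound[where B = 1]) (use f_bound Xm[OF that] in auto)
    qed
    show ?thesis by (rule LIMSEQ_unique[OF a[unfolded c] b])
  qed
  have iff: "indep_vars (\<lambda>_. borel) Y I \<longleftrightarrow>
      (\<forall>A\<in>I \<rightarrow> E. prob (\<Inter>j\<in>I. Y j -` A j \<inter> space M) = (\<Prod>j\<in>I. prob (Y j -` A j \<inter> space M)))"
  proof (rule indep_vars_finite[where E = "\<lambda>_. E" and I = I and M' = "\<lambda>_. borel" and X = Y, OF False fin])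
    show "space borel \<in> E" "E \<subseteq> Pow (space borel)" by (simp_all add: E_def)
    show "Int_stable E" by (rule stable)
    show "sets borel = sigma_sets (space borel) E" by (rule gen)
    show "random_variable borel (Y i)" if "i \<in> I" for i using that by (rule Y)
  qed
  show ?thesis
  proof (rule iff[THEN iffD2])
    show "\<forall>A\<in>I \<rightarrow> E. prob (\<Inter>j\<in>I. Y j -` A j \<inter> space M) = (\<Prod>j\<in>I. prob (Y j -` A j \<inter> space M))"
    proof
      fix A assume A: "A \<in> I \<rightarrow> E"
      have As: "A i \<in> sets borel" if "i \<in> I" for i
        using Pi_mem[OF A that] unfolding E_def by (elim insertE rangeE) simp_all
      have "(\<lambda>k. expectation (\<lambda>\<omega>. \<Prod>i\<in>I. f k (A i) (Y i \<omega>))) \<longlonglongrightarrow> expectation (\<lambda>\<omega>. \<Prod>i\<in>I. indicator (A i) (Y i \<omega>))"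
      proof (rule integral_dominated_convergence[where w = "\<lambda>_. 1"])
        show "AE \<omega> in M. (\<lambda>k. \<Prod>i\<in>I. f k (A i) (Y i \<omega>)) \<longlonglongrightarrow> (\<Prod>i\<in>I. indicator (A i) (Y i \<omega>))"
          using A by (intro AE_I2 tendsto_prod f_lim) auto
        show "AE \<omega> in M. norm (\<Prod>i\<in>I. f k (A i) (Y i \<omega>)) \<le> 1" for k
          using f_bound by (intro AE_I2) (auto intro!: prod_le_1 simp: abs_prod)
      qed (use Y As in \<open>auto intro!: borel_measurable_prod\<close>)
      moreover have "(\<lambda>k. \<Prod>i\<in>I. expectation (\<lambda>\<omega>. f k (A i) (Y i \<omega>))) \<longlonglongrightarrow> (\<Prod>i\<in>I. expectation (\<lambda>\<omega>. indicator (A i) (Y i \<omega>)))"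
      proof (rule tendsto_prod)
        fix i assume i: "i \<in> I"
        show "(\<lambda>k. expectation (\<lambda>\<omega>. f k (A i) (Y i \<omega>))) \<longlonglongrightarrow> expectation (\<lambda>\<omega>. indicator (A i) (Y i \<omega>))"
        proof (rule integral_dominated_convergence[where w = "\<lambda>_. 1"])
          show "AE \<omega> in M. (\<lambda>k. f k (A i) (Y i \<omega>)) \<longlonglongrightarrow> indicator (A i) (Y i \<omega>)"
            using A i by (intro AE_I2 f_lim) auto
          show "AE \<omega> in M. norm (f k (A i) (Y i \<omega>)) \<le> 1" for k
            using f_bound by (intro AE_I2) auto
        qed (use i Y As in auto)
      qed
      ultimately have eq: "expectation (\<lambda>\<omega>. \<Prod>i\<in>I. indicator (A i) (Y i \<omega>) :: real) = (\<Prod>i\<in>I. expectation (\<lambda>\<omega>. indicator (A i) (Y i \<omega>)))"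
        unfolding prodE by (rule LIMSEQ_unique)
      have "expectation (\<lambda>\<omega>. \<Prod>i\<in>I. indicator (A i) (Y i \<omega>) :: real) = expectation (indicator (\<Inter>j\<in>I. Y j -` A j \<inter> space M))"
      proof (intro Bochner_Integration.integral_cong refl)
        fix \<omega> assume w: "\<omega> \<in> space M"
        show "(\<Prod>i\<in>I. indicator (A i) (Y i \<omega>)) = (indicator (\<Inter>j\<in>I. Y j -` A j \<inter> space M) \<omega> :: real)"
        proof (cases "\<forall>i\<in>I. Y i \<omega> \<in> A i")
          case True
          then show ?thesis using w False by (simp add: indicator_def)
        next
          case nall: False
          then obtain i where i: "i \<in> I" "Y i \<omega> \<notin> A i" by blast
          then have "(\<Prod>i\<in>I. indicator (A i) (Y i \<omega>)) = (0::real)" using fin by (intro prod_zero) (auto intro!: bexI[of _ i])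
          then show ?thesis using i by (auto simp: indicator_def)
        qed
      qed
      also have "\<dots> = prob (\<Inter>j\<in>I. Y j -` A j \<inter> space M)"
      proof -
        have ev: "(\<Inter>j\<in>I. Y j -` A j \<inter> space M) \<in> events"
          using fin False Y As by (intro sets.finite_INT measurable_sets) auto
        show ?thesis unfolding Bochner_Integration.integral_indicator sets.Int_space_eq2[OF ev] ..
      qed
      finally have l: "expectation (\<lambda>\<omega>. \<Prod>i\<in>I. indicator (A i) (Y i \<omega>) :: real) = prob (\<Inter>j\<in>I. Y j -` A j \<inter> space M)" .
      have r: "expectation (\<lambda>\<omega>. indicator (A i) (Y i \<omega>)) = prob (Y i -` A i \<inter> space M)" if "i \<in> I" for i
      proof -
        have "expectation (\<lambda>\<omega>. indicator (A i) (Y i \<omega>)) = expectation (indicator (Y i -` A i \<inter> space M))"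
          by (intro Bochner_Integration.integral_cong refl) (auto simp: indicator_def)
        also have "\<dots> = prob (Y i -` A i \<inter> space M)"
          using measurable_sets[OF Y[OF that] As[OF that]] by simp
        finally show ?thesis .
      qed
      show "prob (\<Inter>j\<in>I. Y j -` A j \<inter> space M) = (\<Prod>j\<in>I. prob (Y j -` A j \<inter> space M))"
        unfolding l[symmetric] eq by (rule prod.cong[OF refl r])
    qed
  qed
qed

end

section \<open>Levy's construction of the Wiener process\<close>

text \<open>
With \<open>c j\<close> the part of the \<open>j\<close>-th interval that lies to the left of a point, this is the value at that
point of the piecewise linear function with slopes \<open>a j\<close>.
\<close>

lemma sum_ramp:
  fixes a :: "nat \<Rightarrow> real"
  assumes "k < A" and "\<And>j. j < k \<Longrightarrow> c j = 1" and "\<And>j. k < j \<Longrightarrow> c j = 0"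
  shows "(\<Sum>j<A. a j * c j) = (\<Sum>j<k. a j) + a k * c k"
proof -
  have "(\<Sum>j<A. a j * c j) = (\<Sum>j<Suc k. a j * c j)"
    by (rule sum.mono_neutral_right) (use assms in auto)
  then show ?thesis using assms(2) by simp
qed

definition tent :: "real \<Rightarrow> real" where "tent s = max 0 (1 - \<bar>2 * s - 1\<bar>)"

lemma tent_bounds: "0 \<le> tent s" "tent s \<le> 1"
  by (auto simp: tent_def)

lemma tent_eq_0: "s \<le> 0 \<or> 1 \<le> s \<Longrightarrow> tent s = 0"
  by (auto simp: tent_def)

lemma continuous_on_half_line:
  fixes f :: "real \<Rightarrow> real" and b :: "nat \<Rightarrow> real"
  assumes c: "\<And>A. continuous_on {0..<b A} f" and b: "\<And>t. \<exists>A. t < b A"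
  shows "continuous_on {0..} f"
  unfolding continuous_on_eq_continuous_within
proof
  fix x :: real assume x: "x \<in> {0..}"
  obtain A where A: "x < b A" using b by blast
  have "at x within {0..} = at x within {0..<b A}"
    by (rule at_within_nhd[of x "{..<b A}"]) (use A in auto)
  then show "continuous (at x within {0..}) f"
    using c[of A] x A by (simp add: continuous_on_eq_continuous_within)
qed

lemma floor_grid:
  assumes "0 \<le> s" "s < 1"
  shows "nat \<lfloor>real i + s\<rfloor> = i" "frac (real i + s) = s"
proof -
  have "\<lfloor>real i + s\<rfloor> = int i" using assms by (simp add: floor_eq_iff)
  then show "nat \<lfloor>real i + s\<rfloor> = i" "frac (real i + s) = s" by (simp_all add: frac_def)
qed

text \<open>
The half-line is divided into consecutive intervals of lengths \<open>l 0, l 1, \<dots>\<close>. The process is to have the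
prescribed increment \<open>sqrt (l i) * N 0 i\<close> over the \<open>i\<close>-th interval; the variables \<open>N (Suc n) i\<close>
displace the midpoints at the \<open>n\<close>-th level of dyadic subdivision. The construction runs in the rescaled
time \<open>clock\<close>, in which every interval has length 1.
\<close>

locale levy = prob_space M for M :: "'a measure" +
  fixes N :: "nat \<Rightarrow> nat \<Rightarrow> 'a \<Rightarrow> real" and l :: "nat \<Rightarrow> real"
  assumes indep_N: "indep_vars (\<lambda>_. borel) (\<lambda>(n, i). N n i) UNIV"
    and law_N: "\<And>n i. distr M borel (N n i) = normal_law 1"
    and l_pos: "\<And>j. 0 < l j"
    and T_top: "filterlim (\<lambda>j. \<Sum>i<j. l i) at_top sequentially"
begin

lemma N_measurable [measurable]: "N n i \<in> borel_measurable M"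
  using indep_vars_measurable[OF indep_N, of "(n, i)"] by simp

text \<open>
The standardised increments at the \<open>n\<close>-th level: an increment is split into two halves by an
orthogonal rotation with a fresh normal variable.
\<close>

fun J :: "nat \<Rightarrow> nat \<Rightarrow> 'a \<Rightarrow> real" where
  "J 0 i \<omega> = N 0 i \<omega>"
| "J (Suc n) i \<omega> = (if even i then J n (i div 2) \<omega> + N (Suc n) (i div 2) \<omega>
     else J n (i div 2) \<omega> - N (Suc n) (i div 2) \<omega>) / sqrt 2"

text \<open>
The increments of level \<open>n\<close> together with the variables not used so far. Rotating pairs of members of
this family yields the family of level \<open>n + 1\<close>, so its independence can be proved by induction.
\<close>

definition mixed :: "nat \<Rightarrow> nat \<times> nat \<Rightarrow> 'a \<Rightarrow> real" where
  "mixed n k \<omega> = (if fst k = n then J n (snd k) \<omega> else N (fst k) (snd k) \<omega>)"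

lemma mixed_step:
  assumes ind: "indep_vars (\<lambda>_. borel) (mixed n) ({n..} \<times> UNIV)" and law: "\<And>i. distr M borel (J n i) = normal_law 1"
  shows "indep_vars (\<lambda>_. borel) (mixed (Suc n)) ({Suc n..} \<times> UNIV)" "distr M borel (J (Suc n) i) = normal_law 1"
proof -
  have ip: "indep_var borel (J n i) borel (N (Suc n) i)" for i
  proof -
    have "indep_var borel (\<lambda>\<omega>. (\<lambda>f. f (n, i)) (\<lambda>j\<in>{(n, i)}. mixed n j \<omega>)) borel (\<lambda>\<omega>. (\<lambda>f. f (Suc n, i)) (\<lambda>j\<in>{(Suc n, i)}. mixed n j \<omega>))"
      by (rule indep_var_blocks[OF ind]) auto
    then show ?thesis by (simp add: mixed_def)
  qed
  note rot = normal_rotate[OF ip law law_N]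
  show "distr M borel (J (Suc n) i) = normal_law 1"
    using rot(1,2)[of "i div 2"] by (cases "even i") (simp_all add: fun_eq_iff[symmetric] cong: distr_cong)
  let ?K = "{Suc n..} \<times> (UNIV :: nat set)"
  \<comment> \<open>an unused variable is treated as a pair with second component 0, so that one splitting covers both cases\<close>
  define G where "G k = (if fst k = Suc n then {(n, snd k), (Suc n, snd k)} else {k})" for k :: "nat \<times> nat"
  define g where "g k f = (if fst k = Suc n then ((f (n, snd k) + f (Suc n, snd k)) / sqrt 2, (f (n, snd k) - f (Suc n, snd k)) / sqrt 2)
     else (f k, 0))" for k :: "nat \<times> nat" and f :: "nat \<times> nat \<Rightarrow> real"
  define P where "P k \<omega> = g k (\<lambda>j\<in>G k. mixed n j \<omega>)" for k \<omega>
  have P1: "P (Suc n, i) \<omega> = ((J n i \<omega> + N (Suc n) i \<omega>) / sqrt 2, (J n i \<omega> - N (Suc n) i \<omega>) / sqrt 2)" for i \<omega>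
    by (simp add: P_def g_def G_def mixed_def)
  have P2: "P k \<omega> = (N (fst k) (snd k) \<omega>, 0)" if "Suc n < fst k" for k \<omega>
    using that by (simp add: P_def g_def G_def mixed_def)
  have "indep_vars (\<lambda>_. borel \<Otimes>\<^sub>M borel) P ?K"
    unfolding P_def
  proof (rule indep_vars_blocks[OF ind])
    show "disjoint_family_on G ?K"
      unfolding disjoint_family_on_def G_def by (auto split: if_splits)
    show "G k \<subseteq> {n..} \<times> UNIV" if "k \<in> ?K" for k using that by (auto simp: G_def mem_Times_iff split: if_splits)
    show "g k \<in> (Pi\<^sub>M (G k) (\<lambda>_. borel)) \<rightarrow>\<^sub>M borel \<Otimes>\<^sub>M borel" if "k \<in> ?K" for k
    proof (cases "fst k = Suc n")
      case True
      then have "(n, snd k) \<in> G k" "(Suc n, snd k) \<in> G k" by (auto simp: G_def)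
      then have [measurable]: "(\<lambda>f. f (n, snd k)) \<in> borel_measurable (Pi\<^sub>M (G k) (\<lambda>_. borel :: real measure))"
        "(\<lambda>f. f (Suc n, snd k)) \<in> borel_measurable (Pi\<^sub>M (G k) (\<lambda>_. borel :: real measure))" by simp_all
      show ?thesis unfolding g_def[abs_def] using True by simp
    next
      case False
      then have "k \<in> G k" by (auto simp: G_def)
      then have [measurable]: "(\<lambda>f. f k) \<in> borel_measurable (Pi\<^sub>M (G k) (\<lambda>_. borel :: real measure))" by simp
      show ?thesis unfolding g_def[abs_def] using False by simp
    qed
  qed
  then have "indep_vars (\<lambda>_. borel) (\<lambda>(k, b) \<omega>. if b then snd (P k \<omega>) else fst (P k \<omega>)) (?K \<times> UNIV)"
  proof (rule indep_vars_split)
    fix k :: "nat \<times> nat" and A B :: "real set"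
    assume k: "k \<in> ?K" and A: "A \<in> sets borel" and B: "B \<in> sets borel"
    show "prob {\<omega>\<in>space M. fst (P k \<omega>) \<in> A \<and> snd (P k \<omega>) \<in> B}
      = prob {\<omega>\<in>space M. fst (P k \<omega>) \<in> A} * prob {\<omega>\<in>space M. snd (P k \<omega>) \<in> B}"
    proof (cases "fst k = Suc n")
      case True
      then obtain i where [simp]: "k = (Suc n, i)" by (cases k) auto
      show ?thesis using rot(3)[OF A B, of i] by (simp add: P1)
    next
      case False
      then have "Suc n < fst k" using k by auto
      from P2[OF this] show ?thesis by (cases "0 \<in> B") (simp_all add: prob_space)
    qed
  qed
  note split = this
  define h where "h k = (if fst k = Suc n then ((Suc n, snd k div 2), odd (snd k)) else (k, False))" for k :: "nat \<times> nat"
  have inj: "inj_on h ?K"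
  proof (rule inj_onI)
    fix x y assume "x \<in> ?K" "y \<in> ?K" and e: "h x = h y"
    show "x = y"
    proof (cases "fst x = Suc n")
      case True
      then have "fst y = Suc n" using e by (auto simp: h_def split: if_splits)
      then have "snd x div 2 = snd y div 2" "odd (snd x) = odd (snd y)" using e True by (auto simp: h_def)
      then have "snd x = snd y" by (metis even_two_times_div_two odd_two_times_div_two_succ)
      then show ?thesis using True \<open>fst y = Suc n\<close> by (simp add: prod_eq_iff)
    next
      case False
      then show ?thesis using e by (auto simp: h_def split: if_splits)
    qed
  qed
  have "h ` ?K \<subseteq> ?K \<times> UNIV" by (auto simp: h_def)
  from indep_vars_subset[OF split this]
  have "indep_vars (\<lambda>_. borel) (\<lambda>k. (\<lambda>(k, b) \<omega>. if b then snd (P k \<omega>) else fst (P k \<omega>)) (h k)) ?K"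
    by (rule indep_vars_reindex[OF _ inj])
  then show "indep_vars (\<lambda>_. borel) (mixed (Suc n)) ?K"
  proof (rule indep_vars_cong[THEN iffD1, rotated -1])
    fix k :: "nat \<times> nat" assume "k \<in> ?K"
    show "(\<lambda>(k, b) \<omega>. if b then snd (P k \<omega>) else fst (P k \<omega>)) (h k) = mixed (Suc n) k"
    proof (cases "fst k = Suc n")
      case True
      then show ?thesis by (auto simp: h_def mixed_def P1 fun_eq_iff)
    next
      case False
      then have "Suc n < fst k" using \<open>k \<in> ?K\<close> by auto
      then show ?thesis using P2 by (auto simp: h_def mixed_def fun_eq_iff)
    qed
  qed auto
qed

lemma mixed_indep: "indep_vars (\<lambda>_. borel) (mixed n) ({n..} \<times> UNIV)" and J_law: "distr M borel (J n i) = normal_law 1"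
proof -
  have "indep_vars (\<lambda>_. borel) (mixed n) ({n..} \<times> UNIV) \<and> (\<forall>i. distr M borel (J n i) = normal_law 1)"
  proof (induction n)
    case 0
    have J0: "J 0 i = N 0 i" for i by (simp add: fun_eq_iff)
    have "mixed 0 = (\<lambda>(n, i). N n i)" by (auto simp: mixed_def fun_eq_iff)
    then show ?case using indep_N law_N by (simp add: J0)
  next
    case (Suc n)
    then show ?case using mixed_step[of n] by blast
  qed
  then show "indep_vars (\<lambda>_. borel) (mixed n) ({n..} \<times> UNIV)" "distr M borel (J n i) = normal_law 1" by auto
qed

lemma J_indep: "indep_vars (\<lambda>_. borel) (J n) UNIV"
proof -
  have "indep_vars (\<lambda>_. borel) (\<lambda>i. mixed n (n, i)) UNIV"
    by (rule indep_vars_reindex[OF indep_vars_subset[OF mixed_indep[of n]]]) (auto simp: inj_on_def)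
  moreover have "(\<lambda>i. mixed n (n, i)) = J n" by (simp add: mixed_def fun_eq_iff)
  ultimately show ?thesis by simp
qed

lemma J_measurable [measurable]: "J n i \<in> borel_measurable M"
  by (rule indep_vars_measurable[OF J_indep]) simp

text \<open>
The standard deviation of the \<open>k\<close>-th increment at level \<open>n\<close>; it belongs to the interval \<open>k div 2 ^ n\<close>.
\<close>

definition sg :: "nat \<Rightarrow> nat \<Rightarrow> real" where "sg n k = sqrt (l (k div 2 ^ n) / 2 ^ n)"

lemma sg_Suc: "sg (Suc n) (2 * k) = sg n k / sqrt 2" "sg (Suc n) (Suc (2 * k)) = sg n k / sqrt 2"
proof -
  have d: "2 * k div 2 ^ Suc n = k div 2 ^ n" "Suc (2 * k) div 2 ^ Suc n = k div 2 ^ n"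
    by (simp_all add: div_mult2_eq)
  show "sg (Suc n) (2 * k) = sg n k / sqrt 2" "sg (Suc n) (Suc (2 * k)) = sg n k / sqrt 2"
    unfolding sg_def d by (simp_all add: real_sqrt_divide real_sqrt_mult)
qed

definition W :: "nat \<Rightarrow> nat \<Rightarrow> 'a \<Rightarrow> real" where "W n i \<omega> = (\<Sum>k<i. sg n k * J n k \<omega>)"

lemma half: "a / sqrt 2 * (b / sqrt 2) = a * b / (2::real)"
  by simp

lemma W_double: "W (Suc n) (2 * i) \<omega> = W n i \<omega>"
proof (induction i)
  case (Suc i)
  have "W (Suc n) (2 * Suc i) \<omega> = W (Suc n) (2 * i) \<omega> + sg (Suc n) (2 * i) * J (Suc n) (2 * i) \<omega>
      + sg (Suc n) (Suc (2 * i)) * J (Suc n) (Suc (2 * i)) \<omega>"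
    by (simp add: W_def del: J.simps)
  also have "\<dots> = W n i \<omega> + sg n i * J n i \<omega>"
    unfolding Suc sg_Suc J.simps half by (simp add: algebra_simps add_divide_distrib[symmetric])
  finally show ?case by (simp add: W_def)
qed (simp add: W_def)

text \<open>
The linear interpolation of the prescribed increments, in rescaled time.
\<close>

definition base :: "real \<Rightarrow> 'a \<Rightarrow> real" where
  "base y \<omega> = W 0 (nat \<lfloor>y\<rfloor>) \<omega> + (sg 0 (nat \<lfloor>y\<rfloor>) * N 0 (nat \<lfloor>y\<rfloor>) \<omega>) * frac y"

text \<open>
The correction from level \<open>n\<close> to level \<open>n + 1\<close>: a tent over each dyadic interval, since only the
midpoint moves.
\<close>

definition bump :: "nat \<Rightarrow> real \<Rightarrow> 'a \<Rightarrow> real" where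
  "bump n y \<omega> = sg n (nat \<lfloor>2 ^ n * y\<rfloor>) / 2 * N (Suc n) (nat \<lfloor>2 ^ n * y\<rfloor>) \<omega> * tent (frac (2 ^ n * y))"

text \<open>
Finitely many corrections give the piecewise linear path through the points of the \<open>n\<close>-th level.
\<close>

lemma path_grid:
  assumes "0 \<le> s" "s < 1"
  shows "base ((real i + s) / 2 ^ n) \<omega> + (\<Sum>m<n. bump m ((real i + s) / 2 ^ n) \<omega>) = W n i \<omega> + s * (sg n i * J n i \<omega>)"
  using assms
proof (induction n arbitrary: i s)
  case 0
  then show ?case unfolding base_def power_0 div_by_1 floor_grid[OF 0] by simp
next
  case (Suc n)
  define j where "j = i div 2"
  define s' where "s' = (real (i mod 2) + s) / 2"
  have i: "i = 2 * j + i mod 2" by (simp add: j_def)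
  have s': "0 \<le> s'" "s' < 1" using Suc.prems by (auto simp: s'_def)
  have ri: "real i = 2 * real j + real (i mod 2)" by (subst i) simp
  have y: "(real i + s) / 2 ^ Suc n = (real j + s') / 2 ^ n"
    unfolding ri s'_def by (simp add: field_simps)
  have t: "bump n ((real j + s') / 2 ^ n) \<omega> = sg n j / 2 * N (Suc n) j \<omega> * tent s'"
  proof -
    have "2 ^ n * ((real j + s') / 2 ^ n) = real j + s'" by simp
    then show ?thesis by (simp only: bump_def floor_grid[OF s'])
  qed
  have IH: "base ((real j + s') / 2 ^ n) \<omega> + (\<Sum>m<n. bump m ((real j + s') / 2 ^ n) \<omega>) = W n j \<omega> + s' * (sg n j * J n j \<omega>)"
    by (rule Suc.IH[OF s'])
  have "base ((real i + s) / 2 ^ Suc n) \<omega> + (\<Sum>m<Suc n. bump m ((real i + s) / 2 ^ Suc n) \<omega>)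
     = W n j \<omega> + s' * (sg n j * J n j \<omega>) + sg n j / 2 * N (Suc n) j \<omega> * tent s'"
    unfolding y sum.lessThan_Suc t using IH by simp
  also have "\<dots> = W (Suc n) i \<omega> + s * (sg (Suc n) i * J (Suc n) i \<omega>)"
  proof (cases "even i")
    case True
    then have ie: "i = 2 * j" and se: "s' = s / 2" using i by (auto simp: s'_def)
    have "tent s' = s" using Suc.prems by (simp add: se tent_def)
    then show ?thesis
      unfolding ie W_double sg_Suc J.simps half se by (simp add: algebra_simps add_divide_distrib[symmetric])
  next
    case False
    then have m: "i mod 2 = 1" by presburger
    then have ie: "i = Suc (2 * j)" and se: "s' = (1 + s) / 2" using i by (auto simp: s'_def)
    have "2 * s' - 1 = s" by (simp add: se field_simps)
    then have te: "tent s' = 1 - s" using Suc.prems by (simp add: tent_def)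
    have "W (Suc n) (Suc (2 * j)) \<omega> = W n j \<omega> + sg n j * (J n j \<omega> + N (Suc n) j \<omega>) / 2"
      using W_double[of n j \<omega>] sg_Suc(1)[of n j] half by (simp add: W_def)
    then show ?thesis
      unfolding te unfolding ie sg_Suc J.simps half se by (simp add: field_simps)
  qed
  finally show ?case .
qed

definition G :: "real \<Rightarrow> 'a \<Rightarrow> real" where "G y \<omega> = base y \<omega> + (\<Sum>m. bump m y \<omega>)"

lemma base_measurable [measurable]: "base y \<in> borel_measurable M"
  unfolding base_def W_def by measurable

lemma bump_measurable [measurable]: "bump n y \<in> borel_measurable M"
  unfolding bump_def by measurable

lemma G_measurable [measurable]: "G y \<in> borel_measurable M"
  unfolding G_def by (intro borel_measurable_add borel_measurable_suminf) measurable

lemma G_grid: "G (real k / 2 ^ n) \<omega> = W n k \<omega>"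
proof -
  have zero: "bump m (real k / 2 ^ n) \<omega> = 0" if "m \<notin> {..<n}" for m
  proof -
    have "(2::real) ^ m = 2 ^ (m - n) * 2 ^ n" using that by (simp add: power_add[symmetric])
    then have "2 ^ m * (real k / 2 ^ n) = real (2 ^ (m - n) * k)" by simp
    then have fr: "frac (2 ^ m * (real k / 2 ^ n)) = 0" by (metis Ints_of_nat frac_eq_0_iff)
    have t0: "tent 0 = 0" by (simp add: tent_eq_0)
    show ?thesis unfolding bump_def fr t0 by (rule mult_zero_right)
  qed
  have "(\<Sum>m. bump m (real k / 2 ^ n) \<omega>) = (\<Sum>m<n. bump m (real k / 2 ^ n) \<omega>)"
    by (rule suminf_finite) (use zero in auto)
  then show ?thesis using path_grid[of 0 k n \<omega>] by (simp add: G_def)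
qed

text \<open>
An eighth moment suffices for uniform convergence: at level \<open>n\<close> there are about \<open>n * 2 ^ n\<close> tents over
the first \<open>n\<close> intervals, the summability forces \<open>\<bar>N\<bar> \<le> 8 powr (n / 8)\<close> for them eventually, and the
heights \<open>2 powr (- n / 2) * \<bar>N\<bar>\<close> then decay geometrically.
\<close>

definition good :: "'a \<Rightarrow> bool" where
  "good \<omega> \<longleftrightarrow> summable (\<lambda>n. \<Sum>k<n * 2 ^ n. (N (Suc n) k \<omega>) ^ 8 / 8 ^ n)"

lemma AE_good: "AE \<omega> in M. good \<omega>"
  unfolding good_def
proof (rule AE_summable_of_expectation[where c = "\<lambda>n. 105 * (1/2) ^ n"])
  fix n
  have m: "integrable M (\<lambda>\<omega>. N a b \<omega> ^ 8)" "expectation (\<lambda>\<omega>. N a b \<omega> ^ 8) = 105" for a b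
  proof -
    have "integrable (distr M borel (N a b)) (\<lambda>x. x ^ 8)" "(\<integral>x. x ^ 8 \<partial>distr M borel (N a b)) = 105"
      unfolding law_N normal_law_1
      using integrable_std_normal_distribution_moment[of 8] std_normal_distribution_even_moments(1)[of 4]
      by (simp_all add: fact_numeral)
    then show "integrable M (\<lambda>\<omega>. N a b \<omega> ^ 8)" "expectation (\<lambda>\<omega>. N a b \<omega> ^ 8) = 105"
      by (simp_all add: integrable_distr_eq integral_distr)
  qed
  have "(\<integral>\<^sup>+\<omega>. ennreal (\<Sum>k<n * 2 ^ n. N (Suc n) k \<omega> ^ 8 / 8 ^ n) \<partial>M) = ennreal (expectation (\<lambda>\<omega>. \<Sum>k<n * 2 ^ n. N (Suc n) k \<omega> ^ 8 / 8 ^ n))"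
    by (rule nn_integral_eq_integral) (auto intro!: sum_nonneg m)
  also have "expectation (\<lambda>\<omega>. \<Sum>k<n * 2 ^ n. N (Suc n) k \<omega> ^ 8 / 8 ^ n) = real (n * 2 ^ n) * (105 / 8 ^ n)"
    by (subst Bochner_Integration.integral_sum) (auto intro!: m simp: m)
  also have "\<dots> \<le> 105 * (1/2) ^ n"
  proof -
    have "real n \<le> 2 ^ n" using less_exp[of n] by (metis less_imp_le of_nat_le_iff of_nat_power of_nat_numeral)
    then have "real n * 2 ^ n * (1/8 ^ n) \<le> 2 ^ n * 2 ^ n * (1/8 ^ n)" by (intro mult_right_mono) auto
    also have "\<dots> = (1/2 :: real) ^ n" by (simp add: power_mult_distrib[symmetric] power_divide[symmetric])
    finally have "105 * (real n * 2 ^ n * (1/8 ^ n)) \<le> 105 * (1/2) ^ n"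
      by (intro mult_left_mono) auto
    then show ?thesis by (simp add: ac_simps)
  qed
  finally show "(\<integral>\<^sup>+\<omega>. ennreal (\<Sum>k<n * 2 ^ n. N (Suc n) k \<omega> ^ 8 / 8 ^ n) \<partial>M) \<le> ennreal (105 * (1/2) ^ n)"
    by (simp add: ennreal_leI)
qed (auto intro!: sum_nonneg summable_mult summable_geometric)

lemma base_continuous: "continuous_on {0..<real A} (\<lambda>y. base y \<omega>)"
proof -
  have eq: "base y \<omega> = (\<Sum>j<A. (sg 0 j * N 0 j \<omega>) * max 0 (min 1 (y - real j)))" if "y \<in> {0..<real A}" for y
  proof -
    define k where "k = nat \<lfloor>y\<rfloor>"
    have k: "real k \<le> y" "y < real k + 1" using that unfolding k_def by auto
    have fr: "frac y = y - real k" using that by (simp add: frac_def k_def)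
    have kA: "k < A" using k that by auto
    have "(\<Sum>j<A. (sg 0 j * N 0 j \<omega>) * max 0 (min 1 (y - real j)))
       = (\<Sum>j<k. sg 0 j * N 0 j \<omega>) + (sg 0 k * N 0 k \<omega>) * max 0 (min 1 (y - real k))"
      by (rule sum_ramp[OF kA]) (use k in auto)
    also have "max 0 (min 1 (y - real k)) = frac y" using k by (simp add: fr)
    finally show ?thesis unfolding base_def k_def[symmetric] by (simp add: W_def)
  qed
  have cont: "continuous_on {0..<real A} (\<lambda>y. \<Sum>j<A. (sg 0 j * N 0 j \<omega>) * max 0 (min 1 (y - real j)))"
    by (intro continuous_intros)
  show ?thesis by (rule continuous_on_eq[OF cont eq[symmetric]])
qed

lemma grid_index:
  assumes "y \<in> {0..<real A}"
  shows "nat \<lfloor>2 ^ n * y\<rfloor> < A * 2 ^ n"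
proof -
  have "2 ^ n * y < 2 ^ n * real A" using assms by (intro mult_strict_left_mono) auto
  then have "\<lfloor>2 ^ n * y\<rfloor> < int (A * 2 ^ n)" by (simp add: floor_less_iff mult.commute)
  moreover have "0 \<le> \<lfloor>2 ^ n * y\<rfloor>" using assms by simp
  ultimately show ?thesis by linarith
qed

lemma bump_continuous: "continuous_on {0..<real A} (\<lambda>y. bump n y \<omega>)"
proof -
  have eq: "bump n y \<omega> = (\<Sum>k<A * 2 ^ n. sg n k / 2 * N (Suc n) k \<omega> * tent (2 ^ n * y - real k))" if y: "y \<in> {0..<real A}" for y
  proof -
    define k where "k = nat \<lfloor>2 ^ n * y\<rfloor>"
    have y0: "0 \<le> 2 ^ n * y" using y by simp
    then have k: "real k \<le> 2 ^ n * y" "2 ^ n * y < real k + 1" unfolding k_def by linarith+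
    have fr: "frac (2 ^ n * y) = 2 ^ n * y - real k" using y0 by (simp add: frac_def k_def)
    have kA: "k < A * 2 ^ n" unfolding k_def by (rule grid_index[OF y])
    have "(\<Sum>k<A * 2 ^ n. sg n k / 2 * N (Suc n) k \<omega> * tent (2 ^ n * y - real k))
      = (\<Sum>j\<in>{k}. sg n j / 2 * N (Suc n) j \<omega> * tent (2 ^ n * y - real j))"
    proof (rule sum.mono_neutral_right)
      show "\<forall>j\<in>{..<A * 2 ^ n} - {k}. sg n j / 2 * N (Suc n) j \<omega> * tent (2 ^ n * y - real j) = 0"
      proof
        fix j assume "j \<in> {..<A * 2 ^ n} - {k}"
        then have "real j + 1 \<le> real k \<or> real k + 1 \<le> real j" by force
        then have "tent (2 ^ n * y - real j) = 0" using k by (intro tent_eq_0) linarith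
        then show "sg n j / 2 * N (Suc n) j \<omega> * tent (2 ^ n * y - real j) = 0" by simp
      qed
    qed (use kA in auto)
    then show ?thesis by (simp add: bump_def k_def[symmetric] fr)
  qed
  have cont: "continuous_on {0..<real A} (\<lambda>y. \<Sum>k<A * 2 ^ n. sg n k / 2 * N (Suc n) k \<omega> * tent (2 ^ n * y - real k))"
    unfolding tent_def by (intro continuous_intros)
  show ?thesis by (rule continuous_on_eq[OF cont eq[symmetric]])
qed

text \<open>
On \<open>[0, A)\<close> the tents of level \<open>n \<ge> A\<close> belong to the first \<open>n\<close> intervals, so on the set \<open>good\<close> the
series converges uniformly there.
\<close>

lemma G_continuous:
  assumes good: "good \<omega>"
  shows "continuous_on {0..} (\<lambda>y. G y \<omega>)"
proof (rule continuous_on_half_line[where b = real])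
  fix A :: nat
  define L where "L = (\<Sum>j<A. l j)"
  have L: "0 \<le> L" unfolding L_def using l_pos by (intro sum_nonneg) (auto intro: less_imp_le)
  define r where "r = root 8 (1/2 :: real)"
  have r: "0 \<le> r" "r < 1" "r ^ 8 = 1/2" by (simp_all add: r_def)
  have "(\<lambda>n. \<Sum>k<n * 2 ^ n. (N (Suc n) k \<omega>) ^ 8 / 8 ^ n) \<longlonglongrightarrow> 0"
    using good unfolding good_def by (rule summable_LIMSEQ_zero)
  then have "\<forall>\<^sub>F n in sequentially. (\<Sum>k<n * 2 ^ n. (N (Suc n) k \<omega>) ^ 8 / 8 ^ n) < 1"
    by (rule order_tendstoD) simp
  then have ev: "\<forall>\<^sub>F n in sequentially. \<forall>y\<in>{0..<real A}. norm (bump n y \<omega>) \<le> sqrt L * r ^ n"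
    using eventually_ge_at_top[of A]
  proof eventually_elim
    case (elim n)
    show ?case
    proof
      fix y assume y: "y \<in> {0..<real A}"
      define k where "k = nat \<lfloor>2 ^ n * y\<rfloor>"
      have kA: "k < A * 2 ^ n" unfolding k_def by (rule grid_index[OF y])
      also have "\<dots> \<le> n * 2 ^ n" using elim(2) by simp
      finally have kn: "k < n * 2 ^ n" .
      have "(N (Suc n) k \<omega>) ^ 8 / 8 ^ n \<le> (\<Sum>k<n * 2 ^ n. (N (Suc n) k \<omega>) ^ 8 / 8 ^ n)"
        by (rule member_le_sum[of k "{..<n * 2 ^ n}" "\<lambda>k. (N (Suc n) k \<omega>) ^ 8 / 8 ^ n"]) (use kn in auto)
      then have "(N (Suc n) k \<omega>) ^ 8 / 8 ^ n \<le> 1" using elim(1) by linarith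
      then have N8: "(N (Suc n) k \<omega>) ^ 8 \<le> 8 ^ n" by (simp add: pos_divide_le_eq)
      have kd: "k div 2 ^ n < A" using kA by (simp add: less_mult_imp_div_less)
      have lL: "l (k div 2 ^ n) \<le> L" unfolding L_def
        by (rule member_le_sum) (use kd l_pos in \<open>auto intro: less_imp_le\<close>)
      have s8: "sg n k ^ 8 = (l (k div 2 ^ n) / 2 ^ n) ^ 4"
      proof -
        have "sg n k ^ 8 = (sg n k ^ 2) ^ 4" by (simp add: power_mult[symmetric])
        also have "sg n k ^ 2 = l (k div 2 ^ n) / 2 ^ n" using l_pos[of "k div 2 ^ n"] by (simp add: sg_def)
        finally show ?thesis .
      qed
      have "\<bar>bump n y \<omega>\<bar> \<le> \<bar>sg n k * N (Suc n) k \<omega>\<bar>"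
      proof -
        have "\<bar>bump n y \<omega>\<bar> = \<bar>sg n k * N (Suc n) k \<omega>\<bar> * (tent (frac (2 ^ n * y)) / 2)"
          using tent_bounds(1)[of "frac (2 ^ n * y)"] by (simp add: bump_def k_def[symmetric] abs_mult)
        also have "\<dots> \<le> \<bar>sg n k * N (Suc n) k \<omega>\<bar> * 1"
          using tent_bounds[of "frac (2 ^ n * y)"] by (intro mult_left_mono) auto
        finally show ?thesis by simp
      qed
      then have "\<bar>bump n y \<omega>\<bar> ^ 8 \<le> \<bar>sg n k * N (Suc n) k \<omega>\<bar> ^ 8" by (intro power_mono) auto
      also have "\<dots> = sg n k ^ 8 * N (Suc n) k \<omega> ^ 8" by (simp add: power_mult_distrib power_even_abs)
      also have "\<dots> \<le> (L / 2 ^ n) ^ 4 * 8 ^ n"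
        unfolding s8 using N8 lL l_pos[of "k div 2 ^ n"]
        by (intro mult_mono power_mono divide_right_mono) auto
      also have "\<dots> = (sqrt L * r ^ n) ^ 8"
      proof -
        have a: "sqrt L ^ 8 = L ^ 4"
        proof -
          have "sqrt L ^ 8 = (sqrt L ^ 2) ^ 4" by (simp add: power_mult[symmetric])
          then show ?thesis using L by simp
        qed
        have b: "(r ^ n) ^ 8 = (1/2) ^ n" by (metis power_mult mult.commute r(3))
        have c: "(8::real) ^ n / (2 ^ n) ^ 4 = (1/2) ^ n"
        proof -
          have "((2::real) ^ n) ^ 4 = 16 ^ n" by (simp add: power_mult[symmetric] mult.commute[of n]) (simp add: power_mult)
          then show ?thesis by (simp add: power_divide[symmetric])
        qed
        have "(L / 2 ^ n) ^ 4 * 8 ^ n = L ^ 4 * (8 ^ n / (2 ^ n) ^ 4)" by (simp add: power_divide)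
        then show ?thesis unfolding c power_mult_distrib a b .
      qed
      finally show "norm (bump n y \<omega>) \<le> sqrt L * r ^ n"
        using L r(1) by (auto intro: power_le_imp_le_base[of _ 7])
    qed
  qed
  have summ: "summable (\<lambda>n. sqrt L * r ^ n)" using r by (intro summable_mult summable_geometric) auto
  have "uniform_limit {0..<real A} (\<lambda>n y. \<Sum>m<n. bump m y \<omega>) (\<lambda>y. \<Sum>m. bump m y \<omega>) sequentially"
    by (rule Weierstrass_m_test_ev[OF ev summ])
  then have "continuous_on {0..<real A} (\<lambda>y. \<Sum>m. bump m y \<omega>)"
    by (rule uniform_limit_theorem[rotated]) (auto intro!: always_eventually continuous_on_sum bump_continuous)
  then show "continuous_on {0..<real A} (\<lambda>y. G y \<omega>)"
    unfolding G_def by (intro continuous_on_add base_continuous)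
qed (simp add: reals_Archimedean2)

definition T :: "nat \<Rightarrow> real" where "T j = (\<Sum>i<j. l i)"

lemma T_simps [simp]: "T 0 = 0" "T (Suc j) = T j + l j" by (simp_all add: T_def)

lemma T_mono: "i \<le> j \<Longrightarrow> T i \<le> T j"
  unfolding T_def using l_pos by (intro sum_mono2) (auto intro: less_imp_le)

lemma T_less: "i < j \<Longrightarrow> T i < T j"
  using T_mono[of "Suc i" j] l_pos[of i] by simp

lemma T_unbounded: "\<exists>j. t < T j"
proof -
  have "\<forall>\<^sub>F j in sequentially. t < (\<Sum>i<j. l i)" using T_top by (simp add: filterlim_at_top_dense)
  then show ?thesis unfolding T_def by (auto simp: eventually_sequentially)
qed

text \<open>
The index of the interval that contains the time \<open>t\<close>.
\<close>

definition blk :: "real \<Rightarrow> nat" where "blk t = (LEAST j. t < T (Suc j))"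

lemma blk: assumes "0 \<le> t" shows "T (blk t) \<le> t" "t < T (blk t) + l (blk t)"
proof -
  obtain j where "t < T j" using T_unbounded by blast
  then have ex: "t < T (Suc j)" using T_less[of j "Suc j"] by linarith
  show "t < T (blk t) + l (blk t)" unfolding blk_def using LeastI[of "\<lambda>j. t < T (Suc j)", OF ex] by simp
  show "T (blk t) \<le> t"
  proof (cases "blk t")
    case 0
    then show ?thesis using assms by simp
  next
    case (Suc i)
    then have "\<not> t < T (Suc i)" using not_less_Least[of i "\<lambda>j. t < T (Suc j)"] by (simp add: blk_def)
    then show ?thesis using Suc by simp
  qed
qed

definition clock :: "real \<Rightarrow> real" where "clock t = real (blk t) + (t - T (blk t)) / l (blk t)"

lemma phase: assumes "0 \<le> t" shows "0 \<le> (t - T (blk t)) / l (blk t)" "(t - T (blk t)) / l (blk t) < 1"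
  using blk[OF assms] l_pos[of "blk t"] by (simp_all add: field_simps)

lemma clock_nonneg: "0 \<le> t \<Longrightarrow> 0 \<le> clock t"
  using phase by (simp add: clock_def)

lemma clock_T: "clock (T j) = real j"
proof -
  have "0 \<le> T j" using T_mono[of 0 j] by simp
  note b = blk[OF this]
  have "blk (T j) = j"
  proof (rule ccontr)
    assume "blk (T j) \<noteq> j"
    then show False using b T_less[of j "blk (T j)"] T_mono[of "Suc (blk (T j))" j] by (cases "blk (T j) < j") auto
  qed
  then show ?thesis by (simp add: clock_def)
qed

text \<open>
A representation by finitely many continuous functions, from which the continuity of the clock is
read off.
\<close>

lemma clock_sum:
  assumes t: "0 \<le> t" "t < T A"
  shows "clock t = (\<Sum>j<A. max 0 (min 1 ((t - T j) / l j)))"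
proof -
  note b = blk[OF t(1)]
  have kA: "blk t < A" using T_mono[of A "blk t"] b t by (cases "blk t < A") auto
  have "(\<Sum>j<A. 1 * max 0 (min 1 ((t - T j) / l j))) = (\<Sum>j<blk t. 1) + 1 * max 0 (min 1 ((t - T (blk t)) / l (blk t)))"
  proof (rule sum_ramp[OF kA])
    fix j
    show "max 0 (min 1 ((t - T j) / l j)) = 1" if "j < blk t"
      using T_mono[of "Suc j" "blk t"] that b l_pos[of j] by (simp add: field_simps)
    show "max 0 (min 1 ((t - T j) / l j)) = 0" if "blk t < j"
    proof -
      have "(t - T j) / l j \<le> 0" using T_mono[of "Suc (blk t)" j] that b l_pos[of j] by (intro divide_nonpos_pos) auto
      then show ?thesis by simp
    qed
  qed
  then show ?thesis using phase[OF t(1)] by (simp add: clock_def)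
qed

lemma clock_continuous: "continuous_on {0..} clock"
proof (rule continuous_on_half_line[where b = T])
  fix A
  have "continuous_on {0..<T A} (\<lambda>t. \<Sum>j<A. max 0 (min 1 ((t - T j) / l j)))"
    using l_pos by (intro continuous_intros) (auto simp: less_imp_neq[symmetric])
  then show "continuous_on {0..<T A} clock"
    by (rule continuous_on_eq) (simp add: clock_sum[of _ A])
qed (rule T_unbounded)

lemma clock_mono: "0 \<le> s \<Longrightarrow> s \<le> t \<Longrightarrow> clock s \<le> clock t"
proof -
  assume st: "0 \<le> s" "s \<le> t"
  obtain A where A: "t < T A" using T_unbounded by blast
  show ?thesis
    using st A l_pos unfolding clock_sum[OF st(1) order_le_less_trans[OF st(2) A]] clock_sum[OF order_trans[OF st] A]
    by (intro sum_mono max.mono min.mono divide_right_mono) (auto intro: less_imp_le)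
qed

text \<open>
The index of the last point of the \<open>m\<close>-th dyadic level up to the time \<open>t\<close>.
\<close>

definition idx :: "nat \<Rightarrow> real \<Rightarrow> nat" where "idx m t = nat \<lfloor>2 ^ m * clock t\<rfloor>"

lemma idx_mono: "0 \<le> s \<Longrightarrow> s \<le> t \<Longrightarrow> idx m s \<le> idx m t"
  unfolding idx_def using clock_mono by (intro nat_mono floor_mono mult_left_mono) auto

lemma floor_div_limit: "0 \<le> x \<Longrightarrow> (\<lambda>m. real (nat \<lfloor>2 ^ m * x\<rfloor>) / 2 ^ m) \<longlonglongrightarrow> x"
proof (rule tendsto_sandwich[of "\<lambda>m. x - (1/2) ^ m" _ _ "\<lambda>_. x"])
  assume x: "0 \<le> x"
  have b: "2 ^ m * x - 1 \<le> real (nat \<lfloor>2 ^ m * x\<rfloor>)" "real (nat \<lfloor>2 ^ m * x\<rfloor>) \<le> 2 ^ m * x" for m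
  proof -
    have "0 \<le> 2 ^ m * x" using x by simp
    then show "2 ^ m * x - 1 \<le> real (nat \<lfloor>2 ^ m * x\<rfloor>)" "real (nat \<lfloor>2 ^ m * x\<rfloor>) \<le> 2 ^ m * x" by linarith+
  qed
  show "\<forall>\<^sub>F m in sequentially. x - (1/2) ^ m \<le> real (nat \<lfloor>2 ^ m * x\<rfloor>) / 2 ^ m"
  proof (intro always_eventually allI)
    fix m
    have "x - (1/2) ^ m = (2 ^ m * x - 1) / 2 ^ m" by (simp add: diff_divide_distrib power_divide)
    also have "\<dots> \<le> real (nat \<lfloor>2 ^ m * x\<rfloor>) / 2 ^ m" by (intro divide_right_mono b) simp
    finally show "x - (1/2) ^ m \<le> real (nat \<lfloor>2 ^ m * x\<rfloor>) / 2 ^ m" .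
  qed
  show "\<forall>\<^sub>F m in sequentially. real (nat \<lfloor>2 ^ m * x\<rfloor>) / 2 ^ m \<le> x"
    by (intro always_eventually allI) (use b in \<open>simp add: field_simps\<close>)
  show "(\<lambda>m. x - (1/2) ^ m) \<longlonglongrightarrow> x" by real_asymp
qed simp

lemma W_limit:
  assumes "good \<omega>" "0 \<le> t"
  shows "(\<lambda>m. W m (idx m t) \<omega>) \<longlonglongrightarrow> G (clock t) \<omega>"
proof -
  have "(\<lambda>m. G (real (idx m t) / 2 ^ m) \<omega>) \<longlonglongrightarrow> G (clock t) \<omega>"
  proof (rule continuous_on_tendsto_compose[OF G_continuous[OF assms(1)]])
    show "(\<lambda>m. real (idx m t) / 2 ^ m) \<longlonglongrightarrow> clock t"
      unfolding idx_def by (rule floor_div_limit[OF clock_nonneg[OF assms(2)]])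
  qed (use clock_nonneg[OF assms(2)] in auto)
  then show ?thesis by (simp add: G_grid)
qed

lemma sum_l: "r \<le> 2 ^ m \<Longrightarrow> (\<Sum>k<j * 2 ^ m + r. l (k div 2 ^ m) / 2 ^ m) = T j + l j * real r / 2 ^ m"
proof (induction j arbitrary: r)
  case 0
  have "(\<Sum>k<r. l (k div 2 ^ m) / 2 ^ m) = (\<Sum>k<r. l 0 / 2 ^ m)"
    using 0 by (intro sum.cong) (auto simp: div_less)
  then show ?case by simp
next
  case (Suc j)
  show ?case using Suc.prems
  proof (induction r)
    case 0
    show ?case using Suc.IH[of "2 ^ m"] by (simp add: algebra_simps)
  next
    case (Suc r)
    have "(Suc j * 2 ^ m + r) div 2 ^ m = Suc j" using Suc.prems by (intro div_nat_eqI) auto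
    then have "(\<Sum>k<Suc j * 2 ^ m + Suc r. l (k div 2 ^ m) / 2 ^ m)
       = (\<Sum>k<Suc j * 2 ^ m + r. l (k div 2 ^ m) / 2 ^ m) + l (Suc j) / 2 ^ m"
      by (simp only: add_Suc_right sum.lessThan_Suc)
    also have "(\<Sum>k<Suc j * 2 ^ m + r. l (k div 2 ^ m) / 2 ^ m) = T (Suc j) + l (Suc j) * real r / 2 ^ m"
      using Suc.IH Suc.prems by simp
    also have "\<dots> + l (Suc j) / 2 ^ m = T (Suc j) + l (Suc j) * real (Suc r) / 2 ^ m"
      by (simp only: of_nat_Suc distrib_left mult_1_right add_divide_distrib add.assoc add.commute[of _ "l (Suc j) / 2 ^ m"])
    finally show ?case .
  qed
qed

text \<open>
At dyadic points the accumulated variance is the elapsed time, and the points \<open>idx m t\<close> approach \<open>t\<close>.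
\<close>

lemma variance_limit:
  assumes t: "0 \<le> t"
  shows "(\<lambda>m. \<Sum>k<idx m t. l (k div 2 ^ m) / 2 ^ m) \<longlonglongrightarrow> t"
proof -
  define p where "p = (t - T (blk t)) / l (blk t)"
  have p: "0 \<le> p" "p < 1" using phase[OF t] by (auto simp: p_def)
  have idx: "idx m t = blk t * 2 ^ m + nat \<lfloor>2 ^ m * p\<rfloor>" for m
  proof -
    have nat_add: "nat \<lfloor>real K + x\<rfloor> = K + nat \<lfloor>x\<rfloor>" if "0 \<le> x" for K x
      using that by (simp add: nat_add_distrib)
    have c: "clock t = real (blk t) + p" by (simp add: clock_def p_def)
    have "2 ^ m * clock t = real (blk t * 2 ^ m) + 2 ^ m * p"
      unfolding c by (simp add: distrib_left)
    then show ?thesis using nat_add[of "2 ^ m * p" "blk t * 2 ^ m"] p by (simp only: idx_def) simp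
  qed
  have le: "nat \<lfloor>2 ^ m * p\<rfloor> \<le> 2 ^ m" for m
  proof -
    have "real (nat \<lfloor>2 ^ m * p\<rfloor>) \<le> 2 ^ m * p" using p by (intro of_nat_floor) simp
    also have "\<dots> \<le> real (2 ^ m)" using p by simp
    finally have "real (nat \<lfloor>2 ^ m * p\<rfloor>) \<le> real (2 ^ m)" .
    then show ?thesis by (simp only: of_nat_le_iff)
  qed
  have "(\<lambda>m. T (blk t) + l (blk t) * (real (nat \<lfloor>2 ^ m * p\<rfloor>) / 2 ^ m)) \<longlonglongrightarrow> T (blk t) + l (blk t) * p"
    by (intro tendsto_intros floor_div_limit p)
  also have "T (blk t) + l (blk t) * p = t" using l_pos[of "blk t"] by (simp add: p_def)
  finally show ?thesis unfolding idx sum_l[OF le] by simp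
qed

lemma W_diff:
  assumes "i \<le> j"
  shows "W m j \<omega> - W m i \<omega> = (\<Sum>k\<in>{i..<j}. sg m k * J m k \<omega>)"
  unfolding W_def using sum_diff_nat_ivl[of 0 i j "\<lambda>k. sg m k * J m k \<omega>"] assms by (simp add: atLeast0LessThan)

lemma W_diff_law:
  assumes ij: "i \<le> j"
  shows "distr M borel (\<lambda>\<omega>. W m j \<omega> - W m i \<omega>) = normal_law ((\<Sum>k<j. l (k div 2 ^ m) / 2 ^ m) - (\<Sum>k<i. l (k div 2 ^ m) / 2 ^ m))"
proof -
  have pos: "0 \<le> l (k div 2 ^ m) / 2 ^ m" for k using l_pos[of "k div 2 ^ m"] by simp
  have "distr M borel (\<lambda>\<omega>. \<Sum>k\<in>{i..<j}. sg m k * J m k \<omega>) = normal_law (\<Sum>k\<in>{i..<j}. l (k div 2 ^ m) / 2 ^ m)"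
  proof (rule normal_law_sum)
    show "indep_vars (\<lambda>_. borel) (\<lambda>k \<omega>. sg m k * J m k \<omega>) {i..<j}"
      by (rule indep_vars_compose2[OF indep_vars_subset[OF J_indep[of m]]]) auto
    show "distr M borel (\<lambda>\<omega>. sg m k * J m k \<omega>) = normal_law (l (k div 2 ^ m) / 2 ^ m)" for k
      unfolding sg_def by (rule distr_normal_law_scale[OF prob_space_axioms J_measurable pos J_law])
  qed (rule pos)
  also have "(\<Sum>k\<in>{i..<j}. l (k div 2 ^ m) / 2 ^ m) = (\<Sum>k<j. l (k div 2 ^ m) / 2 ^ m) - (\<Sum>k<i. l (k div 2 ^ m) / 2 ^ m)"
    using sum_diff_nat_ivl[of 0 i j "\<lambda>k. l (k div 2 ^ m) / 2 ^ m"] ij by (simp add: atLeast0LessThan)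
  finally show ?thesis unfolding W_diff[OF ij] .
qed

text \<open>
Off a null set the paths are the uniform limits constructed above; on it they are redefined as 0,
because a Wiener process has every path continuous. Increments between arbitrary times are almost sure
limits of increments between dyadic points, and inherit their laws and their independence
through \<open>normal_law_limit\<close> and \<open>indep_vars_limit\<close>.
\<close>

theorem wiener_process_exists:
  obtains \<zeta> where "wiener_process M \<zeta>" "AE \<omega> in M. \<forall>j. \<zeta> (T j) \<omega> = (\<Sum>i<j. sqrt (l i) * N 0 i \<omega>)"
proof -
  obtain Z where Z: "{\<omega>\<in>space M. \<not> good \<omega>} \<subseteq> Z" "emeasure M Z = 0" "Z \<in> sets M"
    using AE_E[OF AE_good] by blast
  have AEZ: "AE \<omega> in M. \<omega> \<notin> Z" by (rule AE_not_in) (use Z in auto)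
  have Zgood: "good \<omega>" if "\<omega> \<in> space M" "\<omega> \<notin> Z" for \<omega> using Z that by auto
  define \<zeta> :: "real \<Rightarrow> 'a \<Rightarrow> real" where "\<zeta> t \<omega> = (if \<omega> \<in> Z then 0 else G (clock t) \<omega>)" for t \<omega>
  have \<zeta>_meas [measurable]: "\<zeta> t \<in> borel_measurable M" for t
    unfolding \<zeta>_def using Z(3) by measurable
  have lim: "AE \<omega> in M. (\<lambda>m. W m (idx m t) \<omega> - W m (idx m s) \<omega>) \<longlonglongrightarrow> \<zeta> t \<omega> - \<zeta> s \<omega>" if "0 \<le> s" "0 \<le> t" for s t
    using AEZ AE_space
  proof eventually_elim
    case (elim \<omega>)
    then have "good \<omega>" by (intro Zgood)
    then show ?case using W_limit that elim by (auto simp: \<zeta>_def intro!: tendsto_diff)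
  qed
  have Wm [measurable]: "W m k \<in> borel_measurable M" for m k unfolding W_def by measurable
  have law: "distr M borel (\<lambda>\<omega>. \<zeta> t \<omega> - \<zeta> s \<omega>) = normal_law (t - s)" if st: "0 \<le> s" "s \<le> t" for s t
  proof (rule normal_law_limit[OF _ _ lim[OF st(1) order_trans[OF st]] W_diff_law[OF idx_mono[OF st]]])
    show "(\<lambda>m. (\<Sum>k<idx m t. l (k div 2 ^ m) / 2 ^ m) - (\<Sum>k<idx m s. l (k div 2 ^ m) / 2 ^ m)) \<longlonglongrightarrow> t - s"
      by (intro tendsto_diff variance_limit) (use st in auto)
    show "0 \<le> (\<Sum>k<idx m t. l (k div 2 ^ m) / 2 ^ m) - (\<Sum>k<idx m s. l (k div 2 ^ m) / 2 ^ m)" for m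
    proof -
      have pos: "0 \<le> l (k div 2 ^ m) / 2 ^ m" for k using l_pos[of "k div 2 ^ m"] by simp
      have "{..<idx m s} \<subseteq> {..<idx m t}" using idx_mono[OF st, of m] by auto
      from sum_mono2[OF _ this pos] show ?thesis by simp
    qed
  qed measurable
  have G0: "G 0 \<omega> = 0" for \<omega> using G_grid[of 0 0 \<omega>] by (simp add: W_def)
  have "wiener_process M \<zeta>"
    unfolding wiener_process_def
  proof (intro conjI allI ballI impI)
    show "prob_space M" by (rule prob_space_axioms)
    show "\<zeta> 0 \<omega> = 0" for \<omega> using clock_T[of 0] G0 by (simp add: \<zeta>_def)
    show "continuous_on {0..} (\<lambda>t. \<zeta> t \<omega>)" if "\<omega> \<in> space M" for \<omega>
    proof (cases "\<omega> \<in> Z")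
      case True
      then show ?thesis by (simp add: \<zeta>_def)
    next
      case False
      have "continuous_on {0..} (\<lambda>t. G (clock t) \<omega>)"
        by (rule continuous_on_compose2[OF G_continuous[OF Zgood[OF that False]] clock_continuous])
          (use clock_nonneg in auto)
      then show ?thesis using False by (simp add: \<zeta>_def)
    qed
    fix s t :: real assume st: "0 \<le> s \<and> s < t"
    have "distr M lborel (\<lambda>\<omega>. \<zeta> t \<omega> - \<zeta> s \<omega>) = distr M borel (\<lambda>\<omega>. \<zeta> t \<omega> - \<zeta> s \<omega>)"
      by (rule distr_cong) auto
    also have "\<dots> = density lborel (normal_density 0 (sqrt (t - s)))"
      using law[of s t] st by (simp add: normal_law_density)
    finally show "distributed M lborel (\<lambda>\<omega>. \<zeta> t \<omega> - \<zeta> s \<omega>) (normal_density 0 (sqrt (t - s)))"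
      by (auto simp: distributed_def)
  next
    fix n and t :: "nat \<Rightarrow> real" assume t: "0 \<le> t 0 \<and> (\<forall>i<n. t i \<le> t (Suc i))"
    have mono: "t i \<le> t j" if "i \<le> j" "j \<le> n" for i j
      using that
    proof (induction j)
      case (Suc j)
      then show ?case using t by (cases "i = Suc j") (auto intro: order_trans)
    qed simp
    have pos: "0 \<le> t i" if "i \<le> n" for i using mono[of 0 i] t that by auto
    show "indep_vars (\<lambda>_. borel) (\<lambda>i \<omega>. \<zeta> (t (Suc i)) \<omega> - \<zeta> (t i) \<omega>) {..<n}"
    proof (rule indep_vars_limit[where X = "\<lambda>m i \<omega>. W m (idx m (t (Suc i))) \<omega> - W m (idx m (t i)) \<omega>"])
      fix m
      define K where "K i = {idx m (t i)..<idx m (t (Suc i))}" for i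
      have le: "idx m (t i) \<le> idx m (t j)" if "i \<le> j" "j \<le> n" for i j
        using that mono pos by (intro idx_mono) auto
      have "indep_vars (\<lambda>_. borel) (\<lambda>i \<omega>. (\<lambda>f. \<Sum>k\<in>K i. sg m k * f k) (\<lambda>k\<in>K i. J m k \<omega>)) {..<n}"
      proof (rule indep_vars_blocks[OF J_indep[of m]])
        show "disjoint_family_on K {..<n}"
          unfolding disjoint_family_on_def
        proof (intro ballI impI)
          fix i j assume "i \<in> {..<n}" "j \<in> {..<n}" "i \<noteq> j"
          then show "K i \<inter> K j = {}"
            using le[of "Suc i" j] le[of "Suc j" i] by (cases "i < j") (auto simp: K_def)
        qed
      qed auto
      moreover have "(\<Sum>k\<in>K i. sg m k * (\<lambda>k\<in>K i. J m k \<omega>) k) = W m (idx m (t (Suc i))) \<omega> - W m (idx m (t i)) \<omega>" if "i < n" for i \<omega>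
        using that le[of i "Suc i"] by (simp add: W_diff K_def)
      ultimately show "indep_vars (\<lambda>_. borel) (\<lambda>i \<omega>. W m (idx m (t (Suc i))) \<omega> - W m (idx m (t i)) \<omega>) {..<n}"
        by (subst indep_vars_cong[OF refl _ refl, symmetric]) auto
    next
      fix i assume "i \<in> {..<n}"
      then show "AE \<omega> in M. (\<lambda>m. W m (idx m (t (Suc i))) \<omega> - W m (idx m (t i)) \<omega>) \<longlonglongrightarrow> \<zeta> (t (Suc i)) \<omega> - \<zeta> (t i) \<omega>"
        by (intro lim pos) auto
    qed auto
  qed measurable
  moreover have "AE \<omega> in M. \<forall>j. \<zeta> (T j) \<omega> = (\<Sum>i<j. sqrt (l i) * N 0 i \<omega>)"
    using AEZ
  proof eventually_elim
    case (elim \<omega>)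
    show ?case
    proof
      fix j
      have "\<zeta> (T j) \<omega> = W 0 j \<omega>" using elim G_grid[of j 0 \<omega>] by (simp add: \<zeta>_def clock_T)
      then show "\<zeta> (T j) \<omega> = (\<Sum>i<j. sqrt (l i) * N 0 i \<omega>)" by (simp add: W_def sg_def)
    qed
  qed
  ultimately show thesis by (rule that)
qed

end

section \<open>Ergodic sums as sums of independent variables\<close>

lemma unit_uniform_atom: "emeasure unit_uniform {c} = 0"
proof -
  have "emeasure unit_uniform {c} = (\<integral>\<^sup>+x. indicator {c} x \<partial>unit_uniform)" by simp
  also have "\<dots> = (\<integral>\<^sup>+x. indicator {c} x * indicator {0..<1} x \<partial>lborel)"
    by (subst nn_integral_unit_uniform, simp) (rule nn_integral_circle, simp)
  also have "\<dots> \<le> (\<integral>\<^sup>+x. indicator {c} x \<partial>lborel)"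
    by (intro nn_integral_mono) (auto simp: indicator_def)
  also have "\<dots> = 0" by simp
  finally show ?thesis by simp
qed

lemma distr_unit_uniform_frac: "distr unit_uniform borel frac = unit_uniform"
proof -
  have "distr unit_uniform borel frac = distr circle_measure borel (\<lambda>x. frac (x + 0))"
    unfolding unit_uniform_def by (subst distr_distr) (auto simp: comp_def id_measurable_circle)
  then show ?thesis unfolding distr_circle_rotation unit_uniform_def .
qed

text \<open>
The array of independent variables \<open>Xc\<close> supplies everything random: row 0 the uniform variables for
the coupled point, row 1 the noise added to the blocks, and the rows from 2 on the normal variables for
the midpoint displacements. The function \<open>v\<close> dominates \<open>\<phi>\<close>, and \<open>p k / Q k\<close> approximates \<open>\<alpha>\<close>.
\<close>

locale lacunary_sums = prob_space M for M :: "'a measure" +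
  fixes Xc :: "nat \<times> nat \<Rightarrow> 'a \<Rightarrow> real" and Q p :: "nat \<Rightarrow> nat" and \<alpha> V c :: real and v \<phi> :: "real \<Rightarrow> real"
  assumes indep_Xc: "indep_vars (\<lambda>_. borel) Xc UNIV"
    and law0: "\<And>k. distr M borel (Xc (0, k)) = unit_uniform"
    and law1: "\<And>k. distr M borel (Xc (1, k)) = unit_uniform"
    and law2: "\<And>n k. distr M borel (Xc (Suc (Suc n), k)) = normal_law 1"
    and Q_gt0: "\<And>k. Q k > 0" and Q_step: "\<And>k. 4 ^ Suc k * Q k \<le> Q (Suc k)"
    and cop: "\<And>k. coprime (p k) (Q k)"
    and approx: "\<And>k. \<bar>real (Q k) * \<alpha> - real (p k)\<bar> \<le> 1 / (4 ^ Suc k * real (Q k))"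
    and dom: "dominated V v \<phi>" and cent: "centered \<phi>"
    and c_pos: "0 < c" and lower: "\<And>n. c * real n \<le> (\<Sum>k<n. \<integral>x. (fold_sum (Q k) \<phi> x)\<^sup>2 \<partial>circle_measure)"
begin

lemma Xc_measurable [measurable]: "Xc i \<in> borel_measurable M"
  by (rule indep_vars_measurable[OF indep_Xc]) simp

lemma \<phi>_measurable [measurable]: "\<phi> \<in> borel_measurable borel"
  by (rule dominated_measurable[OF dom])

lemma V_nonneg: "0 \<le> V" by (rule dominated_nonneg[OF dom])

text \<open>
The fractional part confines the variables to \<open>[0,1)\<close> everywhere and not just almost surely.
\<close>

definition u :: "nat \<Rightarrow> 'a \<Rightarrow> real" where "u k \<omega> = frac (Xc (0, k) \<omega>)"

lemma distr_frac_uniform: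
  assumes [measurable]: "X \<in> borel_measurable M" and "distr M borel X = unit_uniform"
  shows "distr M borel (\<lambda>\<omega>. frac (X \<omega>)) = unit_uniform"
proof -
  have "distr M borel (\<lambda>\<omega>. frac (X \<omega>)) = distr (distr M borel X) borel frac"
    by (subst distr_distr) (auto simp: comp_def)
  then show ?thesis by (simp add: assms distr_unit_uniform_frac)
qed

sublocale refinement M u Q
proof
  show "indep_vars (\<lambda>_. borel) u UNIV"
  proof -
    have "indep_vars (\<lambda>_. borel) (\<lambda>k. Xc (0, k)) UNIV"
      by (rule indep_vars_reindex[OF indep_vars_subset[OF indep_Xc]]) (auto simp: inj_on_def)
    then show ?thesis unfolding u_def[abs_def] by (rule indep_vars_compose2) simp
  qed
  show "distr M borel (u k) = unit_uniform" for k
    unfolding u_def by (rule distr_frac_uniform) (simp_all add: law0)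
  show "0 \<le> u k \<omega> \<and> u k \<omega> < 1" for k \<omega> by (simp add: u_def frac_lt_1)
qed (rule Q_gt0, rule Q_step)

lemma expectation_uniform:
  fixes F :: "real \<Rightarrow> real"
  assumes "X \<in> borel_measurable M" "distr M borel X = unit_uniform" "F \<in> borel_measurable borel"
  shows "expectation (\<lambda>\<omega>. F (X \<omega>)) = (\<integral>x. F x \<partial>circle_measure)"
  using integral_distr[OF assms(1,3)] by (simp add: assms(2) integral_unit_uniform[OF assms(3)])

abbreviation g :: "nat \<Rightarrow> real \<Rightarrow> real" where "g k \<equiv> fold_sum (Q k) \<phi>"

lemma dom_g: "dominated V (fold_sum (Q k) v) (g k)"
  by (rule dominated_fold_sum[OF dom Q_gt0])

lemma g_measurable [measurable]: "g k \<in> borel_measurable borel"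
  by (rule dominated_measurable[OF dom_g])

lemma g_bound: "\<bar>g k x\<bar> \<le> V"
  by (rule centered_dominated_bound[OF dom_g centered_fold_sum[OF dom Q_gt0 cent]])

text \<open>
The orbit segment of length \<open>Q k\<close> begins at the time \<open>start k\<close>.
\<close>

definition start :: "nat \<Rightarrow> nat" where "start k = (\<Sum>i<k. Q i)"

definition shift :: "nat \<Rightarrow> real" where "shift k = real (Q k) * (real (start k) * \<alpha>)"

text \<open>
The idealised contribution of the \<open>k\<close>-th segment: \<open>Q k * point\<close> is replaced by the independent
variable \<open>u (Suc k)\<close>.
\<close>

definition \<xi> :: "nat \<Rightarrow> 'a \<Rightarrow> real" where "\<xi> k \<omega> = g k (u (Suc k) \<omega> + shift k)"

lemma \<xi>_measurable [measurable]: "\<xi> k \<in> borel_measurable M"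
  unfolding \<xi>_def by measurable

lemma \<xi>_bound: "\<bar>\<xi> k \<omega>\<bar> \<le> V"
  unfolding \<xi>_def by (rule g_bound)

lemma \<xi>_integrable: "integrable M (\<xi> k)" "integrable M (\<lambda>\<omega>. (\<xi> k \<omega>)\<^sup>2)"
proof -
  show "integrable M (\<xi> k)" by (rule integrable_const_bound[where B = V]) (use \<xi>_bound in auto)
  have "(\<xi> k \<omega>)\<^sup>2 \<le> V\<^sup>2" for \<omega> using power_mono[OF \<xi>_bound abs_ge_zero, of k \<omega> 2] by simp
  then show "integrable M (\<lambda>\<omega>. (\<xi> k \<omega>)\<^sup>2)" by (intro integrable_const_bound[where B = "V\<^sup>2"]) auto
qed

lemma expectation_u_shift:
  fixes F :: "real \<Rightarrow> real"
  assumes [measurable]: "F \<in> borel_measurable borel" and "\<And>x. F (x + 1) = F x"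
  shows "expectation (\<lambda>\<omega>. F (u k \<omega> + d)) = (\<integral>x. F x \<partial>circle_measure)"
  using expectation_uniform[OF u_measurable distr_u, of "\<lambda>x. F (x + d)" k]
    integral_circle_rotation[of F d] assms by simp

lemma \<xi>_mean: "expectation (\<xi> k) = 0"
  using expectation_u_shift[of "g k" "Suc k" "shift k"] dominated_periodic[OF dom_g]
    centered_fold_sum[OF dom Q_gt0 cent] unfolding \<xi>_def centered_def by simp

definition var :: "nat \<Rightarrow> real" where "var k = expectation (\<lambda>\<omega>. (\<xi> k \<omega>)\<^sup>2)"

lemma var_eq: "var k = (\<integral>x. (g k x)\<^sup>2 \<partial>circle_measure)"
  unfolding var_def \<xi>_def by (rule expectation_u_shift) (simp_all add: dominated_periodic[OF dom_g])

lemma var_bounds: "0 \<le> var k" "var k \<le> V\<^sup>2"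
proof -
  show "0 \<le> var k" unfolding var_def by (rule integral_nonneg_AE) auto
  have "(\<xi> k \<omega>)\<^sup>2 \<le> V\<^sup>2" for \<omega> using power_mono[OF \<xi>_bound abs_ge_zero, of k \<omega> 2] by simp
  then have "var k \<le> expectation (\<lambda>\<omega>. V\<^sup>2)"
    unfolding var_def by (intro integral_mono \<xi>_integrable) auto
  then show "var k \<le> V\<^sup>2" by (simp add: prob_space)
qed

definition total :: "nat \<Rightarrow> real" where "total n = (\<Sum>k<n. var k)"

lemma total_lower: "c * real n \<le> total n"
  using lower[of n] by (simp add: total_def var_eq)

definition X :: "nat \<Rightarrow> 'a \<Rightarrow> real" where "X n \<omega> = ergodic_sum \<alpha> \<phi> (start n) (point \<omega>)"

definition Y :: "nat \<Rightarrow> 'a \<Rightarrow> real" where "Y n \<omega> = (\<Sum>k<n. \<xi> k \<omega>)"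

definition err :: "nat \<Rightarrow> 'a \<Rightarrow> real" where
  "err k \<omega> = (\<Sum>j<Q k. \<phi> (point \<omega> + real (start k) * \<alpha> + real j * \<alpha>)) - \<xi> k \<omega>"

lemma err_measurable [measurable]: "err k \<in> borel_measurable M"
  unfolding err_def by measurable

lemma X_eq: "X n \<omega> = Y n \<omega> + (\<Sum>k<n. err k \<omega>)"
proof -
  have "X n \<omega> = (\<Sum>k<n. \<Sum>j<Q k. \<phi> (point \<omega> + real (start k) * \<alpha> + real j * \<alpha>))"
  proof (induction n)
    case 0
    then show ?case by (simp add: X_def start_def ergodic_sum_def)
  next
    case (Suc n)
    have s: "start (Suc n) = start n + Q n" by (simp add: start_def)
    have "(\<Sum>j<start n + m. \<phi> (point \<omega> + real j * \<alpha>))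
       = (\<Sum>j<start n. \<phi> (point \<omega> + real j * \<alpha>)) + (\<Sum>j<m. \<phi> (point \<omega> + real (start n) * \<alpha> + real j * \<alpha>))" for m
      by (induction m) (simp_all add: algebra_simps)
    then show ?case using Suc by (simp add: X_def ergodic_sum_def s)
  qed
  then show ?thesis by (simp add: Y_def err_def sum_subtractf)
qed

text \<open>
One term for replacing the orbit by equally spaced points, one for replacing \<open>Q k * point\<close> by
\<open>u (Suc k)\<close>.
\<close>

definition err_majorant :: "nat \<Rightarrow> 'a \<Rightarrow> real" where
  "err_majorant k \<omega> = (\<Sum>j<Q k. spread v (1 / (4 ^ Suc k * real (Q k))) (point \<omega> + (real (start k) * \<alpha> + real j / real (Q k))))
     + spread (fold_sum (Q k) v) (2 / 4 ^ Suc k) (u (Suc k) \<omega> + shift k)"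

lemma small: "0 \<le> 1 / (4 ^ Suc k * real (Q k))" "1 / (4 ^ Suc k * real (Q k)) \<le> 1 / real (Q k)" "1 / (4 ^ Suc k * real (Q k)) \<le> 1"
  "0 \<le> 2 / (4::real) ^ Suc k" "2 / (4::real) ^ Suc k \<le> 1"
proof -
  have q: "1 \<le> real (Q k)" using Q_gt0[of k] by simp
  have f: "2 \<le> (4::real) ^ Suc k" using one_le_power[of "4::real" k] unfolding power_Suc by linarith
  show "0 \<le> 1 / (4 ^ Suc k * real (Q k))" "0 \<le> 2 / (4::real) ^ Suc k" by simp_all
  have "1 * real (Q k) \<le> 4 ^ Suc k * real (Q k)" using f q by (intro mult_right_mono) auto
  then show a: "1 / (4 ^ Suc k * real (Q k)) \<le> 1 / real (Q k)" using q by (intro divide_left_mono) auto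
  have "1 / real (Q k) \<le> 1" using q by simp
  then show "1 / (4 ^ Suc k * real (Q k)) \<le> 1" using a by linarith
  show "2 / (4::real) ^ Suc k \<le> 1" using f by simp
qed

lemma err_le: "\<bar>err k \<omega>\<bar> \<le> err_majorant k \<omega>"
proof -
  define y where "y = point \<omega> + real (start k) * \<alpha>"
  obtain s where s: "\<bar>s\<bar> \<le> 2 / 4 ^ Suc k"
    "real (Q k) * point \<omega> = of_int \<lfloor>real (Q k) * pt k \<omega>\<rfloor> + u (Suc k) \<omega> + s"
    by (rule mult_point)
  have "real (Q k) * y = (u (Suc k) \<omega> + shift k) + s + of_int \<lfloor>real (Q k) * pt k \<omega>\<rfloor>"
    using s(2) by (simp add: y_def shift_def distrib_left)
  then have gy: "g k (real (Q k) * y) = g k ((u (Suc k) \<omega> + shift k) + s)"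
    using one_periodic_add_int[of "g k"] dominated_periodic[OF dom_g] by simp
  have a: "\<bar>(\<Sum>j<Q k. \<phi> (y + real j * \<alpha>)) - g k (real (Q k) * y)\<bar>
     \<le> (\<Sum>j<Q k. spread v (1 / (4 ^ Suc k * real (Q k))) (y + real j / real (Q k)))"
    by (rule ergodic_sum_fold_sum[OF dom cop Q_gt0 approx])
  have b: "\<bar>g k ((u (Suc k) \<omega> + shift k) + s) - g k (u (Suc k) \<omega> + shift k)\<bar>
     \<le> spread (fold_sum (Q k) v) (2 / 4 ^ Suc k) (u (Suc k) \<omega> + shift k)"
    by (rule dominated_spread[OF dom_g s(1)])
  show ?thesis
    using a b unfolding err_def err_majorant_def \<xi>_def gy y_def[symmetric] add.assoc[symmetric] by linarith
qed

lemma err_majorant_bounds: "0 \<le> err_majorant k \<omega>" "err_majorant k \<omega> \<le> 4 * V"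
proof -
  show "0 \<le> err_majorant k \<omega>"
    unfolding err_majorant_def using spread_nonneg[OF dom small(1)] spread_nonneg[OF dom_g small(4)]
    by (intro add_nonneg_nonneg sum_nonneg) auto
  have "(\<Sum>j<Q k. spread v (1 / (4 ^ Suc k * real (Q k))) (point \<omega> + (real (start k) * \<alpha> + real j / real (Q k)))) \<le> 2 * V"
    using sum_spread_le[OF dom Q_gt0 small(2), of k "point \<omega> + real (start k) * \<alpha>"] by (simp only: add.assoc)
  then show "err_majorant k \<omega> \<le> 4 * V"
    using spread_le[OF dom_g small(5), of k k "u (Suc k) \<omega> + shift k"] unfolding err_majorant_def by linarith
qed

lemma err_majorant_measurable [measurable]: "err_majorant k \<in> borel_measurable M"
proof -
  note [measurable] = spread_measurable[OF dom] spread_measurable[OF dom_g]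
  show ?thesis unfolding err_majorant_def by measurable
qed

lemma err_majorant_integrable: "integrable M (err_majorant k)"
  by (rule integrable_const_bound[where B = "4 * V"]) (use err_majorant_bounds in auto)

lemma err_majorant_mean: "expectation (err_majorant k) \<le> 6 * V / 4 ^ Suc k"
proof -
  note [measurable] = spread_measurable[OF dom] spread_measurable[OF dom_g]
  let ?e = "1 / (4 ^ Suc k * real (Q k))"
  define F where "F x = (\<Sum>j<Q k. spread v ?e (x + (real (start k) * \<alpha> + real j / real (Q k))))" for x
  define H where "H x = spread (fold_sum (Q k) v) (2 / 4 ^ Suc k) (x + shift k)" for x
  have [measurable]: "F \<in> borel_measurable borel" "H \<in> borel_measurable borel" unfolding F_def H_def by measurable
  have F: "expectation (\<lambda>\<omega>. F (point \<omega>)) = real (Q k) * (2 * ?e * V)"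
  proof -
    have "expectation (\<lambda>\<omega>. F (point \<omega>)) = (\<integral>x. F x \<partial>circle_measure)"
      by (rule expectation_uniform[OF point_measurable distr_point]) simp
    also have "\<dots> = (\<Sum>j<Q k. 2 * ?e * V)"
      unfolding F_def using integrable_spread[OF dom small(1,3)] integral_spread[OF dom, of ?e]
      by (subst Bochner_Integration.integral_sum) auto
    finally show ?thesis by simp
  qed
  have H: "expectation (\<lambda>\<omega>. H (u (Suc k) \<omega>)) = 2 * (2 / 4 ^ Suc k) * V"
    unfolding H_def expectation_uniform[OF u_measurable distr_u, of H "Suc k", unfolded H_def, simplified]
    by (subst expectation_uniform[OF u_measurable distr_u, of "\<lambda>x. spread (fold_sum (Q k) v) (2 / 4 ^ Suc k) (x + shift k)"])
      (simp_all add: integral_spread[OF dom_g] del: power_Suc)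
  have d: "err_majorant k = (\<lambda>\<omega>. F (point \<omega>) + H (u (Suc k) \<omega>))" by (simp add: err_majorant_def F_def H_def fun_eq_iff)
  have "integrable M (\<lambda>\<omega>. H (u (Suc k) \<omega>))"
    by (rule integrable_const_bound[where B = "2 * V"])
      (use spread_nonneg[OF dom_g small(4)] spread_le[OF dom_g small(5)] in \<open>auto simp: H_def simp del: power_Suc\<close>)
  moreover have "integrable M (\<lambda>\<omega>. F (point \<omega>))"
    using Bochner_Integration.integrable_diff[OF err_majorant_integrable[of k] calculation] by (simp add: d)
  ultimately have "expectation (err_majorant k) = real (Q k) * (2 * ?e * V) + 2 * (2 / 4 ^ Suc k) * V"
    unfolding d by (simp add: F H del: power_Suc)
  also have "\<dots> = 6 * V / 4 ^ Suc k"
  proof -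
    have "real (Q k) * (2 * ?e * V) = 2 * V / 4 ^ Suc k" using Q_gt0[of k] by (simp del: power_Suc)
    then show ?thesis by (simp del: power_Suc)
  qed
  finally show ?thesis by simp
qed

text \<open>
The means of the errors decay geometrically, so the errors are almost surely summable.
\<close>

lemma AE_err_bounded: "AE \<omega> in M. \<exists>C. \<forall>n. \<bar>X n \<omega> - Y n \<omega>\<bar> \<le> C"
proof -
  have "AE \<omega> in M. summable (\<lambda>k. err_majorant k \<omega>)"
  proof (rule AE_summable_of_expectation[where c = "\<lambda>k. 6 * V * (1/4) ^ Suc k"])
    fix k
    have "(\<integral>\<^sup>+\<omega>. ennreal (err_majorant k \<omega>) \<partial>M) = ennreal (expectation (err_majorant k))"
      by (rule nn_integral_eq_integral[OF err_majorant_integrable]) (simp add: err_majorant_bounds)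
    also have "expectation (err_majorant k) \<le> 6 * V * (1/4) ^ Suc k"
      using err_majorant_mean[of k] by (simp add: power_divide del: power_Suc)
    finally show "(\<integral>\<^sup>+\<omega>. ennreal (err_majorant k \<omega>) \<partial>M) \<le> ennreal (6 * V * (1/4) ^ Suc k)"
      by (simp add: ennreal_leI)
    show "0 \<le> 6 * V * (1/4) ^ Suc k" using V_nonneg by simp
    show "summable (\<lambda>k. 6 * V * (1/4) ^ Suc k)" by (intro summable_mult) (simp add: summable_Suc_iff)
  qed (simp_all add: err_majorant_bounds)
  then show ?thesis
  proof eventually_elim
    case (elim \<omega>)
    show ?case
    proof (intro exI allI)
      fix n
      have "\<bar>X n \<omega> - Y n \<omega>\<bar> \<le> (\<Sum>k<n. \<bar>err k \<omega>\<bar>)" by (simp add: X_eq sum_abs)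
      also have "\<dots> \<le> (\<Sum>k<n. err_majorant k \<omega>)" by (intro sum_mono err_le)
      also have "\<dots> \<le> (\<Sum>k. err_majorant k \<omega>)" by (rule sum_le_suminf[OF elim]) (auto simp: err_majorant_bounds)
      finally show "\<bar>X n \<omega> - Y n \<omega>\<bar> \<le> (\<Sum>k. err_majorant k \<omega>)" .
    qed
  qed
qed

lemma \<xi>_indep: "indep_vars (\<lambda>_. borel) \<xi> UNIV"
proof -
  have "indep_vars (\<lambda>_. borel) (\<lambda>k. u (Suc k)) UNIV"
    by (rule indep_vars_reindex[OF indep_vars_subset[OF indep_u]]) auto
  then show ?thesis unfolding \<xi>_def[abs_def] by (rule indep_vars_compose2) simp
qed

lemma Y_measurable [measurable]: "Y n \<in> borel_measurable M"
  unfolding Y_def by measurable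

lemma Y_bound: "\<bar>Y n \<omega>\<bar> \<le> real n * V"
proof -
  have "\<bar>Y n \<omega>\<bar> \<le> (\<Sum>k<n. \<bar>\<xi> k \<omega>\<bar>)" unfolding Y_def by (rule sum_abs)
  also have "\<dots> \<le> (\<Sum>k<n. V)" by (intro sum_mono \<xi>_bound)
  finally show ?thesis by simp
qed

lemma square_integrable_of_bound:
  fixes f :: "'a \<Rightarrow> real" and B :: real
  assumes [measurable]: "f \<in> borel_measurable M" and "\<And>\<omega>. \<bar>f \<omega>\<bar> \<le> B"
  shows "integrable M (\<lambda>\<omega>. (f \<omega>)\<^sup>2)"
proof (rule integrable_const_bound[where B = "B\<^sup>2"])
  show "AE \<omega> in M. norm ((f \<omega>)\<^sup>2) \<le> B\<^sup>2"
    using power_mono[OF assms(2) abs_ge_zero, of _ 2] by (intro AE_I2) simp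
qed simp

lemma Y_square: "expectation (\<lambda>\<omega>. (Y n \<omega>)\<^sup>2) = total n"
proof (induction n)
  case 0
  then show ?case by (simp add: Y_def total_def)
next
  case (Suc n)
  have iY: "integrable M (Y n)"
    by (rule integrable_const_bound[where B = "real n * V"]) (use Y_bound in auto)
  have ind: "indep_var borel (Y n) borel (\<xi> n)"
  proof -
    have "indep_var borel (\<lambda>\<omega>. (\<lambda>f. \<Sum>k<n. f k) (\<lambda>k\<in>{..<n}. \<xi> k \<omega>)) borel (\<lambda>\<omega>. (\<lambda>f. f n) (\<lambda>k\<in>{n}. \<xi> k \<omega>))"
      by (rule indep_var_blocks[OF \<xi>_indep]) auto
    then show ?thesis by (simp add: Y_def[abs_def])
  qed
  have cross: "expectation (\<lambda>\<omega>. Y n \<omega> * \<xi> n \<omega>) = 0" "integrable M (\<lambda>\<omega>. Y n \<omega> * \<xi> n \<omega>)"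
    using indep_var_lebesgue_integral[OF ind iY \<xi>_integrable(1)] indep_var_integrable[OF ind iY \<xi>_integrable(1)] \<xi>_mean by auto
  have "expectation (\<lambda>\<omega>. (Y (Suc n) \<omega>)\<^sup>2) = expectation (\<lambda>\<omega>. (Y n \<omega>)\<^sup>2 + 2 * (Y n \<omega> * \<xi> n \<omega>) + (\<xi> n \<omega>)\<^sup>2)"
    by (intro Bochner_Integration.integral_cong refl) (simp add: Y_def power2_sum)
  also have "\<dots> = total n + 0 + var n"
    using Suc cross square_integrable_of_bound[OF Y_measurable Y_bound, of n] \<xi>_integrable(2)[of n] by (simp add: var_def)
  finally show ?case by (simp add: total_def)
qed

text \<open>
The errors are not independent. Cauchy--Schwarz with the weights \<open>2 ^ k\<close> compensates the number of terms,
and the geometric decay of the means absorbs the weights.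
\<close>

lemma err_square_sum: "expectation (\<lambda>\<omega>. (X n \<omega> - Y n \<omega>)\<^sup>2) \<le> 24 * V\<^sup>2" "integrable M (\<lambda>\<omega>. (X n \<omega> - Y n \<omega>)\<^sup>2)"
proof -
  have eb: "\<bar>err k \<omega>\<bar> \<le> 4 * V" for k \<omega> using err_le[of k \<omega>] err_majorant_bounds(2)[of k \<omega>] by linarith
  have Zb: "\<bar>X n \<omega> - Y n \<omega>\<bar> \<le> real n * (4 * V)" for \<omega>
  proof -
    have "\<bar>X n \<omega> - Y n \<omega>\<bar> \<le> (\<Sum>k<n. \<bar>err k \<omega>\<bar>)" by (simp add: X_eq sum_abs)
    also have "\<dots> \<le> (\<Sum>k<n. 4 * V)" by (intro sum_mono eb)
    finally show ?thesis by simp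
  qed
  have Zm [measurable]: "(\<lambda>\<omega>. X n \<omega> - Y n \<omega>) \<in> borel_measurable M" by (simp add: X_eq)
  show i: "integrable M (\<lambda>\<omega>. (X n \<omega> - Y n \<omega>)\<^sup>2)" by (rule square_integrable_of_bound[OF Zm Zb])
  have ie: "integrable M (\<lambda>\<omega>. (err k \<omega>)\<^sup>2)" for k by (rule square_integrable_of_bound[OF err_measurable eb])
  have e2: "expectation (\<lambda>\<omega>. (err k \<omega>)\<^sup>2) \<le> 24 * V\<^sup>2 / 4 ^ Suc k" for k
  proof -
    have "expectation (\<lambda>\<omega>. (err k \<omega>)\<^sup>2) \<le> expectation (\<lambda>\<omega>. 4 * V * err_majorant k \<omega>)"
    proof (rule integral_mono[OF ie])
      fix \<omega>
      have "\<bar>err k \<omega>\<bar> * \<bar>err k \<omega>\<bar> \<le> (4 * V) * err_majorant k \<omega>"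
        using eb err_le V_nonneg by (intro mult_mono) auto
      then show "(err k \<omega>)\<^sup>2 \<le> 4 * V * err_majorant k \<omega>" by (simp add: power2_eq_square)
    qed (simp add: err_majorant_integrable)
    also have "\<dots> = 4 * V * expectation (err_majorant k)" by simp
    also have "\<dots> \<le> 4 * V * (6 * V / 4 ^ Suc k)" using err_majorant_mean V_nonneg by (intro mult_left_mono) auto
    also have "\<dots> = 24 * V\<^sup>2 / 4 ^ Suc k" by (simp add: power2_eq_square del: power_Suc)
    finally show ?thesis .
  qed
  have cs: "(X n \<omega> - Y n \<omega>)\<^sup>2 \<le> 2 * (\<Sum>k<n. 2 ^ k * (err k \<omega>)\<^sup>2)" for \<omega>
  proof -
    have "X n \<omega> - Y n \<omega> = (\<Sum>k<n. sqrt (1/2) ^ k * (sqrt 2 ^ k * err k \<omega>))"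
      by (simp add: X_eq mult.assoc[symmetric] power_mult_distrib[symmetric] real_sqrt_mult[symmetric])
    then have "(X n \<omega> - Y n \<omega>)\<^sup>2 \<le> (\<Sum>k<n. (sqrt (1/2) ^ k)\<^sup>2) * (\<Sum>k<n. (sqrt 2 ^ k * err k \<omega>)\<^sup>2)"
      using Cauchy_Schwarz_ineq_sum[of "\<lambda>k. sqrt (1/2) ^ k" "\<lambda>k. sqrt 2 ^ k * err k \<omega>" "{..<n}"] by simp
    also have "(\<Sum>k<n. (sqrt 2 ^ k * err k \<omega>)\<^sup>2) = (\<Sum>k<n. 2 ^ k * (err k \<omega>)\<^sup>2)"
      by (intro sum.cong refl) (simp add: power_mult_distrib power_mult[symmetric] mult.commute[of _ 2] power_mult)
    also have "(\<Sum>k<n. (sqrt (1/2) ^ k)\<^sup>2) = (\<Sum>k<n. (1/2) ^ k)"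
      by (intro sum.cong refl) (simp add: power_mult[symmetric] mult.commute[of _ 2], simp add: power_mult)
    also have "(\<Sum>k<n. (1/2) ^ k) * (\<Sum>k<n. 2 ^ k * (err k \<omega>)\<^sup>2) \<le> 2 * (\<Sum>k<n. 2 ^ k * (err k \<omega>)\<^sup>2)"
    proof (rule mult_right_mono)
      have "(\<Sum>k<n. (1/2 :: real) ^ k) = 2 - 2 * (1/2) ^ n" by (induction n) simp_all
      then show "(\<Sum>k<n. (1/2 :: real) ^ k) \<le> 2" by simp
    qed (auto intro: sum_nonneg)
    finally show ?thesis .
  qed
  have "expectation (\<lambda>\<omega>. (X n \<omega> - Y n \<omega>)\<^sup>2) \<le> expectation (\<lambda>\<omega>. 2 * (\<Sum>k<n. 2 ^ k * (err k \<omega>)\<^sup>2))"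
    by (rule integral_mono[OF i]) (auto intro!: ie cs)
  also have "\<dots> = 2 * (\<Sum>k<n. 2 ^ k * expectation (\<lambda>\<omega>. (err k \<omega>)\<^sup>2))"
    using ie by (simp add: Bochner_Integration.integral_sum)
  also have "\<dots> \<le> 2 * (\<Sum>k<n. 2 ^ k * (24 * V\<^sup>2 / 4 ^ Suc k))"
    by (intro mult_left_mono sum_mono e2) auto
  also have "(\<Sum>k<n. 2 ^ k * (24 * V\<^sup>2 / 4 ^ Suc k)) = 12 * V\<^sup>2 * (1 - (1/2) ^ n)"
  proof (induction n)
    case (Suc n)
    have "(2::real) ^ n * (24 * V\<^sup>2 / 4 ^ Suc n) = 6 * V\<^sup>2 * (1/2) ^ n"
    proof -
      have "(4::real) ^ n = 2 ^ n * 2 ^ n" by (simp add: power_mult_distrib[symmetric])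
      then show ?thesis by (simp add: power_divide)
    qed
    then show ?case using Suc by (simp add: algebra_simps)
  qed simp
  also have "2 * (12 * V\<^sup>2 * (1 - (1/2) ^ n)) \<le> 24 * V\<^sup>2"
    by (simp add: algebra_simps)
  finally show "expectation (\<lambda>\<omega>. (X n \<omega> - Y n \<omega>)\<^sup>2) \<le> 24 * V\<^sup>2" .
qed

text \<open>
\<open>X\<close> differs from the sum of independent variables \<open>Y\<close> by an error bounded in mean square, while the
second moment \<open>total n\<close> of \<open>Y\<close> tends to infinity.
\<close>

lemma X_square_ratio: "(\<lambda>n. expectation (\<lambda>\<omega>. (X n \<omega>)\<^sup>2) / total n) \<longlonglongrightarrow> 1"
proof -
  define R where "R = 24 * V\<^sup>2"
  have R: "0 \<le> R" by (simp add: R_def)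
  have near: "\<bar>expectation (\<lambda>\<omega>. (X n \<omega>)\<^sup>2) / total n - 1\<bar> \<le> 1 / sqrt (real n) + (1 + sqrt (real n)) * R / (c * real n)" if n: "n \<ge> 1" for n
  proof -
    define s where "s = sqrt (real n)"
    have s: "0 < s" using n by (simp add: s_def)
    define Z where "Z \<omega> = X n \<omega> - Y n \<omega>" for \<omega>
    have iZ: "integrable M (\<lambda>\<omega>. (Z \<omega>)\<^sup>2)" and EZ: "expectation (\<lambda>\<omega>. (Z \<omega>)\<^sup>2) \<le> R"
      using err_square_sum[of n] by (simp_all add: Z_def R_def)
    have iY: "integrable M (\<lambda>\<omega>. (Y n \<omega>)\<^sup>2)" by (rule square_integrable_of_bound[OF Y_measurable Y_bound])
    have [measurable]: "Z \<in> borel_measurable M" unfolding Z_def X_eq by simp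
    have pw: "\<bar>(X n \<omega>)\<^sup>2 - (Y n \<omega>)\<^sup>2\<bar> \<le> (Y n \<omega>)\<^sup>2 / s + (1 + s) * (Z \<omega>)\<^sup>2" for \<omega>
    proof -
      have e: "(X n \<omega>)\<^sup>2 - (Y n \<omega>)\<^sup>2 = 2 * (Y n \<omega> * Z \<omega>) + (Z \<omega>)\<^sup>2"
        by (simp add: Z_def power2_eq_square algebra_simps)
      have "0 \<le> (\<bar>Y n \<omega>\<bar> - s * \<bar>Z \<omega>\<bar>)\<^sup>2 / s" using s by simp
      also have "\<dots> = (Y n \<omega>)\<^sup>2 / s + s * (Z \<omega>)\<^sup>2 - 2 * (\<bar>Y n \<omega>\<bar> * \<bar>Z \<omega>\<bar>)"
        using s by (simp add: power2_diff power_mult_distrib field_simps power2_eq_square)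
      finally have "2 * \<bar>Y n \<omega> * Z \<omega>\<bar> \<le> (Y n \<omega>)\<^sup>2 / s + s * (Z \<omega>)\<^sup>2" by (simp add: abs_mult)
      moreover have "\<bar>2 * (Y n \<omega> * Z \<omega>) + (Z \<omega>)\<^sup>2\<bar> \<le> 2 * \<bar>Y n \<omega> * Z \<omega>\<bar> + (Z \<omega>)\<^sup>2"
        using abs_triangle_ineq[of "2 * (Y n \<omega> * Z \<omega>)" "(Z \<omega>)\<^sup>2"] by (simp add: abs_mult)
      ultimately show ?thesis unfolding e by (simp add: distrib_right)
    qed
    have ib: "integrable M (\<lambda>\<omega>. (Y n \<omega>)\<^sup>2 / s + (1 + s) * (Z \<omega>)\<^sup>2)" using iY iZ by simp
    have [measurable]: "X n \<in> borel_measurable M" unfolding X_eq[abs_def] by simp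
    have idf: "integrable M (\<lambda>\<omega>. (X n \<omega>)\<^sup>2 - (Y n \<omega>)\<^sup>2)"
      by (rule Bochner_Integration.integrable_bound[OF ib]) (use order_trans[OF pw abs_ge_self] in auto)
    have iX: "integrable M (\<lambda>\<omega>. (X n \<omega>)\<^sup>2)"
      using Bochner_Integration.integrable_add[OF idf iY] by simp
    have "\<bar>expectation (\<lambda>\<omega>. (X n \<omega>)\<^sup>2) - total n\<bar> = \<bar>expectation (\<lambda>\<omega>. (X n \<omega>)\<^sup>2 - (Y n \<omega>)\<^sup>2)\<bar>"
      using iX iY by (simp add: Y_square)
    also have "\<dots> \<le> expectation (\<lambda>\<omega>. \<bar>(X n \<omega>)\<^sup>2 - (Y n \<omega>)\<^sup>2\<bar>)" by (rule integral_abs_bound)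
    also have "\<dots> \<le> expectation (\<lambda>\<omega>. (Y n \<omega>)\<^sup>2 / s + (1 + s) * (Z \<omega>)\<^sup>2)"
      by (rule integral_mono[OF integrable_abs[OF idf] ib]) (rule pw)
    also have "\<dots> = total n / s + (1 + s) * expectation (\<lambda>\<omega>. (Z \<omega>)\<^sup>2)"
      using iY iZ by (simp add: Y_square)
    also have "\<dots> \<le> total n / s + (1 + s) * R" using EZ s by (intro add_left_mono mult_left_mono) auto
    finally have d: "\<bar>expectation (\<lambda>\<omega>. (X n \<omega>)\<^sup>2) - total n\<bar> \<le> total n / s + (1 + s) * R" .
    have cn: "0 < c * real n" using c_pos n by simp
    then have t: "0 < total n" using total_lower[of n] by linarith
    have "\<bar>expectation (\<lambda>\<omega>. (X n \<omega>)\<^sup>2) / total n - 1\<bar> = \<bar>expectation (\<lambda>\<omega>. (X n \<omega>)\<^sup>2) - total n\<bar> / total n"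
    proof -
      have "expectation (\<lambda>\<omega>. (X n \<omega>)\<^sup>2) / total n - 1 = (expectation (\<lambda>\<omega>. (X n \<omega>)\<^sup>2) - total n) / total n"
        using t by (simp add: diff_divide_distrib)
      then show ?thesis using t by (simp add: abs_divide)
    qed
    also have "\<dots> \<le> (total n / s + (1 + s) * R) / total n" using d t by (intro divide_right_mono) auto
    also have "\<dots> = 1 / s + (1 + s) * R / total n" using t by (simp add: add_divide_distrib)
    also have "\<dots> \<le> 1 / s + (1 + s) * R / (c * real n)"
      using total_lower[of n] cn R s t by (intro add_left_mono divide_left_mono) auto
    finally show ?thesis unfolding s_def .
  qed
  have "(\<lambda>n. 1 / sqrt (real n) + (1 + sqrt (real n)) * R / (c * real n)) \<longlonglongrightarrow> 0"
    using c_pos by real_asymp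
  then have "(\<lambda>n. expectation (\<lambda>\<omega>. (X n \<omega>)\<^sup>2) / total n - 1) \<longlonglongrightarrow> 0"
    by (rule Lim_null_comparison[rotated]) (use near in \<open>auto simp: eventually_sequentially intro!: exI[of _ 1]\<close>)
  then show ?thesis by (rule LIM_zero_cancel)
qed

end

section \<open>Normal approximation of blocks\<close>

lemma normal_law_standardize:
  assumes [measurable]: "X \<in> borel_measurable M" and s: "0 < s" and d: "distr M borel X = normal_law s"
  shows "distr M borel (\<lambda>\<omega>. X \<omega> / sqrt s) = normal_law 1"
proof -
  have "distr M borel (\<lambda>\<omega>. X \<omega> / sqrt s) = distr (distr M borel X) borel (\<lambda>x. x / sqrt s)"
    by (subst distr_distr) (auto simp: comp_def)
  also have "\<dots> = distr std_normal_distribution borel (\<lambda>z. sqrt s * z / sqrt s)"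
    unfolding d normal_law_def by (subst distr_distr) (auto simp: comp_def)
  also have "\<dots> = normal_law 1" using s by (simp add: normal_law_def)
  finally show ?thesis .
qed

definition uniform_mean :: real where "uniform_mean = (\<integral>x. x \<partial>unit_uniform)"

definition uniform_variance :: real where "uniform_variance = (\<integral>x. (x - uniform_mean)\<^sup>2 \<partial>unit_uniform)"

lemma AE_unit_uniform: "AE x in unit_uniform. 0 \<le> x \<and> x < 1"
  unfolding unit_uniform_def by (subst AE_distr_iff) (auto simp: id_measurable_circle space_circle intro!: AE_I2)

lemma uniform_mean_bounds: "0 \<le> uniform_mean" "uniform_mean \<le> 1"
proof -
  interpret U: prob_space unit_uniform by (rule prob_space_unit_uniform)
  have i: "integrable unit_uniform (\<lambda>x. x)"
    by (rule U.integrable_const_bound[where B = 1]) (use AE_unit_uniform in \<open>auto elim: eventually_mono\<close>)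
  show "0 \<le> uniform_mean" unfolding uniform_mean_def
    by (rule integral_nonneg_AE) (use AE_unit_uniform in \<open>auto elim: eventually_mono\<close>)
  show "uniform_mean \<le> 1" unfolding uniform_mean_def
    by (rule U.integral_le_const[OF i]) (use AE_unit_uniform in \<open>auto elim: eventually_mono\<close>)
qed

text \<open>
The uniform law has no atoms and so is not concentrated at its mean.
\<close>

lemma uniform_variance_pos: "0 < uniform_variance"
proof -
  interpret U: prob_space unit_uniform by (rule prob_space_unit_uniform)
  have i: "integrable unit_uniform (\<lambda>x. (x - uniform_mean)\<^sup>2)"
  proof (rule U.integrable_const_bound[where B = 1])
    show "AE x in unit_uniform. norm ((x - uniform_mean)\<^sup>2) \<le> 1"
      using AE_unit_uniform
    proof eventually_elim
      case (elim x)
      then have "\<bar>x - uniform_mean\<bar> \<le> 1" using uniform_mean_bounds by linarith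
      then show ?case using power_mono[of "\<bar>x - uniform_mean\<bar>" 1 2] by simp
    qed
  qed simp
  have "uniform_variance \<noteq> 0"
  proof
    assume "uniform_variance = 0"
    then have "AE x in unit_uniform. (x - uniform_mean)\<^sup>2 = 0"
      unfolding uniform_variance_def using i by (subst (asm) integral_nonneg_eq_0_iff_AE) auto
    moreover have "AE x in unit_uniform. x \<noteq> uniform_mean"
      by (rule AE_I[where N = "{uniform_mean}"]) (auto simp: unit_uniform_atom)
    ultimately have "AE x in unit_uniform. False" by eventually_elim simp
    then show False by simp
  qed
  moreover have "0 \<le> uniform_variance" unfolding uniform_variance_def by (rule integral_nonneg_AE) simp
  ultimately show ?thesis by simp
qed

context lacunary_sums
begin

text \<open>
Adding this variable to the sum over a block removes all atoms, as \<open>monotone_coupling\<close> requires. Its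
positive variance also forces the block variances to have a divergent sum, so that the Wiener process is
defined for all times.
\<close>

definition noise :: "nat \<Rightarrow> 'a \<Rightarrow> real" where "noise j \<omega> = frac (Xc (1, j) \<omega>) - uniform_mean"

lemma noise_measurable [measurable]: "noise j \<in> borel_measurable M"
  unfolding noise_def by measurable

lemma noise_bound: "\<bar>noise j \<omega>\<bar> \<le> 1"
  unfolding noise_def using uniform_mean_bounds frac_ge_0[of "Xc (1, j) \<omega>"] frac_lt_1[of "Xc (1, j) \<omega>"] by linarith

lemma distr_frac_noise: "distr M borel (\<lambda>\<omega>. frac (Xc (1, j) \<omega>)) = unit_uniform"
  by (rule distr_frac_uniform[OF Xc_measurable law1])

lemma expectation_noise:
  fixes F :: "real \<Rightarrow> real"
  assumes [measurable]: "F \<in> borel_measurable borel"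
  shows "expectation (\<lambda>\<omega>. F (frac (Xc (1, j) \<omega>))) = (\<integral>x. F x \<partial>unit_uniform)"
proof -
  have "(\<integral>x. F x \<partial>distr M borel (\<lambda>\<omega>. frac (Xc (1, j) \<omega>))) = expectation (\<lambda>\<omega>. F (frac (Xc (1, j) \<omega>)))"
    by (rule integral_distr) simp_all
  then show ?thesis by (simp only: distr_frac_noise)
qed

lemma noise_mean: "expectation (noise j) = 0"
proof -
  have i: "integrable M (\<lambda>\<omega>. frac (Xc (1, j) \<omega>))"
    by (rule integrable_const_bound[where B = 1]) (auto simp: less_imp_le[OF frac_lt_1])
  have "expectation (noise j) = expectation (\<lambda>\<omega>. frac (Xc (1, j) \<omega>)) - uniform_mean"
    unfolding noise_def[abs_def] using i by (simp add: prob_space)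
  also have "expectation (\<lambda>\<omega>. frac (Xc (1, j) \<omega>)) = uniform_mean"
    unfolding uniform_mean_def by (rule expectation_noise[of "\<lambda>x. x"]) simp
  finally show ?thesis by simp
qed

lemma noise_square: "expectation (\<lambda>\<omega>. (noise j \<omega>)\<^sup>2) = uniform_variance"
  unfolding noise_def uniform_variance_def by (rule expectation_noise) simp

text \<open>
One family over the indices of \<open>Xc\<close> for the contributions, the noise and the normal variables, so that
a single independence statement serves all the groupings.
\<close>

definition \<Xi> :: "nat \<times> nat \<Rightarrow> 'a \<Rightarrow> real" where
  "\<Xi> i \<omega> = (if fst i = 0 then if snd i = 0 then Xc i \<omega> else \<xi> (snd i - 1) \<omega>
     else if fst i = 1 then noise (snd i) \<omega> else Xc i \<omega>)"

lemma \<Xi>_simps [simp]: "\<Xi> (0, Suc k) = \<xi> k" "\<Xi> (1, j) = noise j" "\<Xi> (Suc 0, j) = noise j" "\<Xi> (Suc (Suc n), j) = Xc (Suc (Suc n), j)"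
  by (simp_all add: \<Xi>_def fun_eq_iff)

lemma \<Xi>_indep: "indep_vars (\<lambda>_. borel) \<Xi> UNIV"
proof -
  define \<psi> where "\<psi> i x = (if fst i = 0 then if snd i = 0 then x else g (snd i - 1) (frac x + shift (snd i - 1))
     else if fst i = 1 then frac x - uniform_mean else x)" for i :: "nat \<times> nat" and x
  have "\<Xi> = (\<lambda>i \<omega>. \<psi> i (Xc i \<omega>))"
    by (auto simp: fun_eq_iff \<psi>_def \<Xi>_def \<xi>_def u_def noise_def)
  moreover have "indep_vars (\<lambda>_. borel) (\<lambda>i \<omega>. \<psi> i (Xc i \<omega>)) UNIV"
  proof (rule indep_vars_compose2[OF indep_Xc])
    show "\<psi> i \<in> borel_measurable borel" for i
      unfolding \<psi>_def[abs_def] by (cases "fst i = 0"; cases "snd i = 0"; cases "fst i = 1") simp_all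
  qed
  ultimately show ?thesis by simp
qed

text \<open>
With sixth powers as the end points, the coupling errors of the completed blocks and the fluctuation in
the incomplete block are both at most \<open>n powr (17/36)\<close> up to a constant factor.
\<close>

definition block :: "nat \<Rightarrow> nat set" where "block j = {j ^ 6..<Suc j ^ 6}"

lemma finite_block [simp]: "finite (block j)" by (simp add: block_def)

lemma block_disjoint: "k \<in> block i \<Longrightarrow> k \<in> block j \<Longrightarrow> i = j"
proof (induction i j rule: linorder_wlog)
  case (le i j)
  show ?case
  proof (rule ccontr)
    assume "i \<noteq> j"
    then have "Suc i ^ 6 \<le> j ^ 6" using le by (intro power_mono) auto
    then show False using le unfolding block_def by (meson atLeastLessThan_iff leD order_trans)
  qed
qed simp

lemma card_block: "real (card (block j)) \<le> 6 * (real j + 1) ^ 5"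
proof -
  have "real (card (block j)) = (real j + 1) ^ 6 - real j ^ 6"
  proof -
    have "j ^ 6 \<le> Suc j ^ 6" by (rule power_mono) auto
    then have "real (Suc j ^ 6 - j ^ 6) = real (Suc j ^ 6) - real (j ^ 6)" by (rule of_nat_diff)
    then show ?thesis by (simp add: block_def add.commute)
  qed
  also have "\<dots> = (\<Sum>i\<in>{..<6::nat}. (real j + 1) ^ i * real j ^ (5 - i))"
    using power_diff_sumr2[of "real j + 1" 6 "real j"] by (simp add: mult.commute)
  also have "\<dots> \<le> (\<Sum>i\<in>{..<6::nat}. (real j + 1) ^ 5)"
  proof (rule sum_mono)
    fix i :: nat assume "i \<in> {..<6}"
    then have "(real j + 1) ^ i * real j ^ (5 - i) \<le> (real j + 1) ^ i * (real j + 1) ^ (5 - i)"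
      by (intro mult_left_mono power_mono) auto
    also have "\<dots> = (real j + 1) ^ 5" using \<open>i \<in> {..<6}\<close> by (simp flip: power_add)
    finally show "(real j + 1) ^ i * real j ^ (5 - i) \<le> (real j + 1) ^ 5" .
  qed
  finally show ?thesis by simp
qed

lemma sum_blocks: "(\<Sum>i<j. \<Sum>k\<in>block i. f k) = (\<Sum>k<j ^ 6. f k)" for f :: "nat \<Rightarrow> real"
proof (induction j)
  case (Suc j)
  have "j ^ 6 \<le> Suc j ^ 6" by (rule power_mono) auto
  then have "{..<Suc j ^ 6} = {..<j ^ 6} \<union> block j" unfolding block_def using ivl_disj_un_one(2)[of "j ^ 6" "Suc j ^ 6"] by (simp only: )
  moreover have "{..<j ^ 6} \<inter> block j = {}" by (auto simp: block_def)
  ultimately show ?case using Suc by (simp add: sum.union_disjoint)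
qed simp

text \<open>
The indices of \<open>\<Xi>\<close> that contribute to the \<open>j\<close>-th block, including its noise.
\<close>

definition members :: "nat \<Rightarrow> (nat \<times> nat) set" where
  "members j = insert (1, j) ((\<lambda>k. (0, Suc k)) ` block j)"

lemma sum_members: "(\<Sum>i\<in>members j. F i) = F (1, j) + (\<Sum>k\<in>block j. F (0, Suc k))" for F :: "_ \<Rightarrow> real"
  unfolding members_def by (subst sum.insert) (auto simp: sum.reindex inj_on_def)

lemma card_members: "real (card (members j)) \<le> 7 * (real j + 1) ^ 5"
proof -
  have "card (members j) \<le> Suc (card (block j))"
    unfolding members_def using card_image_le[OF finite_block, of "\<lambda>k. (0, Suc k)" j]
    by (subst card_insert_disjoint) auto
  then have "real (card (members j)) \<le> real (card (block j)) + 1" by linarith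
  moreover have "1 \<le> (real j + 1) ^ 5" by (rule one_le_power) simp
  ultimately show ?thesis using card_block[of j] by linarith
qed

definition S :: "nat \<Rightarrow> 'a \<Rightarrow> real" where "S j \<omega> = noise j \<omega> + (\<Sum>k\<in>block j. \<xi> k \<omega>)"

lemma S_measurable [measurable]: "S j \<in> borel_measurable M"
  unfolding S_def by measurable

lemma S_eq: "S j \<omega> = (\<Sum>i\<in>members j. \<Xi> i \<omega>)"
  by (simp add: S_def sum_members)

lemma S_no_atoms: "prob {\<omega>\<in>space M. S j \<omega> = s} = 0"
proof -
  have ind: "indep_var borel (\<lambda>\<omega>. \<Sum>k\<in>block j. \<xi> k \<omega>) borel (noise j)"
  proof -
    have "indep_var borel (\<lambda>\<omega>. (\<lambda>f. \<Sum>k\<in>block j. f (0, Suc k)) (\<lambda>i\<in>(\<lambda>k. (0, Suc k)) ` block j. \<Xi> i \<omega>))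
        borel (\<lambda>\<omega>. (\<lambda>f. f (1, j)) (\<lambda>i\<in>{(1, j)}. \<Xi> i \<omega>))"
      by (rule indep_var_blocks[OF \<Xi>_indep]) auto
    then show ?thesis by simp
  qed
  have inner: "(\<integral>\<^sup>+y. indicator {s} (x + y) \<partial>distr M borel (noise j)) = 0" for x
  proof -
    have "(\<integral>\<^sup>+y. indicator {s} (x + y) \<partial>distr M borel (noise j)) = (\<integral>\<^sup>+\<omega>. indicator {s} (x + noise j \<omega>) \<partial>M)"
      by (rule nn_integral_distr) simp_all
    also have "\<dots> = (\<integral>\<^sup>+\<omega>. indicator {s - x + uniform_mean} (frac (Xc (1, j) \<omega>)) \<partial>M)"
      by (intro nn_integral_cong) (auto simp: noise_def indicator_def)
    also have "\<dots> = (\<integral>\<^sup>+y. indicator {s - x + uniform_mean} y \<partial>distr M borel (\<lambda>\<omega>. frac (Xc (1, j) \<omega>)))"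
      by (rule nn_integral_distr[symmetric]) simp_all
    also have "\<dots> = 0" unfolding distr_frac_noise by (simp add: unit_uniform_atom)
    finally show ?thesis .
  qed
  have "emeasure M {\<omega>\<in>space M. S j \<omega> = s} = (\<integral>\<^sup>+\<omega>. indicator {\<omega>\<in>space M. S j \<omega> = s} \<omega> \<partial>M)"
    by (rule nn_integral_indicator[symmetric]) simp
  also have "\<dots> = (\<integral>\<^sup>+\<omega>. (\<lambda>(x, y). indicator {s} (x + y)) (\<Sum>k\<in>block j. \<xi> k \<omega>, noise j \<omega>) \<partial>M)"
    by (intro nn_integral_cong) (auto simp: S_def indicator_def add.commute)
  also have "\<dots> = (\<integral>\<^sup>+x. \<integral>\<^sup>+y. (\<lambda>(x, y). indicator {s} (x + y)) (x, y) \<partial>distr M borel (noise j) \<partial>distr M borel (\<lambda>\<omega>. \<Sum>k\<in>block j. \<xi> k \<omega>))"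
    by (rule indep_var_nn_integral_pair[OF ind]) measurable
  also have "\<dots> = 0" by (simp add: inner)
  finally show ?thesis by (simp add: measure_def)
qed

text \<open>
The length of the time interval of the Wiener process for the \<open>j\<close>-th block, which is the variance of
\<open>S j\<close>.
\<close>

definition len :: "nat \<Rightarrow> real" where "len j = uniform_variance + (\<Sum>k\<in>block j. var k)"

lemma len_pos: "0 < len j"
  unfolding len_def using uniform_variance_pos var_bounds by (intro add_pos_nonneg sum_nonneg) auto

lemma sum_len: "(\<Sum>i<j. len i) = real j * uniform_variance + total (j ^ 6)"
  by (simp add: len_def sum.distrib sum_blocks total_def)

definition rate :: real where "rate = 4 * (1 + (1 + abs_moment3) * max V 1 ^ 3) * 2"

lemma rate_nonneg: "0 \<le> rate"
proof -
  have "0 \<le> abs_moment3" unfolding abs_moment3_def by (rule integral_nonneg_AE) simp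
  then show ?thesis unfolding rate_def by simp
qed

text \<open>
A block has at most \<open>7 (j + 1)\<^sup>5\<close> members, and \<open>lipschitz_clt\<close> costs the cube root of their number.
\<close>

lemma block_coupling:
  "\<exists>h. h \<in> borel_measurable borel \<and> distr M borel (\<lambda>\<omega>. h (S j \<omega>)) = normal_law (len j)
     \<and> (\<integral>\<^sup>+\<omega>. ennreal \<bar>S j \<omega> - h (S j \<omega>)\<bar> \<partial>M) \<le> ennreal (rate * (real j + 1) powr (5/3))"
proof -
  have close: "\<bar>expectation (\<lambda>\<omega>. f (S j \<omega>)) - (\<integral>x. f x \<partial>normal_law (len j))\<bar> \<le> rate * (real j + 1) powr (5/3)"
    if A: "\<And>x. \<bar>f x\<bar> \<le> A" and lip: "\<And>x y. \<bar>f x - f y\<bar> \<le> \<bar>x - y\<bar>" for f :: "real \<Rightarrow> real" and A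
  proof -
    let ?K = "4 * (1 + (1 + abs_moment3) * max V 1 ^ 3)"
    have v: "(\<Sum>i\<in>members j. expectation (\<lambda>\<omega>. (\<Xi> i \<omega>)\<^sup>2)) = len j"
      by (simp add: sum_members len_def noise_square var_def)
    have ind: "indep_vars (\<lambda>_. borel) \<Xi> (members j)" by (rule indep_vars_subset[OF \<Xi>_indep]) simp
    have bd: "\<bar>\<Xi> i \<omega>\<bar> \<le> max V 1" if "i \<in> members j" for i \<omega>
      using that \<xi>_bound noise_bound by (auto simp: members_def le_max_iff_disj)
    have mn: "expectation (\<Xi> i) = 0" if "i \<in> members j" for i
      using that \<xi>_mean noise_mean by (auto simp: members_def)
    have fin: "finite (members j)" "members j \<noteq> {}" by (auto simp: members_def)
    have "\<bar>expectation (\<lambda>\<omega>. f (\<Sum>i\<in>members j. \<Xi> i \<omega>)) - (\<integral>x. f x \<partial>normal_law (\<Sum>i\<in>members j. expectation (\<lambda>\<omega>. (\<Xi> i \<omega>)\<^sup>2)))\<bar>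
        \<le> ?K * real (card (members j)) powr (1/3)"
      by (rule lipschitz_clt[OF fin ind bd mn _ A lip]) simp_all
    also have "\<dots> \<le> ?K * (2 * (real j + 1) powr (5/3))"
    proof (rule mult_left_mono)
      have "real (card (members j)) \<le> 8 * (real j + 1) ^ 5"
        using card_members[of j] by (rule order_trans) simp
      then have "real (card (members j)) powr (1/3) \<le> (8 * (real j + 1) ^ 5) powr (1/3)" by (intro powr_mono2) auto
      also have "\<dots> = (2 powr 3 * (real j + 1) powr 5) powr (1/3)" by (simp only: powr_numeral) simp
      also have "\<dots> = 2 * (real j + 1) powr (5/3)" by (simp add: powr_mult powr_powr del: powr_numeral)
      finally show "real (card (members j)) powr (1/3) \<le> 2 * (real j + 1) powr (5/3)" .
      show "0 \<le> ?K" using rate_nonneg unfolding rate_def by simp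
    qed
    also have "\<dots> = rate * (real j + 1) powr (5/3)" by (simp add: rate_def)
    finally show ?thesis by (simp only: v S_eq)
  qed
  show ?thesis
    by (rule monotone_coupling[OF S_measurable S_no_atoms real_distribution_normal_law close]) blast+
qed

definition to_normal :: "nat \<Rightarrow> real \<Rightarrow> real" where
  "to_normal j = (SOME h. h \<in> borel_measurable borel \<and> distr M borel (\<lambda>\<omega>. h (S j \<omega>)) = normal_law (len j)
     \<and> (\<integral>\<^sup>+\<omega>. ennreal \<bar>S j \<omega> - h (S j \<omega>)\<bar> \<partial>M) \<le> ennreal (rate * (real j + 1) powr (5/3)))"

lemma to_normal:
  shows to_normal_measurable [measurable]: "to_normal j \<in> borel_measurable borel"
    and distr_to_normal: "distr M borel (\<lambda>\<omega>. to_normal j (S j \<omega>)) = normal_law (len j)"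
    and to_normal_close: "(\<integral>\<^sup>+\<omega>. ennreal \<bar>S j \<omega> - to_normal j (S j \<omega>)\<bar> \<partial>M) \<le> ennreal (rate * (real j + 1) powr (5/3))"
  using someI_ex[OF block_coupling[of j]] unfolding to_normal_def by blast+

text \<open>
The standard normal variables that drive the construction of the Wiener process: the normalised images
of the block sums determine the increments over the block intervals, and the remaining rows of \<open>Xc\<close>
fill in the paths.
\<close>

definition gauss :: "nat \<Rightarrow> nat \<Rightarrow> 'a \<Rightarrow> real" where
  "gauss n i \<omega> = (case n of 0 \<Rightarrow> to_normal i (S i \<omega>) / sqrt (len i) | Suc n \<Rightarrow> Xc (Suc (Suc n), i) \<omega>)"

sublocale levy M gauss len
proof
  define K :: "nat \<times> nat \<Rightarrow> (nat \<times> nat) set" where "K = (\<lambda>(n, i). case n of 0 \<Rightarrow> members i | Suc n \<Rightarrow> {(Suc (Suc n), i)})"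
  define G :: "nat \<times> nat \<Rightarrow> (nat \<times> nat \<Rightarrow> real) \<Rightarrow> real" where
    "G = (\<lambda>(n, i) f. case n of 0 \<Rightarrow> to_normal i (\<Sum>k\<in>members i. f k) / sqrt (len i) | Suc n \<Rightarrow> f (Suc (Suc n), i))"
  have "indep_vars (\<lambda>_. borel) (\<lambda>j \<omega>. G j (\<lambda>i\<in>K j. \<Xi> i \<omega>)) UNIV"
  proof (rule indep_vars_blocks[OF \<Xi>_indep])
    show "disjoint_family_on K UNIV"
      unfolding disjoint_family_on_def
    proof (intro ballI impI)
      fix a b :: "nat \<times> nat" assume "a \<noteq> b"
      obtain n i m j where ab: "a = (n, i)" "b = (m, j)" by (metis surj_pair)
      show "K a \<inter> K b = {}"
        using \<open>a \<noteq> b\<close> block_disjoint unfolding ab by (cases n; cases m) (auto simp: K_def members_def)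
    qed
    show "G j \<in> borel_measurable (PiM (K j) (\<lambda>_. borel))" for j
    proof -
      obtain n i where j: "j = (n, i)" by (metis surj_pair)
      show ?thesis
      proof (cases n)
        case 0
        have [measurable]: "(\<lambda>f. \<Sum>k\<in>members i. f k) \<in> borel_measurable (PiM (members i) (\<lambda>_. borel :: real measure))"
          by (intro borel_measurable_sum measurable_component_singleton)
        show ?thesis unfolding j 0 G_def K_def by simp
      next
        case (Suc m)
        then show ?thesis unfolding j Suc G_def K_def by simp
      qed
    qed
  qed simp
  also have "(\<lambda>j \<omega>. G j (\<lambda>i\<in>K j. \<Xi> i \<omega>)) = (\<lambda>(n, i). gauss n i)"
  proof (intro ext)
    fix j :: "nat \<times> nat" and \<omega>
    obtain n i where j: "j = (n, i)" by (metis surj_pair)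
    show "G j (\<lambda>i\<in>K j. \<Xi> i \<omega>) = (\<lambda>(n, i). gauss n i) j \<omega>"
      unfolding j by (cases n) (simp_all add: G_def K_def gauss_def S_eq)
  qed
  finally show "indep_vars (\<lambda>_. borel) (\<lambda>(n, i). gauss n i) UNIV" .
  show "distr M borel (gauss n i) = normal_law 1" for n i
  proof (cases n)
    case 0
    show ?thesis unfolding gauss_def[abs_def] 0 nat.case
      by (rule normal_law_standardize[OF _ len_pos distr_to_normal]) simp
  next
    case (Suc m)
    show ?thesis unfolding gauss_def[abs_def] Suc nat.case by (rule law2)
  qed
  show "0 < len j" for j by (rule len_pos)
  show "filterlim (\<lambda>j. \<Sum>i<j. len i) at_top sequentially"
  proof (rule filterlim_at_top_mono)
    show "filterlim (\<lambda>j. uniform_variance * real j) at_top sequentially"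
      using uniform_variance_pos by real_asymp
    show "\<forall>\<^sub>F j in sequentially. uniform_variance * real j \<le> (\<Sum>i<j. len i)"
    proof (intro always_eventually allI)
      fix j
      have "0 \<le> total (j ^ 6)" unfolding total_def by (intro sum_nonneg var_bounds)
      then show "uniform_variance * real j \<le> (\<Sum>i<j. len i)" unfolding sum_len by (simp add: mult.commute)
    qed
  qed
qed

lemma sum_sqrt_gauss: "(\<Sum>i<j. sqrt (len i) * gauss 0 i \<omega>) = (\<Sum>i<j. to_normal i (S i \<omega>))"
  by (intro sum.cong refl) (use len_pos in \<open>simp add: gauss_def less_imp_neq[symmetric]\<close>)

end

section \<open>The approximation error\<close>

text \<open>
The number of blocks that are complete at the index \<open>n\<close>.
\<close>

definition sixth_root :: "nat \<Rightarrow> nat" where "sixth_root n = nat \<lfloor>root 6 (real n)\<rfloor>"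

lemma sixth_root_bounds: "sixth_root n ^ 6 \<le> n" "n < Suc (sixth_root n) ^ 6"
proof -
  define r where "r = root 6 (real n)"
  have r: "0 \<le> r" "r ^ 6 = real n" by (simp_all add: r_def real_root_pow_pos2)
  have s: "real (sixth_root n) \<le> r" "r < real (sixth_root n) + 1"
    using r(1) by (simp_all add: sixth_root_def r_def[symmetric] floor_less_iff of_nat_nat)
  have "real (sixth_root n) ^ 6 \<le> real n" unfolding r(2)[symmetric] using s by (intro power_mono) auto
  then show "sixth_root n ^ 6 \<le> n" by (simp flip: of_nat_power)
  have "real n < (real (sixth_root n) + 1) ^ 6"
    unfolding r(2)[symmetric] using s(2) r(1) by (intro power_strict_mono) auto
  then have "real n < real (Suc (sixth_root n) ^ 6)" by (simp add: add.commute)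
  then show "n < Suc (sixth_root n) ^ 6" by (simp only: of_nat_less_iff)
qed

lemma sixth_root_mono: "m \<le> n \<Longrightarrow> sixth_root m \<le> sixth_root n"
  unfolding sixth_root_def by (intro nat_mono floor_mono real_root_le_mono) auto

lemma sixth_root_powr:
  assumes "1 \<le> n"
  shows "1 \<le> sixth_root n" "0 \<le> a \<Longrightarrow> real (sixth_root n) powr a \<le> real n powr (a / 6)"
    "(real (sixth_root n) + 1) ^ 5 \<le> 32 * real n powr (5/6)"
proof -
  show one: "1 \<le> sixth_root n"
    using sixth_root_mono[OF assms] by (simp add: sixth_root_def)
  have "real (sixth_root n) = (real (sixth_root n) powr 6) powr (1/6)" using one by (simp add: powr_powr del: powr_numeral)
  also have "\<dots> \<le> real n powr (1/6)"
  proof (rule powr_mono2)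
    have "real (sixth_root n ^ 6) \<le> real n" using sixth_root_bounds(1)[of n] by (simp only: of_nat_le_iff)
    then show "real (sixth_root n) powr 6 \<le> real n" by simp
  qed auto
  finally have le: "real (sixth_root n) \<le> real n powr (1/6)" .
  show "real (sixth_root n) powr a \<le> real n powr (a / 6)" if "0 \<le> a"
    using powr_mono2[OF that _ le] by (simp add: powr_powr mult.commute)
  have "real (sixth_root n) + 1 \<le> 2 * real n powr (1/6)" using le one by simp
  then have "(real (sixth_root n) + 1) ^ 5 \<le> (2 * real n powr (1/6)) ^ 5" by (intro power_mono) auto
  also have "\<dots> = 32 * real n powr (5/6)" using assms by (simp add: power_mult_distrib powr_power)
  finally show "(real (sixth_root n) + 1) ^ 5 \<le> 32 * real n powr (5/6)" .
qed

context lacunary_sums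
begin

definition tail :: "nat \<Rightarrow> nat set" where "tail n = {sixth_root n ^ 6..<n}"

lemma finite_tail [simp]: "finite (tail n)" by (simp add: tail_def)

lemma card_tail: "1 \<le> n \<Longrightarrow> real (card (tail n)) \<le> 192 * real n powr (5/6)"
proof -
  assume n: "1 \<le> n"
  have "tail n \<subseteq> block (sixth_root n)" using sixth_root_bounds[of n] by (auto simp: tail_def block_def)
  then have "card (tail n) \<le> card (block (sixth_root n))" by (intro card_mono) auto
  then show ?thesis using card_block[of "sixth_root n"] sixth_root_powr(3)[OF n] by linarith
qed

lemma Y_tail: "Y n \<omega> = Y (sixth_root n ^ 6) \<omega> + (\<Sum>k\<in>tail n. \<xi> k \<omega>)"
  and total_tail: "total n = total (sixth_root n ^ 6) + (\<Sum>k\<in>tail n. var k)"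
proof -
  have "(\<Sum>k<n. f k) = (\<Sum>k<sixth_root n ^ 6. f k) + (\<Sum>k\<in>tail n. f k)" for f :: "nat \<Rightarrow> real"
  proof -
    have "{..<n} = {..<sixth_root n ^ 6} \<union> tail n" unfolding tail_def using ivl_disj_un_one(2)[OF sixth_root_bounds(1)] by simp
    moreover have "{..<sixth_root n ^ 6} \<inter> tail n = {}" by (auto simp: tail_def)
    ultimately show ?thesis by (simp add: sum.union_disjoint)
  qed
  then show "Y n \<omega> = Y (sixth_root n ^ 6) \<omega> + (\<Sum>k\<in>tail n. \<xi> k \<omega>)"
    "total n = total (sixth_root n ^ 6) + (\<Sum>k\<in>tail n. var k)" unfolding Y_def total_def by blast+
qed

text \<open>
Hoeffding's inequality for at most \<open>192 n\<^bsup>5/6\<^esup>\<close> variables. The exponent \<open>17/36\<close> exceeds the half of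
\<open>5/6\<close> by \<open>1/18\<close>, which leaves the factor \<open>n\<^bsup>1/9\<^esup>\<close> in the exponential.
\<close>

lemma tail_deviation:
  assumes n: "1 \<le> n"
  shows "prob {\<omega>\<in>space M. real n powr (17/36) \<le> \<bar>\<Sum>k\<in>tail n. \<xi> k \<omega>\<bar>}
    \<le> 2 * exp (- (real n powr (1/9)) / (384 * (max V 1)\<^sup>2))"
proof (cases "tail n = {}")
  case True
  have "{\<omega>\<in>space M. real n powr (17/36) \<le> \<bar>\<Sum>k\<in>tail n. \<xi> k \<omega>\<bar>} = {}" using n True by (simp add: not_le)
  then show ?thesis by (simp only: measure_empty) simp
next
  case False
  define D where "D = max V 1"
  have D: "1 \<le> D" "V \<le> D" by (auto simp: D_def)
  interpret H: Hoeffding_ineq M "tail n" \<xi> "\<lambda>_. - D" "\<lambda>_. D" "\<Sum>k\<in>tail n. expectation (\<xi> k)"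
  proof unfold_locales
    show "indep_vars (\<lambda>_. borel) \<xi> (tail n)" by (rule indep_vars_subset[OF \<xi>_indep]) simp
    show "AE \<omega> in M. \<xi> k \<omega> \<in> {- D..D}" for k
    proof (intro AE_I2)
      fix \<omega> show "\<xi> k \<omega> \<in> {- D..D}" using \<xi>_bound[of k \<omega>] D(2) by (auto simp: abs_le_iff)
    qed
  qed simp_all
  let ?s = "\<Sum>k\<in>tail n. (D - - D)\<^sup>2"
  have c: "0 < real (card (tail n))" using False by (simp add: card_gt_0_iff)
  have s: "?s = real (card (tail n)) * (4 * D\<^sup>2)" by (simp add: power2_eq_square)
  have s0: "0 < ?s" unfolding s using c D by simp
  have "prob {\<omega>\<in>space M. real n powr (17/36) \<le> \<bar>(\<Sum>k\<in>tail n. \<xi> k \<omega>) - (\<Sum>k\<in>tail n. expectation (\<xi> k))\<bar>}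
     \<le> 2 * exp (- 2 * (real n powr (17/36))\<^sup>2 / ?s)"
    by (rule H.Hoeffding_ineq_abs_ge[OF _ s0]) simp
  also have "\<dots> \<le> 2 * exp (- (real n powr (1/9)) / (384 * D\<^sup>2))"
  proof -
    have "real n powr (1/9) / (384 * D\<^sup>2) = 2 * (real n powr (17/36))\<^sup>2 / (192 * real n powr (5/6) * (4 * D\<^sup>2))"
    proof -
      have "(real n powr (17/36))\<^sup>2 = real n powr (1/9) * real n powr (5/6)"
        using n by (simp add: powr_power powr_add[symmetric])
      then show ?thesis using n D by simp
    qed
    also have "\<dots> \<le> 2 * (real n powr (17/36))\<^sup>2 / ?s"
    proof (rule divide_left_mono)
      show "?s \<le> 192 * real n powr (5/6) * (4 * D\<^sup>2)" unfolding s using card_tail[OF n] by (intro mult_right_mono) auto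
      show "0 < 192 * real n powr (5/6) * (4 * D\<^sup>2) * ?s" using n D s0 by simp
    qed simp
    finally show ?thesis by simp
  qed
  finally show ?thesis by (simp add: \<xi>_mean D_def)
qed

lemma AE_tail_small: "AE \<omega> in M. \<forall>\<^sub>F n in sequentially. \<bar>\<Sum>k\<in>tail n. \<xi> k \<omega>\<bar> < real n powr (17/36)"
proof -
  define A where "A n = {\<omega>\<in>space M. real n powr (17/36) \<le> \<bar>\<Sum>k\<in>tail n. \<xi> k \<omega>\<bar>}" for n
  have [measurable]: "A n \<in> events" for n unfolding A_def by measurable
  define a where "a = 1 / (384 * (max V 1)\<^sup>2)"
  have a: "0 < a" unfolding a_def by (simp add: less_max_iff_disj)
  have "summable (\<lambda>n. prob (A n))"
  proof (rule summable_comparison_test_ev)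
    have "(\<lambda>n. 2 * exp (- (a * real n powr (1/9))) * real n ^ 2) \<longlonglongrightarrow> 0" using a by real_asymp
    then have "\<forall>\<^sub>F n in sequentially. 2 * exp (- (a * real n powr (1/9))) * real n ^ 2 < 1"
      by (rule order_tendstoD) simp
    then show "\<forall>\<^sub>F n in sequentially. norm (prob (A n)) \<le> inverse (real n ^ 2)"
      using eventually_ge_at_top[of 1]
    proof eventually_elim
      case (elim n)
      have "prob (A n) \<le> 2 * exp (- (a * real n powr (1/9)))"
        using tail_deviation[OF elim(2)] by (simp add: A_def a_def)
      also have "\<dots> \<le> inverse (real n ^ 2)" using elim by (simp add: field_simps)
      finally show ?case by simp
    qed
    show "summable (\<lambda>n. inverse (real n ^ 2))" by (rule inverse_power_summable) simp
  qed
  then have "AE \<omega> in M. \<forall>\<^sub>F n in sequentially. \<omega> \<in> space M - A n"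
    by (intro borel_cantelli_AE1) (auto simp: less_top[symmetric])
  then show ?thesis
    by eventually_elim (auto simp: A_def not_le elim: eventually_mono)
qed

definition defect :: "nat \<Rightarrow> 'a \<Rightarrow> real" where "defect i \<omega> = S i \<omega> - to_normal i (S i \<omega>)"

text \<open>
The defects have mean \<open>O((i + 1)\<^bsup>5/3\<^esup>)\<close>. Divided by \<open>(i + 1)\<^bsup>17/6\<^esup>\<close> these means are
\<open>O((i + 1)\<^bsup>-7/6\<^esup>)\<close> and summable, so the weighted defects are almost surely summable.
\<close>

lemma AE_defect_sum: "AE \<omega> in M. \<exists>C\<ge>0. \<forall>j. (\<Sum>i<j. \<bar>defect i \<omega>\<bar>) \<le> C * real j powr (17/6)"
proof -
  have [measurable]: "defect i \<in> borel_measurable M" for i unfolding defect_def by measurable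
  have "AE \<omega> in M. summable (\<lambda>i. \<bar>defect i \<omega>\<bar> * (real i + 1) powr (- 17/6))"
  proof (rule AE_summable_of_expectation[where c = "\<lambda>i. rate * (real i + 1) powr (- 7/6)"])
    fix i
    have "(\<integral>\<^sup>+\<omega>. ennreal (\<bar>defect i \<omega>\<bar> * (real i + 1) powr (- 17/6)) \<partial>M)
       = (\<integral>\<^sup>+\<omega>. ennreal \<bar>defect i \<omega>\<bar> \<partial>M) * ennreal ((real i + 1) powr (- 17/6))"
      by (subst nn_integral_multc[symmetric]) (simp_all add: ennreal_mult)
    also have "\<dots> \<le> ennreal (rate * (real i + 1) powr (5/3)) * ennreal ((real i + 1) powr (- 17/6))"
      unfolding defect_def by (intro mult_right_mono to_normal_close) simp
    also have "\<dots> = ennreal (rate * (real i + 1) powr (5/3) * (real i + 1) powr (- 17/6))"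
      by (rule ennreal_mult[symmetric]) (simp_all add: rate_nonneg)
    also have "rate * (real i + 1) powr (5/3) * (real i + 1) powr (- 17/6) = rate * (real i + 1) powr (- 7/6)"
      by (simp add: mult.assoc powr_add[symmetric])
    finally show "(\<integral>\<^sup>+\<omega>. ennreal (\<bar>defect i \<omega>\<bar> * (real i + 1) powr (- 17/6)) \<partial>M) \<le> ennreal (rate * (real i + 1) powr (- 7/6))" .
  next
    have "summable (\<lambda>i. real (Suc i) powr (- 7/6))"
      by (subst summable_Suc_iff, subst summable_real_powr_iff) simp
    then show "summable (\<lambda>i. rate * (real i + 1) powr (- 7/6))" by (intro summable_mult) (simp add: add.commute)
  qed (simp_all add: rate_nonneg)
  then show ?thesis
  proof eventually_elim
    case (elim \<omega>)
    let ?a = "\<lambda>i. \<bar>defect i \<omega>\<bar> * (real i + 1) powr (- 17/6)"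
    show ?case
    proof (intro exI[of _ "\<Sum>i. ?a i"] conjI allI)
      show "0 \<le> (\<Sum>i. ?a i)" by (intro suminf_nonneg elim) simp
      fix j
      have "(\<Sum>i<j. \<bar>defect i \<omega>\<bar>) = (\<Sum>i<j. ?a i * (real i + 1) powr (17/6))"
        by (intro sum.cong refl) (simp add: mult.assoc powr_add[symmetric])
      also have "\<dots> \<le> (\<Sum>i<j. ?a i * real j powr (17/6))"
        by (intro sum_mono mult_left_mono powr_mono2) auto
      also have "\<dots> = (\<Sum>i<j. ?a i) * real j powr (17/6)" by (rule sum_distrib_right[symmetric])
      also have "\<dots> \<le> (\<Sum>i. ?a i) * real j powr (17/6)" by (intro mult_right_mono sum_le_suminf elim) auto
      finally show "(\<Sum>i<j. \<bar>defect i \<omega>\<bar>) \<le> (\<Sum>i. ?a i) * real j powr (17/6)" .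
    qed
  qed
qed

lemma sum_S: "(\<Sum>i<j. S i \<omega>) = Y (j ^ 6) \<omega> + (\<Sum>i<j. noise i \<omega>)"
  by (simp add: S_def sum.distrib sum_blocks Y_def)

text \<open>
The difference consists of the bounded error of the coupled point, the incomplete block, the coupling
errors of the completed blocks, and their noise.
\<close>

theorem wiener_approximation:
  obtains \<zeta> where "wiener_process M \<zeta>"
    "AE \<omega> in M. (\<lambda>n. X n \<omega> - \<zeta> (T (sixth_root n)) \<omega>) \<in> o(\<lambda>n. real n powr (1/2 - 1/72))"
proof -
  obtain \<zeta> where z: "wiener_process M \<zeta>" "AE \<omega> in M. \<forall>j. \<zeta> (T j) \<omega> = (\<Sum>i<j. sqrt (len i) * gauss 0 i \<omega>)"
    by (rule wiener_process_exists)
  have "AE \<omega> in M. (\<lambda>n. X n \<omega> - \<zeta> (T (sixth_root n)) \<omega>) \<in> o(\<lambda>n. real n powr (1/2 - 1/72))"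
    using z(2) AE_err_bounded AE_tail_small AE_defect_sum
  proof eventually_elim
    case (elim \<omega>)
    note zeta = elim(1)
    obtain C where C: "\<bar>X n \<omega> - Y n \<omega>\<bar> \<le> C" for n using elim(2) by blast
    obtain D where D: "0 \<le> D" "\<forall>j. (\<Sum>i<j. \<bar>defect i \<omega>\<bar>) \<le> D * real j powr (17/6)" using elim(4) by blast
    have "(\<lambda>n. X n \<omega> - \<zeta> (T (sixth_root n)) \<omega>) \<in> O(\<lambda>n. real n powr (17/36))"
    proof (rule bigoI)
      show "\<forall>\<^sub>F n in sequentially. norm (X n \<omega> - \<zeta> (T (sixth_root n)) \<omega>) \<le> (\<bar>C\<bar> + D + 2) * norm (real n powr (17/36))"
        using elim(3) eventually_ge_at_top[of 1]
      proof eventually_elim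
        case (elim n)
        define j where "j = sixth_root n"
        define r where "r = real n powr (17/36)"
        have "\<zeta> (T j) \<omega> = (\<Sum>i<j. S i \<omega>) - (\<Sum>i<j. defect i \<omega>)"
          using zeta by (simp add: sum_sqrt_gauss defect_def sum_subtractf)
        then have eq: "X n \<omega> - \<zeta> (T j) \<omega> = (X n \<omega> - Y n \<omega>) + (\<Sum>k\<in>tail n. \<xi> k \<omega>) + (\<Sum>i<j. defect i \<omega>) - (\<Sum>i<j. noise i \<omega>)"
          using Y_tail[of n \<omega>] sum_S[of \<omega> j] unfolding j_def by linarith
        have r1: "1 \<le> r" unfolding r_def using elim(2) by (intro ge_one_powr_ge_zero) auto
        then have "\<bar>C\<bar> * 1 \<le> \<bar>C\<bar> * r" by (intro mult_left_mono) auto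
        then have 1: "\<bar>X n \<omega> - Y n \<omega>\<bar> \<le> \<bar>C\<bar> * r" using C[of n] by linarith
        have "\<bar>\<Sum>i<j. defect i \<omega>\<bar> \<le> (\<Sum>i<j. \<bar>defect i \<omega>\<bar>)" by (rule sum_abs)
        also have "\<dots> \<le> D * real j powr (17/6)" using D(2) by blast
        also have "\<dots> \<le> D * r" using sixth_root_powr(2)[OF elim(2), of "17/6"] D(1)
          unfolding r_def j_def by (intro mult_left_mono) auto
        finally have 2: "\<bar>\<Sum>i<j. defect i \<omega>\<bar> \<le> D * r" .
        have "\<bar>\<Sum>i<j. noise i \<omega>\<bar> \<le> (\<Sum>i<j. \<bar>noise i \<omega>\<bar>)" by (rule sum_abs)
        also have "\<dots> \<le> (\<Sum>i<j. 1)" by (intro sum_mono noise_bound)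
        also have "\<dots> = real j powr 1" by simp
        also have "\<dots> \<le> real n powr (1/6)" unfolding j_def using sixth_root_powr(2)[OF elim(2), of 1] by simp
        also have "\<dots> \<le> r" unfolding r_def using elim(2) by (intro powr_mono) auto
        finally have 3: "\<bar>\<Sum>i<j. noise i \<omega>\<bar> \<le> r" .
        have "\<bar>X n \<omega> - \<zeta> (T j) \<omega>\<bar> \<le> \<bar>C\<bar> * r + r + D * r + r"
          unfolding eq using 1 2 3 elim(1) unfolding r_def[symmetric] by linarith
        also have "\<dots> = (\<bar>C\<bar> + D + 2) * r" by (simp add: algebra_simps)
        finally show ?case by (simp add: j_def r_def)
      qed
    qed
    also have "(\<lambda>n. real n powr (17/36)) \<in> o(\<lambda>n. real n powr (1/2 - 1/72))" by real_asymp
    finally show ?case .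
  qed
  then show ?thesis using z(1) that by blast
qed

text \<open>
\<open>T (sixth_root n)\<close> is the variance of the completed blocks; it lacks at most \<open>O(n\<^bsup>5/6\<^esup>)\<close> from
the incomplete block and exceeds by the variance of the noise, while \<open>total n\<close> grows at least linearly.
\<close>

lemma T_ratio: "(\<lambda>n. T (sixth_root n) / expectation (\<lambda>\<omega>. (X n \<omega>)\<^sup>2)) \<longlonglongrightarrow> 1"
proof -
  have near: "\<bar>T (sixth_root n) / total n - 1\<bar>
      \<le> (uniform_variance * real n powr (1/6) + 192 * V\<^sup>2 * real n powr (5/6)) / (c * real n)"
    and t: "0 < total n" if n: "1 \<le> n" for n
  proof -
    have cn: "0 < c * real n" using c_pos n by simp
    then show t: "0 < total n" using total_lower[of n] by linarith
    have d: "T (sixth_root n) - total n = real (sixth_root n) * uniform_variance - (\<Sum>k\<in>tail n. var k)"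
      using total_tail[of n] by (simp add: T_def sum_len)
    have "(\<Sum>k\<in>tail n. var k) \<le> (\<Sum>k\<in>tail n. V\<^sup>2)" by (intro sum_mono var_bounds)
    also have "\<dots> = real (card (tail n)) * V\<^sup>2" by simp
    also have "\<dots> \<le> 192 * real n powr (5/6) * V\<^sup>2" by (intro mult_right_mono card_tail n) simp
    finally have 1: "(\<Sum>k\<in>tail n. var k) \<le> 192 * V\<^sup>2 * real n powr (5/6)" by (simp add: mult.commute mult.left_commute)
    have 2: "0 \<le> (\<Sum>k\<in>tail n. var k)" by (intro sum_nonneg var_bounds)
    have 3: "real (sixth_root n) * uniform_variance \<le> uniform_variance * real n powr (1/6)"
      using sixth_root_powr(2)[OF n, of 1] uniform_variance_pos by (simp add: mult.commute)
    have 4: "0 \<le> real (sixth_root n) * uniform_variance" using uniform_variance_pos by simp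
    have "\<bar>T (sixth_root n) - total n\<bar> \<le> uniform_variance * real n powr (1/6) + 192 * V\<^sup>2 * real n powr (5/6)"
      unfolding d using 1 2 3 4 by linarith
    moreover have "\<bar>T (sixth_root n) / total n - 1\<bar> = \<bar>T (sixth_root n) - total n\<bar> / total n"
    proof -
      have "T (sixth_root n) / total n - 1 = (T (sixth_root n) - total n) / total n"
        using t by (simp add: diff_divide_distrib)
      then show ?thesis using t by (simp add: abs_divide)
    qed
    ultimately show "\<bar>T (sixth_root n) / total n - 1\<bar>
      \<le> (uniform_variance * real n powr (1/6) + 192 * V\<^sup>2 * real n powr (5/6)) / (c * real n)"
      using total_lower[of n] cn by (simp add: frac_le)
  qed
  have "(\<lambda>n. (uniform_variance * real n powr (1/6) + 192 * V\<^sup>2 * real n powr (5/6)) / (c * real n)) \<longlonglongrightarrow> 0"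
    using c_pos by real_asymp
  then have "(\<lambda>n. T (sixth_root n) / total n - 1) \<longlonglongrightarrow> 0"
    by (rule Lim_null_comparison[rotated]) (use near in \<open>auto simp: eventually_sequentially intro!: exI[of _ 1]\<close>)
  then have "(\<lambda>n. T (sixth_root n) / total n) \<longlonglongrightarrow> 1" by (rule LIM_zero_cancel)
  from tendsto_divide[OF this X_square_ratio]
  have "(\<lambda>n. T (sixth_root n) / total n / (expectation (\<lambda>\<omega>. (X n \<omega>)\<^sup>2) / total n)) \<longlonglongrightarrow> 1" by simp
  then show ?thesis
  proof (rule Lim_transform_eventually)
    show "\<forall>\<^sub>F n in sequentially. T (sixth_root n) / total n / (expectation (\<lambda>\<omega>. (X n \<omega>)\<^sup>2) / total n)
        = T (sixth_root n) / expectation (\<lambda>\<omega>. (X n \<omega>)\<^sup>2)"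
      using eventually_ge_at_top[of 1] by eventually_elim (use t in \<open>simp add: less_imp_neq[symmetric]\<close>)
  qed
qed

end

section \<open>The invariance principle\<close>

text \<open>
The product measure has the required coordinates, and its sample points are real sequences, so
it provides a probability space of the type \<open>sample\<close>.
\<close>

lemma independent_coordinates:
  fixes laws :: "nat \<Rightarrow> real measure"
  assumes P: "\<And>i. prob_space (laws i)" and sets: "\<And>i. sets (laws i) = sets borel"
  shows "prob_space (PiM UNIV laws)"
    "prob_space.indep_vars (PiM UNIV laws) (\<lambda>_. borel) (\<lambda>i \<omega>. \<omega> i) UNIV"
    "distr (PiM UNIV laws) borel (\<lambda>\<omega>. \<omega> i) = laws i"
proof -
  interpret prob_space "PiM UNIV laws" by (rule prob_space_PiM) (rule P)
  show "prob_space (PiM UNIV laws)" by (rule prob_space_axioms)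
  have d: "distr (PiM UNIV laws) (laws i) (\<lambda>\<omega>. \<omega> i) = laws i" for i
    by (rule distr_PiM_component) (simp_all add: P)
  have "indep_vars laws (\<lambda>i \<omega>. \<omega> i) UNIV"
  proof (subst indep_vars_iff_distr_eq_PiM')
    show "distr (PiM UNIV laws) (PiM UNIV laws) (\<lambda>x. \<lambda>i\<in>UNIV. x i)
        = (\<Pi>\<^sub>M i\<in>UNIV. distr (PiM UNIV laws) (laws i) (\<lambda>\<omega>. \<omega> i))"
      by (simp add: d restrict_UNIV)
  qed simp_all
  then show "indep_vars (\<lambda>_. borel) (\<lambda>i \<omega>. \<omega> i) UNIV"
    by (rule indep_vars_compose2[where Y = "\<lambda>_ x. x"]) (rule measurable_ident_sets, rule sets)
  have "distr (PiM UNIV laws) borel (\<lambda>\<omega>. \<omega> i) = distr (PiM UNIV laws) (laws i) (\<lambda>\<omega>. \<omega> i)"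
    by (rule distr_cong) (simp_all add: sets)
  then show "distr (PiM UNIV laws) borel (\<lambda>\<omega>. \<omega> i) = laws i" by (simp add: d)
qed

theorem corollary2p3:
  fixes \<alpha> :: real
  assumes "0 < \<alpha>" "\<alpha> < 1" "\<alpha> \<notin> \<rat>"
    and "\<not> bdd_above (partial_quotient \<alpha> ` {1..})"
  shows "\<exists>\<delta>>0. \<exists>t :: nat \<Rightarrow> nat. strict_mono_on {1..} t \<and> (\<forall>k\<ge>1. t k > 0) \<and>
    (\<forall>L :: nat \<Rightarrow> nat. (\<forall>n. L n = (\<Sum>k=1..n. cf_denominator \<alpha> (t k))) \<longrightarrow>
      (\<forall>\<phi> :: real \<Rightarrow> real.
        one_periodic \<phi> \<and> bounded_variation_on {0..<1} \<phi> \<and> centered \<phi> \<and>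
        (\<exists>c>0. \<forall>n\<ge>1. (\<Sum>k=1..n. (circle_L2_norm (hat_fun \<phi> (cf_denominator \<alpha> (t k))))\<^sup>2)
                        \<ge> c * real n)
        \<longrightarrow>
        (\<exists>(M :: sample measure) (X :: nat \<Rightarrow> sample \<Rightarrow> real)
           (\<zeta> :: real \<Rightarrow> sample \<Rightarrow> real) (\<tau> :: nat \<Rightarrow> sample \<Rightarrow> real).
           prob_space M \<and>
           same_law M X circle_measure (\<lambda>n. ergodic_sum \<alpha> \<phi> (L n)) \<and>
           wiener_process M \<zeta> \<and>
           (\<forall>n\<ge>1. \<tau> n \<in> borel_measurable M) \<and>
           (\<forall>\<omega>\<in>space M. \<forall>n\<ge>1. 0 \<le> \<tau> n \<omega> \<and> \<tau> n \<omega> \<le> \<tau> (Suc n) \<omega>) \<and>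
           (AE \<omega> in M. (\<lambda>n. \<tau> n \<omega> / (circle_L2_norm (ergodic_sum \<alpha> \<phi> (L n)))\<^sup>2) \<longlonglongrightarrow> 1) \<and>
           (AE \<omega> in M. (\<lambda>n. X n \<omega> - \<zeta> (\<tau> n \<omega>) \<omega>) \<in> o(\<lambda>n. real n powr (1/2 - \<delta>))))))"
proof -
  obtain t' where t': "strict_mono t'" "\<And>k. t' k > 0" "\<And>k. partial_quotient \<alpha> (Suc (t' k)) \<ge> 4 ^ Suc k"
    by (rule large_partial_quotients[OF assms(4)]) blast
  define Q where "Q k = cf_denominator \<alpha> (t' k)" for k
  have Q0: "0 < Q k" for k using cf_denominator_pos[OF assms(1-3), of "t' k"] by (simp add: Q_def)
  have Qs: "4 ^ Suc k * Q k \<le> cf_denominator \<alpha> (Suc (t' k))" for k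
    using order_trans[OF mult_le_mono1[OF t'(3)] cf_denominator_Suc_ge[OF assms(1-3)], of k] by (simp only: Q_def)
  have Q1: "4 ^ Suc k * Q k \<le> Q (Suc k)" for k
  proof -
    have "Suc (t' k) \<le> t' (Suc k)" using strict_monoD[OF t'(1), of k "Suc k"] by simp
    then show ?thesis using cf_denominator_mono[OF assms(1-3)] Qs[of k] unfolding Q_def by (meson order_trans)
  qed
  have approx: "\<bar>real (Q k) * \<alpha> - real (cf_numerator \<alpha> (t' k))\<bar> \<le> 1 / (4 ^ Suc k * real (Q k))" for k
  proof -
    have "\<bar>real (Q k) * \<alpha> - real (cf_numerator \<alpha> (t' k))\<bar> \<le> 1 / real (cf_denominator \<alpha> (Suc (t' k)))"
      using cf_error_le[OF assms(1-3), of "t' k"] by (simp add: cf_error_def[OF assms(1-3)] Q_def)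
    also have "\<dots> \<le> 1 / (4 ^ Suc k * real (Q k))"
    proof (rule divide_left_mono)
      have "real (4 ^ Suc k * Q k) \<le> real (cf_denominator \<alpha> (Suc (t' k)))" using Qs[of k] by (simp only: of_nat_le_iff)
      then show "4 ^ Suc k * real (Q k) \<le> real (cf_denominator \<alpha> (Suc (t' k)))" by simp
      show "0 < real (cf_denominator \<alpha> (Suc (t' k))) * (4 ^ Suc k * real (Q k))"
        using Q0[of k] cf_denominator_pos[OF assms(1-3), of "Suc (t' k)"] by simp
    qed simp
    finally show ?thesis .
  qed
  define laws where "laws i = (if fst (prod_decode i) < 2 then unit_uniform else normal_law 1)" for i
  define M where "M = PiM UNIV laws"
  \<comment> \<open>the array of variables is laid out along a single sequence by the pairing of natural numbers\<close>
  define Xc where "Xc i \<omega> = \<omega> (prod_encode i)" for i and \<omega> :: sample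
  have laws: "prob_space (laws i)" "sets (laws i) = sets borel" for i
    using prob_space_unit_uniform prob_space_normal_law[of 1] by (simp_all add: laws_def normal_law_def)
  note coord = independent_coordinates[of laws, OF laws, folded M_def]
  interpret prob_space M by (rule coord(1))
  have indep: "indep_vars (\<lambda>_. borel) Xc UNIV"
    unfolding Xc_def[abs_def]
    by (rule indep_vars_reindex[OF indep_vars_subset[OF coord(2)]]) (auto simp: inj_prod_encode)
  have law: "distr M borel (Xc i) = (if fst i < 2 then unit_uniform else normal_law 1)" for i
    unfolding Xc_def[abs_def] coord(3) by (simp add: laws_def)
  \<comment> \<open>the sequence in the statement starts at index 1\<close>
  define t where "t k = t' (k - 1)" for k
  have tmono: "strict_mono_on {1..} t"
    using t'(1) by (auto simp: t_def strict_mono_on_def strict_mono_def)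
  show ?thesis
  proof (intro exI[of _ "1/72 :: real"] conjI exI[of _ t] tmono allI impI)
    show "0 < (1/72 :: real)" by simp
    show "0 < t k" for k by (simp add: t_def t')
    fix L :: "nat \<Rightarrow> nat" and \<phi> :: "real \<Rightarrow> real"
    assume L: "\<forall>n. L n = (\<Sum>k=1..n. cf_denominator \<alpha> (t k))"
      and \<phi>: "one_periodic \<phi> \<and> bounded_variation_on {0..<1} \<phi> \<and> centered \<phi> \<and>
        (\<exists>c>0. \<forall>n\<ge>1. (\<Sum>k=1..n. (circle_L2_norm (hat_fun \<phi> (cf_denominator \<alpha> (t k))))\<^sup>2) \<ge> c * real n)"
    obtain V v where dom: "dominated V v \<phi>"
      using bounded_variation_imp_dominated[of \<phi>] \<phi> by blast
    have cent: "centered \<phi>" using \<phi> by blast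
    obtain c where c: "0 < c" "\<And>n. 1 \<le> n \<Longrightarrow> c * real n \<le> (\<Sum>k=1..n. (circle_L2_norm (hat_fun \<phi> (cf_denominator \<alpha> (t k))))\<^sup>2)"
      using \<phi> by blast
    have lower: "c * real n \<le> (\<Sum>k<n. \<integral>x. (fold_sum (Q k) \<phi> x)\<^sup>2 \<partial>circle_measure)" for n
    proof (cases n)
      case (Suc m)
      then have "c * real n \<le> (\<Sum>k=1..n. (circle_L2_norm (hat_fun \<phi> (cf_denominator \<alpha> (t k))))\<^sup>2)" by (intro c) simp
      also have "\<dots> = (\<Sum>k<n. (circle_L2_norm (hat_fun \<phi> (Q k)))\<^sup>2)"
        unfolding One_nat_def sum.atLeast1_atMost_eq by (simp add: t_def Q_def)
      also have "\<dots> \<le> (\<Sum>k<n. \<integral>x. (fold_sum (Q k) \<phi> x)\<^sup>2 \<partial>circle_measure)"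
        by (intro sum_mono hat_fun_L2_norm_le[OF dom Q0])
      finally show ?thesis .
    qed simp
    interpret lacunary_sums M Xc Q "\<lambda>k. cf_numerator \<alpha> (t' k)" \<alpha> V c v \<phi>
    proof unfold_locales
      show "coprime (cf_numerator \<alpha> (t' k)) (Q k)" for k
        unfolding Q_def by (rule cf_coprime[OF assms(1-3)])
    qed (simp_all only: indep law Q0 Q1 approx dom cent c(1) lower, simp_all)
    have start: "start n = L n" for n
    proof -
      have "L n = (\<Sum>k=Suc 0..n. cf_denominator \<alpha> (t k))" using L by simp
      also have "\<dots> = start n" unfolding sum.atLeast1_atMost_eq start_def by (simp add: t_def Q_def)
      finally show ?thesis ..
    qed
    obtain \<zeta> where \<zeta>: "wiener_process M \<zeta>"
      "AE \<omega> in M. (\<lambda>n. X n \<omega> - \<zeta> (T (sixth_root n)) \<omega>) \<in> o(\<lambda>n. real n powr (1/2 - 1/72))"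
      by (rule wiener_approximation)
    let ?\<phi> = "\<lambda>n. ergodic_sum \<alpha> \<phi> (L n)"
    have E_measurable [measurable]: "?\<phi> n \<in> borel_measurable borel" for n
      unfolding ergodic_sum_def by measurable
    have X_point: "X n \<omega> = ?\<phi> n (point \<omega>)" for n \<omega> by (simp add: X_def start)
    have Em: "?\<phi> n \<in> borel_measurable circle_measure" for n
      by (rule measurable_circle_borel) simp
    have Xm [measurable]: "X n \<in> borel_measurable M" for n
      unfolding X_point by measurable
    have norm: "(circle_L2_norm (?\<phi> n))\<^sup>2 = expectation (\<lambda>\<omega>. (X n \<omega>)\<^sup>2)" for n
    proof -
      have "expectation (\<lambda>\<omega>. (X n \<omega>)\<^sup>2) = (\<integral>x. (?\<phi> n x)\<^sup>2 \<partial>circle_measure)"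
        unfolding X_point by (rule expectation_uniform[OF point_measurable distr_point]) simp
      moreover have "0 \<le> (\<integral>x. (?\<phi> n x)\<^sup>2 \<partial>circle_measure)" by (rule integral_nonneg_AE) simp
      ultimately show ?thesis by (simp add: circle_L2_norm_def)
    qed
    have law_X: "same_law M X circle_measure ?\<phi>"
    proof -
      define \<Phi> where "\<Phi> x = (\<lambda>n\<in>{1..}. ?\<phi> n x)" for x
      have \<Phi>: "\<Phi> \<in> measurable borel (\<Pi>\<^sub>M n\<in>{1::nat..}. borel)"
        unfolding \<Phi>_def[abs_def] by (intro measurable_restrict) simp
      have "distr M (\<Pi>\<^sub>M n\<in>{1..}. borel) (\<lambda>\<omega>. \<lambda>n\<in>{1..}. X n \<omega>) = distr (distr M borel point) (\<Pi>\<^sub>M n\<in>{1..}. borel) \<Phi>"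
        by (subst distr_distr[OF \<Phi>]) (simp_all add: comp_def \<Phi>_def X_point)
      also have "\<dots> = distr circle_measure (\<Pi>\<^sub>M n\<in>{1..}. borel) (\<lambda>x. \<lambda>n\<in>{1..}. ?\<phi> n x)"
        unfolding distr_point unit_uniform_def
        by (subst distr_distr[OF \<Phi>]) (simp_all add: id_measurable_circle comp_def \<Phi>_def)
      finally show ?thesis unfolding same_law_def using Em Xm by blast
    qed
    show "\<exists>(M :: sample measure) X \<zeta> \<tau>. prob_space M \<and> same_law M X circle_measure ?\<phi> \<and> wiener_process M \<zeta> \<and>
           (\<forall>n\<ge>1. \<tau> n \<in> borel_measurable M) \<and>
           (\<forall>\<omega>\<in>space M. \<forall>n\<ge>1. 0 \<le> \<tau> n \<omega> \<and> \<tau> n \<omega> \<le> \<tau> (Suc n) \<omega>) \<and>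
           (AE \<omega> in M. (\<lambda>n. \<tau> n \<omega> / (circle_L2_norm (?\<phi> n))\<^sup>2) \<longlonglongrightarrow> 1) \<and>
           (AE \<omega> in M. (\<lambda>n. X n \<omega> - \<zeta> (\<tau> n \<omega>) \<omega>) \<in> o(\<lambda>n. real n powr (1/2 - 1/72)))"
    proof (rule exI[of _ M], rule exI[of _ X], rule exI[of _ \<zeta>], rule exI[of _ "\<lambda>n _. T (sixth_root n)"],
        intro conjI allI impI ballI)
      show "AE \<omega> :: sample in M. (\<lambda>n. T (sixth_root n) / (circle_L2_norm (?\<phi> n))\<^sup>2) \<longlonglongrightarrow> 1"
        unfolding norm using T_ratio by simp
      show "0 \<le> T (sixth_root n)" for n using T_mono[of 0] by simp
      show "T (sixth_root n) \<le> T (sixth_root (Suc n))" for n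
        by (intro T_mono sixth_root_mono) simp
    qed (use \<zeta> in \<open>simp_all add: coord(1) law_X\<close>)
  qed
qed

end
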